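(* Let $\partial\Omega=\Gamma_0\cup\Gamma_1\cup\Gamma_3$ and let $\bar u\in V_0$ solve $$\int_\Omega\Delta\bar u\,\Delta v+c_0\nabla\bar u\cdot\nabla v+c_1\bar u v=\int_\Omega fv\qquad\forall v\in V_0 .$$ Consider the saddle-point problem of finding $(u,\vec v,\vec\alpha)\in L^2(\Omega)\times H_0^{\Gamma_1\cup\Gamma_3}(\mathrm{div};\Omega)\times H_0^{\Gamma_3}(\mathrm{div};\Omega)$ such that $$a\big((u,\vec v),(\phi,\vec\psi)\big)+b\big((\phi,\vec\psi),\vec\alpha\big)=F(\phi),\qquad b\big((u,\vec v),\vec\beta\big)=0$$ for all $(\phi,\vec\psi,\vec\beta)\in L^2(\Omega)\times H_0^{\Gamma_1\cup\Gamma_3}(\mathrm{div};\Omega)\times H_0^{\Gamma_3}(\mathrm{div};\Omega)$. The pair $(u,\vec v)$ that solves this saddle-point problem is unique for any $c_0\ge0$ and $c_1\ge0$, with $(u,\vec v)=(\bar u,\nabla\bar u)$. Moreover, $\vec\alpha$ is unique if $\bar u\in H^p(\Omega)$, $p\ge4$.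
   Context: $\Omega\subset\mathbb R^d$, $d\in\{2,3\}$, is an open, connected, bounded polytope with Lipschitz boundary and outward pointing normal $\vec n$; $c_0,c_1$ are nonnegative constants. The $\Gamma_i$ are segments of $\partial\Omega$ carrying different boundary conditions for the fourth-order problem $\Delta^2u-c_0\Delta u+c_1u=f$: $u=\Delta u=0$ on $\Gamma_0$, $u=\frac{\partial u}{\partial n}=0$ on $\Gamma_1$, and $\frac{\partial(\Delta u-c_0u)}{\partial n}=\frac{\partial u}{\partial n}=0$ on $\Gamma_3$. $V=\{v\in H^1(\Omega):\Delta v\in L^2(\Omega)\}$ (with inner product $\int_\Omega uv+\nabla u\cdot\nabla v+\Delta u\,\Delta v$), $V^*$ is its dual space, and $f\in V^*$. Further, $V_0=\{v\in V: v=0\text{ on }\Gamma_0\cup\Gamma_1\text{ and }\frac{\partial v}{\partial n}=0\text{ on }\Gamma_1\cup\Gamma_3\}$. For $\Gamma\subset\partial\Omega$, $H_0^{\Gamma}(\mathrm{div};\Omega)=\{\vec v\in H(\mathrm{div};\Omega): \vec v\cdot\vec n=0\text{ on }\Gamma\}$. The forms are $$a\big((u,\vec v),(\phi,\vec\psi)\big)=c_0\int_\Omega\vec v\cdot\vec\psi+\int_\Omega\nabla\cdot\vec v\,\nabla\cdot\vec\psi+c_1\int_\Omega u\phi,$$ $$b\big((u,\vec v),\vec\beta\big)=\int_\Omega\vec\beta\cdot\vec v+u\,\nabla\cdot\vec\beta,\qquad F(\phi)=\int_\Omega f\phi.$$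
   Formalization: The case Γ_3=∂Ω with c_1=0 is excluded, since there adding a constant to u yields further solutions, and f∈V* is assumed to extend to a bounded linear functional F on L²(Ω), so that F(φ) is defined for every φ∈L²(Ω). *)

theory Defs
  imports "HOL-Analysis.Analysis"
begin

section \<open>Domains and boundary segments\<close>

text \<open>A polytope need not be convex here: its closure is a finite union of convex polytopes.\<close>

definition polytopal :: "(real^'n) set \<Rightarrow> bool" where
  "polytopal \<Omega> \<longleftrightarrow> (\<exists>\<P>. finite \<P> \<and> (\<forall>P\<in>\<P>. polytope P) \<and> closure \<Omega> = \<Union>\<P>)"

text \<open>Near each boundary point, the set is the strict subgraph, in some direction \<open>e\<close>, of a
  Lipschitz function on the hyperplane orthogonal to \<open>e\<close>.\<close>

definition lipschitz_boundary :: "(real^'n) set \<Rightarrow> bool" where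
  "lipschitz_boundary \<Omega> \<longleftrightarrow>
     (\<forall>x\<in>frontier \<Omega>. \<exists>U e g L. open U \<and> x \<in> U \<and> norm e = 1 \<and> L-lipschitz_on UNIV g \<and>
        \<Omega> \<inter> U = {y \<in> U. y \<bullet> e < g (y - (y \<bullet> e) *\<^sub>R e)})"

text \<open>A (possibly empty) finite union of flat pieces of the boundary, each of dimension \<open>d - 1\<close>.\<close>

definition boundary_segment :: "(real^'n) set \<Rightarrow> (real^'n) set \<Rightarrow> bool" where
  "boundary_segment \<Omega> \<Gamma> \<longleftrightarrow> \<Gamma> \<subseteq> frontier \<Omega> \<and>
     (\<exists>\<P>. finite \<P> \<and> (\<forall>P\<in>\<P>. polytope P \<and> aff_dim P = int CARD('n) - 1) \<and> \<Gamma> = \<Union>\<P>)"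

text \<open>Segments are closed, so distinct ones may share their relative boundaries, but nothing more.\<close>

definition nonoverlapping :: "(real^'n) set \<Rightarrow> (real^'n) set \<Rightarrow> (real^'n) set \<Rightarrow> bool" where
  "nonoverlapping \<Omega> \<Gamma> \<Gamma>' \<longleftrightarrow> top_of_set (frontier \<Omega>) interior_of (\<Gamma> \<inter> \<Gamma>') = {}"

section \<open>Smooth functions\<close>

definition partial_deriv :: "'n \<Rightarrow> (real^'n \<Rightarrow> real) \<Rightarrow> real^'n \<Rightarrow> real" where
  "partial_deriv i f x = frechet_derivative f (at x) (axis i 1)"

definition gradient :: "(real^'n \<Rightarrow> real) \<Rightarrow> real^'n \<Rightarrow> real^'n" where
  "gradient f x = (\<chi> i. partial_deriv i f x)"

primrec C_k :: "nat \<Rightarrow> (real^'n \<Rightarrow> real) \<Rightarrow> bool" where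
  "C_k 0 f \<longleftrightarrow> continuous_on UNIV f"
| "C_k (Suc k) f \<longleftrightarrow> f differentiable_on UNIV \<and> (\<forall>i. C_k k (partial_deriv i f))"

definition smooth :: "(real^'n \<Rightarrow> real) \<Rightarrow> bool" where
  "smooth f \<longleftrightarrow> (\<forall>k. C_k k f)"

definition test_fun :: "(real^'n) set \<Rightarrow> (real^'n \<Rightarrow> real) \<Rightarrow> bool" where
  "test_fun \<Omega> \<phi> \<longleftrightarrow> smooth \<phi> \<and> (\<exists>K. compact K \<and> K \<subseteq> \<Omega> \<and> (\<forall>x. x \<notin> K \<longrightarrow> \<phi> x = 0))"

section \<open>Function spaces on \<open>\<Omega>\<close>\<close>

text \<open>Elements of the spaces are functions rather than equivalence classes; equality in the spaces
  is equality almost everywhere on \<open>\<Omega>\<close>.\<close>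

definition L2 :: "(real^'n) set \<Rightarrow> (real^'n \<Rightarrow> 'b::euclidean_space) set" where
  "L2 \<Omega> = {u. set_borel_measurable lebesgue \<Omega> u \<and> set_integrable lebesgue \<Omega> (\<lambda>x. (norm (u x))\<^sup>2)}"

definition L2_norm :: "(real^'n) set \<Rightarrow> (real^'n \<Rightarrow> 'b::euclidean_space) \<Rightarrow> real" where
  "L2_norm \<Omega> u = sqrt (LINT x:\<Omega>|lebesgue. (norm (u x))\<^sup>2)"

definition is_weak_gradient ::
    "(real^'n) set \<Rightarrow> (real^'n \<Rightarrow> real) \<Rightarrow> (real^'n \<Rightarrow> real^'n) \<Rightarrow> bool" where
  "is_weak_gradient \<Omega> u g \<longleftrightarrow>
     (\<forall>\<phi>. test_fun \<Omega> \<phi> \<longrightarrow>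
        (LINT x:\<Omega>|lebesgue. u x *\<^sub>R gradient \<phi> x) = - (LINT x:\<Omega>|lebesgue. \<phi> x *\<^sub>R g x))"

definition is_weak_divergence ::
    "(real^'n) set \<Rightarrow> (real^'n \<Rightarrow> real^'n) \<Rightarrow> (real^'n \<Rightarrow> real) \<Rightarrow> bool" where
  "is_weak_divergence \<Omega> v q \<longleftrightarrow>
     (\<forall>\<phi>. test_fun \<Omega> \<phi> \<longrightarrow>
        (LINT x:\<Omega>|lebesgue. v x \<bullet> gradient \<phi> x) = - (LINT x:\<Omega>|lebesgue. \<phi> x * q x))"

definition H1 :: "(real^'n) set \<Rightarrow> (real^'n \<Rightarrow> real) set" where
  "H1 \<Omega> = {u \<in> L2 \<Omega>. \<exists>g\<in>L2 \<Omega>. is_weak_gradient \<Omega> u g}"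

definition Hdiv :: "(real^'n) set \<Rightarrow> (real^'n \<Rightarrow> real^'n) set" where
  "Hdiv \<Omega> = {v \<in> L2 \<Omega>. \<exists>q\<in>L2 \<Omega>. is_weak_divergence \<Omega> v q}"

text \<open>The weak derivatives are unique almost everywhere; the operators pick a representative.\<close>

definition wgrad :: "(real^'n) set \<Rightarrow> (real^'n \<Rightarrow> real) \<Rightarrow> real^'n \<Rightarrow> real^'n" where
  "wgrad \<Omega> u = (SOME g. g \<in> L2 \<Omega> \<and> is_weak_gradient \<Omega> u g)"

definition wdiv :: "(real^'n) set \<Rightarrow> (real^'n \<Rightarrow> real^'n) \<Rightarrow> real^'n \<Rightarrow> real" where
  "wdiv \<Omega> v = (SOME q. q \<in> L2 \<Omega> \<and> is_weak_divergence \<Omega> v q)"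

definition wlaplace :: "(real^'n) set \<Rightarrow> (real^'n \<Rightarrow> real) \<Rightarrow> real^'n \<Rightarrow> real" where
  "wlaplace \<Omega> u = wdiv \<Omega> (wgrad \<Omega> u)"

definition H1_norm :: "(real^'n) set \<Rightarrow> (real^'n \<Rightarrow> real) \<Rightarrow> real" where
  "H1_norm \<Omega> u = sqrt (LINT x:\<Omega>|lebesgue. (u x)\<^sup>2 + wgrad \<Omega> u x \<bullet> wgrad \<Omega> u x)"

text \<open>Sobolev spaces of real order \<open>s \<ge> 0\<close>: for fractional \<open>s\<close> the weak derivatives of order
  \<open>\<lfloor>s\<rfloor>\<close> have finite Sobolev--Slobodeckij seminorm.\<close>

primrec Hs_aux :: "(real^'n) set \<Rightarrow> real \<Rightarrow> nat \<Rightarrow> (real^'n \<Rightarrow> real) set" where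
  "Hs_aux \<Omega> \<theta> 0 = {u \<in> L2 \<Omega>. \<theta> > 0 \<longrightarrow>
     (\<integral>\<^sup>+x\<in>\<Omega>. (\<integral>\<^sup>+y\<in>\<Omega>. ennreal ((u x - u y)\<^sup>2 / dist x y powr (real CARD('n) + 2 * \<theta>)) \<partial>lebesgue) \<partial>lebesgue) < \<infinity>}"
| "Hs_aux \<Omega> \<theta> (Suc k) = {u \<in> H1 \<Omega>. \<forall>i. (\<lambda>x. wgrad \<Omega> u x $ i) \<in> Hs_aux \<Omega> \<theta> k}"

definition Hs :: "(real^'n) set \<Rightarrow> real \<Rightarrow> (real^'n \<Rightarrow> real) set" where
  "Hs \<Omega> s = Hs_aux \<Omega> (frac s) (nat \<lfloor>s\<rfloor>)"

definition V :: "(real^'n) set \<Rightarrow> (real^'n \<Rightarrow> real) set" where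
  "V \<Omega> = {v \<in> H1 \<Omega>. wgrad \<Omega> v \<in> Hdiv \<Omega>}"

definition V_inner :: "(real^'n) set \<Rightarrow> (real^'n \<Rightarrow> real) \<Rightarrow> (real^'n \<Rightarrow> real) \<Rightarrow> real" where
  "V_inner \<Omega> u v =
     (LINT x:\<Omega>|lebesgue. u x * v x + wgrad \<Omega> u x \<bullet> wgrad \<Omega> v x + wlaplace \<Omega> u x * wlaplace \<Omega> v x)"

definition V_norm :: "(real^'n) set \<Rightarrow> (real^'n \<Rightarrow> real) \<Rightarrow> real" where
  "V_norm \<Omega> v = sqrt (V_inner \<Omega> v v)"

text \<open>Bounded linear functionals on a space \<open>X\<close> of functions with (semi)norm \<open>N\<close>.\<close>

definition dual :: "('a \<Rightarrow> real) set \<Rightarrow> (('a \<Rightarrow> real) \<Rightarrow> real) \<Rightarrow> (('a \<Rightarrow> real) \<Rightarrow> real) set" where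
  "dual X N = {f. (\<forall>u\<in>X. \<forall>v\<in>X. \<forall>a b. f (\<lambda>x. a * u x + b * v x) = a * f u + b * f v) \<and>
                  (\<exists>C. \<forall>u\<in>X. \<bar>f u\<bar> \<le> C * N u)}"

section \<open>Boundary conditions\<close>

text \<open>\<open>v = 0\<close> on \<open>\<Gamma>\<close> in the sense of traces: \<open>v\<close> is a limit in \<open>H1\<close> of functions that are smooth up
  to the boundary and vanish on \<open>\<Gamma>\<close>.\<close>

definition trace_zero_on :: "(real^'n) set \<Rightarrow> (real^'n) set \<Rightarrow> (real^'n \<Rightarrow> real) \<Rightarrow> bool" where
  "trace_zero_on \<Omega> \<Gamma> v \<longleftrightarrow> v \<in> H1 \<Omega> \<and>
     (\<exists>\<phi> :: nat \<Rightarrow> real^'n \<Rightarrow> real. (\<forall>k. smooth (\<phi> k) \<and> (\<forall>x\<in>\<Gamma>. \<phi> k x = 0)) \<and>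
        (\<lambda>k. H1_norm \<Omega> (\<lambda>x. v x - \<phi> k x)) \<longlonglongrightarrow> 0)"

text \<open>The normal trace \<open>v \<bullet> n\<close> of a field in \<open>H(div)\<close> is the functional on traces given by Green's
  formula. It vanishes on \<open>\<Gamma>\<close> if it annihilates the functions whose trace is supported in \<open>\<Gamma>\<close>.\<close>

definition normal_trace ::
    "(real^'n) set \<Rightarrow> (real^'n \<Rightarrow> real^'n) \<Rightarrow> (real^'n \<Rightarrow> real) \<Rightarrow> real" where
  "normal_trace \<Omega> v z = (LINT x:\<Omega>|lebesgue. v x \<bullet> wgrad \<Omega> z x + wdiv \<Omega> v x * z x)"

definition normal_trace_zero_on ::
    "(real^'n) set \<Rightarrow> (real^'n) set \<Rightarrow> (real^'n \<Rightarrow> real^'n) \<Rightarrow> bool" where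
  "normal_trace_zero_on \<Omega> \<Gamma> v \<longleftrightarrow>
     (\<forall>z\<in>H1 \<Omega>. trace_zero_on \<Omega> (frontier \<Omega> - \<Gamma>) z \<longrightarrow> normal_trace \<Omega> v z = 0)"

definition H0div :: "(real^'n) set \<Rightarrow> (real^'n) set \<Rightarrow> (real^'n \<Rightarrow> real^'n) set" where
  "H0div \<Omega> \<Gamma> = {v \<in> Hdiv \<Omega>. normal_trace_zero_on \<Omega> \<Gamma> v}"

definition V0 :: "(real^'n) set \<Rightarrow> (real^'n) set \<Rightarrow> (real^'n) set \<Rightarrow> (real^'n) set \<Rightarrow>
    (real^'n \<Rightarrow> real) set" where
  "V0 \<Omega> \<Gamma>0 \<Gamma>1 \<Gamma>3 =
     {v \<in> V \<Omega>. trace_zero_on \<Omega> (\<Gamma>0 \<union> \<Gamma>1) v \<and> normal_trace_zero_on \<Omega> (\<Gamma>1 \<union> \<Gamma>3) (wgrad \<Omega> v)}"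

section \<open>The primal and the saddle-point problem\<close>

definition primal_solution ::
    "(real^'n) set \<Rightarrow> (real^'n) set \<Rightarrow> (real^'n) set \<Rightarrow> (real^'n) set \<Rightarrow> real \<Rightarrow> real \<Rightarrow>
     ((real^'n \<Rightarrow> real) \<Rightarrow> real) \<Rightarrow> (real^'n \<Rightarrow> real) \<Rightarrow> bool" where
  "primal_solution \<Omega> \<Gamma>0 \<Gamma>1 \<Gamma>3 c0 c1 f u \<longleftrightarrow> u \<in> V0 \<Omega> \<Gamma>0 \<Gamma>1 \<Gamma>3 \<and>
     (\<forall>v \<in> V0 \<Omega> \<Gamma>0 \<Gamma>1 \<Gamma>3.
        (LINT x:\<Omega>|lebesgue. wlaplace \<Omega> u x * wlaplace \<Omega> v x
           + c0 * (wgrad \<Omega> u x \<bullet> wgrad \<Omega> v x) + c1 * (u x * v x)) = f v)"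

definition a_form :: "(real^'n) set \<Rightarrow> real \<Rightarrow> real \<Rightarrow>
    (real^'n \<Rightarrow> real) \<times> (real^'n \<Rightarrow> real^'n) \<Rightarrow> (real^'n \<Rightarrow> real) \<times> (real^'n \<Rightarrow> real^'n) \<Rightarrow> real" where
  "a_form \<Omega> c0 c1 = (\<lambda>(u, v) (\<phi>, \<psi>).
     c0 * (LINT x:\<Omega>|lebesgue. v x \<bullet> \<psi> x) + (LINT x:\<Omega>|lebesgue. wdiv \<Omega> v x * wdiv \<Omega> \<psi> x)
     + c1 * (LINT x:\<Omega>|lebesgue. u x * \<phi> x))"

definition b_form :: "(real^'n) set \<Rightarrow>
    (real^'n \<Rightarrow> real) \<times> (real^'n \<Rightarrow> real^'n) \<Rightarrow> (real^'n \<Rightarrow> real^'n) \<Rightarrow> real" where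
  "b_form \<Omega> = (\<lambda>(u, v) \<beta>. LINT x:\<Omega>|lebesgue. \<beta> x \<bullet> v x + u x * wdiv \<Omega> \<beta> x)"

definition saddle_solution ::
    "(real^'n) set \<Rightarrow> (real^'n) set \<Rightarrow> (real^'n) set \<Rightarrow> real \<Rightarrow> real \<Rightarrow>
     ((real^'n \<Rightarrow> real) \<Rightarrow> real) \<Rightarrow>
     (real^'n \<Rightarrow> real) \<Rightarrow> (real^'n \<Rightarrow> real^'n) \<Rightarrow> (real^'n \<Rightarrow> real^'n) \<Rightarrow> bool" where
  "saddle_solution \<Omega> \<Gamma>1 \<Gamma>3 c0 c1 F u v \<alpha> \<longleftrightarrow>
     u \<in> L2 \<Omega> \<and> v \<in> H0div \<Omega> (\<Gamma>1 \<union> \<Gamma>3) \<and> \<alpha> \<in> H0div \<Omega> \<Gamma>3 \<and>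
     (\<forall>\<phi>\<in>L2 \<Omega>. \<forall>\<psi>\<in>H0div \<Omega> (\<Gamma>1 \<union> \<Gamma>3).
        a_form \<Omega> c0 c1 (u, v) (\<phi>, \<psi>) + b_form \<Omega> (\<phi>, \<psi>) \<alpha> = F \<phi>) \<and>
     (\<forall>\<beta>\<in>H0div \<Omega> \<Gamma>3. b_form \<Omega> (u, v) \<beta> = 0)"

end

theory Submission
  imports Defs "HOL-Analysis.Analysis"
begin

text \<open>The second equation of the saddle-point problem says that \<open>v\<close> is the weak gradient of \<open>u\<close> and, by
  duality (a function outside a closed subspace of \<open>L\<^sup>2\<close> is separated from it by an annihilator), that
  \<open>u\<close> has trace zero on \<open>\<Gamma>0 \<union> \<Gamma>1\<close>. Testing the first equation with \<open>(z, \<nabla>z)\<close>, \<open>z \<in> V\<^sub>0\<close>, eliminates the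
  multiplier, so \<open>u\<close> solves the primal problem, whose solution is unique.

  If \<open>ubar\<close> is regular, the multiplier is \<open>\<alpha> = \<nabla>\<Delta>ubar - c0 \<nabla>ubar\<close>. What remains are its natural boundary
  conditions. By the Lipschitz property the boundary is a graph, and outside finitely many affine
  sets of codimension two it is locally a hyperplane on which a single boundary condition holds. The
  exceptional set is removed by cut-off functions with bounded energy, so that Green's formula has to
  be checked only near flat points; there explicit test functions of the form
  \<open>z - \<tau> \<partial>\<^sub>nz\<close> and \<open>\<tau> \<theta>\<close>, with \<open>\<tau>\<close> the signed distance to the face, are admissible in the primal
  problem. Traces are handled by mollification with kernels supported on one side of the face.\<close>

section \<open>Smooth functions\<close>

text \<open>Nothing is ever restricted to the boundary: boundary values are read off from L2
  products of pairs. If \<open>w0\<close> is the divergence of \<open>w1\<close>, the pair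
  (\<open>w0\<close>, \<open>w1\<close>) acts on a function paired with its gradient as the boundary
  integral of that function against the normal trace of \<open>w1\<close>, and every boundary
  condition says that such products vanish. The difficulty is that the primal equation may be tested
  only with members of V0. Near an edge where two conditions meet, no member with prescribed
  boundary values is at hand, whereas on a single face one can be written down. Cut-offs at scale h
  around a set of codimension two have gradients of size 1/h on a volume of size h^2, so their
  energies stay bounded without becoming small. Bounded energy still makes these gradients tend
  weakly to zero, which is enough when they are multiplied by a bounded function. A smooth function
  is bounded on the domain, but p, the Laplacian of \<open>ubar\<close>, enters only as an H1
  function; it is therefore replaced by sin(s p)/s, and s tends to 0 at the end.\<close>

lemma has_derivative_gradient:
  fixes f :: "real^'n \<Rightarrow> real"
  assumes "f differentiable (at x)"
  shows "(f has_derivative (\<lambda>h. gradient f x \<bullet> h)) (at x)"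
proof -
  let ?D = "frechet_derivative f (at x)"
  have D: "(f has_derivative ?D) (at x)"
    using assms by (simp add: frechet_derivative_works)
  then have lin: "linear ?D"
    using has_derivative_linear by blast
  have "?D h = gradient f x \<bullet> h" for h
  proof -
    have "?D h = ?D (\<Sum>i\<in>UNIV. (h $ i) *\<^sub>R axis i 1)"
      using basis_expansion[of h] by (simp add: scalar_mult_eq_scaleR)
    also have "\<dots> = (\<Sum>i\<in>UNIV. h $ i * ?D (axis i 1))"
      using lin by (simp add: linear_sum linear_scale)
    also have "\<dots> = gradient f x \<bullet> h"
      by (simp add: gradient_def partial_deriv_def inner_vec_def mult.commute)
    finally show ?thesis .
  qed
  then show ?thesis
    using D by (metis (no_types, lifting) ext)
qed

lemma gradient_eqI:
  fixes f :: "real^'n \<Rightarrow> real"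
  assumes "(f has_derivative (\<lambda>h. g \<bullet> h)) (at x)"
  shows "gradient f x = g"
  using frechet_derivative_at[OF assms]
  by (simp add: vec_eq_iff gradient_def partial_deriv_def inner_axis flip: fun_eq_iff)
    (metis inner_axis inner_real_def mult.right_neutral)

lemma partial_deriv_eqI:
  fixes f :: "real^'n \<Rightarrow> real"
  assumes "(f has_derivative (\<lambda>h. g \<bullet> h)) (at x)"
  shows "partial_deriv i f x = g $ i"
  using gradient_eqI[OF assms] by (auto simp: gradient_def)

lemma C_k_SucD: "C_k (Suc k) f \<Longrightarrow> C_k k f"
proof (induction k arbitrary: f)
  case 0
  then show ?case
    by (simp add: differentiable_imp_continuous_on)
qed simp

lemma C_k_Suc_has_derivative:
  "C_k (Suc k) f \<Longrightarrow> (f has_derivative (\<lambda>h. gradient f x \<bullet> h)) (at x)"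
  by (rule has_derivative_gradient) (simp add: differentiable_on_def)

text \<open>The common induction step of the closure properties: once a formula for the gradient is
  exhibited, the next order of differentiability reduces to \<open>C_k\<close> of its
  components.\<close>

lemma C_k_SucI:
  fixes f :: "real^'n \<Rightarrow> real"
  assumes "\<And>x. (f has_derivative (\<lambda>h. g x \<bullet> h)) (at x)" and "\<And>i. C_k k (\<lambda>x. g x $ i)"
  shows "C_k (Suc k) f"
proof -
  have "partial_deriv i f = (\<lambda>x. g x $ i)" for i
    using partial_deriv_eqI[OF assms(1)] by blast
  then show ?thesis
    using assms by (auto simp: differentiable_on_def differentiable_def)
qed

lemma C_k_add: "C_k k f \<Longrightarrow> C_k k g \<Longrightarrow> C_k k (\<lambda>x. f x + g x)"
proof (induction k arbitrary: f g)
  case 0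
  then show ?case by (simp add: continuous_on_add)
next
  case (Suc k)
  show ?case
  proof (rule C_k_SucI)
    show "((\<lambda>x. f x + g x) has_derivative (\<lambda>h. (gradient f x + gradient g x) \<bullet> h)) (at x)" for x
      using Suc.prems[THEN C_k_Suc_has_derivative, of x]
      by (auto intro!: derivative_eq_intros simp: inner_add_left)
    show "C_k k (\<lambda>x. (gradient f x + gradient g x) $ i)" for i
      using Suc by (simp add: gradient_def)
  qed
qed

lemma C_k_const: "C_k k (\<lambda>x::real^'n. c)"
proof (induction k arbitrary: c)
  case (Suc k)
  show ?case
    by (rule C_k_SucI[where g = "\<lambda>_. 0"]) (auto simp: Suc)
qed auto

lemma C_k_mult: "C_k k f \<Longrightarrow> C_k k g \<Longrightarrow> C_k k (\<lambda>x. f x * g x)"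
proof (induction k arbitrary: f g)
  case 0
  then show ?case by (simp add: continuous_on_mult)
next
  case (Suc k)
  show ?case
  proof (rule C_k_SucI)
    show "((\<lambda>x. f x * g x) has_derivative
        (\<lambda>h. (f x *\<^sub>R gradient g x + g x *\<^sub>R gradient f x) \<bullet> h)) (at x)" for x
      using Suc.prems[THEN C_k_Suc_has_derivative, of x]
      by (auto intro!: derivative_eq_intros simp: inner_add_left)
    show "C_k k (\<lambda>x. (f x *\<^sub>R gradient g x + g x *\<^sub>R gradient f x) $ i)" for i
      using Suc by (auto simp: gradient_def intro!: C_k_add Suc.IH C_k_SucD[of k f] C_k_SucD[of k g])
  qed
qed

lemma C_k_minus: "C_k k f \<Longrightarrow> C_k k (\<lambda>x. - f x)"
  using C_k_mult[OF C_k_const[of k "-1"], of f] by simp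

lemma C_k_inner: "C_k k (\<lambda>x::real^'n. x \<bullet> a)"
proof (cases k)
  case 0
  then show ?thesis by (auto intro!: continuous_intros)
next
  case (Suc m)
  show ?thesis unfolding Suc
    by (rule C_k_SucI[where g = "\<lambda>_. a"])
      (auto intro!: derivative_eq_intros C_k_const simp: inner_commute)
qed

lemma C_k_inverse:
  assumes nz: "\<And>x. f x \<noteq> 0"
  shows "C_k k f \<Longrightarrow> C_k k (\<lambda>x. inverse (f x))"
proof (induction k)
  case 0
  then show ?case using nz by (auto intro!: continuous_intros)
next
  case (Suc k)
  have inv: "C_k k (\<lambda>x. inverse (f x))"
    using Suc C_k_SucD by blast
  show ?case
  proof (rule C_k_SucI)
    show "((\<lambda>x. inverse (f x)) has_derivative
        (\<lambda>h. ((- 1 * (inverse (f x) * inverse (f x))) *\<^sub>R gradient f x) \<bullet> h)) (at x)" for x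
      using Suc.prems[THEN C_k_Suc_has_derivative, of x] nz[of x]
      by (auto intro!: derivative_eq_intros simp: algebra_simps)
    show "C_k k (\<lambda>x. ((- 1 * (inverse (f x) * inverse (f x))) *\<^sub>R gradient f x) $ i)" for i
      using inv Suc.prems by (auto simp: gradient_def intro!: C_k_minus C_k_mult)
  qed
qed

lemma C_k_sin_cos:
  "C_k k f \<Longrightarrow> C_k k (\<lambda>x. sin (f x)) \<and> C_k k (\<lambda>x. cos (f x))"
proof (induction k)
  case 0
  then show ?case by (auto intro!: continuous_intros)
next
  case (Suc k)
  have IH: "C_k k (\<lambda>x. sin (f x))" "C_k k (\<lambda>x. cos (f x))"
    using Suc C_k_SucD by blast+
  have g: "C_k k (\<lambda>x. gradient f x $ i)" for i
    using Suc.prems by (simp add: gradient_def)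
  have "C_k (Suc k) (\<lambda>x. sin (f x))"
    by (rule C_k_SucI[where g = "\<lambda>x. cos (f x) *\<^sub>R gradient f x"])
      (use Suc.prems[THEN C_k_Suc_has_derivative] IH g in
        \<open>auto intro!: derivative_eq_intros C_k_mult\<close>)
  moreover have "C_k (Suc k) (\<lambda>x. cos (f x))"
    by (rule C_k_SucI[where g = "\<lambda>x. (- 1 * sin (f x)) *\<^sub>R gradient f x"])
      (use Suc.prems[THEN C_k_Suc_has_derivative] IH g in
        \<open>auto intro!: derivative_eq_intros C_k_minus C_k_mult\<close>)
  ultimately show ?case ..
qed

lemma C_k_reflect:
  fixes f :: "real^'n \<Rightarrow> real"
  shows "C_k k f \<Longrightarrow> C_k k (\<lambda>x. f (y - x))"
proof (induction k arbitrary: f)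
  case 0
  then have "continuous_on UNIV f" by simp
  then show ?case by (auto intro!: continuous_intros continuous_on_compose2[of UNIV f])
next
  case (Suc k)
  show ?case
  proof (rule C_k_SucI)
    show "((\<lambda>x. f (y - x)) has_derivative (\<lambda>h. ((-1) *\<^sub>R gradient f (y - x)) \<bullet> h)) (at x)" for x
    proof -
      have "((\<lambda>x. y - x) has_derivative (\<lambda>h. - h)) (at x)"
        by (auto intro!: derivative_eq_intros)
      from has_derivative_compose[OF this C_k_Suc_has_derivative[OF Suc.prems, of "y - x"]]
      show ?thesis by simp
    qed
    show "C_k k (\<lambda>x. ((-1) *\<^sub>R gradient f (y - x)) $ i)" for i
      using Suc by (auto simp: gradient_def intro!: C_k_minus)
  qed
qed

lemma smooth_const [intro, simp]: "smooth (\<lambda>x. c)"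
  and smooth_inner [intro, simp]: "smooth (\<lambda>x. x \<bullet> a)"
  by (simp_all add: smooth_def C_k_const C_k_inner)

lemma smooth_component [intro, simp]: "smooth (\<lambda>x. x $ i)"
  using smooth_inner[of "axis i 1"] by (simp add: inner_axis)

lemma smooth_add [intro]: "smooth f \<Longrightarrow> smooth g \<Longrightarrow> smooth (\<lambda>x. f x + g x)"
  and smooth_mult [intro]: "smooth f \<Longrightarrow> smooth g \<Longrightarrow> smooth (\<lambda>x. f x * g x)"
  and smooth_sin [intro]: "smooth f \<Longrightarrow> smooth (\<lambda>x. sin (f x))"
  and smooth_reflect: "smooth f \<Longrightarrow> smooth (\<lambda>x. f (y - x))"
  by (simp_all add: smooth_def C_k_add C_k_mult C_k_sin_cos C_k_reflect)

lemma smooth_minus [intro]: "smooth f \<Longrightarrow> smooth (\<lambda>x. - f x)"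
  using smooth_mult[of "\<lambda>_. -1" f] by simp

lemma smooth_diff [intro]: "smooth f \<Longrightarrow> smooth g \<Longrightarrow> smooth (\<lambda>x. f x - g x)"
  using smooth_add[of f "\<lambda>x. - g x"] by auto

lemma smooth_divide [intro]:
  "smooth f \<Longrightarrow> smooth g \<Longrightarrow> (\<And>x. g x \<noteq> 0) \<Longrightarrow> smooth (\<lambda>x. f x / g x)"
  using smooth_mult[of f "\<lambda>x. inverse (g x)"]
  by (simp add: smooth_def C_k_inverse divide_inverse)

lemma smooth_sum [intro]: "(\<And>i. i \<in> I \<Longrightarrow> smooth (f i)) \<Longrightarrow> smooth (\<lambda>x. \<Sum>i\<in>I. f i x)"
  by (induction I rule: infinite_finite_induct) auto

lemma smooth_prod [intro]: "(\<And>i. i \<in> I \<Longrightarrow> smooth (f i)) \<Longrightarrow> smooth (\<lambda>x. \<Prod>i\<in>I. f i x)"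
  by (induction I rule: infinite_finite_induct) auto

lemma smooth_power [intro]: "smooth f \<Longrightarrow> smooth (\<lambda>x. f x ^ m)"
  by (induction m) auto

lemma smooth_partial_deriv [intro]: "smooth f \<Longrightarrow> smooth (partial_deriv i f)"
  unfolding smooth_def by (meson C_k.simps(2))

lemma smooth_gradient_component [intro]: "smooth f \<Longrightarrow> smooth (\<lambda>x. gradient f x $ i)"
  by (simp add: gradient_def smooth_partial_deriv)

lemma smooth_has_derivative:
  "smooth f \<Longrightarrow> (f has_derivative (\<lambda>h. gradient f x \<bullet> h)) (at x)"
  by (rule C_k_Suc_has_derivative[of 0]) (simp only: smooth_def)

lemma smooth_continuous_on: "smooth f \<Longrightarrow> continuous_on S f"
  by (metis continuous_on_subset subset_UNIV C_k.simps(1) smooth_def)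

lemma smooth_gradient_inner [intro]:
  "smooth f \<Longrightarrow> smooth (\<lambda>x. gradient f x \<bullet> a)"
  unfolding inner_vec_def by (auto intro!: smooth_sum smooth_mult)

lemma gradient_const [simp]: "gradient (\<lambda>x. c) x = 0"
  and gradient_inner [simp]: "gradient (\<lambda>x. x \<bullet> a) x = a"
  by (rule gradient_eqI, auto intro!: derivative_eq_intros simp: inner_commute)+

lemma gradient_add:
  "smooth f \<Longrightarrow> smooth g \<Longrightarrow> gradient (\<lambda>x. f x + g x) x = gradient f x + gradient g x"
  by (rule gradient_eqI)
    (auto intro!: derivative_eq_intros smooth_has_derivative simp: inner_add_left)

lemma gradient_diff:
  "smooth f \<Longrightarrow> smooth g \<Longrightarrow> gradient (\<lambda>x. f x - g x) x = gradient f x - gradient g x"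
  by (rule gradient_eqI)
    (auto intro!: derivative_eq_intros smooth_has_derivative simp: inner_diff_left)

lemma gradient_mult:
  "smooth f \<Longrightarrow> smooth g \<Longrightarrow>
    gradient (\<lambda>x. f x * g x) x = f x *\<^sub>R gradient g x + g x *\<^sub>R gradient f x"
  by (rule gradient_eqI)
    (auto intro!: derivative_eq_intros smooth_has_derivative simp: inner_add_left)

lemma gradient_compose:
  assumes "smooth f" "(\<phi> has_real_derivative d) (at (f x))"
  shows "gradient (\<lambda>x. \<phi> (f x)) x = d *\<^sub>R gradient f x"
proof (rule gradient_eqI)
  from has_derivative_compose[OF smooth_has_derivative[OF assms(1), of x]
      assms(2)[unfolded has_field_derivative_def]]
  show "((\<lambda>x. \<phi> (f x)) has_derivative (\<lambda>h. (d *\<^sub>R gradient f x) \<bullet> h)) (at x)"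
    by simp
qed

lemma gradient_sin: "smooth f \<Longrightarrow> gradient (\<lambda>x. sin (f x)) x = cos (f x) *\<^sub>R gradient f x"
  by (rule gradient_compose) (auto intro!: derivative_eq_intros)

lemma gradient_reflect:
  "smooth f \<Longrightarrow> gradient (\<lambda>x. f (y - x)) x = - gradient f (y - x)"
proof (rule gradient_eqI)
  assume "smooth f"
  have "((\<lambda>x. y - x) has_derivative (\<lambda>h. - h)) (at x)"
    by (auto intro!: derivative_eq_intros)
  from has_derivative_compose[OF this smooth_has_derivative[OF \<open>smooth f\<close>]]
  show "((\<lambda>x. f (y - x)) has_derivative (\<lambda>h. (- gradient f (y - x)) \<bullet> h)) (at x)"
    by simp
qed

lemma gradient_eq_0_open:
  assumes "open S" "\<And>x. x \<in> S \<Longrightarrow> f x = 0" "x \<in> S"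
  shows "gradient f x = 0"
proof (rule gradient_eqI)
  have "((\<lambda>_. 0) has_derivative (\<lambda>h. 0 \<bullet> h)) (at x)" by simp
  then show "(f has_derivative (\<lambda>h. 0 \<bullet> h)) (at x)"
    by (rule has_derivative_transform_within_open[OF _ assms(1,3)]) (simp add: assms)
qed

subsection \<open>Cut-off functions\<close>

text \<open>The flat function exp(-1/t), extended by 0. The power \<open>m\<close> is carried along
  because differentiation turns the member \<open>m\<close> into a combination of the members
  \<open>m + 1\<close> and \<open>m + 2\<close>, so the family is closed under derivatives and
  smoothness follows by one induction.\<close>

definition expinv :: "nat \<Rightarrow> real \<Rightarrow> real" where
  "expinv m t = (if t > 0 then inverse t ^ m * exp (- inverse t) else 0)"

lemma expinv_tendsto_0: "(expinv m \<longlongrightarrow> 0) (at 0)"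
proof -
  have "((\<lambda>x. inverse x ^ m * exp (- inverse x)) \<longlongrightarrow> 0) (at_right (0::real))"
    using filterlim_compose[OF tendsto_power_div_exp_0[of m] filterlim_inverse_at_top_right]
    by (simp add: divide_inverse exp_minus)
  then have "(expinv m \<longlongrightarrow> 0) (at_right 0)"
    by (rule Lim_transform_eventually)
      (auto simp: expinv_def eventually_at_filter)
  moreover have "(expinv m \<longlongrightarrow> 0) (at_left 0)"
    by (rule Lim_transform_eventually[OF tendsto_const])
      (auto simp: expinv_def eventually_at_filter)
  ultimately show ?thesis
    by (simp add: filterlim_split_at_real)
qed

lemma expinv_deriv:
  "(expinv m has_real_derivative (expinv (m + 2) t - real m * expinv (m + 1) t)) (at t)"
proof -
  consider "t > 0" | "t < 0" | "t = 0" by linarith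
  then show ?thesis
  proof cases
    case 1
    have "((\<lambda>t. inverse t ^ m * exp (- inverse t)) has_real_derivative
        (expinv (m + 2) t - real m * expinv (m + 1) t)) (at t)"
    proof -
      have "((\<lambda>t. inverse t ^ m) has_real_derivative
          (real m * (- (inverse t)\<^sup>2) * inverse t ^ (m - 1))) (at t)"
        using DERIV_power[of inverse "- (inverse t ^ Suc (Suc 0))" t UNIV m] DERIV_inverse[of t] 1
        by (simp add: numeral_2_eq_2 mult.assoc)
      moreover have "((\<lambda>t. exp (- inverse t)) has_real_derivative
          ((inverse t)\<^sup>2 * exp (- inverse t))) (at t)"
        using 1 by (auto intro!: derivative_eq_intros simp: power2_eq_square)
      ultimately have D: "((\<lambda>t. inverse t ^ m * exp (- inverse t)) has_real_derivative
          (real m * (- (inverse t)\<^sup>2) * inverse t ^ (m - 1) * exp (- inverse t) +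
            (inverse t)\<^sup>2 * exp (- inverse t) * inverse t ^ m)) (at t)"
        by (rule DERIV_mult)
      show ?thesis
        by (rule DERIV_cong[OF D])
          (use 1 in \<open>cases m; simp add: expinv_def power2_eq_square algebra_simps\<close>)
    qed
    then show ?thesis
      by (rule has_field_derivative_transform_within_open[OF _ open_greaterThan[of 0]])
        (use 1 in \<open>auto simp: expinv_def\<close>)
  next
    case 2
    have "((\<lambda>t. 0) has_real_derivative (expinv (m + 2) t - real m * expinv (m + 1) t)) (at t)"
      using 2 by (auto simp: expinv_def)
    then show ?thesis
      by (rule has_field_derivative_transform_within_open[OF _ open_lessThan[of 0]])
        (use 2 in \<open>auto simp: expinv_def\<close>)
  next
    case 3
    \<comment> \<open>Dividing by \<open>h\<close> only raises the power by one, so the difference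
      quotient at 0 is again a member of the family and tends to 0.\<close>
    have "(\<lambda>h. (expinv m (0 + h) - expinv m 0) / h) = expinv (Suc m)"
      by (auto simp: fun_eq_iff expinv_def field_simps)
    then show ?thesis
      using expinv_tendsto_0[of "Suc m"] 3 by (simp add: DERIV_def expinv_def)
  qed
qed

lemma C_k_expinv: "C_k k f \<Longrightarrow> C_k k (\<lambda>x. expinv m (f x))"
proof (induction k arbitrary: m)
  case 0
  have "continuous_on UNIV (expinv m)"
    by (meson DERIV_isCont continuous_at_imp_continuous_on expinv_deriv)
  then show ?case using 0 by (auto intro: continuous_on_compose2)
next
  case (Suc k)
  have IH: "C_k k (\<lambda>x. expinv m (f x))" for m
    using Suc C_k_SucD by blast
  let ?g = "\<lambda>x. (expinv (m + 2) (f x) + (- real m) * expinv (m + 1) (f x)) *\<^sub>R gradient f x"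
  show ?case
  proof (rule C_k_SucI)
    fix x
    from has_derivative_compose[OF C_k_Suc_has_derivative[OF Suc.prems, of x]
        expinv_deriv[of m, unfolded has_field_derivative_def]]
    show "((\<lambda>x. expinv m (f x)) has_derivative (\<lambda>h. ?g x \<bullet> h)) (at x)"
      by simp
  next
    have "C_k k (\<lambda>x. gradient f x $ i)" for i
      using Suc.prems by (simp add: gradient_def)
    then show "C_k k (\<lambda>x. ?g x $ i)" for i
      unfolding vector_scaleR_component real_scaleR_def
      by (intro C_k_mult C_k_add C_k_const IH)
  qed
qed

lemma smooth_expinv [intro]: "smooth f \<Longrightarrow> smooth (\<lambda>x. expinv m (f x))"
  by (simp add: smooth_def C_k_expinv)

lemma expinv_nonneg [simp]: "expinv m t \<ge> 0"
  and expinv_pos: "t > 0 \<Longrightarrow> expinv m t > 0"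
  and expinv_0: "t \<le> 0 \<Longrightarrow> expinv m t = 0"
  by (auto simp: expinv_def)

text \<open>The standard smooth transition from 0 to 1 over the unit interval. The quotient is
  harmless because \<open>t\<close> and \<open>1 - t\<close> are never both nonpositive.\<close>

definition plateau :: "real \<Rightarrow> real" where
  "plateau t = expinv 0 t / (expinv 0 t + expinv 0 (1 - t))"

lemma plateau_denominator: "expinv 0 t + expinv 0 (1 - t) > 0"
proof (cases "t > 0")
  case True
  then show ?thesis using expinv_pos[of t 0] expinv_nonneg[of 0 "1 - t"] by linarith
next
  case False
  then show ?thesis using expinv_pos[of "1 - t" 0] expinv_nonneg[of 0 t] by linarith
qed

lemma smooth_plateau [intro]: "smooth f \<Longrightarrow> smooth (\<lambda>x. plateau (f x))"
  unfolding plateau_def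
  by (intro smooth_divide smooth_add smooth_expinv smooth_diff smooth_const)
    (use plateau_denominator in \<open>auto simp: less_imp_neq[symmetric] neq_iff\<close>)

lemma plateau_bounds: "0 \<le> plateau t" "plateau t \<le> 1"
  using plateau_denominator[of t] by (auto simp: plateau_def)

lemma plateau_0: "t \<le> 0 \<Longrightarrow> plateau t = 0"
  by (simp add: plateau_def expinv_0)

lemma plateau_1: "t \<ge> 1 \<Longrightarrow> plateau t = 1"
  using plateau_denominator[of t] by (simp add: plateau_def expinv_0)

text \<open>The derivative is an explicit quotient, continuous on the compact interval [0,1] and
  zero outside it. The bound \<open>L\<close> gives every rescaled transition a gradient of order
  one over its width, the input of all later energy estimates.\<close>

lemma plateau_deriv_bounded:
  obtains d L where "\<And>t. (plateau has_real_derivative d t) (at t)" "\<And>t. \<bar>d t\<bar> \<le> L"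
    "\<And>t. t < 0 \<or> t > 1 \<Longrightarrow> d t = 0"
proof -
  let ?e' = "\<lambda>t. expinv 2 t" and ?N = "\<lambda>t. expinv 0 t + expinv 0 (1 - t)"
  have e: "(expinv 0 has_real_derivative expinv 2 t) (at t)" for t
    using expinv_deriv[of 0 t] by (simp add: numeral_2_eq_2)
  have e1: "((\<lambda>t. expinv 0 (1 - t)) has_real_derivative - expinv 2 (1 - t)) (at t)" for t
  proof -
    have "((\<lambda>t. 1 - t) has_real_derivative -1) (at t)"
      by (auto intro!: derivative_eq_intros)
    from DERIV_chain2[OF e this] show ?thesis by simp
  qed
  define d where "d = (\<lambda>t. (?e' t * ?N t - expinv 0 t * (?e' t - ?e' (1 - t))) / (?N t * ?N t))"
  have D: "(plateau has_real_derivative d t) (at t)" for t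
    unfolding plateau_def[abs_def] d_def
    using plateau_denominator[of t]
    by (intro DERIV_divide e DERIV_add e1[simplified] ) (auto intro!: derivative_eq_intros e e1)
  have zero: "d t = 0" if "t < 0 \<or> t > 1" for t
    using that by (auto simp: d_def expinv_0)
  have cont: "continuous_on {0..1} (expinv m)" for m
    by (meson DERIV_isCont continuous_at_imp_continuous_on expinv_deriv)
  have cont': "continuous_on {0..1} (\<lambda>t. expinv m (1 - t))" for m
    by (rule continuous_on_compose2[OF cont]) (auto intro!: continuous_intros)
  have "continuous_on {0..1} d"
    unfolding d_def using plateau_denominator
    by (intro continuous_intros cont cont') (auto simp: less_imp_neq[symmetric] neq_iff)
  then have "bounded (d ` {0..1})"
    by (simp add: compact_continuous_image compact_imp_bounded)
  then obtain L where L: "\<And>t. t \<in> {0..1} \<Longrightarrow> \<bar>d t\<bar> \<le> L"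
    unfolding bounded_iff by (metis imageI real_norm_def)
  have "\<bar>d t\<bar> \<le> \<bar>L\<bar>" for t
    using L[of t] zero[of t] by (cases "t \<in> {0..1}") auto
  from that[OF D this zero] show ?thesis .
qed

lemma smooth_bump:
  fixes x :: "real^'n"
  assumes "0 < r" "r < s"
  obtains b where "smooth b" "\<And>y. 0 \<le> b y" "\<And>y. b y \<le> 1" "\<And>y. y \<in> ball x r \<Longrightarrow> b y = 1"
    "\<And>y. y \<notin> cball x s \<Longrightarrow> b y = 0"
proof
  \<comment> \<open>The squared distance is used because it is a polynomial. The normalisation makes
    the argument at least 1 on the inner ball and at most 0 outside the outer one.\<close>
  let ?f = "\<lambda>y. (s\<^sup>2 - (y - x) \<bullet> (y - x)) / (s\<^sup>2 - r\<^sup>2)"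
  let ?b = "\<lambda>y. plateau (?f y)"
  have rs: "s\<^sup>2 - r\<^sup>2 > 0"
    using assms by (simp add: power_strict_mono)
  have "?f = (\<lambda>y. (s\<^sup>2 - (\<Sum>i\<in>UNIV. (y $ i - x $ i)\<^sup>2)) / (s\<^sup>2 - r\<^sup>2))"
    by (simp add: inner_vec_def power2_eq_square)
  moreover have "smooth (\<lambda>y. (s\<^sup>2 - (\<Sum>i\<in>UNIV. (y $ i - x $ i)\<^sup>2)) / (s\<^sup>2 - r\<^sup>2))"
    using rs by (intro smooth_divide smooth_diff smooth_sum smooth_power) auto
  ultimately have "smooth ?f" by simp
  then show "smooth ?b" by (rule smooth_plateau)
  show "0 \<le> ?b y" "?b y \<le> 1" for y
    by (rule plateau_bounds)+
  show "?b y = 1" if "y \<in> ball x r" for y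
  proof -
    have "(y - x) \<bullet> (y - x) \<le> r\<^sup>2"
      using that assms by (simp add: dist_norm norm_minus_commute dot_square_norm power_mono)
    then show ?thesis using rs by (intro plateau_1) (simp add: field_simps)
  qed
  show "?b y = 0" if "y \<notin> cball x s" for y
  proof -
    have "(y - x) \<bullet> (y - x) \<ge> s\<^sup>2"
      using that assms by (simp add: dist_norm norm_minus_commute dot_square_norm power_mono)
    then show ?thesis using rs by (intro plateau_0) (simp add: field_simps)
  qed
qed

section \<open>Square-integrable functions\<close>

text \<open>Euclidean values allow a function and its gradient to be treated as one element
  \<open>(z x, g x)\<close> of a single Hilbert space; all duality arguments below take place
  there.\<close>

definition sqint :: "'a measure \<Rightarrow> ('a \<Rightarrow> 'b::euclidean_space) set" where
  "sqint M = {u \<in> borel_measurable M. integrable M (\<lambda>x. (norm (u x))\<^sup>2)}"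

definition ip :: "'a measure \<Rightarrow> ('a \<Rightarrow> 'b::euclidean_space) \<Rightarrow> ('a \<Rightarrow> 'b) \<Rightarrow> real" where
  "ip M u v = (\<integral>x. u x \<bullet> v x \<partial>M)"

lemma sqint_measurable [measurable_dest]: "u \<in> sqint M \<Longrightarrow> u \<in> borel_measurable M"
  by (simp add: sqint_def)

lemma sqint_integrable: "u \<in> sqint M \<Longrightarrow> integrable M (\<lambda>x. (norm (u x))\<^sup>2)"
  by (simp add: sqint_def)

lemma ip_self: "ip M u u = (\<integral>x. (norm (u x))\<^sup>2 \<partial>M)"
  by (simp add: ip_def dot_square_norm)

lemma ip_self_nonneg [simp]: "0 \<le> ip M u u"
  by (simp add: ip_self)

lemma ip_commute: "ip M u v = ip M v u"
  by (simp add: ip_def inner_commute)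

lemma two_norm_mult_le: "2 * (norm a * norm b) \<le> (norm a)\<^sup>2 + (norm b)\<^sup>2"
  using sum_squares_bound[of "norm a" "norm b"] by simp

lemma sqint_norm_mult_integrable:
  assumes "u \<in> sqint M" "v \<in> sqint M"
  shows "integrable M (\<lambda>x. norm (u x) * norm (v x))"
proof (rule Bochner_Integration.integrable_bound)
  show "integrable M (\<lambda>x. (norm (u x))\<^sup>2 + (norm (v x))\<^sup>2)"
    using assms by (auto simp: sqint_def)
  show "(\<lambda>x. norm (u x) * norm (v x)) \<in> borel_measurable M"
    using assms[THEN sqint_measurable] by measurable
  have "norm (u x) * norm (v x) \<le> (norm (u x))\<^sup>2 + (norm (v x))\<^sup>2" for x
    using two_norm_mult_le[of "u x" "v x"] by (smt (verit) mult_nonneg_nonneg norm_ge_zero)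
  then show "AE x in M. norm (norm (u x) * norm (v x)) \<le> norm ((norm (u x))\<^sup>2 + (norm (v x))\<^sup>2)"
    by (auto simp: abs_mult)
qed

lemma sqint_inner_integrable [intro]:
  assumes "u \<in> sqint M" "v \<in> sqint M"
  shows "integrable M (\<lambda>x. u x \<bullet> v x)"
  by (rule Bochner_Integration.integrable_bound[OF sqint_norm_mult_integrable[OF assms]])
    (use assms[THEN sqint_measurable] Cauchy_Schwarz_ineq2 in \<open>auto simp: abs_mult\<close>)

lemma sqint_mult_integrable [intro]:
  fixes u v :: "'a \<Rightarrow> real"
  shows "u \<in> sqint M \<Longrightarrow> v \<in> sqint M \<Longrightarrow> integrable M (\<lambda>x. u x * v x)"
  using sqint_inner_integrable[of u M v] by simp

lemma sqint_add [intro]: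
  assumes "u \<in> sqint M" "v \<in> sqint M"
  shows "(\<lambda>x. u x + v x) \<in> sqint M"
proof -
  have "integrable M (\<lambda>x. (norm (u x))\<^sup>2 + 2 * (u x \<bullet> v x) + (norm (v x))\<^sup>2)"
    using assms sqint_integrable by (intro Bochner_Integration.integrable_add) auto
  moreover have "(norm (u x))\<^sup>2 + 2 * (u x \<bullet> v x) + (norm (v x))\<^sup>2 = (norm (u x + v x))\<^sup>2" for x
    by (simp flip: dot_square_norm add: inner_add_left inner_add_right inner_commute)
  ultimately show ?thesis
    using assms[THEN sqint_measurable] by (simp add: sqint_def)
qed

lemma sqint_bounded_scale:
  assumes "u \<in> sqint M" and [measurable]: "m \<in> borel_measurable M"
    and "\<And>x. x \<in> space M \<Longrightarrow> \<bar>m x\<bar> \<le> C"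
  shows "(\<lambda>x. m x *\<^sub>R u x) \<in> sqint M"
proof -
  have [measurable]: "u \<in> borel_measurable M"
    using assms(1) by (rule sqint_measurable)
  have "integrable M (\<lambda>x. (norm (m x *\<^sub>R u x))\<^sup>2)"
  proof (rule Bochner_Integration.integrable_bound)
    show "integrable M (\<lambda>x. C\<^sup>2 * (norm (u x))\<^sup>2)"
      using sqint_integrable[OF assms(1)] by simp
    have "(m x)\<^sup>2 \<le> C\<^sup>2" if "x \<in> space M" for x
      using assms(3)[OF that] by (metis abs_ge_zero power2_abs power_mono)
    then show "AE x in M. norm ((norm (m x *\<^sub>R u x))\<^sup>2) \<le> norm (C\<^sup>2 * (norm (u x))\<^sup>2)"
      by (auto intro!: AE_I2 mult_right_mono simp: power_mult_distrib)
  qed measurable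
  then show ?thesis
    by (simp add: sqint_def)
qed

lemma sqint_scale [intro]: "u \<in> sqint M \<Longrightarrow> (\<lambda>x. c *\<^sub>R u x) \<in> sqint M"
  by (rule sqint_bounded_scale[where C = "\<bar>c\<bar>"]) auto

lemma sqint_cmult [intro]:
  fixes u :: "'a \<Rightarrow> real" shows "u \<in> sqint M \<Longrightarrow> (\<lambda>x. c * u x) \<in> sqint M"
  using sqint_scale[of u M c] by simp

lemma sqint_diff [intro]: "u \<in> sqint M \<Longrightarrow> v \<in> sqint M \<Longrightarrow> (\<lambda>x. u x - v x) \<in> sqint M"
  using sqint_add[of u M "\<lambda>x. (-1) *\<^sub>R v x"] sqint_scale[of v M "-1"] by simp

lemma sqint_zero [simp]: "(\<lambda>x. 0) \<in> sqint M"
  by (simp add: sqint_def)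

lemma sqint_sum [intro]: "(\<And>i. i \<in> I \<Longrightarrow> u i \<in> sqint M) \<Longrightarrow> (\<lambda>x. \<Sum>i\<in>I. u i x) \<in> sqint M"
  by (induction I rule: infinite_finite_induct) auto

lemma sqint_cong_AE:
  assumes "u \<in> sqint M" "AE x in M. u x = v x" "v \<in> borel_measurable M"
  shows "v \<in> sqint M"
proof -
  have [measurable]: "u \<in> borel_measurable M" "v \<in> borel_measurable M"
    using assms sqint_measurable by auto
  have "integrable M (\<lambda>x. (norm (u x))\<^sup>2) \<longleftrightarrow> integrable M (\<lambda>x. (norm (v x))\<^sup>2)"
    using assms(2) by (intro Bochner_Integration.integrable_cong_AE) auto
  then show ?thesis
    using assms by (simp add: sqint_def)
qed

lemma sqint_inner_const [intro]:
  assumes "u \<in> sqint M" shows "(\<lambda>x. u x \<bullet> a) \<in> sqint M"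
proof -
  have [measurable]: "u \<in> borel_measurable M" using assms by (rule sqint_measurable)
  have "integrable M (\<lambda>x. (norm (u x \<bullet> a))\<^sup>2)"
  proof (rule Bochner_Integration.integrable_bound)
    show "integrable M (\<lambda>x. (norm a)\<^sup>2 * (norm (u x))\<^sup>2)"
      using sqint_integrable[OF assms] by simp
    have "(u x \<bullet> a)\<^sup>2 \<le> (norm a)\<^sup>2 * (norm (u x))\<^sup>2" for x
      using Cauchy_Schwarz_ineq[of "u x" a] by (simp add: dot_square_norm mult.commute)
    then show "AE x in M. norm ((norm (u x \<bullet> a))\<^sup>2) \<le> norm ((norm a)\<^sup>2 * (norm (u x))\<^sup>2)"
      by (auto simp: abs_mult)
  qed measurable
  then show ?thesis by (simp add: sqint_def)
qed

lemma sqint_scale_const [intro]: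
  fixes u :: "'a \<Rightarrow> real"
  assumes "u \<in> sqint M" shows "(\<lambda>x. u x *\<^sub>R a) \<in> sqint M"
proof -
  have "integrable M (\<lambda>x. (u x)\<^sup>2 * (norm a)\<^sup>2)"
    using sqint_integrable[OF assms] by simp
  then show ?thesis
    using sqint_measurable[OF assms] by (simp add: sqint_def power_mult_distrib)
qed

lemma sqint_component [intro]:
  fixes u :: "'a \<Rightarrow> real^'n"
  shows "u \<in> sqint M \<Longrightarrow> (\<lambda>x. u x $ i) \<in> sqint M"
  using sqint_inner_const[of u M "axis i 1"] by (simp add: inner_axis)

lemma sqint_vec:
  fixes u :: "'a \<Rightarrow> real^'n"
  assumes "\<And>i. (\<lambda>x. u x $ i) \<in> sqint M" shows "u \<in> sqint M"
proof -
  have *: "(\<lambda>x. \<Sum>i\<in>UNIV. (u x $ i) *\<^sub>R (axis i 1 :: real^'n)) \<in> sqint M"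
    using assms by (intro sqint_sum) (rule sqint_scale_const)
  have eq: "(\<lambda>x. \<Sum>i\<in>UNIV. (u x $ i) *\<^sub>R (axis i 1 :: real^'n)) = u"
    by (rule ext, rule basis_expansion[where ?'a = real, unfolded scalar_mult_eq_scaleR])
  show ?thesis using * unfolding eq .
qed

lemma sqint_Pair [intro]:
  fixes u :: "'a \<Rightarrow> real" and v :: "'a \<Rightarrow> 'b::euclidean_space"
  assumes "u \<in> sqint M" "v \<in> sqint M" shows "(\<lambda>x. (u x, v x)) \<in> sqint M"
  using assms by (auto simp: sqint_def norm_prod_def intro: borel_measurable_Pair)

lemma sqint_PairD:
  fixes w :: "'a \<Rightarrow> real \<times> 'b::euclidean_space"
  assumes "w \<in> sqint M"
  shows "(\<lambda>x. fst (w x)) \<in> sqint M" "(\<lambda>x. snd (w x)) \<in> sqint M"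
proof -
  have [measurable]: "w \<in> borel_measurable M" using assms by (rule sqint_measurable)
  have n: "(norm (w x))\<^sup>2 = (fst (w x))\<^sup>2 + (norm (snd (w x)))\<^sup>2" for x
    by (simp add: norm_prod_def)
  have meas: "(\<lambda>x. fst (w x)) \<in> borel_measurable M" "(\<lambda>x. snd (w x)) \<in> borel_measurable M"
    using borel_measurable_continuous_on[OF continuous_on_fst[OF continuous_on_id]
        \<open>w \<in> borel_measurable M\<close>]
      borel_measurable_continuous_on[OF continuous_on_snd[OF continuous_on_id]
        \<open>w \<in> borel_measurable M\<close>]
    by simp_all
  note [measurable] = meas
  have "integrable M (\<lambda>x. (norm (fst (w x)))\<^sup>2)"
    by (rule Bochner_Integration.integrable_bound[OF sqint_integrable[OF assms]]) (auto simp: n)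
  moreover have "integrable M (\<lambda>x. (norm (snd (w x)))\<^sup>2)"
    by (rule Bochner_Integration.integrable_bound[OF sqint_integrable[OF assms]]) (auto simp: n)
  ultimately show "(\<lambda>x. fst (w x)) \<in> sqint M" "(\<lambda>x. snd (w x)) \<in> sqint M"
    using meas by (auto simp: sqint_def)
qed

section \<open>The L2 product: Cauchy-Schwarz, completeness and orthogonal projection\<close>

lemma ip_add: "u \<in> sqint M \<Longrightarrow> v \<in> sqint M \<Longrightarrow> w \<in> sqint M \<Longrightarrow>
    ip M w (\<lambda>x. u x + v x) = ip M w u + ip M w v"
  and ip_diff: "u \<in> sqint M \<Longrightarrow> v \<in> sqint M \<Longrightarrow> w \<in> sqint M \<Longrightarrow>
    ip M w (\<lambda>x. u x - v x) = ip M w u - ip M w v"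
  and ip_scale: "ip M w (\<lambda>x. c *\<^sub>R u x) = c * ip M w u"
  by (auto simp: ip_def inner_add_right inner_diff_right sqint_inner_integrable)

lemma ip_add_self:
  assumes "u \<in> sqint M" "v \<in> sqint M"
  shows "ip M (\<lambda>x. u x + t *\<^sub>R v x) (\<lambda>x. u x + t *\<^sub>R v x) = ip M u u + 2 * t * ip M u v + t\<^sup>2 * ip M v v"
proof -
  have tv: "(\<lambda>x. t *\<^sub>R v x) \<in> sqint M" "(\<lambda>x. u x + t *\<^sub>R v x) \<in> sqint M"
    using assms by auto
  have *: "ip M (\<lambda>x. u x + t *\<^sub>R v x) w = ip M u w + t * ip M v w" if "w \<in> sqint M" for w
    unfolding ip_commute[of M _ w] using that assms tv by (simp add: ip_add ip_scale)
  show ?thesis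
    unfolding *[OF tv(2)] unfolding ip_commute[of M _ "\<lambda>x. u x + t *\<^sub>R v x"]
    using assms *[of u] *[of v] ip_commute[of M v u] by (simp add: power2_eq_square algebra_simps)
qed

text \<open>The discriminant of a nonnegative quadratic. It gives Cauchy-Schwarz, and with
  \<open>A = 0\<close> it turns the minimality of a distance into orthogonality.\<close>

lemma quadratic_nonneg_imp:
  fixes A B C :: real
  assumes "\<And>t. 0 \<le> A + 2 * t * B + t\<^sup>2 * C" and "0 \<le> C"
  shows "B\<^sup>2 \<le> A * C"
proof (cases "C = 0")
  case True
  have "B = 0"
  proof (rule ccontr)
    assume "B \<noteq> 0"
    \<comment> \<open>At this \<open>t\<close> the remaining affine function takes the value
      -1.\<close>
    then have "2 * (- (A + 1) / (2 * B)) * B = - (A + 1)" by simp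
    then show False
      using assms(1)[of "- (A + 1) / (2 * B)"] True by simp
  qed
  then show ?thesis using True by simp
next
  case False
  then have C: "C > 0" using assms(2) by simp
  have "A + 2 * (- B / C) * B + (- B / C)\<^sup>2 * C = A - B\<^sup>2 / C"
    using C by (simp add: power2_eq_square)
  then have "B\<^sup>2 / C \<le> A" using assms(1)[of "- B / C"] by simp
  then show ?thesis using C by (simp add: field_simps)
qed

lemma ip_Cauchy_Schwarz:
  assumes "u \<in> sqint M" "v \<in> sqint M"
  shows "(ip M u v)\<^sup>2 \<le> ip M u u * ip M v v"
proof (rule quadratic_nonneg_imp)
  show "0 \<le> ip M u u + 2 * t * ip M u v + t\<^sup>2 * ip M v v" for t
    unfolding ip_add_self[OF assms, symmetric] by simp
qed simp

lemma ip_tendsto: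
  assumes "\<And>k. u k \<in> sqint M" "v \<in> sqint M" "w \<in> sqint M"
    and "(\<lambda>k. ip M (\<lambda>x. v x - u k x) (\<lambda>x. v x - u k x)) \<longlonglongrightarrow> 0"
  shows "(\<lambda>k. ip M w (u k)) \<longlonglongrightarrow> ip M w v"
proof -
  have d: "(\<lambda>x. v x - u k x) \<in> sqint M" for k using assms by auto
  have "(\<lambda>k. (ip M w (\<lambda>x. v x - u k x))\<^sup>2) \<longlonglongrightarrow> 0"
  proof (rule tendsto_sandwich[OF _ _ tendsto_const])
    show "\<forall>\<^sub>F k in sequentially. 0 \<le> (ip M w (\<lambda>x. v x - u k x))\<^sup>2" by simp
    show "(\<lambda>k. ip M w w * ip M (\<lambda>x. v x - u k x) (\<lambda>x. v x - u k x)) \<longlonglongrightarrow> 0"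
      using tendsto_mult[OF tendsto_const assms(4), of "ip M w w"] by simp
  qed (use ip_Cauchy_Schwarz[OF assms(3) d] in simp)
  then have "(\<lambda>k. ip M w v - ip M w (u k)) \<longlonglongrightarrow> 0"
    using assms by (simp add: ip_diff)
  then show ?thesis
    using tendsto_diff[OF tendsto_const[of "ip M w v"]] by fastforce
qed

lemma ip_self_diff:
  assumes "u \<in> sqint M" "v \<in> sqint M"
  shows "ip M (\<lambda>x. u x - v x) (\<lambda>x. u x - v x) \<le> 2 * ip M u u + 2 * ip M v v"
proof -
  have "ip M (\<lambda>x. u x - v x) (\<lambda>x. u x - v x) = ip M u u - 2 * ip M u v + ip M v v"
    using ip_add_self[OF assms, of "-1"] by simp
  moreover have "0 \<le> ip M u u + 2 * ip M u v + ip M v v"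
    using ip_add_self[OF assms, of 1] ip_self_nonneg[of M "\<lambda>x. u x + 1 *\<^sub>R v x"] by simp
  ultimately show ?thesis by simp
qed

lemma ip_self_tendsto:
  assumes "\<And>k. u k \<in> sqint M" "v \<in> sqint M"
    and "(\<lambda>k. ip M (\<lambda>x. v x - u k x) (\<lambda>x. v x - u k x)) \<longlonglongrightarrow> 0"
  shows "(\<lambda>k. ip M (u k) (u k)) \<longlonglongrightarrow> ip M v v"
proof -
  have d: "(\<lambda>x. v x - u k x) \<in> sqint M" for k using assms by auto
  have "ip M (\<lambda>x. v x - u k x) (\<lambda>x. v x - u k x) = ip M v v - 2 * ip M v (u k) + ip M (u k) (u k)" for k
    using ip_add_self[OF assms(2) assms(1), of "-1" k] by simp
  then have eq: "ip M (u k) (u k) =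
      ip M (\<lambda>x. v x - u k x) (\<lambda>x. v x - u k x) - ip M v v + 2 * ip M v (u k)" for k
    by simp
  have "(\<lambda>k. ip M (u k) (u k)) \<longlonglongrightarrow> 0 - ip M v v + 2 * ip M v v"
    unfolding eq by (intro tendsto_intros assms ip_tendsto)
  then show ?thesis by simp
qed

text \<open>Riesz-Fischer: a fast Cauchy subsequence converges almost everywhere because a weighted
  series of its increments has finite integral, and Fatou's lemma turns the pointwise limit into a
  limit in norm.\<close>

theorem sqint_complete:
  fixes u :: "nat \<Rightarrow> 'a \<Rightarrow> 'b::euclidean_space"
  assumes u: "\<And>k. u k \<in> sqint M"
    and cauchy: "\<And>e. e > 0 \<Longrightarrow> \<exists>N. \<forall>m\<ge>N. \<forall>n\<ge>N. ip M (\<lambda>x. u m x - u n x) (\<lambda>x. u m x - u n x) \<le> e"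
  obtains v where "v \<in> sqint M" "(\<lambda>k. ip M (\<lambda>x. v x - u k x) (\<lambda>x. v x - u k x)) \<longlonglongrightarrow> 0"
proof -
  let ?d = "\<lambda>m n. ip M (\<lambda>x. u m x - u n x) (\<lambda>x. u m x - u n x)"
  have [measurable]: "u k \<in> borel_measurable M" for k using u by (rule sqint_measurable)
  have d: "(\<lambda>x. u m x - u n x) \<in> sqint M" for m n using u by auto
  have nn: "(\<integral>\<^sup>+x. ennreal ((norm (u m x - u n x))\<^sup>2) \<partial>M) = ennreal (?d m n)" for m n
    unfolding ip_self using sqint_integrable[OF d] by (intro nn_integral_eq_integral) auto
  \<comment> \<open>The rate \<open>(1/8) ^ k\<close> still leaves \<open>(1/2) ^ k\<close> after
    the weight \<open>4 ^ k\<close> below. The weighted series is then finite almost everywhere,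
    which bounds the increments themselves by a multiple of \<open>(1/2) ^ k\<close>.\<close>
  define N where "N k = (SOME N. \<forall>m\<ge>N. \<forall>n\<ge>N. ?d m n \<le> (1/8) ^ k)" for k
  have N: "?d m n \<le> (1/8) ^ k" if "m \<ge> N k" "n \<ge> N k" for m n k
    using someI_ex[OF cauchy[of "(1/8) ^ k"]] that unfolding N_def by auto
  \<comment> \<open>Summing the \<open>N j\<close> makes the index sequence monotone and keeps it
    above every \<open>N k\<close>.\<close>
  define r where "r k = k + (\<Sum>j\<le>k. N j)" for k
  have rN: "N k \<le> r k" for k
  proof -
    have "N k \<le> (\<Sum>j\<le>k. N j)" by (rule member_le_sum) auto
    then show ?thesis unfolding r_def by simp
  qed
  have rmono: "r k \<le> r (Suc k)" for k unfolding r_def by simp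
  then have rincr: "incseq r" by (rule incseq_SucI)
  have rge: "k \<le> r k" for k unfolding r_def by simp
  let ?f = "\<lambda>k x. norm (u (r (Suc k)) x - u (r k) x)"
  have "(\<integral>\<^sup>+x. (\<Sum>k. ennreal (4 ^ k * (?f k x)\<^sup>2)) \<partial>M) = (\<Sum>k. \<integral>\<^sup>+x. ennreal (4 ^ k * (?f k x)\<^sup>2) \<partial>M)"
    by (rule nn_integral_suminf) measurable
  also have "\<dots> \<le> (\<Sum>k. ennreal ((1/2) ^ k))"
  proof (rule suminf_le)
    fix k
    have "(\<integral>\<^sup>+x. ennreal (4 ^ k * (?f k x)\<^sup>2) \<partial>M) = ennreal (4 ^ k) * ennreal (?d (r (Suc k)) (r k))"
      by (simp add: ennreal_mult nn_integral_cmult nn)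
    also have "\<dots> \<le> ennreal (4 ^ k) * ennreal ((1/8) ^ k)"
      using N[of k "r (Suc k)" "r k"] rN[of k] rmono[of k] by (intro mult_left_mono ennreal_leI) auto
    also have "\<dots> = ennreal ((1/2) ^ k)"
      by (simp flip: ennreal_mult power_mult_distrib)
    finally show "(\<integral>\<^sup>+x. ennreal (4 ^ k * (?f k x)\<^sup>2) \<partial>M) \<le> ennreal ((1/2) ^ k)" .
  qed auto
  also have "\<dots> = ennreal (\<Sum>k. (1/2) ^ k)"
    by (rule suminf_ennreal2) (auto intro: summable_geometric)
  also have "\<dots> < \<infinity>" by simp
  finally have "AE x in M. (\<Sum>k. ennreal (4 ^ k * (?f k x)\<^sup>2)) \<noteq> \<infinity>"
    by (intro nn_integral_PInf_AE) (auto simp: less_top)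
  then have conv: "AE x in M. (\<lambda>k. u (r k) x) \<longlonglongrightarrow> lim (\<lambda>k. u (r k) x)"
  proof eventually_elim
    case (elim x)
    have "summable (\<lambda>k. 4 ^ k * (?f k x)\<^sup>2)"
      using elim by (intro summable_suminf_not_top) auto
    then have "Bseq (\<lambda>k. 4 ^ k * (?f k x)\<^sup>2)"
      using convergentI[OF summable_LIMSEQ_zero] convergent_imp_Bseq by blast
    then obtain C where "\<And>k. norm (4 ^ k * (?f k x)\<^sup>2) \<le> C"
      unfolding Bseq_def by blast
    then have C: "4 ^ k * (?f k x)\<^sup>2 \<le> C" for k
      by (metis abs_le_D1 real_norm_def)
    have "?f k x \<le> sqrt C * (1/2) ^ k" for k
    proof -
      have "(2 ^ k * ?f k x)\<^sup>2 \<le> C"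
      proof -
        have "(2 ^ k)\<^sup>2 = (4::real) ^ k" by (simp flip: power_mult add: mult.commute[of k] power_mult)
        then show ?thesis using C[of k] by (simp only: power_mult_distrib)
      qed
      then have "2 ^ k * ?f k x \<le> sqrt C"
        by (simp add: real_le_rsqrt)
      then show ?thesis by (simp add: field_simps)
    qed
    then have "summable (\<lambda>k. u (r (Suc k)) x - u (r k) x)"
      by (intro summable_comparison_test'[where N = 0, OF summable_mult[OF summable_geometric[of "1/2"]]]) auto
    then have "convergent (\<lambda>n. \<Sum>k<n. u (r (Suc k)) x - u (r k) x)"
      by (simp add: summable_iff_convergent)
    then have "convergent (\<lambda>n. u (r n) x - u (r 0) x)"
      unfolding sum_lessThan_telescope[of "\<lambda>k. u (r k) x"] .
    then have "convergent (\<lambda>n. u (r n) x)"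
      using convergent_diff_const_right_iff by blast
    then show ?case by (simp add: convergent_LIMSEQ_iff)
  qed
  define v where "v x = lim (\<lambda>k. u (r k) x)" for x
  have [measurable]: "v \<in> borel_measurable M"
    unfolding v_def[abs_def] by (rule borel_measurable_lim_metric) measurable
  \<comment> \<open>The index \<open>n\<close> stays fixed while the subsequence index
    \<open>j\<close> tends to infinity, so the estimate covers the full sequence and not only the
    subsequence.\<close>
  have fatou: "(\<integral>\<^sup>+x. ennreal ((norm (v x - u n x))\<^sup>2) \<partial>M) \<le> ennreal ((1/8) ^ k)" if "n \<ge> r k" for n k
  proof -
    have "(\<integral>\<^sup>+x. ennreal ((norm (v x - u n x))\<^sup>2) \<partial>M)
        = (\<integral>\<^sup>+x. liminf (\<lambda>j. ennreal ((norm (u (r j) x - u n x))\<^sup>2)) \<partial>M)"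
    proof (rule nn_integral_cong_AE, use conv in eventually_elim)
      case (elim x)
      have "(\<lambda>j. ennreal ((norm (u (r j) x - u n x))\<^sup>2)) \<longlonglongrightarrow> ennreal ((norm (v x - u n x))\<^sup>2)"
        using elim unfolding v_def by (intro tendsto_intros)
      then show ?case by (intro lim_imp_Liminf[symmetric]) auto
    qed
    also have "\<dots> \<le> liminf (\<lambda>j. \<integral>\<^sup>+x. ennreal ((norm (u (r j) x - u n x))\<^sup>2) \<partial>M)"
      by (rule nn_integral_liminf) measurable
    also have "\<dots> = liminf (\<lambda>j. ennreal (?d (r j) n))"
      by (simp add: nn)
    also have "\<dots> \<le> ennreal ((1/8) ^ k)"
    proof -
      have "\<forall>\<^sub>F j in sequentially. ennreal (?d (r j) n) \<le> ennreal ((1/8) ^ k)"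
        using eventually_ge_at_top[of k]
      proof eventually_elim
        case (elim j)
        have "N k \<le> r j" "N k \<le> n"
          using rN[of k] incseqD[OF rincr elim] that by linarith+
        then show ?case using N by (intro ennreal_leI) auto
      qed
      then have "Limsup sequentially (\<lambda>j. ennreal (?d (r j) n)) \<le> ennreal ((1/8) ^ k)"
        by (rule Limsup_bounded)
      then show ?thesis
        using Liminf_le_Limsup[of sequentially "\<lambda>j. ennreal (?d (r j) n)"] by simp
    qed
    finally show ?thesis .
  qed
  have int: "integrable M (\<lambda>x. (norm (v x - u (r 0) x))\<^sup>2)"
    using le_less_trans[OF fatou[OF order_refl, of 0] ennreal_less_top]
    by (intro integrableI_bounded) auto
  have v: "v \<in> sqint M"
  proof -
    have "(\<lambda>x. v x - u (r 0) x) \<in> sqint M"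
      using int by (simp add: sqint_def)
    from sqint_add[OF this u[of "r 0"]] show ?thesis by simp
  qed
  have bound: "ip M (\<lambda>x. v x - u n x) (\<lambda>x. v x - u n x) \<le> (1/8) ^ k" if "n \<ge> r k" for n k
  proof -
    have "(\<lambda>x. v x - u n x) \<in> sqint M" using v u by auto
    then have "ennreal (ip M (\<lambda>x. v x - u n x) (\<lambda>x. v x - u n x)) = (\<integral>\<^sup>+x. ennreal ((norm (v x - u n x))\<^sup>2) \<partial>M)"
      unfolding ip_self by (intro nn_integral_eq_integral[symmetric] sqint_integrable) auto
    then have "ennreal (ip M (\<lambda>x. v x - u n x) (\<lambda>x. v x - u n x)) \<le> ennreal ((1/8) ^ k)"
      using fatou[OF that] by (simp only:)
    then show ?thesis
      by (subst (asm) ennreal_le_iff) auto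
  qed
  have "(\<lambda>k. ip M (\<lambda>x. v x - u k x) (\<lambda>x. v x - u k x)) \<longlonglongrightarrow> 0"
  proof (rule LIMSEQ_I)
    fix e :: real assume "e > 0"
    then obtain k where "(1/8) ^ k < e"
      using real_arch_pow_inv[of e "1/8"] by auto
    then have "\<forall>n\<ge>r k. norm (ip M (\<lambda>x. v x - u n x) (\<lambda>x. v x - u n x) - 0) < e"
      using bound[of k] by (auto intro: le_less_trans)
    then show "\<exists>n0. \<forall>n\<ge>n0. norm (ip M (\<lambda>x. v x - u n x) (\<lambda>x. v x - u n x) - 0) < e" ..
  qed
  with v show thesis by (rule that)
qed

text \<open>The projection theorem in the form needed for traces: \<open>U\<close> lies in the
  closure of the subspace \<open>S\<close> once every annihilator of \<open>S\<close> annihilates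
  \<open>U\<close>. The residuals of a minimising sequence converge to some \<open>W\<close>
  orthogonal to \<open>S\<close>, hence to \<open>U\<close>, hence to all residuals and so to
  itself.\<close>

theorem sqint_approximation:
  fixes S :: "('a \<Rightarrow> 'b::euclidean_space) set"
  assumes S: "S \<subseteq> sqint M" and S0: "(\<lambda>_. 0) \<in> S"
    and comb: "\<And>f g a b. f \<in> S \<Longrightarrow> g \<in> S \<Longrightarrow> (\<lambda>x. a *\<^sub>R f x + b *\<^sub>R g x) \<in> S"
    and U: "U \<in> sqint M"
    and orth: "\<And>W. W \<in> sqint M \<Longrightarrow> (\<And>Z. Z \<in> S \<Longrightarrow> ip M W Z = 0) \<Longrightarrow> ip M W U = 0"
  obtains Z where "\<And>k::nat. Z k \<in> S" "(\<lambda>k. ip M (\<lambda>x. U x - Z k x) (\<lambda>x. U x - Z k x)) \<longlonglongrightarrow> 0"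
proof -
  let ?n = "\<lambda>Z. ip M (\<lambda>x. U x - Z x) (\<lambda>x. U x - Z x)"
  define D where "D = (INF Z\<in>S. ?n Z)"
  have bdd: "bdd_below (?n ` S)" by (rule bdd_belowI[of _ 0]) auto
  have D_le: "D \<le> ?n Z" if "Z \<in> S" for Z
    unfolding D_def using that by (intro cINF_lower bdd)
  have "\<exists>Z\<in>S. ?n Z < D + inverse (real (Suc k))" for k
    using cINF_less_iff[of S ?n "D + inverse (real (Suc k))"] S0 bdd unfolding D_def by auto
  then obtain Z where Z: "\<And>k. Z k \<in> S" "\<And>k. ?n (Z k) < D + inverse (real (Suc k))"
    by metis
  have nlim: "(\<lambda>k. ?n (Z k)) \<longlonglongrightarrow> D"
  proof (rule tendsto_sandwich[OF _ _ tendsto_const])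
    show "(\<lambda>k. D + inverse (real (Suc k))) \<longlonglongrightarrow> D"
      using tendsto_add[OF tendsto_const LIMSEQ_inverse_real_of_nat, of D] by simp
    show "\<forall>\<^sub>F k in sequentially. D \<le> ?n (Z k)" by (rule always_eventually) (intro allI D_le Z(1))
    show "\<forall>\<^sub>F k in sequentially. ?n (Z k) \<le> D + inverse (real (Suc k))"
      by (rule always_eventually) (intro allI less_imp_le Z(2))
  qed
  define R where "R k x = U x - Z k x" for k x
  have Zs: "Z k \<in> sqint M" for k using Z S by auto
  have R: "R k \<in> sqint M" for k unfolding R_def[abs_def] using Zs U by auto
  have nR: "ip M (R k) (R k) = ?n (Z k)" for k by (simp add: R_def[abs_def])
  have parallel: "ip M (\<lambda>x. R m x - R n x) (\<lambda>x. R m x - R n x) \<le>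
      2 * (inverse (real (Suc m)) + inverse (real (Suc n)))" for m n
  proof -
    \<comment> \<open>The midpoint belongs to \<open>S\<close>, so half the sum of two residuals has
      squared norm at least \<open>D\<close>. The parallelogram law then bounds their
      difference.\<close>
    have "(\<lambda>x. (1/2) *\<^sub>R Z m x + (1/2) *\<^sub>R Z n x) \<in> S" by (intro comb Z)
    from D_le[OF this]
    have "D \<le> ip M (\<lambda>x. (1/2) *\<^sub>R (R m x + 1 *\<^sub>R R n x)) (\<lambda>x. (1/2) *\<^sub>R (R m x + 1 *\<^sub>R R n x))"
    proof -
      have "U x - ((1/2) *\<^sub>R Z m x + (1/2) *\<^sub>R Z n x) = (1/2) *\<^sub>R (R m x + 1 *\<^sub>R R n x)" for x
      proof -
        have "U x = (1/2) *\<^sub>R U x + (1/2) *\<^sub>R U x" by (simp flip: scaleR_add_left)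
        then show ?thesis by (simp add: R_def algebra_simps)
      qed
      then show ?thesis using \<open>D \<le> _\<close> by simp
    qed
    also have "\<dots> = (1/4) * ip M (\<lambda>x. R m x + 1 *\<^sub>R R n x) (\<lambda>x. R m x + 1 *\<^sub>R R n x)"
      unfolding ip_scale unfolding ip_commute[of M "\<lambda>x. (1/2) *\<^sub>R (R m x + 1 *\<^sub>R R n x)"] ip_scale by simp
    also have "\<dots> = (1/4) * (ip M (R m) (R m) + 2 * ip M (R m) (R n) + ip M (R n) (R n))"
      using ip_add_self[OF R R, of m 1 n] by simp
    finally have "4 * D \<le> ip M (R m) (R m) + 2 * ip M (R m) (R n) + ip M (R n) (R n)" by simp
    moreover have "ip M (\<lambda>x. R m x - R n x) (\<lambda>x. R m x - R n x) =
        ip M (R m) (R m) - 2 * ip M (R m) (R n) + ip M (R n) (R n)"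
      using ip_add_self[OF R R, of m "-1" n] by simp
    ultimately show ?thesis
      using Z(2)[of m] Z(2)[of n] by (simp add: nR)
  qed
  have "\<exists>N. \<forall>m\<ge>N. \<forall>n\<ge>N. ip M (\<lambda>x. R m x - R n x) (\<lambda>x. R m x - R n x) \<le> e" if "e > 0" for e
  proof -
    obtain N where N: "inverse (real (Suc N)) < e / 4"
      using reals_Archimedean[of "e / 4"] \<open>e > 0\<close> unfolding zero_less_divide_iff by fastforce
    have *: "inverse (real (Suc m)) \<le> e / 4" if "m \<ge> N" for m
      by (rule order_trans[OF le_imp_inverse_le less_imp_le[OF N]]) (use that in auto)
    show ?thesis
    proof (intro exI allI impI)
      fix m n assume "N \<le> m" "N \<le> n"
      then show "ip M (\<lambda>x. R m x - R n x) (\<lambda>x. R m x - R n x) \<le> e"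
        using order_trans[OF parallel[of m n] mult_left_mono[OF add_mono[OF *[of m] *[of n]]]]
        by simp
    qed
  qed
  from sqint_complete[OF R this] obtain W where W: "W \<in> sqint M"
    and lim: "(\<lambda>k. ip M (\<lambda>x. W x - R k x) (\<lambda>x. W x - R k x)) \<longlonglongrightarrow> 0" by blast
  have WW: "ip M W W = D"
    using LIMSEQ_unique[OF ip_self_tendsto[OF R W lim]] nlim by (simp add: nR)
  have "ip M W Y = 0" if Y: "Y \<in> S" for Y
  proof -
    have Ys: "Y \<in> sqint M" using Y S by auto
    have "0 \<le> 0 + 2 * t * ip M W Y + t\<^sup>2 * ip M Y Y" for t
    proof -
      \<comment> \<open>Perturbing the approximant by \<open>- t\<close> times \<open>Y\<close>
        perturbs the residual by \<open>t\<close> times \<open>Y\<close>. In the limit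
        \<open>D\<close> cancels and a quadratic without constant term remains.\<close>
      have "D \<le> ip M (R k) (R k) + 2 * t * ip M (R k) Y + t\<^sup>2 * ip M Y Y" for k
      proof -
        have "(\<lambda>x. 1 *\<^sub>R Z k x + (- t) *\<^sub>R Y x) \<in> S" by (intro comb Z Y)
        from D_le[OF this] show ?thesis
          using ip_add_self[OF R Ys, of k t] by (simp add: R_def[abs_def] algebra_simps)
      qed
      moreover have "(\<lambda>k. ip M (R k) (R k) + 2 * t * ip M (R k) Y + t\<^sup>2 * ip M Y Y) \<longlonglongrightarrow>
          ip M W W + 2 * t * ip M W Y + t\<^sup>2 * ip M Y Y"
        using ip_tendsto[OF R W Ys lim]
        by (intro tendsto_intros ip_self_tendsto R W lim) (simp add: ip_commute[of M _ Y])
      ultimately have "D \<le> ip M W W + 2 * t * ip M W Y + t\<^sup>2 * ip M Y Y"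
        by (meson LIMSEQ_le_const)
      then show ?thesis by (simp add: WW)
    qed
    from quadratic_nonneg_imp[OF this] show ?thesis by simp
  qed
  then have WZ: "\<And>k. ip M W (Z k) = 0" and WU: "ip M W U = 0"
    using Z orth[OF W] by auto
  have "ip M W (R k) = 0" for k
    unfolding R_def[abs_def] using WZ WU by (simp add: ip_diff Zs U W)
  \<comment> \<open>The products of \<open>W\<close> with the residuals vanish and converge to the
    squared norm of \<open>W\<close>, which is \<open>D\<close>.\<close>
  with ip_tendsto[OF R W W lim] have "D = 0"
    using WW by (simp add: LIMSEQ_const_iff)
  then show thesis
    using nlim by (intro that[OF Z(1)]) simp
qed

section \<open>Test functions and weak derivatives\<close>

lemma test_fun_smooth: "test_fun \<Omega> \<phi> \<Longrightarrow> smooth \<phi>"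
  by (simp add: test_fun_def)

lemma test_funE:
  assumes "test_fun \<Omega> \<phi>"
  obtains K where "smooth \<phi>" "compact K" "K \<subseteq> \<Omega>" "\<And>x. x \<notin> K \<Longrightarrow> \<phi> x = 0"
  using assms by (auto simp: test_fun_def)

lemma test_funI:
  "smooth \<phi> \<Longrightarrow> compact K \<Longrightarrow> K \<subseteq> \<Omega> \<Longrightarrow> (\<And>x. x \<notin> K \<Longrightarrow> \<phi> x = 0) \<Longrightarrow> test_fun \<Omega> \<phi>"
  by (auto simp: test_fun_def)

lemma test_fun_outside: "test_fun \<Omega> \<phi> \<Longrightarrow> x \<notin> \<Omega> \<Longrightarrow> \<phi> x = 0"
  by (auto simp: test_fun_def)

lemma test_fun_mono: "test_fun \<Omega> \<phi> \<Longrightarrow> \<Omega> \<subseteq> \<Omega>' \<Longrightarrow> test_fun \<Omega>' \<phi>"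
  unfolding test_fun_def by blast

lemma test_fun_mult [intro]:
  assumes "smooth f" "test_fun \<Omega> \<phi>"
  shows "test_fun \<Omega> (\<lambda>x. f x * \<phi> x)"
  using assms(2) by (rule test_funE) (auto intro!: test_funI assms(1))

lemma test_fun_mult' [intro]:
  assumes "test_fun \<Omega> \<phi>" "smooth f"
  shows "test_fun \<Omega> (\<lambda>x. \<phi> x * f x)"
  using test_fun_mult[OF assms(2,1)] by (simp add: mult.commute)

lemma test_fun_zero [simp]: "test_fun \<Omega> (\<lambda>_. 0)"
  by (rule test_funI[of _ "{}"]) auto

lemma test_fun_add [intro]:
  assumes "test_fun \<Omega> \<phi>" "test_fun \<Omega> \<psi>"
  shows "test_fun \<Omega> (\<lambda>x. \<phi> x + \<psi> x)"
proof -
  obtain K where K: "smooth \<phi>" "compact K" "K \<subseteq> \<Omega>" "\<And>x. x \<notin> K \<Longrightarrow> \<phi> x = 0"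
    using assms(1) by (rule test_funE) blast
  obtain L where L: "smooth \<psi>" "compact L" "L \<subseteq> \<Omega>" "\<And>x. x \<notin> L \<Longrightarrow> \<psi> x = 0"
    using assms(2) by (rule test_funE) blast
  show ?thesis
    by (rule test_funI[of _ "K \<union> L"]) (use K L in auto)
qed

lemma test_fun_gradient_0:
  assumes "compact K" "\<And>x. x \<notin> K \<Longrightarrow> \<phi> x = 0" "x \<notin> K"
  shows "gradient \<phi> x = 0"
  by (rule gradient_eq_0_open[of "- K"]) (use assms compact_imp_closed in auto)

lemma test_fun_gradient_inner [intro]:
  assumes "test_fun \<Omega> \<phi>" shows "test_fun \<Omega> (\<lambda>x. gradient \<phi> x \<bullet> a)"
  using assms
proof (rule test_funE)
  fix K assume K: "smooth \<phi>" "compact K" "K \<subseteq> \<Omega>" "\<And>x. x \<notin> K \<Longrightarrow> \<phi> x = 0"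
  show ?thesis
    by (rule test_funI[of _ K]) (use K test_fun_gradient_0[of K \<phi>] in auto)
qed

lemma test_fun_gradient_component [intro]:
  "test_fun \<Omega> \<phi> \<Longrightarrow> test_fun \<Omega> (\<lambda>x. gradient \<phi> x $ i)"
  using test_fun_gradient_inner[of \<Omega> \<phi> "axis i 1"] by (simp add: inner_axis)

lemma test_fun_bounded:
  assumes "test_fun \<Omega> \<phi>"
  obtains C where "C \<ge> 0" "\<And>x. \<bar>\<phi> x\<bar> \<le> C"
proof -
  obtain K where K: "smooth \<phi>" "compact K" "K \<subseteq> \<Omega>" "\<And>x. x \<notin> K \<Longrightarrow> \<phi> x = 0"
    using assms by (rule test_funE) blast
  have "bounded (\<phi> ` K)"
    using K by (intro compact_imp_bounded compact_continuous_image smooth_continuous_on)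
  then obtain C where C: "\<forall>x\<in>\<phi> ` K. norm x \<le> C"
    unfolding bounded_iff by blast
  have "\<bar>\<phi> x\<bar> \<le> \<bar>C\<bar>" for x
    using C K(4)[of x] by (cases "x \<in> K") force+
  then show thesis by (rule that[rotated]) auto
qed

lemma test_fun_gradient_bounded:
  fixes \<phi> :: "real^'n \<Rightarrow> real"
  assumes "test_fun \<Omega> \<phi>"
  obtains C where "C \<ge> 0" "\<And>x. norm (gradient \<phi> x) \<le> C"
proof -
  have "\<exists>C. \<forall>x. \<bar>gradient \<phi> x $ i\<bar> \<le> C" for i
    by (rule test_fun_bounded[OF test_fun_gradient_component[OF assms]]) blast
  then obtain C where C: "\<And>i x. \<bar>gradient \<phi> x $ i\<bar> \<le> C i" by metis
  have "norm (gradient \<phi> x) \<le> (\<Sum>i\<in>UNIV. C i)" for x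
    by (rule order_trans[OF norm_le_l1_cart sum_mono[OF C]])
  moreover from this have "0 \<le> (\<Sum>i\<in>UNIV. C i)"
    by (rule order_trans[OF norm_ge_zero])
  ultimately show thesis by (rule that[rotated])
qed

lemma test_fun_Lipschitz:
  assumes "test_fun \<Omega> \<phi>"
  obtains C where "C \<ge> 0" "\<And>x y. \<bar>\<phi> x - \<phi> y\<bar> \<le> C * norm (x - y)"
proof -
  obtain C where C: "C \<ge> 0" "\<And>x. norm (gradient \<phi> x) \<le> C"
    using assms by (rule test_fun_gradient_bounded) blast
  have "norm (\<phi> x - \<phi> y) \<le> C * norm (x - y)" for x y
  proof (rule differentiable_bound[of UNIV])
    show "(\<phi> has_derivative (\<lambda>h. gradient \<phi> z \<bullet> h)) (at z within UNIV)" for z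
      using smooth_has_derivative[OF test_fun_smooth[OF assms]] by simp
    show "onorm ((\<bullet>) (gradient \<phi> z)) \<le> C" for z
      using C(1) by (rule onorm_bound)
        (use C(2) order_trans[OF Cauchy_Schwarz_ineq2 mult_right_mono] in auto)
  qed auto
  with C(1) show thesis by (intro that) auto
qed

section \<open>Integrals of test functions and the fundamental lemma of the calculus of
  variations\<close>

lemma smooth_measurable [measurable]: "smooth f \<Longrightarrow> f \<in> borel_measurable borel"
  by (intro borel_measurable_continuous_onI smooth_continuous_on)

lemma integrable_indicator_cball: "integrable lborel (indicat_real (cball (c::'a::euclidean_space) R))"
  by (rule integrable_real_indicator) (simp, rule emeasure_bounded_finite, simp)

lemma integrable_lborel_bounded_support:
  fixes f :: "real^'n \<Rightarrow> 'b::euclidean_space"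
  assumes "f \<in> borel_measurable borel" "\<And>x. norm (f x) \<le> C" "\<And>x. x \<notin> cball 0 R \<Longrightarrow> f x = 0"
  shows "integrable lborel f"
proof (rule Bochner_Integration.integrable_bound)
  show "integrable lborel (\<lambda>x::real^'n. \<bar>C\<bar> * indicator (cball 0 R) x)"
    by (intro integrable_mult_right integrable_indicator_cball)
  show "AE x in lborel. norm (f x) \<le> norm (\<bar>C\<bar> * indicator (cball 0 R) x)"
    using assms(2) assms(3) order_trans[OF assms(2) abs_ge_self]
    by (auto simp: indicator_def simp del: mem_cball)
qed (use assms in simp)

lemma test_fun_integrable:
  assumes "test_fun \<Omega> \<phi>" shows "integrable lborel \<phi>"
proof -
  obtain K where K: "smooth \<phi>" "compact K" "K \<subseteq> \<Omega>" "\<And>x. x \<notin> K \<Longrightarrow> \<phi> x = 0"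
    using assms by (rule test_funE) blast
  obtain R where "K \<subseteq> cball 0 R"
    using compact_imp_bounded[OF K(2)] unfolding bounded_iff by (metis mem_cball_0 subsetI)
  moreover obtain C where "\<And>x. \<bar>\<phi> x\<bar> \<le> C" using assms by (rule test_fun_bounded) blast
  ultimately show ?thesis
    using K by (intro integrable_lborel_bounded_support[of _ C R] smooth_measurable) (auto simp: subset_iff)
qed

lemma integral_lborel_shift:
  fixes f :: "'a::euclidean_space \<Rightarrow> real"
  assumes [measurable]: "f \<in> borel_measurable borel"
  shows "(\<integral>x. f (c + x) \<partial>lborel) = (\<integral>x. f x \<partial>lborel)"
proof -
  have "(\<integral>x. f x \<partial>lborel) = (\<integral>x. f x \<partial>distr lborel borel ((+) c))"
    by (simp add: lborel_distr_plus)
  also have "\<dots> = (\<integral>x. f (c + x) \<partial>lborel)"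
    by (rule integral_distr) auto
  finally show ?thesis ..
qed

lemma integrable_lborel_shift:
  fixes f :: "'a::euclidean_space \<Rightarrow> real"
  assumes "integrable lborel f"
  shows "integrable lborel (\<lambda>x. f (c + x))"
proof -
  have "integrable (distr lborel borel ((+) c)) f"
    using assms by (simp add: lborel_distr_plus)
  then show ?thesis
    by (subst (asm) integrable_distr_eq) (use assms in auto)
qed

text \<open>Difference quotients integrate to zero by translation invariance of Lebesgue measure;
  the Lipschitz bound dominates them, so the limit, a directional derivative, integrates to zero as
  well.\<close>

theorem integral_gradient_test_fun:
  fixes \<phi> :: "real^'n \<Rightarrow> real"
  assumes "test_fun \<Omega> \<phi>"
  shows "(\<integral>x. gradient \<phi> x \<bullet> a \<partial>lborel) = 0"
proof -
  obtain K where K: "smooth \<phi>" "compact K" "K \<subseteq> \<Omega>" "\<And>x. x \<notin> K \<Longrightarrow> \<phi> x = 0"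
    using assms by (rule test_funE) blast
  obtain R where R: "K \<subseteq> cball 0 R"
    using compact_imp_bounded[OF K(2)] unfolding bounded_iff by (metis mem_cball_0 subsetI)
  obtain C where C: "C \<ge> 0" "\<And>x y. \<bar>\<phi> x - \<phi> y\<bar> \<le> C * norm (x - y)"
    using assms by (rule test_fun_Lipschitz) blast
  have [measurable]: "\<phi> \<in> borel_measurable borel" using K(1) by (rule smooth_measurable)
  have [measurable]: "(\<lambda>x. gradient \<phi> x \<bullet> a) \<in> borel_measurable borel"
    using K(1) by (intro smooth_measurable) auto
  define h where "h k = inverse (real (Suc k))" for k
  have h: "h k > 0" "h k \<le> 1" for k by (auto simp: h_def field_simps)
  let ?D = "\<lambda>k x. (\<phi> (h k *\<^sub>R a + x) - \<phi> x) / h k"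
  \<comment> \<open>The steps \<open>h k\<close> are at most 1, so a translate moves the support by
    at most \<open>norm a\<close>; this fixes the radius of the dominating ball.\<close>
  have lim: "(\<lambda>k. \<integral>x. ?D k x \<partial>lborel) \<longlonglongrightarrow> (\<integral>x. gradient \<phi> x \<bullet> a \<partial>lborel)"
  proof (rule integral_dominated_convergence[where
        w = "\<lambda>x. C * norm a * indicator (cball 0 (R + norm a)) x"])
    show "integrable lborel (\<lambda>x::real^'n. C * norm a * indicator (cball 0 (R + norm a)) x)"
      by (intro integrable_mult_right integrable_indicator_cball)
    show "AE x in lborel. (\<lambda>k. ?D k x) \<longlonglongrightarrow> gradient \<phi> x \<bullet> a"
    proof (rule AE_I2)
      fix x
      have "((\<lambda>t. x + t *\<^sub>R a) has_derivative (\<lambda>t. t *\<^sub>R a)) (at 0)"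
        by (auto intro!: derivative_eq_intros)
      from has_derivative_compose[OF this, of \<phi> "\<lambda>h. gradient \<phi> x \<bullet> h"] smooth_has_derivative[OF K(1)]
      have "((\<lambda>t. \<phi> (x + t *\<^sub>R a)) has_real_derivative (gradient \<phi> x \<bullet> a)) (at 0)"
        by (simp add: has_field_derivative_def mult_commute_abs)
      then have "((\<lambda>t. (\<phi> (x + t *\<^sub>R a) - \<phi> x) / t) \<longlongrightarrow> gradient \<phi> x \<bullet> a) (at 0)"
        by (simp add: DERIV_def)
      moreover have "filterlim h (at 0) sequentially"
        unfolding filterlim_at h_def[abs_def] using LIMSEQ_inverse_real_of_nat by auto
      ultimately show "(\<lambda>k. ?D k x) \<longlonglongrightarrow> gradient \<phi> x \<bullet> a"
        using filterlim_compose[of "\<lambda>t. (\<phi> (x + t *\<^sub>R a) - \<phi> x) / t"]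
        by (force simp: add.commute[of x])
    qed
    show "AE x in lborel. norm (?D k x) \<le> C * norm a * indicator (cball 0 (R + norm a)) x" for k
    proof (rule AE_I2)
      fix x
      show "norm (?D k x) \<le> C * norm a * indicator (cball 0 (R + norm a)) x"
      proof (cases "x \<in> cball 0 (R + norm a)")
        case True
        have "\<bar>\<phi> (h k *\<^sub>R a + x) - \<phi> x\<bar> \<le> C * (h k * norm a)"
          using C(2)[of "h k *\<^sub>R a + x" x] h(1)[of k] by simp
        then show ?thesis using True h(1)[of k] by (simp add: field_simps)
      next
        case False
        have "norm x \<le> norm (h k *\<^sub>R a + x) + norm (h k *\<^sub>R a)"
          by (metis add_diff_cancel_left' norm_triangle_ineq4)
        moreover have "norm (h k *\<^sub>R a) \<le> norm a"
          using h[of k] by (simp add: mult_left_le_one_le)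
        ultimately have "\<not> norm x \<le> R" "\<not> norm (h k *\<^sub>R a + x) \<le> R"
          using False norm_ge_zero[of a] unfolding mem_cball_0 by linarith+
        then have "x \<notin> K" "h k *\<^sub>R a + x \<notin> K"
          using R by (auto simp: subset_iff)
        then show ?thesis using False K(4) by simp
      qed
    qed
  qed measurable
  have 0: "(\<integral>x. ?D k x \<partial>lborel) = 0" for k
    using integral_lborel_shift[of \<phi> "h k *\<^sub>R a"] test_fun_integrable[OF assms]
      integrable_lborel_shift[OF test_fun_integrable[OF assms], of "h k *\<^sub>R a"]
    by simp
  show ?thesis
    using lim unfolding 0 by (simp add: LIMSEQ_const_iff)
qed

text \<open>One minus the product of the complements of finitely many bumps: on \<open>K\<close>
  some factor is zero, and away from all bumps every factor is one.\<close>

lemma smooth_Urysohn: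
  fixes K U :: "(real^'n) set"
  assumes "compact K" "open U" "K \<subseteq> U"
  obtains \<phi> where "test_fun U \<phi>" "\<And>x. 0 \<le> \<phi> x" "\<And>x. \<phi> x \<le> 1" "\<And>x. x \<in> K \<Longrightarrow> \<phi> x = 1"
proof -
  define G where "G x r b \<longleftrightarrow> r > 0 \<and> smooth b \<and> cball x r \<subseteq> U \<and> (\<forall>y. 0 \<le> b y \<and> b y \<le> 1) \<and>
      (\<forall>y\<in>ball x (r/2). b y = 1) \<and> (\<forall>y. y \<notin> cball x r \<longrightarrow> b y = 0)"
    for x :: "real^'n" and r :: real and b
  have "\<exists>r b. G x r b" if "x \<in> K" for x
  proof -
    obtain r where r: "r > 0" "cball x r \<subseteq> U"
      using \<open>x \<in> K\<close> assms open_contains_cball by blast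
    obtain b where "smooth b" "\<And>y. 0 \<le> b y" "\<And>y. b y \<le> 1" "\<And>y. y \<in> ball x (r/2) \<Longrightarrow> b y = 1"
      "\<And>y. y \<notin> cball x r \<Longrightarrow> b y = 0"
      by (rule smooth_bump[of "r/2" r x]) (use r in auto)
    with r have "G x r b" by (auto simp: G_def simp del: mem_ball mem_cball)
    then show ?thesis by blast
  qed
  then obtain r b where G: "\<And>x. x \<in> K \<Longrightarrow> G x (r x) (b x)" by metis
  then have rb: "r x > 0" "smooth (b x)" "cball x (r x) \<subseteq> U" "0 \<le> b x y" "b x y \<le> 1"
    "y \<in> ball x (r x/2) \<Longrightarrow> b x y = 1" "y \<notin> cball x (r x) \<Longrightarrow> b x y = 0" if "x \<in> K" for x y
    using that unfolding G_def by blast+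
  have cover: "K \<subseteq> (\<Union>x\<in>K. ball x (r x/2))" using rb(1) by auto
  obtain D where D: "D \<subseteq> K" "finite D" "K \<subseteq> (\<Union>x\<in>D. ball x (r x/2))"
    by (rule compactE_image[OF assms(1) _ cover]) auto
  let ?p = "\<lambda>y. \<Prod>x\<in>D. (1 - b x y)"
  have p: "0 \<le> ?p y" "?p y \<le> 1" for y
    using rb(4,5) D(1) by (auto intro!: prod_nonneg prod_le_1)
  show thesis
  proof (rule that[of "\<lambda>y. 1 - ?p y"])
    show "test_fun U (\<lambda>y. 1 - ?p y)"
    proof (rule test_funI[of _ "\<Union>x\<in>D. cball x (r x)"])
      show "smooth (\<lambda>y. 1 - ?p y)" using rb(2) D(1) by (intro smooth_diff smooth_prod) auto
      show "compact (\<Union>x\<in>D. cball x (r x))" using D by auto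
      show "(\<Union>x\<in>D. cball x (r x)) \<subseteq> U" using rb(3) D(1) by blast
      show "1 - ?p y = 0" if "y \<notin> (\<Union>x\<in>D. cball x (r x))" for y
        using that rb(7) D(1) by (subst prod.neutral) auto
    qed
    show "1 - ?p y = 1" if y: "y \<in> K" for y
    proof -
      obtain x where "x \<in> D" "y \<in> ball x (r x/2)" using D y by blast
      then have "\<exists>x\<in>D. 1 - b x y = 0" using rb(6)[of x y] D(1) by auto
      then show ?thesis using D(2) by simp
    qed
  qed (use p in auto)
qed

lemma set_integral_lebesgue_on:
  fixes f :: "'a::euclidean_space \<Rightarrow> 'b::{banach, second_countable_topology}"
  shows "A \<in> sets lebesgue \<Longrightarrow> (LINT x:A|lebesgue. f x) = (\<integral>x. f x \<partial>lebesgue_on A)"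
  unfolding set_lebesgue_integral_def by (subst integral_restrict_space) auto

lemma L2_eq_sqint: "A \<in> sets lebesgue \<Longrightarrow> u \<in> L2 A \<longleftrightarrow> u \<in> sqint (lebesgue_on A)"
  by (simp add: L2_def sqint_def set_borel_measurable_def set_integrable_def
      borel_measurable_restrict_space_iff integrable_restrict_space)

text \<open>Up to a null set, \<open>{g > 0}\<close> is a countable union of compact sets, so it
  suffices that each compact part \<open>K\<close> is null. Urysohn functions of shrinking
  neighbourhoods converge to the indicator of \<open>K\<close>, so the integral of \<open>g\<close>
  over \<open>K\<close> is zero although \<open>g\<close> is positive there. The same applied to
  \<open>- g\<close> finishes the proof.\<close>

theorem fundamental_lemma:
  fixes g :: "real^'n \<Rightarrow> real"
  assumes "open \<Omega>" and g: "integrable (lebesgue_on \<Omega>) g"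
    and test: "\<And>\<phi>. test_fun \<Omega> \<phi> \<Longrightarrow> (\<integral>x. \<phi> x * g x \<partial>lebesgue_on \<Omega>) = 0"
  shows "AE x in lebesgue_on \<Omega>. g x = 0"
proof -
  have S: "\<Omega> \<in> sets lebesgue" using assms(1) by simp
  have le: "AE x in lebesgue_on \<Omega>. g x \<le> 0" if g: "integrable (lebesgue_on \<Omega>) g"
    and test: "\<And>\<phi>. test_fun \<Omega> \<phi> \<Longrightarrow> (\<integral>x. \<phi> x * g x \<partial>lebesgue_on \<Omega>) = 0" for g :: "real^'n \<Rightarrow> real"
  proof -
    have [measurable]: "g \<in> borel_measurable (lebesgue_on \<Omega>)" using g by auto
    define A where "A = {x \<in> \<Omega>. g x > 0}"
    have "{x \<in> space (lebesgue_on \<Omega>). g x > 0} \<in> sets (lebesgue_on \<Omega>)" by measurable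
    moreover have "{x \<in> space (lebesgue_on \<Omega>). g x > 0} = A" by (simp add: A_def)
    ultimately have A: "A \<in> sets lebesgue"
      using S sets_restrict_space_iff[of \<Omega> lebesgue A] by (simp only:) simp
    have null: "negligible K" if K: "compact K" "K \<subseteq> A" for K
    proof -
      define U where "U m = \<Omega> \<inter> (\<Union>x\<in>K. ball x (inverse (real (Suc m))))" for m
      have "\<exists>\<phi>. test_fun (U m) \<phi> \<and> (\<forall>x. 0 \<le> \<phi> x \<and> \<phi> x \<le> 1) \<and> (\<forall>x\<in>K. \<phi> x = 1)" for m
      proof -
        have "open (U m)" "K \<subseteq> U m"
          using K assms(1) by (auto simp: U_def A_def)
        from smooth_Urysohn[OF K(1) this] show ?thesis by metis
      qed
      then obtain \<phi> where \<phi>: "\<And>m. test_fun (U m) (\<phi> m)" "\<And>m x. 0 \<le> \<phi> m x" "\<And>m x. \<phi> m x \<le> 1"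
        "\<And>m x. x \<in> K \<Longrightarrow> \<phi> m x = 1" by metis
      have tf: "test_fun \<Omega> (\<phi> m)" for m
        using \<phi>(1) by (rule test_fun_mono) (auto simp: U_def)
      have [measurable]: "\<phi> m \<in> borel_measurable (lebesgue_on \<Omega>)" for m
        by (rule continuous_imp_measurable_on_sets_lebesgue[OF smooth_continuous_on S])
          (use tf test_fun_smooth in auto)
      have KS [measurable]: "K \<in> sets lebesgue" "K \<inter> \<Omega> \<in> sets lebesgue"
        using compact_imp_closed[OF K(1)] S by (auto intro: sets.Int)
      have [measurable]: "indicat_real K \<in> borel_measurable (lebesgue_on \<Omega>)"
        by (rule measurable_restrict_space1) simp
      have "(\<lambda>m. \<integral>x. \<phi> m x * g x \<partial>lebesgue_on \<Omega>) \<longlonglongrightarrow> (\<integral>x. indicator K x * g x \<partial>lebesgue_on \<Omega>)"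
      proof (rule integral_dominated_convergence[where w = "\<lambda>x. \<bar>g x\<bar>"])
        show "AE x in lebesgue_on \<Omega>. (\<lambda>m. \<phi> m x * g x) \<longlonglongrightarrow> indicator K x * g x"
        proof (rule AE_I2)
          fix x
          show "(\<lambda>m. \<phi> m x * g x) \<longlonglongrightarrow> indicator K x * g x"
          proof (cases "x \<in> K")
            case True
            then show ?thesis using \<phi>(4) by simp
          next
            case False
            have "open (- K)" using K compact_imp_closed by blast
            then obtain d where d: "d > 0" "ball x d \<subseteq> - K"
              using False by (auto simp: open_contains_ball)
            obtain N where N: "inverse (real (Suc N)) < d"
              using reals_Archimedean[OF d(1)] by auto
            have "\<phi> m x = 0" if "m \<ge> N" for m
            proof (rule test_fun_outside[OF \<phi>(1)])
              have "inverse (real (Suc m)) < d"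
                by (rule le_less_trans[OF le_imp_inverse_le N]) (use \<open>m \<ge> N\<close> in auto)
              then show "x \<notin> U m"
                using d(2) by (auto simp: U_def subset_iff dist_commute)
            qed
            then have "\<forall>\<^sub>F m in sequentially. \<phi> m x * g x = 0"
              by (auto simp: eventually_sequentially)
            then show ?thesis using False by (simp add: tendsto_eventually)
          qed
        qed
        show "AE x in lebesgue_on \<Omega>. norm (\<phi> m x * g x) \<le> \<bar>g x\<bar>" for m
          using \<phi>(2)[of m] \<phi>(3)[of m] by (auto simp: abs_mult mult_left_le_one_le)
      qed (use g in auto)
      then have 0: "(\<integral>x. indicator K x * g x \<partial>lebesgue_on \<Omega>) = 0"
        using test[OF tf] by (simp add: LIMSEQ_const_iff)
      have int: "integrable (lebesgue_on \<Omega>) (\<lambda>x. indicator K x * g x)"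
        by (rule Bochner_Integration.integrable_bound[OF g])
          (measurable, auto simp: indicator_def)
      have "AE x in lebesgue_on \<Omega>. 0 \<le> indicator K x * g x"
        by (intro AE_I2) (use K in \<open>auto simp: A_def indicator_def\<close>)
      from integral_nonneg_eq_0_iff_AE[OF int this]
      have "AE x in lebesgue_on \<Omega>. indicator K x * g x = 0"
        using 0 by simp
      then have "AE x in lebesgue. x \<in> \<Omega> \<longrightarrow> indicator K x * g x = 0"
        using S by (simp add: AE_restrict_space_iff)
      then have "AE x in lebesgue. x \<notin> K"
        by eventually_elim (use K in \<open>force simp: A_def\<close>)
      then show ?thesis
        using KS(1) by (simp add: negligible_iff_null_sets AE_iff_null_sets)
    qed
    obtain C T where CT: "fsigma C" "negligible T" "C \<union> T = A"
      using lebesgue_set_almost_fsigma[OF A] by (metis negligible_iff_null_sets)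
    obtain F :: "nat \<Rightarrow> (real^'n) set" where F: "\<And>n. closed (F n)" "C = \<Union>(range F)"
      using CT(1) by (auto elim: fsigma.cases)
    have "C = (\<Union>n. \<Union>m::nat. F n \<inter> cball 0 (real m))"
      unfolding F(2) using real_arch_simple by auto
    moreover have "negligible (\<Union>m::nat. F n \<inter> cball 0 (real m))" for n
    proof (rule negligible_Union_nat)
      show "negligible (F n \<inter> cball 0 (real m))" for m
        using CT F by (intro null closed_Int_compact) auto
    qed
    ultimately have "negligible C" by (simp only: negligible_Union_nat)
    then have "negligible A" using CT by (metis negligible_Un)
    then have "AE x in lebesgue. x \<notin> A"
      using A by (simp add: negligible_iff_null_sets AE_iff_null_sets)
    then have "AE x in lebesgue. x \<in> \<Omega> \<longrightarrow> g x \<le> 0"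
      by eventually_elim (auto simp: A_def not_less)
    then show ?thesis using S by (simp add: AE_restrict_space_iff)
  qed
  have "AE x in lebesgue_on \<Omega>. g x \<le> 0" by (rule le[OF g test])
  moreover have "AE x in lebesgue_on \<Omega>. - g x \<le> 0"
    using g test by (intro le) auto
  ultimately show ?thesis by eventually_elim auto
qed

section \<open>Sobolev spaces on bounded open sets\<close>

locale bounded_open =
  fixes \<Omega> :: "(real^'n) set"
  assumes open_domain: "open \<Omega>" and bounded_domain: "bounded \<Omega>"
begin

abbreviation "M \<equiv> lebesgue_on \<Omega>"

text \<open>With \<open>w0\<close> the divergence of \<open>w1\<close> and \<open>g\<close> the
  gradient of \<open>z\<close>, this is the integral over the domain that Green's formula equates
  with the boundary integral of \<open>z\<close> against the normal component of
  \<open>w1\<close>.\<close>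

abbreviation pair_ip :: "(real^'n \<Rightarrow> real) \<Rightarrow> (real^'n \<Rightarrow> real^'n) \<Rightarrow>
    (real^'n \<Rightarrow> real) \<Rightarrow> (real^'n \<Rightarrow> real^'n) \<Rightarrow> real" where
  "pair_ip w0 w1 z g \<equiv> ip M (\<lambda>x. (w0 x, w1 x)) (\<lambda>x. (z x, g x))"

lemma domain_sets [simp, measurable]: "\<Omega> \<in> sets lebesgue"
  using open_domain by simp

lemma LINT_domain:
  fixes f :: "real^'n \<Rightarrow> 'b::{banach, second_countable_topology}"
  shows "(LINT x:\<Omega>|lebesgue. f x) = (\<integral>x. f x \<partial>M)"
  by (rule set_integral_lebesgue_on) simp

lemma L2_iff: "u \<in> L2 \<Omega> \<longleftrightarrow> u \<in> sqint M"
  by (rule L2_eq_sqint) simp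

lemma AE_domain: "(AE x\<in>\<Omega> in lebesgue. P x) \<longleftrightarrow> (AE x in M. P x)"
  by (simp add: AE_restrict_space_iff)

lemma finite_measure_domain: "finite_measure M"
proof
  have "emeasure lebesgue \<Omega> < \<infinity>"
    using emeasure_bounded_finite[OF bounded_domain] open_domain by simp
  then show "emeasure M (space M) \<noteq> \<infinity>"
    by (simp add: emeasure_restrict_space)
qed

lemma sqint_const [simp, intro]: "(\<lambda>_. c) \<in> sqint M"
  using finite_measure.integrable_const[OF finite_measure_domain] by (simp add: sqint_def)

lemma sqint_imp_integrable: "u \<in> sqint M \<Longrightarrow> integrable M u"
  using sqint_norm_mult_integrable[of u M "\<lambda>_. 1::real"] sqint_measurable[of u M]
  by (auto simp: integrable_norm_iff)

lemma continuous_measurable_domain: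
  fixes f :: "real^'n \<Rightarrow> 'b::euclidean_space"
  shows "continuous_on UNIV f \<Longrightarrow> f \<in> borel_measurable M"
  by (rule continuous_imp_measurable_on_sets_lebesgue[OF continuous_on_subset]) auto

lemma continuous_bounded_domain:
  fixes f :: "real^'n \<Rightarrow> 'b::euclidean_space"
  assumes "continuous_on UNIV f"
  obtains C where "\<And>x. x \<in> \<Omega> \<Longrightarrow> norm (f x) \<le> C"
proof -
  have "bounded (f ` closure \<Omega>)"
    using bounded_domain assms
    by (intro compact_imp_bounded compact_continuous_image) (auto intro: continuous_on_subset)
  then obtain C where C: "\<forall>y\<in>f ` closure \<Omega>. norm y \<le> C"
    unfolding bounded_iff by blast
  show thesis
    by (rule that[of C]) (use C closure_subset in blast)
qed

lemma continuous_scale_sqint: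
  assumes "continuous_on UNIV f" "u \<in> sqint M"
  shows "(\<lambda>x. f x *\<^sub>R u x) \<in> sqint M"
proof -
  obtain C where C: "\<And>x. x \<in> \<Omega> \<Longrightarrow> norm (f x) \<le> C"
    using assms(1) by (rule continuous_bounded_domain) blast
  show ?thesis
    by (rule sqint_bounded_scale[OF assms(2) continuous_measurable_domain[OF assms(1)], of C])
      (use C in auto)
qed

lemma smooth_scale_sqint [intro]: "smooth f \<Longrightarrow> u \<in> sqint M \<Longrightarrow> (\<lambda>x. f x *\<^sub>R u x) \<in> sqint M"
  by (rule continuous_scale_sqint[OF smooth_continuous_on])

lemma smooth_mult_sqint [intro]:
  fixes u :: "real^'n \<Rightarrow> real"
  shows "smooth f \<Longrightarrow> u \<in> sqint M \<Longrightarrow> (\<lambda>x. f x * u x) \<in> sqint M"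
  using smooth_scale_sqint[of f u] by simp

lemma smooth_sqint [intro]: "smooth f \<Longrightarrow> f \<in> sqint M"
  using smooth_mult_sqint[of f "\<lambda>_. 1"] by simp

lemma smooth_gradient_sqint [intro]: "smooth f \<Longrightarrow> gradient f \<in> sqint M"
  by (rule sqint_vec) auto

lemma smooth_measurable_domain: "smooth f \<Longrightarrow> f \<in> borel_measurable M"
  by (rule continuous_measurable_domain[OF smooth_continuous_on])

lemma test_fun_sqint [intro]: "test_fun \<Omega> \<phi> \<Longrightarrow> \<phi> \<in> sqint M"
  by (rule smooth_sqint[OF test_fun_smooth])

lemma test_fun_integral:
  assumes "test_fun \<Omega> \<phi>"
  shows "(\<integral>x. \<phi> x \<partial>M) = (\<integral>x. \<phi> x \<partial>lborel)"
proof -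
  have eq: "indicat_real \<Omega> x *\<^sub>R \<phi> x = \<phi> x" for x
    using test_fun_outside[OF assms, of x] by (auto simp: indicator_def)
  have "(\<integral>x. \<phi> x \<partial>M) = (\<integral>x. \<phi> x \<partial>lebesgue)"
    by (subst integral_restrict_space) (simp, simp only: eq)
  also have "\<dots> = (\<integral>x. \<phi> x \<partial>lborel)"
    using smooth_measurable[OF test_fun_smooth[OF assms]] by (intro integral_completion) simp
  finally show ?thesis .
qed

section \<open>Weak gradient and weak divergence\<close>

lemma integration_by_parts:
  assumes "test_fun \<Omega> \<phi>" "smooth f"
  shows "(\<integral>x. f x * (gradient \<phi> x \<bullet> a) \<partial>M) = - (\<integral>x. \<phi> x * (gradient f x \<bullet> a) \<partial>M)"
proof -
  have tf: "test_fun \<Omega> (\<lambda>x. f x * \<phi> x)" using assms by blast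
  have s: "smooth \<phi>" using assms(1) by (rule test_fun_smooth)
  have "0 = (\<integral>x. gradient (\<lambda>x. f x * \<phi> x) x \<bullet> a \<partial>M)"
    using integral_gradient_test_fun[OF tf, of a] test_fun_integral[OF test_fun_gradient_inner[OF tf]]
    by simp
  also have "\<dots> = (\<integral>x. f x * (gradient \<phi> x \<bullet> a) + \<phi> x * (gradient f x \<bullet> a) \<partial>M)"
    using assms(2) s by (simp add: gradient_mult inner_add_left)
  also have "\<dots> = (\<integral>x. f x * (gradient \<phi> x \<bullet> a) \<partial>M) + (\<integral>x. \<phi> x * (gradient f x \<bullet> a) \<partial>M)"
    using assms(2) s by (intro Bochner_Integration.integral_add sqint_mult_integrable) auto
  finally show ?thesis by simp
qed

text \<open>A relation instead of an operator: \<open>wgrad\<close> and \<open>wdiv\<close> pick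
  unspecified representatives, whereas here any explicit derivative may be used, with square
  integrability bundled in.\<close>

definition weak_grad :: "(real^'n \<Rightarrow> real) \<Rightarrow> (real^'n \<Rightarrow> real^'n) \<Rightarrow> bool" where
  "weak_grad u g \<longleftrightarrow> u \<in> sqint M \<and> g \<in> sqint M \<and>
     (\<forall>\<phi> i. test_fun \<Omega> \<phi> \<longrightarrow> (\<integral>x. u x * gradient \<phi> x $ i \<partial>M) = - (\<integral>x. \<phi> x * g x $ i \<partial>M))"

definition weak_div :: "(real^'n \<Rightarrow> real^'n) \<Rightarrow> (real^'n \<Rightarrow> real) \<Rightarrow> bool" where
  "weak_div v q \<longleftrightarrow> v \<in> sqint M \<and> q \<in> sqint M \<and>
     (\<forall>\<phi>. test_fun \<Omega> \<phi> \<longrightarrow> (\<integral>x. v x \<bullet> gradient \<phi> x \<partial>M) = - (\<integral>x. \<phi> x * q x \<partial>M))"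

lemma weak_gradD: "weak_grad u g \<Longrightarrow> u \<in> sqint M" "weak_grad u g \<Longrightarrow> g \<in> sqint M"
  by (auto simp: weak_grad_def)

lemma weak_divD: "weak_div v q \<Longrightarrow> v \<in> sqint M" "weak_div v q \<Longrightarrow> q \<in> sqint M"
  by (auto simp: weak_div_def)

lemma integral_vec_component:
  fixes f :: "real^'n \<Rightarrow> real^'n"
  shows "integrable M f \<Longrightarrow> (\<integral>x. f x \<partial>M) $ i = (\<integral>x. f x $ i \<partial>M)"
  using integral_inner_left[of "axis i 1" M f] by (simp add: inner_axis)

lemma weak_grad_iff: "weak_grad u g \<longleftrightarrow> u \<in> L2 \<Omega> \<and> g \<in> L2 \<Omega> \<and> is_weak_gradient \<Omega> u g"
proof (cases "u \<in> sqint M \<and> g \<in> sqint M")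
  case True
  have "((\<integral>x. u x *\<^sub>R gradient \<phi> x \<partial>M) = - (\<integral>x. \<phi> x *\<^sub>R g x \<partial>M)) \<longleftrightarrow>
      (\<forall>i. (\<integral>x. u x * gradient \<phi> x $ i \<partial>M) = - (\<integral>x. \<phi> x * g x $ i \<partial>M))"
    if "test_fun \<Omega> \<phi>" for \<phi>
  proof -
    have s: "smooth \<phi>" using that by (rule test_fun_smooth)
    have "integrable M (\<lambda>x. u x *\<^sub>R gradient \<phi> x)"
    proof (rule sqint_imp_integrable, rule sqint_vec)
      show "(\<lambda>x. (u x *\<^sub>R gradient \<phi> x) $ i) \<in> sqint M" for i
        using smooth_mult_sqint[of "\<lambda>x. gradient \<phi> x $ i" u] s True by (auto simp: mult.commute)
    qed
    moreover have "integrable M (\<lambda>x. \<phi> x *\<^sub>R g x)"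
      using s True by (intro sqint_imp_integrable) auto
    ultimately show ?thesis
      by (simp add: vec_eq_iff integral_vec_component)
  qed
  then show ?thesis
    using True by (auto simp: weak_grad_def is_weak_gradient_def L2_iff LINT_domain)
qed (auto simp: weak_grad_def L2_iff)

lemma weak_div_iff: "weak_div v q \<longleftrightarrow> v \<in> L2 \<Omega> \<and> q \<in> L2 \<Omega> \<and> is_weak_divergence \<Omega> v q"
  by (auto simp: weak_div_def is_weak_divergence_def L2_iff LINT_domain)

lemma sqint_eq_0_AE:
  assumes "w \<in> sqint M" "\<And>\<phi>. test_fun \<Omega> \<phi> \<Longrightarrow> (\<integral>x. \<phi> x * w x \<partial>M) = 0"
  shows "AE x in M. w x = 0"
  by (rule fundamental_lemma[OF open_domain sqint_imp_integrable[OF assms(1)] assms(2)])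

lemma weak_grad_unique:
  assumes "weak_grad u g" "weak_grad u h"
  shows "AE x in M. g x = h x"
proof -
  have "AE x in M. g x $ i - h x $ i = 0" for i
  proof (rule sqint_eq_0_AE)
    show "(\<lambda>x. g x $ i - h x $ i) \<in> sqint M"
      using assms[THEN weak_gradD(2)] by (intro sqint_diff sqint_component)
    fix \<phi> assume \<phi>: "test_fun \<Omega> \<phi>"
    have "integrable M (\<lambda>x. \<phi> x * g x $ i)" "integrable M (\<lambda>x. \<phi> x * h x $ i)"
      using assms[THEN weak_gradD(2)] \<phi> by (intro sqint_mult_integrable; blast)+
    then show "(\<integral>x. \<phi> x * (g x $ i - h x $ i) \<partial>M) = 0"
      using assms \<phi> by (simp add: weak_grad_def right_diff_distrib)
  qed
  then have "AE x in M. \<forall>i. g x $ i - h x $ i = 0"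
    by (rule eventually_all_finite)
  then show ?thesis by (simp add: vec_eq_iff)
qed

lemma weak_div_unique:
  assumes "weak_div v p" "weak_div v q"
  shows "AE x in M. p x = q x"
proof -
  have "AE x in M. p x - q x = 0"
  proof (rule sqint_eq_0_AE)
    show "(\<lambda>x. p x - q x) \<in> sqint M"
      using assms[THEN weak_divD(2)] by (intro sqint_diff)
    fix \<phi> assume \<phi>: "test_fun \<Omega> \<phi>"
    have "integrable M (\<lambda>x. \<phi> x * p x)" "integrable M (\<lambda>x. \<phi> x * q x)"
      using assms[THEN weak_divD(2)] \<phi> by (intro sqint_mult_integrable; blast)+
    then show "(\<integral>x. \<phi> x * (p x - q x) \<partial>M) = 0"
      using assms \<phi> by (simp add: weak_div_def right_diff_distrib)
  qed
  then show ?thesis by simp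
qed

lemma weak_grad_wgrad: "u \<in> H1 \<Omega> \<Longrightarrow> weak_grad u (wgrad \<Omega> u)"
proof -
  assume u: "u \<in> H1 \<Omega>"
  then have "\<exists>g. g \<in> L2 \<Omega> \<and> is_weak_gradient \<Omega> u g" by (auto simp: H1_def)
  from someI_ex[OF this] show ?thesis
    using u by (simp add: weak_grad_iff wgrad_def H1_def)
qed

lemma weak_div_wdiv: "v \<in> Hdiv \<Omega> \<Longrightarrow> weak_div v (wdiv \<Omega> v)"
proof -
  assume v: "v \<in> Hdiv \<Omega>"
  then have "\<exists>q. q \<in> L2 \<Omega> \<and> is_weak_divergence \<Omega> v q" by (auto simp: Hdiv_def)
  from someI_ex[OF this] show ?thesis
    using v by (simp add: weak_div_iff wdiv_def Hdiv_def)
qed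

lemma weak_grad_imp_H1: "weak_grad u g \<Longrightarrow> u \<in> H1 \<Omega>"
  by (auto simp: weak_grad_iff H1_def)

lemma weak_div_imp_Hdiv: "weak_div v q \<Longrightarrow> v \<in> Hdiv \<Omega>"
  by (auto simp: weak_div_iff Hdiv_def)

lemma wgrad_AE: "weak_grad u g \<Longrightarrow> AE x in M. wgrad \<Omega> u x = g x"
  by (rule weak_grad_unique[OF weak_grad_wgrad[OF weak_grad_imp_H1]])

lemma wdiv_AE: "weak_div v q \<Longrightarrow> AE x in M. wdiv \<Omega> v x = q x"
  by (rule weak_div_unique[OF weak_div_wdiv[OF weak_div_imp_Hdiv]])

lemma weak_grad_inner:
  assumes "weak_grad u g" "test_fun \<Omega> \<phi>"
  shows "(\<integral>x. u x * (gradient \<phi> x \<bullet> a) \<partial>M) = - (\<integral>x. \<phi> x * (g x \<bullet> a) \<partial>M)"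
proof -
  have s: "smooth \<phi>" using assms(2) by (rule test_fun_smooth)
  have int: "integrable M (\<lambda>x. u x * gradient \<phi> x $ i * c)" "integrable M (\<lambda>x. \<phi> x * g x $ i * c)" for i c
    using assms(1)[THEN weak_gradD(1)] assms(1)[THEN weak_gradD(2)] s
    by (intro integrable_mult_left sqint_mult_integrable; blast)+
  have "(\<integral>x. u x * (gradient \<phi> x \<bullet> a) \<partial>M) = (\<Sum>i\<in>UNIV. \<integral>x. u x * gradient \<phi> x $ i * a $ i \<partial>M)"
    using int(1) by (subst Bochner_Integration.integral_sum[symmetric])
      (auto simp: inner_vec_def sum_distrib_left mult.assoc)
  also have "\<dots> = - (\<Sum>i\<in>UNIV. \<integral>x. \<phi> x * g x $ i * a $ i \<partial>M)"
    using assms by (simp add: weak_grad_def sum_negf)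
  also have "\<dots> = - (\<integral>x. \<phi> x * (g x \<bullet> a) \<partial>M)"
    using int(2) by (subst Bochner_Integration.integral_sum[symmetric])
      (auto simp: inner_vec_def sum_distrib_left mult.assoc)
  finally show ?thesis .
qed

lemma weak_grad_smooth: "smooth f \<Longrightarrow> weak_grad f (gradient f)"
  unfolding weak_grad_def using integration_by_parts[of _ f "axis i 1" for i]
  by (auto simp: inner_axis)

lemma weak_grad_lincomb:
  assumes "weak_grad u g" "weak_grad v h"
  shows "weak_grad (\<lambda>x. a * u x + b * v x) (\<lambda>x. a *\<^sub>R g x + b *\<^sub>R h x)"
  unfolding weak_grad_def
proof (intro conjI allI impI)
  note sq = assms(1)[THEN weak_gradD(1)] assms(1)[THEN weak_gradD(2)]
    assms(2)[THEN weak_gradD(1)] assms(2)[THEN weak_gradD(2)]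
  show "(\<lambda>x. a * u x + b * v x) \<in> sqint M" "(\<lambda>x. a *\<^sub>R g x + b *\<^sub>R h x) \<in> sqint M"
    using sq by (auto intro!: sqint_add sqint_cmult sqint_scale)
  fix \<phi> i assume \<phi>: "test_fun \<Omega> \<phi>"
  then have s: "smooth \<phi>" by (rule test_fun_smooth)
  have int: "integrable M (\<lambda>x. u x * gradient \<phi> x $ i)" "integrable M (\<lambda>x. v x * gradient \<phi> x $ i)"
    "integrable M (\<lambda>x. \<phi> x * g x $ i)" "integrable M (\<lambda>x. \<phi> x * h x $ i)"
    using sq s by (intro sqint_mult_integrable; blast)+
  have "(\<integral>x. (a * u x + b * v x) * gradient \<phi> x $ i \<partial>M) =
      (\<integral>x. a * (u x * gradient \<phi> x $ i) + b * (v x * gradient \<phi> x $ i) \<partial>M)"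
    by (simp add: algebra_simps)
  also have "\<dots> = - (\<integral>x. a * (\<phi> x * g x $ i) + b * (\<phi> x * h x $ i) \<partial>M)"
    using int assms \<phi> by (simp add: weak_grad_def)
  also have "\<dots> = - (\<integral>x. \<phi> x * (a *\<^sub>R g x + b *\<^sub>R h x) $ i \<partial>M)"
    by (simp add: algebra_simps)
  finally show "(\<integral>x. (a * u x + b * v x) * gradient \<phi> x $ i \<partial>M) =
      - (\<integral>x. \<phi> x * (a *\<^sub>R g x + b *\<^sub>R h x) $ i \<partial>M)" .
qed

lemma weak_grad_diff:
  "weak_grad u g \<Longrightarrow> weak_grad v h \<Longrightarrow> weak_grad (\<lambda>x. u x - v x) (\<lambda>x. g x - h x)"
  using weak_grad_lincomb[of u g v h 1 "-1"] by simp

lemma weak_div_lincomb: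
  assumes "weak_div v p" "weak_div w q"
  shows "weak_div (\<lambda>x. a *\<^sub>R v x + b *\<^sub>R w x) (\<lambda>x. a * p x + b * q x)"
  unfolding weak_div_def
proof (intro conjI allI impI)
  note sq = assms(1)[THEN weak_divD(1)] assms(1)[THEN weak_divD(2)]
    assms(2)[THEN weak_divD(1)] assms(2)[THEN weak_divD(2)]
  show "(\<lambda>x. a *\<^sub>R v x + b *\<^sub>R w x) \<in> sqint M" "(\<lambda>x. a * p x + b * q x) \<in> sqint M"
    using sq by (auto intro!: sqint_add sqint_cmult sqint_scale)
  fix \<phi> assume \<phi>: "test_fun \<Omega> \<phi>"
  then have s: "smooth \<phi>" by (rule test_fun_smooth)
  have int: "integrable M (\<lambda>x. v x \<bullet> gradient \<phi> x)" "integrable M (\<lambda>x. w x \<bullet> gradient \<phi> x)"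
    "integrable M (\<lambda>x. \<phi> x * p x)" "integrable M (\<lambda>x. \<phi> x * q x)"
    using sq s by (intro sqint_mult_integrable sqint_inner_integrable; blast)+
  have "(\<integral>x. (a *\<^sub>R v x + b *\<^sub>R w x) \<bullet> gradient \<phi> x \<partial>M) =
      (\<integral>x. a * (v x \<bullet> gradient \<phi> x) + b * (w x \<bullet> gradient \<phi> x) \<partial>M)"
    by (simp add: inner_add_left)
  also have "\<dots> = - (\<integral>x. a * (\<phi> x * p x) + b * (\<phi> x * q x) \<partial>M)"
    using int assms \<phi> by (simp add: weak_div_def)
  also have "\<dots> = - (\<integral>x. \<phi> x * (a * p x + b * q x) \<partial>M)"
    by (simp add: algebra_simps)
  finally show "(\<integral>x. (a *\<^sub>R v x + b *\<^sub>R w x) \<bullet> gradient \<phi> x \<partial>M) =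
      - (\<integral>x. \<phi> x * (a * p x + b * q x) \<partial>M)" .
qed

lemma weak_div_cong_AE:
  assumes "weak_div v q" "AE x in M. v x = w x" "w \<in> borel_measurable M"
  shows "weak_div w q"
proof -
  have v: "v \<in> borel_measurable M" using assms(1) weak_divD sqint_measurable by blast
  have "(\<integral>x. v x \<bullet> gradient \<phi> x \<partial>M) = (\<integral>x. w x \<bullet> gradient \<phi> x \<partial>M)" if "test_fun \<Omega> \<phi>" for \<phi>
  proof (rule integral_cong_AE)
    have [measurable]: "gradient \<phi> \<in> borel_measurable M" "v \<in> borel_measurable M" "w \<in> borel_measurable M"
      using that v assms(3) test_fun_smooth smooth_gradient_sqint sqint_measurable by blast+
    show "(\<lambda>x. v x \<bullet> gradient \<phi> x) \<in> borel_measurable M" "(\<lambda>x. w x \<bullet> gradient \<phi> x) \<in> borel_measurable M"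
      by measurable
    show "AE x in M. v x \<bullet> gradient \<phi> x = w x \<bullet> gradient \<phi> x"
      using assms(2) by eventually_elim simp
  qed
  then show ?thesis
    using assms sqint_cong_AE[OF weak_divD(1)[OF assms(1)] assms(2,3)] by (simp add: weak_div_def)
qed

lemma weak_grad_cong_AE:
  assumes "weak_grad u g" "AE x in M. u x = v x" "v \<in> borel_measurable M"
  shows "weak_grad v g"
proof -
  have u: "u \<in> borel_measurable M" using assms(1) weak_gradD sqint_measurable by blast
  have "(\<integral>x. u x * gradient \<phi> x $ i \<partial>M) = (\<integral>x. v x * gradient \<phi> x $ i \<partial>M)" if "test_fun \<Omega> \<phi>" for \<phi> i
  proof (rule integral_cong_AE)
    have [measurable]: "(\<lambda>x. gradient \<phi> x $ i) \<in> borel_measurable M" "u \<in> borel_measurable M" "v \<in> borel_measurable M"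
      using that u assms(3) smooth_measurable_domain[OF test_fun_smooth[OF test_fun_gradient_component]] by blast+
    show "(\<lambda>x. u x * gradient \<phi> x $ i) \<in> borel_measurable M" "(\<lambda>x. v x * gradient \<phi> x $ i) \<in> borel_measurable M"
      by measurable
    show "AE x in M. u x * gradient \<phi> x $ i = v x * gradient \<phi> x $ i"
      using assms(2) by eventually_elim simp
  qed
  then show ?thesis
    using assms sqint_cong_AE[OF weak_gradD(1)[OF assms(1)] assms(2,3)] by (simp add: weak_grad_def)
qed

definition div_smooth :: "(real^'n \<Rightarrow> real^'n) \<Rightarrow> real^'n \<Rightarrow> real" where
  "div_smooth Y x = (\<Sum>i\<in>UNIV. gradient (\<lambda>x. Y x $ i) x $ i)"

lemma smooth_div_smooth [intro]: "(\<And>i. smooth (\<lambda>x. Y x $ i)) \<Longrightarrow> smooth (div_smooth Y)"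
  unfolding div_smooth_def[abs_def] by (intro smooth_sum smooth_gradient_component)

lemma weak_grad_test_field:
  assumes "weak_grad z g" "\<And>i. test_fun \<Omega> (\<lambda>x. Y x $ i)"
  shows "pair_ip (div_smooth Y) Y z g = 0"
proof -
  have s: "smooth (\<lambda>x. Y x $ i)" for i using assms(2) by (rule test_fun_smooth)
  note sq = weak_gradD[OF assms(1)]
  have int: "integrable M (\<lambda>x. z x * gradient (\<lambda>x. Y x $ i) x $ i)" "integrable M (\<lambda>x. Y x $ i * g x $ i)" for i
    using sq s by (intro sqint_mult_integrable; blast)+
  have "pair_ip (div_smooth Y) Y z g =
      (\<integral>x. (\<Sum>i\<in>UNIV. z x * gradient (\<lambda>x. Y x $ i) x $ i + Y x $ i * g x $ i) \<partial>M)"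
    by (simp add: ip_def div_smooth_def inner_vec_def sum.distrib sum_distrib_left mult.commute[of "z _"]
        sum_distrib_right)
  also have "\<dots> = (\<Sum>i\<in>UNIV. (\<integral>x. z x * gradient (\<lambda>x. Y x $ i) x $ i \<partial>M) + (\<integral>x. Y x $ i * g x $ i \<partial>M))"
    using int by simp
  also have "\<dots> = 0"
    using assms by (simp add: weak_grad_def)
  finally show ?thesis .
qed

lemma weak_div_smooth:
  assumes "\<And>i. smooth (\<lambda>x. Y x $ i)"
  shows "weak_div Y (div_smooth Y)"
  unfolding weak_div_def
proof (intro conjI allI impI)
  show sq: "Y \<in> sqint M" "div_smooth Y \<in> sqint M"
    using assms by (auto intro: sqint_vec)
  fix \<phi> assume \<phi>: "test_fun \<Omega> \<phi>"
  have int: "integrable M (\<lambda>x. Y x $ i * gradient \<phi> x $ i)" "integrable M (\<lambda>x. \<phi> x * gradient (\<lambda>x. Y x $ i) x $ i)" for i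
    using \<phi> assms test_fun_smooth[OF \<phi>] by (intro sqint_mult_integrable; blast)+
  have "(\<integral>x. Y x \<bullet> gradient \<phi> x \<partial>M) = (\<Sum>i\<in>UNIV. \<integral>x. Y x $ i * gradient \<phi> x $ i \<partial>M)"
    using int(1) by (simp add: inner_vec_def)
  also have "\<dots> = (\<Sum>i\<in>UNIV. - (\<integral>x. \<phi> x * gradient (\<lambda>x. Y x $ i) x $ i \<partial>M))"
    using integration_by_parts[OF \<phi> assms, of i "axis i 1" for i] by (simp add: inner_axis)
  also have "\<dots> = - (\<integral>x. \<phi> x * div_smooth Y x \<partial>M)"
    using int(2) by (simp add: div_smooth_def sum_distrib_left sum_negf)
  finally show "(\<integral>x. Y x \<bullet> gradient \<phi> x \<partial>M) = - (\<integral>x. \<phi> x * div_smooth Y x \<partial>M)" .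
qed

lemma pair_ip_test_fun:
  assumes "weak_div v q" "test_fun \<Omega> \<phi>"
  shows "pair_ip q v \<phi> (gradient \<phi>) = 0"
proof -
  have "integrable M (\<lambda>x. q x * \<phi> x)" "integrable M (\<lambda>x. v x \<bullet> gradient \<phi> x)"
    using weak_divD[OF assms(1)] assms(2) test_fun_smooth by (blast intro: sqint_mult_integrable)+
  then show ?thesis
    using assms by (simp add: ip_def weak_div_def mult.commute)
qed

lemma pair_ip_test_funD:
  assumes "q \<in> sqint M" "v \<in> sqint M" "\<And>\<phi>. test_fun \<Omega> \<phi> \<Longrightarrow> pair_ip q v \<phi> (gradient \<phi>) = 0"
  shows "weak_div v q"
  unfolding weak_div_def
proof (intro conjI assms allI impI)
  fix \<phi> assume \<phi>: "test_fun \<Omega> \<phi>"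
  have "integrable M (\<lambda>x. q x * \<phi> x)" "integrable M (\<lambda>x. v x \<bullet> gradient \<phi> x)"
    using assms(1,2) \<phi> test_fun_smooth by (blast intro: sqint_mult_integrable)+
  then show "(\<integral>x. v x \<bullet> gradient \<phi> x \<partial>M) = - (\<integral>x. \<phi> x * q x \<partial>M)"
    using assms(3)[OF \<phi>] by (simp add: ip_def mult.commute[of "q _"])
qed

section \<open>Traces and normal traces as annihilation conditions\<close>

lemma ip_cong_AE:
  fixes u v u' v' :: "real^'n \<Rightarrow> 'b::euclidean_space"
  assumes "AE x in M. u x = u' x" "AE x in M. v x = v' x"
    "u \<in> sqint M" "v \<in> sqint M" "u' \<in> sqint M" "v' \<in> sqint M"
  shows "ip M u v = ip M u' v'"
  unfolding ip_def
proof (rule integral_cong_AE)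
  have [measurable]: "u \<in> borel_measurable M" "v \<in> borel_measurable M"
    "u' \<in> borel_measurable M" "v' \<in> borel_measurable M"
    using assms(3-6) sqint_measurable by blast+
  show "(\<lambda>x. u x \<bullet> v x) \<in> borel_measurable M" "(\<lambda>x. u' x \<bullet> v' x) \<in> borel_measurable M"
    by measurable
  show "AE x in M. u x \<bullet> v x = u' x \<bullet> v' x"
    using assms(1,2) by eventually_elim simp
qed

lemma normal_trace_eq:
  assumes "weak_div v q" "weak_grad z g"
  shows "normal_trace \<Omega> v z = pair_ip q v z g"
proof -
  have "normal_trace \<Omega> v z = pair_ip (wdiv \<Omega> v) v z (wgrad \<Omega> z)"
    by (simp add: normal_trace_def LINT_domain ip_def add.commute)
  also have "\<dots> = pair_ip q v z g"
  proof (rule ip_cong_AE)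
    show "AE x in M. (wdiv \<Omega> v x, v x) = (q x, v x)"
      using wdiv_AE[OF assms(1)] by eventually_elim simp
    show "AE x in M. (z x, wgrad \<Omega> z x) = (z x, g x)"
      using wgrad_AE[OF assms(2)] by eventually_elim simp
  qed (use weak_divD[OF assms(1)] weak_gradD[OF assms(2)]
      weak_divD[OF weak_div_wdiv[OF weak_div_imp_Hdiv[OF assms(1)]]]
      weak_gradD[OF weak_grad_wgrad[OF weak_grad_imp_H1[OF assms(2)]]] in auto)
  finally show ?thesis .
qed

lemma H1_norm_eq:
  assumes "weak_grad u g"
  shows "H1_norm \<Omega> u = sqrt (pair_ip u g u g)"
proof -
  have "H1_norm \<Omega> u = sqrt (pair_ip u (wgrad \<Omega> u) u (wgrad \<Omega> u))"
    by (simp add: H1_norm_def LINT_domain ip_def power2_eq_square)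
  also have "pair_ip u (wgrad \<Omega> u) u (wgrad \<Omega> u) = pair_ip u g u g"
  proof (rule ip_cong_AE)
    show "AE x in M. (u x, wgrad \<Omega> u x) = (u x, g x)" "AE x in M. (u x, wgrad \<Omega> u x) = (u x, g x)"
      using wgrad_AE[OF assms] by (eventually_elim, simp)+
  qed (use weak_gradD[OF assms]
      weak_gradD[OF weak_grad_wgrad[OF weak_grad_imp_H1[OF assms]]] in auto)
  finally show ?thesis .
qed

text \<open>The H1 distance to a smooth function is the L2 distance of the pairs (function,
  gradient), so the chosen representative \<open>wgrad\<close> disappears and the Hilbert space
  tools apply.\<close>

lemma trace_zero_on_iff:
  assumes "weak_grad v g"
  shows "trace_zero_on \<Omega> \<Gamma> v \<longleftrightarrow>
    (\<exists>\<phi> :: nat \<Rightarrow> real^'n \<Rightarrow> real. (\<forall>k. smooth (\<phi> k) \<and> (\<forall>x\<in>\<Gamma>. \<phi> k x = 0)) \<and>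
      (\<lambda>k. ip M (\<lambda>x. (v x, g x) - (\<phi> k x, gradient (\<phi> k) x)) (\<lambda>x. (v x, g x) - (\<phi> k x, gradient (\<phi> k) x))) \<longlonglongrightarrow> 0)"
proof -
  have "((\<lambda>k. H1_norm \<Omega> (\<lambda>x. v x - \<phi> k x)) \<longlonglongrightarrow> 0) \<longleftrightarrow>
      (\<lambda>k. ip M (\<lambda>x. (v x, g x) - (\<phi> k x, gradient (\<phi> k) x)) (\<lambda>x. (v x, g x) - (\<phi> k x, gradient (\<phi> k) x))) \<longlonglongrightarrow> 0"
    if "\<forall>k. smooth (\<phi> k)" for \<phi> :: "nat \<Rightarrow> real^'n \<Rightarrow> real"
  proof -
    have eq: "H1_norm \<Omega> (\<lambda>x. v x - \<phi> k x) =
        sqrt (ip M (\<lambda>x. (v x, g x) - (\<phi> k x, gradient (\<phi> k) x)) (\<lambda>x. (v x, g x) - (\<phi> k x, gradient (\<phi> k) x)))" for k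
      using H1_norm_eq[OF weak_grad_diff[OF assms weak_grad_smooth], of "\<phi> k"] that by simp
    show ?thesis unfolding eq
    proof
      assume "(\<lambda>k. sqrt (ip M (\<lambda>x. (v x, g x) - (\<phi> k x, gradient (\<phi> k) x)) (\<lambda>x. (v x, g x) - (\<phi> k x, gradient (\<phi> k) x)))) \<longlonglongrightarrow> 0"
      from tendsto_power[OF this, of 2] show "(\<lambda>k. ip M (\<lambda>x. (v x, g x) - (\<phi> k x, gradient (\<phi> k) x)) (\<lambda>x. (v x, g x) - (\<phi> k x, gradient (\<phi> k) x))) \<longlonglongrightarrow> 0"
        by simp
    qed (use tendsto_real_sqrt in fastforce)
  qed
  then show ?thesis
    using weak_grad_imp_H1[OF assms] unfolding trace_zero_on_def by (metis (no_types, lifting))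
qed

lemma trace_zero_on_smooth:
  assumes "smooth \<phi>" "\<And>x. x \<in> \<Gamma> \<Longrightarrow> \<phi> x = 0"
  shows "trace_zero_on \<Omega> \<Gamma> \<phi>"
  unfolding trace_zero_on_iff[OF weak_grad_smooth[OF assms(1)]]
  using assms by (intro exI[of _ "\<lambda>_. \<phi>"]) (auto simp: ip_def zero_prod_def[symmetric])

lemma trace_zero_on_annihilator:
  assumes "weak_grad v g" "trace_zero_on \<Omega> \<Gamma> v" "w0 \<in> sqint M" "w1 \<in> sqint M"
    and ann: "\<And>\<phi>. smooth \<phi> \<Longrightarrow> (\<And>x. x \<in> \<Gamma> \<Longrightarrow> \<phi> x = 0) \<Longrightarrow> pair_ip w0 w1 \<phi> (gradient \<phi>) = 0"
  shows "pair_ip w0 w1 v g = 0"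
proof -
  obtain \<phi> :: "nat \<Rightarrow> real^'n \<Rightarrow> real" where \<phi>: "\<And>k. smooth (\<phi> k)" "\<And>k x. x \<in> \<Gamma> \<Longrightarrow> \<phi> k x = 0"
    "(\<lambda>k. ip M (\<lambda>x. (v x, g x) - (\<phi> k x, gradient (\<phi> k) x)) (\<lambda>x. (v x, g x) - (\<phi> k x, gradient (\<phi> k) x))) \<longlonglongrightarrow> 0"
    using assms(2) unfolding trace_zero_on_iff[OF assms(1)] by blast
  have "(\<lambda>k. pair_ip w0 w1 (\<phi> k) (gradient (\<phi> k))) \<longlonglongrightarrow> pair_ip w0 w1 v g"
    by (rule ip_tendsto[OF _ _ _ \<phi>(3)])
      (use assms(3,4) weak_gradD[OF assms(1)] \<phi>(1) in auto)
  then show ?thesis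
    using ann \<phi>(1,2) by (simp add: LIMSEQ_const_iff)
qed

text \<open>The pairs of an admissible smooth function and its gradient form a subspace, and the
  projection theorem yields the approximants that the definition of a zero trace asks for. A trace
  condition can thus be proved without constructing any approximation.\<close>

lemma trace_zero_onI:
  assumes "weak_grad v g"
    and ann: "\<And>w0 w1. w0 \<in> sqint M \<Longrightarrow> w1 \<in> sqint M \<Longrightarrow>
      (\<And>\<phi>. smooth \<phi> \<Longrightarrow> (\<And>x. x \<in> \<Gamma> \<Longrightarrow> \<phi> x = 0) \<Longrightarrow> pair_ip w0 w1 \<phi> (gradient \<phi>) = 0) \<Longrightarrow>
      pair_ip w0 w1 v g = 0"
  shows "trace_zero_on \<Omega> \<Gamma> v"
proof -
  let ?S = "{(\<lambda>x. (\<phi> x, gradient \<phi> x)) | \<phi>. smooth \<phi> \<and> (\<forall>x\<in>\<Gamma>. \<phi> x = 0)}"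
  obtain Z where Z: "\<And>k::nat. Z k \<in> ?S"
    "(\<lambda>k. ip M (\<lambda>x. (v x, g x) - Z k x) (\<lambda>x. (v x, g x) - Z k x)) \<longlonglongrightarrow> 0"
  proof (rule sqint_approximation[of ?S M "\<lambda>x. (v x, g x)"])
    show "?S \<subseteq> sqint M" by auto
    show "(\<lambda>_. 0) \<in> ?S"
      by (rule CollectI, rule exI[of _ "\<lambda>_. 0"]) (auto simp: zero_prod_def)
    show "(\<lambda>x. a *\<^sub>R f x + b *\<^sub>R h x) \<in> ?S" if fh: "f \<in> ?S" "h \<in> ?S" for f h a b
    proof -
      obtain \<phi> where \<phi>: "f = (\<lambda>x. (\<phi> x, gradient \<phi> x))" "smooth \<phi>" "\<forall>x\<in>\<Gamma>. \<phi> x = 0"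
        using fh(1) by blast
      obtain \<psi> where \<psi>: "h = (\<lambda>x. (\<psi> x, gradient \<psi> x))" "smooth \<psi>" "\<forall>x\<in>\<Gamma>. \<psi> x = 0"
        using fh(2) by blast
      have s: "smooth (\<lambda>x. a * \<phi> x)" "smooth (\<lambda>x. b * \<psi> x)" using \<phi> \<psi> by auto
      have "gradient (\<lambda>x. a * \<phi> x + b * \<psi> x) x = a *\<^sub>R gradient \<phi> x + b *\<^sub>R gradient \<psi> x" for x
        using s \<phi> \<psi> by (simp add: gradient_add gradient_mult)
      then show ?thesis
        using s \<phi> \<psi> by (intro CollectI exI[of _ "\<lambda>x. a * \<phi> x + b * \<psi> x"]) auto
    qed
    show "(\<lambda>x. (v x, g x)) \<in> sqint M" using weak_gradD[OF assms(1)] by auto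
    fix W :: "real^'n \<Rightarrow> real \<times> (real^'n)"
    assume W: "W \<in> sqint M" "\<And>Z. Z \<in> ?S \<Longrightarrow> ip M W Z = 0"
    have "pair_ip (\<lambda>x. fst (W x)) (\<lambda>x. snd (W x)) v g = 0"
    proof (rule ann[OF sqint_PairD[OF W(1)]])
      fix \<phi> assume "smooth \<phi>" "\<And>x. x \<in> \<Gamma> \<Longrightarrow> \<phi> x = (0::real)"
      then show "pair_ip (\<lambda>x. fst (W x)) (\<lambda>x. snd (W x)) \<phi> (gradient \<phi>) = 0"
        using W(2)[of "\<lambda>x. (\<phi> x, gradient \<phi> x)"] by auto
    qed
    then show "ip M W (\<lambda>x. (v x, g x)) = 0" by simp
  qed blast
  have "\<forall>k. \<exists>\<phi>. Z k = (\<lambda>x. (\<phi> x, gradient \<phi> x)) \<and> smooth \<phi> \<and> (\<forall>x\<in>\<Gamma>. \<phi> x = 0)"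
    using Z(1) by blast
  then obtain \<phi> where \<phi>: "\<And>k. Z k = (\<lambda>x. (\<phi> k x, gradient (\<phi> k) x))" "\<And>k. smooth (\<phi> k)"
      "\<And>k x. x \<in> \<Gamma> \<Longrightarrow> \<phi> k x = 0"
    by metis
  show ?thesis
    unfolding trace_zero_on_iff[OF assms(1)] using Z(2) \<phi> by (intro exI[of _ \<phi>]) simp
qed

text \<open>By density in the definition of a zero trace, only smooth test functions matter, and any
  weak divergence \<open>q\<close> may stand for \<open>wdiv\<close>.\<close>

lemma H0div_iff:
  assumes "weak_div v q"
  shows "v \<in> H0div \<Omega> \<Gamma> \<longleftrightarrow> (\<forall>\<phi>. smooth \<phi> \<longrightarrow> (\<forall>x\<in>frontier \<Omega> - \<Gamma>. \<phi> x = 0) \<longrightarrow>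
    pair_ip q v \<phi> (gradient \<phi>) = 0)" (is "_ \<longleftrightarrow> ?R")
proof
  assume v: "v \<in> H0div \<Omega> \<Gamma>"
  show ?R
  proof (intro allI impI)
    fix \<phi> assume \<phi>: "smooth \<phi>" "\<forall>x\<in>frontier \<Omega> - \<Gamma>. \<phi> x = 0"
    then have "normal_trace \<Omega> v \<phi> = 0"
      using v trace_zero_on_smooth[of \<phi> "frontier \<Omega> - \<Gamma>"] weak_grad_imp_H1[OF weak_grad_smooth]
      by (auto simp: H0div_def normal_trace_zero_on_def)
    then show "pair_ip q v \<phi> (gradient \<phi>) = 0"
      using normal_trace_eq[OF assms weak_grad_smooth[OF \<phi>(1)]] by simp
  qed
next
  assume R: ?R
  have "normal_trace \<Omega> v z = 0" if z: "z \<in> H1 \<Omega>" "trace_zero_on \<Omega> (frontier \<Omega> - \<Gamma>) z" for z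
    unfolding normal_trace_eq[OF assms weak_grad_wgrad[OF z(1)]]
    using R by (intro trace_zero_on_annihilator[OF weak_grad_wgrad[OF z(1)] z(2) weak_divD(2,1)[OF assms]]) auto
  then show "v \<in> H0div \<Omega> \<Gamma>"
    using weak_div_imp_Hdiv[OF assms] by (simp add: H0div_def normal_trace_zero_on_def)
qed

text \<open>Green's formula without boundary term: the normal trace of \<open>v\<close> vanishes on
  \<open>\<Gamma>\<close> and \<open>z\<close> vanishes on a set containing the rest of the
  frontier.\<close>

lemma H0div_annihilates:
  assumes "weak_div v q" "v \<in> H0div \<Omega> \<Gamma>" "weak_grad z g" "trace_zero_on \<Omega> \<Delta> z" "frontier \<Omega> - \<Gamma> \<subseteq> \<Delta>"
  shows "pair_ip q v z g = 0"
proof (rule trace_zero_on_annihilator[OF assms(3,4) weak_divD(2,1)[OF assms(1)]])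
  fix \<phi> assume "smooth \<phi>" "\<And>x. x \<in> \<Delta> \<Longrightarrow> \<phi> x = (0::real)"
  then show "pair_ip q v \<phi> (gradient \<phi>) = 0"
    using assms(2,5) unfolding H0div_iff[OF assms(1)] by blast
qed

text \<open>The fundamental lemma says that only the zero class annihilates all test functions, so
  the projection theorem gives density.\<close>

lemma test_fun_dense:
  assumes "u \<in> sqint M"
  obtains \<phi> where "\<And>k::nat. test_fun \<Omega> (\<phi> k)"
    "(\<lambda>k. ip M (\<lambda>x. u x - \<phi> k x) (\<lambda>x. u x - \<phi> k x)) \<longlonglongrightarrow> (0::real)"
proof (rule sqint_approximation[of "Collect (test_fun \<Omega>)" M u])
  show "Collect (test_fun \<Omega>) \<subseteq> sqint M" by auto
  fix f g :: "real^'n \<Rightarrow> real" and a b :: real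
  assume "f \<in> Collect (test_fun \<Omega>)" "g \<in> Collect (test_fun \<Omega>)"
  then have "test_fun \<Omega> (\<lambda>x. a * f x)" "test_fun \<Omega> (\<lambda>x. b * g x)" by auto
  then show "(\<lambda>x. a *\<^sub>R f x + b *\<^sub>R g x) \<in> Collect (test_fun \<Omega>)" by auto
next
  fix W :: "real^'n \<Rightarrow> real" assume W: "W \<in> sqint M" "\<And>Z. Z \<in> Collect (test_fun \<Omega>) \<Longrightarrow> ip M W Z = 0"
  have "AE x in M. W x = 0"
    using W by (intro sqint_eq_0_AE) (auto simp: ip_def mult.commute)
  then have "ip M W u = ip M (\<lambda>_. 0) u"
    using W(1) assms by (intro ip_cong_AE) auto
  then show "ip M W u = 0" by (simp add: ip_def)
qed (use assms in auto)

end

section \<open>Flat boundary points and exceptional sets of codimension two\<close>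

text \<open>Orthonormal normals make the sum of the squares of \<open>a \<bullet> x - s\<close> and
  \<open>b \<bullet> x - t\<close> the squared distance to the set, and let translates in the two
  directions be counted independently.\<close>

definition codim2 :: "(real^'n) set \<Rightarrow> bool" where
  "codim2 A \<longleftrightarrow> (\<exists>a b s t. norm a = 1 \<and> norm b = 1 \<and> a \<bullet> b = 0 \<and> A = {x. a \<bullet> x = s \<and> b \<bullet> x = t})"

lemma codim2I:
  assumes "a \<noteq> 0" "b \<noteq> 0" "a \<bullet> b = 0"
  shows "codim2 {x. a \<bullet> x = s \<and> b \<bullet> x = t}"
  unfolding codim2_def
proof (intro exI conjI)
  show "norm (a /\<^sub>R norm a) = 1" "norm (b /\<^sub>R norm b) = 1" using assms by auto
  show "(a /\<^sub>R norm a) \<bullet> (b /\<^sub>R norm b) = 0" using assms by simp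
  show "{x. a \<bullet> x = s \<and> b \<bullet> x = t} =
      {x. (a /\<^sub>R norm a) \<bullet> x = s / norm a \<and> (b /\<^sub>R norm b) \<bullet> x = t / norm b}"
    using assms by (auto simp: field_simps)
qed

text \<open>Gram-Schmidt: if the part of \<open>n\<close> orthogonal to \<open>m\<close> is nonzero,
  it is a second normal of the intersection; if it is zero, the hyperplanes are parallel.\<close>

lemma hyperplane_inter_cases:
  fixes m n :: "real^'n"
  assumes "norm m = 1" "norm n = 1"
  shows "codim2 ({x. m \<bullet> x = s} \<inter> {x. n \<bullet> x = t}) \<or> {x. m \<bullet> x = s} \<inter> {x. n \<bullet> x = t} = {} \<or>
    {x. m \<bullet> x = s} = {x. n \<bullet> x = t}"
proof (cases "n - (m \<bullet> n) *\<^sub>R m = 0")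
  case False
  have "{x. m \<bullet> x = s} \<inter> {x. n \<bullet> x = t} =
      {x. m \<bullet> x = s \<and> (n - (m \<bullet> n) *\<^sub>R m) \<bullet> x = t - (m \<bullet> n) * s}"
    by (auto simp: inner_diff_left)
  moreover have "codim2 \<dots>"
  proof (rule codim2I)
    have "m \<bullet> m = 1" using assms by (simp add: dot_square_norm)
    then show "m \<bullet> (n - (m \<bullet> n) *\<^sub>R m) = 0" by (simp add: inner_diff_right)
  qed (use False assms in auto)
  ultimately show ?thesis by simp
next
  case True
  define c where "c = m \<bullet> n"
  have n: "n = c *\<^sub>R m" using True by (simp add: c_def)
  have "\<bar>c\<bar> = 1" using assms unfolding n by simp
  then have "c \<noteq> 0" by auto
  show ?thesis
  proof (cases "t = c * s")
    case True
    then have "{x. m \<bullet> x = s} = {x. n \<bullet> x = t}" using \<open>c \<noteq> 0\<close> by (auto simp: n)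
    then show ?thesis by blast
  next
    case False
    then have "{x. m \<bullet> x = s} \<inter> {x. n \<bullet> x = t} = {}" by (auto simp: n)
    then show ?thesis by blast
  qed
qed

text \<open>A facet is its affine hull cut by finitely many half-spaces whose normals may be chosen
  parallel to the hull. The bounding hyperplanes then meet the hull in sets of codimension two, and
  off these sets all the inequalities are strict, hence hold in a whole ball.\<close>

lemma facet_flat_points:
  fixes P :: "(real^'n) set"
  assumes "polytope P" "aff_dim P = int CARD('n) - 1"
  shows "\<exists>n s \<B>. norm n = 1 \<and> P \<subseteq> {x. n \<bullet> x = s} \<and> finite \<B> \<and> (\<forall>B\<in>\<B>. codim2 B) \<and>
    (\<forall>x\<in>P - \<Union>\<B>. \<exists>r>0. P \<inter> ball x r = {y. n \<bullet> y = s} \<inter> ball x r)"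
proof -
  obtain m c where m: "m \<noteq> 0" "affine hull P = {x. m \<bullet> x = c}"
    using assms(2) aff_dim_eq_hyperplane[of P] by auto
  define n s where "n = m /\<^sub>R norm m" and "s = c / norm m"
  have n: "norm n = 1" "affine hull P = {x. n \<bullet> x = s}"
    using m by (auto simp: n_def s_def field_simps)
  have "polyhedron P" using assms(1) by (rule polytope_imp_polyhedron)
  then obtain F where F: "finite F" "P = affine hull P \<inter> \<Inter>F"
    "\<And>h. h \<in> F \<Longrightarrow> \<exists>a b. a \<noteq> 0 \<and> h = {x. a \<bullet> x \<le> b} \<and> (\<forall>x\<in>affine hull P. (x + a) \<in> affine hull P)"
    unfolding polyhedron_Int_affine_parallel by (elim exE conjE) (rule that, assumption+, blast)
  then obtain a b where ab: "\<And>h. h \<in> F \<Longrightarrow> a h \<noteq> 0 \<and> h = {x. a h \<bullet> x \<le> b h} \<and>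
      (\<forall>x\<in>affine hull P. (x + a h) \<in> affine hull P)"
    by metis
  define \<B> where "\<B> = (\<lambda>h. {x. n \<bullet> x = s \<and> a h \<bullet> x = b h}) ` F"
  have sub: "P \<subseteq> {x. n \<bullet> x = s}" using hull_subset[of P affine] n(2) by simp
  have "affine hull P \<noteq> {}"
  proof -
    have "n \<bullet> (s *\<^sub>R n) = s" using n(1) by (simp add: dot_square_norm)
    then show ?thesis using n(2) by blast
  qed
  then obtain y where y: "n \<bullet> y = s" using n(2) by blast
  show ?thesis
  proof (intro exI[of _ n] exI[of _ s] exI[of _ \<B>] conjI)
    show "finite \<B>" using F(1) by (simp add: \<B>_def)
    show "\<forall>B\<in>\<B>. codim2 B"
    proof
      fix B assume "B \<in> \<B>"
      then obtain h where h: "h \<in> F" "B = {x. n \<bullet> x = s \<and> a h \<bullet> x = b h}" by (auto simp: \<B>_def)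
      have "n \<bullet> (y + a h) = s" using ab[OF h(1)] y n(2) by blast
      \<comment> \<open>Adding \<open>a h\<close> does not leave the hull, so \<open>a h\<close> is
        tangential to it.\<close>
      then have "n \<bullet> a h = 0" using y by (simp add: inner_add_right)
      moreover have "n \<noteq> 0" using n(1) by auto
      ultimately show "codim2 B" unfolding h(2) using ab[OF h(1)] by (intro codim2I) auto
    qed
    show "\<forall>x\<in>P - \<Union>\<B>. \<exists>r>0. P \<inter> ball x r = {y. n \<bullet> y = s} \<inter> ball x r"
    proof
      fix x assume x: "x \<in> P - \<Union>\<B>"
      have xs: "n \<bullet> x = s" using x sub by auto
      have "a h \<bullet> x < b h" if "h \<in> F" for h
      proof -
        have "x \<in> h" using x F(2) that by auto
        then have "a h \<bullet> x \<le> b h" using ab[OF that] by auto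
        moreover have "a h \<bullet> x \<noteq> b h" using x xs that by (auto simp: \<B>_def)
        ultimately show ?thesis by simp
      qed
      then have "x \<in> (\<Inter>h\<in>F. {y. a h \<bullet> y < b h})" by blast
      moreover have "open (\<Inter>h\<in>F. {y. a h \<bullet> y < b h})"
        using F(1) by (intro open_INT) (auto intro: open_halfspace_lt)
      ultimately obtain r where r: "r > 0" "ball x r \<subseteq> (\<Inter>h\<in>F. {y. a h \<bullet> y < b h})"
        by (meson open_contains_ball)
      have "ball x r \<subseteq> \<Inter>F"
      proof
        fix y assume y: "y \<in> ball x r"
        have "y \<in> h" if "h \<in> F" for h
        proof -
          have "a h \<bullet> y < b h" using r(2) y that by blast
          then show ?thesis using ab[OF that] by (metis less_imp_le mem_Collect_eq)
        qed
        then show "y \<in> \<Inter>F" by blast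
      qed
      then have "P \<inter> ball x r = {y. n \<bullet> y = s} \<inter> ball x r"
        using F(2) n(2) by blast
      then show "\<exists>r>0. P \<inter> ball x r = {y. n \<bullet> y = s} \<inter> ball x r" using r(1) by blast
    qed
  qed (use n sub in auto)
qed

text \<open>Besides the exceptional sets of the single facets, the codimension-two intersections of
  facet hyperplanes are removed. All facets through a remaining point then lie in one hyperplane,
  and closed facets not containing it are avoided by a small ball.\<close>

lemma facets_flat_points:
  fixes \<P> :: "(real^'n) set set"
  assumes fin: "finite \<P>" and P: "\<And>P. P \<in> \<P> \<Longrightarrow> polytope P \<and> aff_dim P = int CARD('n) - 1"
  shows "\<exists>\<A>. finite \<A> \<and> (\<forall>A\<in>\<A>. codim2 A) \<and>
    (\<forall>x\<in>\<Union>\<P> - \<Union>\<A>. \<exists>n s r. r > 0 \<and> norm n = 1 \<and> n \<bullet> x = s \<and>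
      (\<forall>P\<in>\<P>. P \<inter> ball x r = {} \<or> P \<inter> ball x r = {y. n \<bullet> y = s} \<inter> ball x r))"
proof -
  define G where "G P n s \<B> \<longleftrightarrow> norm n = 1 \<and> P \<subseteq> {x. n \<bullet> x = s} \<and> finite \<B> \<and> (\<forall>B\<in>\<B>. codim2 B) \<and>
    (\<forall>x\<in>P - \<Union>\<B>. \<exists>r>0. P \<inter> ball x r = {y. n \<bullet> y = s} \<inter> ball x r)"
    for P :: "(real^'n) set" and n s \<B>
  have "\<forall>P\<in>\<P>. \<exists>n s \<B>. G P n s \<B>"
    unfolding G_def by (intro ballI facet_flat_points) (use P in auto)
  then obtain n s \<B> where G: "\<And>P. P \<in> \<P> \<Longrightarrow> G P (n P) (s P) (\<B> P)" by metis
  then have n: "\<And>P. P \<in> \<P> \<Longrightarrow> norm (n P) = 1"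
    and sub: "\<And>P. P \<in> \<P> \<Longrightarrow> P \<subseteq> {x. n P \<bullet> x = s P}"
    and B: "\<And>P. P \<in> \<P> \<Longrightarrow> finite (\<B> P)" "\<And>P B. P \<in> \<P> \<Longrightarrow> B \<in> \<B> P \<Longrightarrow> codim2 B"
    and flat: "\<And>P x. P \<in> \<P> \<Longrightarrow> x \<in> P - \<Union>(\<B> P) \<Longrightarrow> \<exists>r>0. P \<inter> ball x r = {y. n P \<bullet> y = s P} \<inter> ball x r"
    using G unfolding G_def by blast+
  let ?H = "\<lambda>P. {x. n P \<bullet> x = s P}"
  define \<A> where "\<A> = \<Union>(\<B> ` \<P>) \<union> {A \<in> (\<lambda>(P, Q). ?H P \<inter> ?H Q) ` (\<P> \<times> \<P>). codim2 A}"
  have "finite \<A>" using fin B by (auto simp: \<A>_def)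
  moreover have "\<forall>A\<in>\<A>. codim2 A" using B by (auto simp: \<A>_def)
  moreover have "\<exists>n s r. r > 0 \<and> norm n = 1 \<and> n \<bullet> x = s \<and>
      (\<forall>P\<in>\<P>. P \<inter> ball x r = {} \<or> P \<inter> ball x r = {y. n \<bullet> y = s} \<inter> ball x r)"
    if x: "x \<in> \<Union>\<P> - \<Union>\<A>" for x
  proof -
    obtain Q where Q: "Q \<in> \<P>" "x \<in> Q" using x by blast
    have "\<exists>r>0. P \<inter> ball x r = {} \<or> P \<inter> ball x r = ?H Q \<inter> ball x r" if PP: "P \<in> \<P>" for P
    proof (cases "x \<in> P")
      case False
      have "open (- P)" using P[OF PP] polytope_imp_closed by blast
      then obtain r where "r > 0" "ball x r \<subseteq> - P" using False by (auto simp: open_contains_ball)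
      then show ?thesis by blast
    next
      case True
      have xH: "x \<in> ?H P \<inter> ?H Q" using True Q sub PP by blast
      have "x \<notin> \<Union>(\<B> P)" using x PP by (auto simp: \<A>_def)
      then obtain r where r: "r > 0" "P \<inter> ball x r = ?H P \<inter> ball x r"
        using flat[OF PP] True by blast
      have "\<not> codim2 (?H P \<inter> ?H Q)"
      proof
        assume "codim2 (?H P \<inter> ?H Q)"
        then have "?H P \<inter> ?H Q \<in> \<A>" using PP Q(1) by (auto simp: \<A>_def)
        then show False using x xH by blast
      qed
      then have "?H P = ?H Q"
        using hyperplane_inter_cases[OF n[OF PP] n[OF Q(1)], of "s P" "s Q"] xH by blast
      then show ?thesis using r by blast
    qed
    then obtain r where r: "\<And>P. P \<in> \<P> \<Longrightarrow> r P > 0"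
      "\<And>P. P \<in> \<P> \<Longrightarrow> P \<inter> ball x (r P) = {} \<or> P \<inter> ball x (r P) = ?H Q \<inter> ball x (r P)"
      by metis
    define d where "d = Min (r ` \<P>)"
    have d: "d > 0" "\<And>P. P \<in> \<P> \<Longrightarrow> d \<le> r P"
    proof -
      have "Min (r ` \<P>) \<in> r ` \<P>" using fin Q(1) by (intro Min_in) auto
      then show "d > 0" using r(1) unfolding d_def by auto
    qed (use fin in \<open>simp add: d_def\<close>)
    have "P \<inter> ball x d = {} \<or> P \<inter> ball x d = ?H Q \<inter> ball x d" if "P \<in> \<P>" for P
    proof -
      have "ball x d \<subseteq> ball x (r P)" using d(2)[OF that] by (rule subset_ball)
      then show ?thesis using r(2)[OF that] by blast
    qed
    moreover have "n Q \<bullet> x = s Q" using sub[OF Q(1)] Q(2) by blast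
    ultimately show ?thesis
      using d(1) n[OF Q(1)] by (intro exI[of _ "n Q"] exI[of _ "s Q"] exI[of _ d]) simp
  qed
  ultimately show ?thesis by (intro exI[of _ \<A>]) simp
qed

section \<open>Local shape of the boundary: half balls at flat points\<close>

definition flat_point :: "(real^'n) set \<Rightarrow> real^'n \<Rightarrow> real^'n \<Rightarrow> real \<Rightarrow> bool" where
  "flat_point \<Omega> x n r \<longleftrightarrow> r > 0 \<and> norm n = 1 \<and>
     \<Omega> \<inter> ball x r = {y \<in> ball x r. (y - x) \<bullet> n < 0} \<and>
     frontier \<Omega> \<inter> ball x r = {y \<in> ball x r. (y - x) \<bullet> n = 0}"

text \<open>Frontier points must lie on the graph: strictly below it they would belong to the open
  domain, and strictly above it they have a neighbourhood that misses the domain.\<close>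

lemma lipschitz_boundary_chart:
  assumes "lipschitz_boundary \<Omega>" "open \<Omega>" "x \<in> frontier \<Omega>"
  obtains U e g L where "open U" "x \<in> U" "norm e = 1" "L-lipschitz_on UNIV g"
    "\<Omega> \<inter> U = {y \<in> U. y \<bullet> e < g (y - (y \<bullet> e) *\<^sub>R e)}"
    "\<And>y. y \<in> frontier \<Omega> \<inter> U \<Longrightarrow> y \<bullet> e = g (y - (y \<bullet> e) *\<^sub>R e)"
proof -
  obtain U e g L where U: "open U" "x \<in> U" "norm e = 1" "L-lipschitz_on UNIV g"
    "\<Omega> \<inter> U = {y \<in> U. y \<bullet> e < g (y - (y \<bullet> e) *\<^sub>R e)}"
    using bspec[OF assms(1)[unfolded lipschitz_boundary_def] assms(3)]
    by (elim exE conjE) (rule that)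
  have "continuous_on UNIV g" using U(4) by (rule lipschitz_on_continuous_on)
  then have cont: "continuous_on UNIV (\<lambda>y. g (y - (y \<bullet> e) *\<^sub>R e))"
    by (rule continuous_on_compose2) (auto intro!: continuous_intros)
  have "y \<bullet> e = g (y - (y \<bullet> e) *\<^sub>R e)" if y: "y \<in> frontier \<Omega> \<inter> U" for y
  proof (rule antisym)
    have "y \<notin> \<Omega>" using y assms(2) by (auto simp: frontier_def interior_open)
    then show "g (y - (y \<bullet> e) *\<^sub>R e) \<le> y \<bullet> e" using U(5) y by force
    show "y \<bullet> e \<le> g (y - (y \<bullet> e) *\<^sub>R e)"
    proof (rule ccontr)
      assume a: "\<not> ?thesis"
      have "open ({z. g (z - (z \<bullet> e) *\<^sub>R e) < z \<bullet> e} \<inter> U)"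
        using U(1) by (intro open_Int open_Collect_less cont) (auto intro!: continuous_intros)
      moreover have "y \<in> {z. g (z - (z \<bullet> e) *\<^sub>R e) < z \<bullet> e} \<inter> U" using a y by auto
      moreover have "y \<in> closure \<Omega>" using y by (auto simp: frontier_def)
      ultimately have "\<Omega> \<inter> ({z. g (z - (z \<bullet> e) *\<^sub>R e) < z \<bullet> e} \<inter> U) \<noteq> {}"
        using open_Int_closure_eq_empty by blast
      then obtain z where z: "z \<in> \<Omega> \<inter> U" "g (z - (z \<bullet> e) *\<^sub>R e) < z \<bullet> e" by blast
      then show False unfolding U(5) by simp
    qed
  qed
  with U show thesis by (rule that)
qed

lemma proj_shift: "norm e = 1 \<Longrightarrow> (y + t *\<^sub>R e) - ((y + t *\<^sub>R e) \<bullet> e) *\<^sub>R e = y - (y \<bullet> e) *\<^sub>R e"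
  by (simp add: inner_add_left dot_square_norm algebra_simps)

lemma small_segment:
  fixes x e :: "'a::real_normed_vector"
  assumes "open U" "x \<in> U"
  obtains t where "t > 0" "\<And>h. \<bar>h\<bar> \<le> t \<Longrightarrow> x + h *\<^sub>R e \<in> U"
proof -
  obtain d where d: "d > 0" "ball x d \<subseteq> U" using assms open_contains_ball by blast
  show thesis
  proof (rule that[of "d / (2 * (norm e + 1))"])
    show "d / (2 * (norm e + 1)) > 0" using d(1) by (simp add: add_nonneg_pos)
    fix h assume h: "\<bar>h\<bar> \<le> d / (2 * (norm e + 1))"
    have pos: "2 * (norm e + 1) > 0" by (simp add: add_nonneg_pos)
    have "\<bar>h\<bar> * (2 * (norm e + 1)) \<le> d" using h pos by (simp add: field_simps)
    then have "2 * (\<bar>h\<bar> * norm e) \<le> d" using abs_ge_zero[of h] by (simp add: algebra_simps)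
    then have "\<bar>h\<bar> * norm e < d" using d(1) by linarith
    then have "x + h *\<^sub>R e \<in> ball x d" by (simp add: dist_norm)
    then show "x + h *\<^sub>R e \<in> U" using d(2) by blast
  qed
qed

text \<open>The disk cuts the ball into two convex halves. Neither contains a frontier point, so
  each lies inside the domain or misses it. Since the centre is a frontier point, some half lies
  inside; the chart excludes that both do, as they would along a crack.\<close>

lemma flat_pointI:
  fixes \<Omega> :: "(real^'n) set"
  assumes \<Omega>: "lipschitz_boundary \<Omega>" "open \<Omega>" and x: "x \<in> frontier \<Omega>" and r: "r > 0"
    and n: "norm n = 1" "n \<bullet> x = s"
    and fr: "frontier \<Omega> \<inter> ball x r = {y. n \<bullet> y = s} \<inter> ball x r"
  shows "\<exists>m. flat_point \<Omega> x m r"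
proof -
  have fr': "y \<in> frontier \<Omega> \<longleftrightarrow> (y - x) \<bullet> n = 0" if "y \<in> ball x r" for y
  proof -
    have "y \<in> frontier \<Omega> \<longleftrightarrow> n \<bullet> y = s" using fr that by blast
    then show ?thesis using n(2) by (simp add: inner_diff_right inner_commute[of _ n])
  qed
  have disj: "\<Omega> \<inter> frontier \<Omega> = {}" using \<Omega>(2) by (auto simp: frontier_def interior_open)
  define B where "B \<sigma> = {y. \<sigma> * ((y - x) \<bullet> n) < 0} \<inter> ball x r" for \<sigma> :: real
  have Beq: "B \<sigma> = {y. (\<sigma> *\<^sub>R n) \<bullet> y < \<sigma> * (n \<bullet> x)} \<inter> ball x r" for \<sigma>
    by (auto simp: B_def inner_diff_left inner_commute[of n] algebra_simps)
  have conn: "connected (B \<sigma>)" for \<sigma>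
    unfolding Beq by (intro convex_connected convex_Int convex_halfspace_lt convex_ball)
  have dich: "B \<sigma> \<subseteq> \<Omega> \<or> B \<sigma> \<inter> \<Omega> = {}" for \<sigma>
  proof (rule ccontr)
    assume "\<not> ?thesis"
    then have "B \<sigma> \<inter> frontier \<Omega> \<noteq> {}"
      using connected_Int_frontier[OF conn, of \<sigma> \<Omega>] by blast
    then obtain y where "y \<in> B \<sigma>" "y \<in> frontier \<Omega>" by blast
    then show False using fr'[of y] by (auto simp: B_def)
  qed
  have cover: "\<Omega> \<inter> ball x r \<subseteq> B 1 \<union> B (-1)"
  proof
    fix y assume y: "y \<in> \<Omega> \<inter> ball x r"
    then have "(y - x) \<bullet> n \<noteq> 0" using fr'[of y] disj by blast
    then show "y \<in> B 1 \<union> B (-1)" using y by (auto simp: B_def)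
  qed
  have ne: "\<Omega> \<inter> ball x r \<noteq> {}"
  proof -
    have "x \<in> closure \<Omega>" using x by (auto simp: frontier_def)
    then show ?thesis
      using open_Int_closure_eq_empty[of "ball x r" \<Omega>] r by (auto simp: Int_commute)
  qed
  \<comment> \<open>If both halves were inside, the point \<open>x + t *\<^sub>R e\<close> above the
    graph could only lie on the disk, so \<open>e\<close> would be tangential. Then
    \<open>x + (- t) *\<^sub>R e\<close> would lie on the disk too, hence in the frontier, although
    the chart puts it into the domain.\<close>
  have notboth: "\<not> (B 1 \<subseteq> \<Omega> \<and> B (-1) \<subseteq> \<Omega>)"
  proof
    assume both: "B 1 \<subseteq> \<Omega> \<and> B (-1) \<subseteq> \<Omega>"
    obtain U e g L where U: "open U" "x \<in> U" "norm e = 1"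
      "\<Omega> \<inter> U = {y \<in> U. y \<bullet> e < g (y - (y \<bullet> e) *\<^sub>R e)}"
      "\<And>y. y \<in> frontier \<Omega> \<inter> U \<Longrightarrow> y \<bullet> e = g (y - (y \<bullet> e) *\<^sub>R e)"
      using \<Omega> x by (rule lipschitz_boundary_chart) (rule that)
    obtain t where t: "t > 0" "\<And>h. \<bar>h\<bar> \<le> t \<Longrightarrow> x + h *\<^sub>R e \<in> U \<inter> ball x r"
      by (rule small_segment[of "U \<inter> ball x r" x]) (use U r in auto)
    have xe: "x \<bullet> e = g (x - (x \<bullet> e) *\<^sub>R e)" using U(5) x U(2) by blast
    have val: "(x + h *\<^sub>R e) \<bullet> e = x \<bullet> e + h" for h
      using U(3) by (simp add: inner_add_left dot_square_norm)
    have in_iff: "x + h *\<^sub>R e \<in> \<Omega> \<longleftrightarrow> h < 0" if "\<bar>h\<bar> \<le> t" for h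
    proof -
      have "x + h *\<^sub>R e \<in> U" using t(2)[OF that] by blast
      then have "x + h *\<^sub>R e \<in> \<Omega> \<longleftrightarrow> x + h *\<^sub>R e \<in> {y \<in> U. y \<bullet> e < g (y - (y \<bullet> e) *\<^sub>R e)}"
        using U(4) by blast
      also have "\<dots> \<longleftrightarrow> x \<bullet> e + h < x \<bullet> e"
        using \<open>x + h *\<^sub>R e \<in> U\<close> unfolding mem_Collect_eq proj_shift[OF U(3)] unfolding val using xe by simp
      finally show ?thesis by simp
    qed
    have out: "x + t *\<^sub>R e \<notin> \<Omega>" using in_iff[of t] t(1) by simp
    have bt: "x + t *\<^sub>R e \<in> ball x r" "x + (- t) *\<^sub>R e \<in> ball x r" using t(1) t(2)[of t] t(2)[of "-t"] by auto
    have "(x + t *\<^sub>R e - x) \<bullet> n = 0"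
    proof (rule ccontr)
      assume "(x + t *\<^sub>R e - x) \<bullet> n \<noteq> 0"
      then have "1 * ((x + t *\<^sub>R e - x) \<bullet> n) < 0 \<or> (-1) * ((x + t *\<^sub>R e - x) \<bullet> n) < 0" by linarith
      then have "x + t *\<^sub>R e \<in> B 1 \<union> B (-1)" using bt(1) unfolding B_def by blast
      then show False using both out by blast
    qed
    then have "e \<bullet> n = 0" using t(1) by simp
    then have "x + (- t) *\<^sub>R e \<in> frontier \<Omega>" using fr'[OF bt(2)] by simp
    moreover have "x + (- t) *\<^sub>R e \<in> \<Omega>" using in_iff[of "- t"] t(1) by simp
    ultimately show False using disj by blast
  qed
  have "\<exists>\<sigma>. \<bar>\<sigma>\<bar> = 1 \<and> B \<sigma> = \<Omega> \<inter> ball x r"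
  proof (cases "B 1 \<subseteq> \<Omega>")
    case True
    moreover have "B (-1) \<inter> \<Omega> = {}" using True notboth dich[of "-1"] by blast
    moreover have "B 1 \<subseteq> ball x r" unfolding B_def by blast
    ultimately have "B 1 = \<Omega> \<inter> ball x r" using cover by blast
    then show ?thesis by (metis abs_one)
  next
    case False
    then have "B (-1) \<subseteq> \<Omega>" using dich[of 1] dich[of "-1"] cover ne by blast
    moreover have "B 1 \<inter> \<Omega> = {}" using False dich[of 1] by blast
    moreover have "B (-1) \<subseteq> ball x r" unfolding B_def by blast
    ultimately have "B (-1) = \<Omega> \<inter> ball x r" using cover by blast
    then show ?thesis by (metis abs_minus_cancel abs_one)
  qed
  then obtain \<sigma> where \<sigma>: "\<bar>\<sigma>\<bar> = 1" "B \<sigma> = \<Omega> \<inter> ball x r" by blast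
  have "flat_point \<Omega> x (\<sigma> *\<^sub>R n) r"
    unfolding flat_point_def
  proof (intro conjI)
    show "\<Omega> \<inter> ball x r = {y \<in> ball x r. (y - x) \<bullet> (\<sigma> *\<^sub>R n) < 0}"
      unfolding \<sigma>(2)[symmetric] B_def by auto
    have "\<sigma> \<noteq> 0" using \<sigma>(1) by auto
    then show "frontier \<Omega> \<inter> ball x r = {y \<in> ball x r. (y - x) \<bullet> (\<sigma> *\<^sub>R n) = 0}"
      using fr' by auto
  qed (use \<sigma> n r in auto)
  then show ?thesis by blast
qed

definition regular_point :: "(real^'n) set \<Rightarrow> (real^'n) set set \<Rightarrow> real^'n \<Rightarrow> real^'n \<Rightarrow> real \<Rightarrow> bool" where
  "regular_point \<Omega> \<G> x n r \<longleftrightarrow> flat_point \<Omega> x n r \<and>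
     (\<forall>\<Gamma>\<in>\<G>. \<Gamma> \<inter> ball x r = {} \<or> \<Gamma> \<inter> ball x r = frontier \<Omega> \<inter> ball x r)"

text \<open>In a small ball every facet is empty or the full disk, hence so is every segment. The
  frontier itself is then the disk, which makes the point flat.\<close>

theorem regular_points:
  fixes \<Omega> :: "(real^'n) set"
  assumes \<Omega>: "lipschitz_boundary \<Omega>" "open \<Omega>"
    and \<G>: "finite \<G>" "\<And>\<Gamma>. \<Gamma> \<in> \<G> \<Longrightarrow> boundary_segment \<Omega> \<Gamma>" "frontier \<Omega> = \<Union>\<G>"
  shows "\<exists>\<A>. finite \<A> \<and> (\<forall>A\<in>\<A>. codim2 A) \<and>
    (\<forall>x\<in>frontier \<Omega> - \<Union>\<A>. \<exists>n r. regular_point \<Omega> \<G> x n r)"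
proof -
  have "\<forall>\<Gamma>\<in>\<G>. \<exists>\<P>. finite \<P> \<and> (\<forall>P\<in>\<P>. polytope P \<and> aff_dim P = int CARD('n) - 1) \<and> \<Gamma> = \<Union>\<P>"
    using \<G>(2) by (auto simp: boundary_segment_def)
  then obtain \<P> where \<P>: "\<And>\<Gamma>. \<Gamma> \<in> \<G> \<Longrightarrow> finite (\<P> \<Gamma>)"
    "\<And>\<Gamma> P. \<Gamma> \<in> \<G> \<Longrightarrow> P \<in> \<P> \<Gamma> \<Longrightarrow> polytope P \<and> aff_dim P = int CARD('n) - 1"
    "\<And>\<Gamma>. \<Gamma> \<in> \<G> \<Longrightarrow> \<Gamma> = \<Union>(\<P> \<Gamma>)" by metis
  let ?Q = "\<Union>(\<P> ` \<G>)"
  have fr: "frontier \<Omega> = \<Union>?Q" using \<G>(3) \<P>(3) by blast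
  have "finite ?Q" using \<G>(1) \<P>(1) by blast
  moreover have "polytope P \<and> aff_dim P = int CARD('n) - 1" if "P \<in> ?Q" for P
    using that \<P>(2) by blast
  ultimately have "\<exists>\<A>. finite \<A> \<and> (\<forall>A\<in>\<A>. codim2 A) \<and>
    (\<forall>x\<in>\<Union>?Q - \<Union>\<A>. \<exists>n s r. r > 0 \<and> norm n = 1 \<and> n \<bullet> x = s \<and>
      (\<forall>P\<in>?Q. P \<inter> ball x r = {} \<or> P \<inter> ball x r = {y. n \<bullet> y = s} \<inter> ball x r))"
    by (rule facets_flat_points)
  then obtain \<A> where \<A>: "finite \<A>" "\<forall>A\<in>\<A>. codim2 A"
    and reg: "\<forall>x\<in>\<Union>?Q - \<Union>\<A>. \<exists>n s r. r > 0 \<and> norm n = 1 \<and> n \<bullet> x = s \<and>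
      (\<forall>P\<in>?Q. P \<inter> ball x r = {} \<or> P \<inter> ball x r = {y. n \<bullet> y = s} \<inter> ball x r)"
    by (elim exE conjE) (rule that)
  have "\<exists>n r. regular_point \<Omega> \<G> x n r" if x: "x \<in> frontier \<Omega> - \<Union>\<A>" for x
  proof -
    obtain n s r where r: "r > 0" and n: "norm n = 1" "n \<bullet> x = s"
      and P: "\<And>P. P \<in> ?Q \<Longrightarrow> P \<inter> ball x r = {} \<or> P \<inter> ball x r = {y. n \<bullet> y = s} \<inter> ball x r"
    proof -
      have "x \<in> \<Union>?Q - \<Union>\<A>" using x fr by simp
      from bspec[OF reg this] show thesis by (elim exE conjE) (rule that, assumption+, blast)
    qed
    obtain P where "P \<in> ?Q" "x \<in> P" using x fr by blast
    then have "P \<inter> ball x r \<noteq> {}" using r by auto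
    then have "P \<inter> ball x r = {y. n \<bullet> y = s} \<inter> ball x r" using P[OF \<open>P \<in> ?Q\<close>] by blast
    then have H: "{y. n \<bullet> y = s} \<inter> ball x r \<subseteq> frontier \<Omega>" using \<open>P \<in> ?Q\<close> fr by blast
    have fb: "frontier \<Omega> \<inter> ball x r = {y. n \<bullet> y = s} \<inter> ball x r"
    proof
      show "frontier \<Omega> \<inter> ball x r \<subseteq> {y. n \<bullet> y = s} \<inter> ball x r"
      proof
        fix y assume y: "y \<in> frontier \<Omega> \<inter> ball x r"
        then obtain P where "P \<in> ?Q" "y \<in> P" using fr by blast
        then show "y \<in> {y. n \<bullet> y = s} \<inter> ball x r" using P[of P] y by blast
      qed
    qed (use H in blast)
    obtain m where m: "flat_point \<Omega> x m r"
      using flat_pointI[OF \<Omega> _ r n fb] x by blast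
    have "\<Gamma> \<inter> ball x r = {} \<or> \<Gamma> \<inter> ball x r = frontier \<Omega> \<inter> ball x r" if \<Gamma>: "\<Gamma> \<in> \<G>" for \<Gamma>
    proof (cases "\<Gamma> \<inter> ball x r = {}")
      case False
      then obtain y where y: "y \<in> \<Gamma>" "y \<in> ball x r" by blast
      then obtain P where PP: "P \<in> \<P> \<Gamma>" "y \<in> P" using \<P>(3)[OF \<Gamma>] by blast
      then have "P \<inter> ball x r = {y. n \<bullet> y = s} \<inter> ball x r" using P[of P] \<Gamma> y by blast
      then have "frontier \<Omega> \<inter> ball x r \<subseteq> \<Gamma> \<inter> ball x r" using fb PP(1) \<P>(3)[OF \<Gamma>] by blast
      moreover have "\<Gamma> \<subseteq> frontier \<Omega>" using \<G>(3) \<Gamma> by blast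
      ultimately show ?thesis by blast
    qed simp
    then show ?thesis using m unfolding regular_point_def by blast
  qed
  then show ?thesis using \<A> by blast
qed

section \<open>Removing exceptional sets\<close>

lemma codim2_negligible: "codim2 A \<Longrightarrow> negligible A"
proof -
  assume "codim2 A"
  then obtain a b s t where "norm a = 1" "A = {x. a \<bullet> x = s \<and> b \<bullet> x = t}"
    unfolding codim2_def by blast
  then have "A \<subseteq> {x. a \<bullet> x = s}" "a \<noteq> 0" by auto
  then show ?thesis using negligible_hyperplane[of a s] negligible_subset by blast
qed

lemma measurable_strip:
  "{y \<in> ball 0 R. \<bar>a \<bullet> y - s\<bar> \<le> d \<and> \<bar>b \<bullet> y - t\<bar> \<le> d} \<in> lmeasurable"
proof -
  have "closed {y. \<bar>a \<bullet> y - s\<bar> \<le> d \<and> \<bar>b \<bullet> y - t\<bar> \<le> d}"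
    by (intro closed_Collect_conj closed_Collect_le continuous_intros)
  then have "{y. \<bar>a \<bullet> y - s\<bar> \<le> d \<and> \<bar>b \<bullet> y - t\<bar> \<le> d} \<in> sets lebesgue" by simp
  then have "ball 0 R \<inter> {y. \<bar>a \<bullet> y - s\<bar> \<le> d \<and> \<bar>b \<bullet> y - t\<bar> \<le> d} \<in> lmeasurable"
    by (intro fmeasurable_Int_fmeasurable) auto
  moreover have "{y \<in> ball 0 R. \<bar>a \<bullet> y - s\<bar> \<le> d \<and> \<bar>b \<bullet> y - t\<bar> \<le> d} =
      ball 0 R \<inter> {y. \<bar>a \<bullet> y - s\<bar> \<le> d \<and> \<bar>b \<bullet> y - t\<bar> \<le> d}" by auto
  ultimately show ?thesis by simp
qed

text \<open>About \<open>d\<^sup>-\<^sup>2\<close> disjoint translates of the neighbourhood fit into one fixed ball.\<close>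

lemma measure_strip_le:
  fixes a b :: "real^'n"
  assumes a: "norm a = 1" and b: "norm b = 1" and ab: "a \<bullet> b = 0" and d: "0 < d" "d \<le> 1"
  shows "measure lebesgue {y \<in> ball 0 R. \<bar>a \<bullet> y - s\<bar> \<le> d \<and> \<bar>b \<bullet> y - t\<bar> \<le> d} \<le>
    measure lebesgue (ball (0::real^'n) (\<bar>R\<bar> + 12)) * d\<^sup>2" (is "measure lebesgue ?S \<le> ?V * _")
proof -
  \<comment> \<open>The choice ensures \<open>1 \<le> real m * d\<close> and
    \<open>real m * d \<le> 2\<close>. Hence there are at least \<open>1 / d\<close> translates in
    each direction, the spacing \<open>3 * d\<close> exceeds the strip width \<open>2 * d\<close>,
    and the total shift is at most 6 + 6 = 12.\<close>
  define m where "m = nat \<lceil>1 / d\<rceil>"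
  have m1: "1 / d \<le> real m" unfolding m_def by linarith
  have m2: "real m * d \<le> 2"
  proof -
    have "real m \<le> 1 / d + 1" unfolding m_def using d by (simp add: le_nat_iff)
    then have "real m * d \<le> (1 / d + 1) * d" using d by (intro mult_right_mono) auto
    then show ?thesis using d by (simp add: algebra_simps)
  qed
  define I where "I = {..<m} \<times> {..<m}"
  define p where "p ij = (3 * d * real (fst ij)) *\<^sub>R a + (3 * d * real (snd ij)) *\<^sub>R b" for ij :: "nat \<times> nat"
  have aa: "a \<bullet> a = 1" "b \<bullet> b = 1" using a b by (simp_all add: dot_square_norm)
  have ap: "a \<bullet> p ij = 3 * d * real (fst ij)" "b \<bullet> p ij = 3 * d * real (snd ij)" for ij
    using aa ab by (simp_all add: p_def inner_add_right inner_commute[of b a])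
  have sep: "i = j" if "\<bar>u - 3 * d * real i\<bar> \<le> d" "\<bar>u - 3 * d * real j\<bar> \<le> d" for u :: real and i j :: nat
  proof (rule ccontr)
    assume "i \<noteq> j"
    then have "1 \<le> \<bar>real i - real j\<bar>" by linarith
    then have "3 * d \<le> 3 * d * \<bar>real i - real j\<bar>" using d by simp
    also have "\<dots> = \<bar>3 * d * real i - 3 * d * real j\<bar>"
      using d by (simp add: abs_mult flip: right_diff_distrib)
    also have "\<dots> \<le> 2 * d" using that by linarith
    finally show False using d by simp
  qed
  have mS: "?S \<in> lmeasurable" by (rule measurable_strip)
  have mpS: "(+) (p ij) ` ?S \<in> lmeasurable" for ij
    using mS by (rule measurable_translation)
  have disj: "disjoint_family_on (\<lambda>ij. (+) (p ij) ` ?S) I"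
    unfolding disjoint_family_on_def
  proof (intro ballI impI)
    fix k l assume kl: "k \<in> I" "l \<in> I" "k \<noteq> l"
    show "(+) (p k) ` ?S \<inter> (+) (p l) ` ?S = {}"
    proof (rule ccontr)
      assume "\<not> ?thesis"
      then obtain y z where yz: "y \<in> ?S" "z \<in> ?S" "p k + y = p l + z" by blast
      have "a \<bullet> (p k + y) = a \<bullet> (p l + z)" "b \<bullet> (p k + y) = b \<bullet> (p l + z)" using yz(3) by auto
      then have e: "3 * d * real (fst k) + a \<bullet> y = 3 * d * real (fst l) + a \<bullet> z"
        "3 * d * real (snd k) + b \<bullet> y = 3 * d * real (snd l) + b \<bullet> z"
        by (simp_all add: inner_add_right ap)
      have "fst k = fst l"
      proof (rule sep)
        show "\<bar>(3 * d * real (fst k) + a \<bullet> y - s) - 3 * d * real (fst k)\<bar> \<le> d" using yz(1) by simp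
        show "\<bar>(3 * d * real (fst k) + a \<bullet> y - s) - 3 * d * real (fst l)\<bar> \<le> d" using yz(2) e by simp
      qed
      moreover have "snd k = snd l"
      proof (rule sep)
        show "\<bar>(3 * d * real (snd k) + b \<bullet> y - t) - 3 * d * real (snd k)\<bar> \<le> d" using yz(1) by simp
        show "\<bar>(3 * d * real (snd k) + b \<bullet> y - t) - 3 * d * real (snd l)\<bar> \<le> d" using yz(2) e by simp
      qed
      ultimately show False using kl(3) by (simp add: prod_eq_iff)
    qed
  qed
  have sub: "(\<Union>ij\<in>I. (+) (p ij) ` ?S) \<subseteq> ball 0 (\<bar>R\<bar> + 12)"
  proof
    fix w assume "w \<in> (\<Union>ij\<in>I. (+) (p ij) ` ?S)"
    then obtain i j y where ij: "i < m" "j < m" "y \<in> ?S" "w = p (i, j) + y" by (auto simp: I_def)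
    have le6: "3 * d * real i \<le> 6" if "i < m" for i :: nat
    proof -
      have "real i * d \<le> real m * d" using that d by (intro mult_right_mono) auto
      then show ?thesis using m2 by (simp add: algebra_simps)
    qed
    have "norm (p (i, j)) \<le> norm ((3 * d * real i) *\<^sub>R a) + norm ((3 * d * real j) *\<^sub>R b)"
      unfolding p_def fst_conv snd_conv by (rule norm_triangle_ineq)
    also have "\<dots> = 3 * d * real i + 3 * d * real j" using a b d by simp
    also have "\<dots> \<le> 12" using le6[OF ij(1)] le6[OF ij(2)] by simp
    finally have "norm (p (i, j)) \<le> 12" .
    moreover have "norm y < \<bar>R\<bar>" using ij(3) by auto
    ultimately show "w \<in> ball 0 (\<bar>R\<bar> + 12)"
      using norm_triangle_ineq[of "p (i, j)" y] by (simp add: ij(4))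
  qed
  have "(real m)\<^sup>2 * measure lebesgue ?S = (\<Sum>ij\<in>I. measure lebesgue ((+) (p ij) ` ?S))"
    unfolding measure_translation sum_constant by (simp add: I_def power2_eq_square)
  also have "\<dots> = measure lebesgue (\<Union>ij\<in>I. (+) (p ij) ` ?S)"
  proof (rule measure_finite_Union[symmetric])
    show "(\<lambda>ij. (+) (p ij) ` ?S) ` I \<subseteq> sets lebesgue" using mpS fmeasurableD by blast
    show "emeasure lebesgue ((+) (p ij) ` ?S) \<noteq> \<infinity>" for ij
      using fmeasurableD2[OF mpS] by simp
  qed (simp add: I_def, rule disj)
  also have "\<dots> \<le> ?V"
  proof (rule measure_mono_fmeasurable[OF sub])
    show "(\<Union>ij\<in>I. (+) (p ij) ` ?S) \<in> sets lebesgue"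
      using mpS fmeasurableD by (intro sets.finite_UN) (auto simp: I_def)
  qed simp
  finally have le: "(real m)\<^sup>2 * measure lebesgue ?S \<le> ?V" .
  have "measure lebesgue ?S \<le> (real m * d)\<^sup>2 * measure lebesgue ?S"
  proof -
    have "1 \<le> real m * d" using m1 d by (simp add: field_simps)
    then have "1 \<le> (real m * d)\<^sup>2" by (simp add: one_le_power)
    then show ?thesis by (simp add: mult_le_cancel_right1)
  qed
  also have "\<dots> = ((real m)\<^sup>2 * measure lebesgue ?S) * d\<^sup>2" by (simp add: power_mult_distrib)
  also have "\<dots> \<le> ?V * d\<^sup>2" using le by (intro mult_right_mono) auto
  finally show ?thesis .
qed

text \<open>Vanishing on a neighbourhood of \<open>A\<close> leaves a compact rest of the closure to
  be covered by finitely many balls. The condition that each point off \<open>A\<close> eventually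
  sees the constant 1, together with the energy bound, is what weak convergence of the gradients to
  zero requires.\<close>

definition (in bounded_open) cutoff_seq :: "(real^'n) set \<Rightarrow> (nat \<Rightarrow> real^'n \<Rightarrow> real) \<Rightarrow> bool" where
  "cutoff_seq A c \<longleftrightarrow> (\<forall>k. smooth (c k)) \<and> (\<forall>k x. 0 \<le> c k x \<and> c k x \<le> 1) \<and>
     (\<forall>k. \<exists>N. open N \<and> A \<subseteq> N \<and> (\<forall>x\<in>N. c k x = 0)) \<and>
     (\<forall>x. x \<notin> A \<longrightarrow> (\<forall>\<^sub>F k in sequentially. c k x = 1 \<and> gradient (c k) x = 0)) \<and>
     (\<exists>B. \<forall>k. ip M (gradient (c k)) (gradient (c k)) \<le> B)"

text \<open>The transition takes place where the squared distance \<open>D\<close> lies between the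
  square of \<open>h k\<close> and twice that square. There the gradient is of order
  \<open>1 / h k\<close>, and the volume of the tube is of order the square of \<open>h k\<close>,
  so the energy is bounded independently of \<open>k\<close>.\<close>

lemma (in bounded_open) cutoff_seq_codim2:
  assumes "codim2 A"
  shows "\<exists>c. cutoff_seq A c"
proof -
  obtain a b s t where ab: "norm a = 1" "norm b = 1" "a \<bullet> b = 0" "A = {x. a \<bullet> x = s \<and> b \<bullet> x = t}"
    using assms unfolding codim2_def by blast
  obtain d L where dL: "\<And>t. (plateau has_real_derivative d t) (at t)" "\<And>t. \<bar>d t\<bar> \<le> L"
    "\<And>t. t < 0 \<or> t > 1 \<Longrightarrow> d t = 0"
    by (rule plateau_deriv_bounded) (rule that)
  obtain R where R: "\<Omega> \<subseteq> ball 0 R"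
    using bounded_subset_ballD[OF bounded_domain, of 0] by blast
  define D where "D y = (y \<bullet> a - s)\<^sup>2 + (y \<bullet> b - t)\<^sup>2" for y
  \<comment> \<open>The double successor gives \<open>h k \<le> 1 / 2\<close>, so the half width
    \<open>2 * h k\<close> of the strip stays within the range of the measure estimate.\<close>
  define h where "h k = inverse (real (Suc (Suc k)))" for k
  have h: "0 < h k" "h k \<le> 1 / 2" for k by (auto simp: h_def field_simps)
  define f where "f k y = D y / (h k)\<^sup>2 - 1" for k y
  define c where "c k y = plateau (f k y)" for k y
  have sD: "smooth D" unfolding D_def[abs_def] by (intro smooth_add smooth_power smooth_diff) auto
  have sf: "smooth (f k)" for k
    unfolding f_def[abs_def] using sD h(1)[of k] by (intro smooth_diff smooth_divide) auto
  have sc: "smooth (c k)" for k unfolding c_def[abs_def] using sf by (rule smooth_plateau)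
  have gD: "gradient D y = (2 * (y \<bullet> a - s)) *\<^sub>R a + (2 * (y \<bullet> b - t)) *\<^sub>R b" for y
    unfolding D_def[abs_def]
    by (rule gradient_eqI) (auto intro!: derivative_eq_intros simp: inner_add_left inner_commute algebra_simps)
  have gf: "gradient (f k) y = gradient D y /\<^sub>R (h k)\<^sup>2" for k y
    unfolding f_def[abs_def]
    by (rule gradient_eqI) (auto intro!: derivative_eq_intros smooth_has_derivative sD simp: divide_inverse)
  have gc: "gradient (c k) y = d (f k y) *\<^sub>R gradient (f k) y" for k y
    unfolding c_def[abs_def] by (rule gradient_compose[OF sf dL(1)])
  have nD: "(norm (gradient D y))\<^sup>2 = 4 * D y" for y
  proof -
    have aa: "a \<bullet> a = 1" "b \<bullet> b = 1" using ab by (simp_all add: dot_square_norm)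
    show ?thesis
      unfolding gD dot_square_norm[symmetric]
      by (simp add: inner_add_left inner_add_right aa ab(3) inner_commute[of b a] D_def power2_eq_square
          algebra_simps)
  qed
  define S where "S k = {y \<in> ball 0 R. \<bar>a \<bullet> y - s\<bar> \<le> 2 * h k \<and> \<bar>b \<bullet> y - t\<bar> \<le> 2 * h k}" for k
  have S: "S k \<in> lmeasurable" for k unfolding S_def by (rule measurable_strip)
  \<comment> \<open>The gradient of \<open>D\<close> has squared norm \<open>4 * D\<close>, and
    \<open>D\<close> is at most twice the square of \<open>h k\<close> on the tube; this is the
    factor 8.\<close>
  define C where "C = L\<^sup>2 * 8"
  have bound: "(norm (gradient (c k) y))\<^sup>2 \<le> C / (h k)\<^sup>2 * indicator (S k) y" if "y \<in> \<Omega>" for k y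
  proof (cases "f k y > 1")
    case True
    then have "gradient (c k) y = 0" by (simp add: gc dL(3))
    then show ?thesis by (simp add: C_def)
  next
    case False
    then have D2: "D y \<le> 2 * (h k)\<^sup>2" using h(1)[of k] by (simp add: f_def field_simps)
    have "(y \<bullet> a - s)\<^sup>2 \<le> (2 * h k)\<^sup>2" "(y \<bullet> b - t)\<^sup>2 \<le> (2 * h k)\<^sup>2"
      using D2 unfolding D_def by (simp_all add: power_mult_distrib) (smt (verit) zero_le_power2)+
    then have "\<bar>y \<bullet> a - s\<bar> \<le> 2 * h k" "\<bar>y \<bullet> b - t\<bar> \<le> 2 * h k"
      using h(1)[of k] abs_le_square_iff[of _ "2 * h k"] by (metis abs_of_pos mult_pos_pos zero_less_numeral)+
    then have yS: "y \<in> S k" using that R by (auto simp: S_def inner_commute)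
    have "(norm (gradient (c k) y))\<^sup>2 = (d (f k y))\<^sup>2 * (4 * D y) / (h k)^4"
      using h(1)[of k] by (simp add: gc gf power_mult_distrib nD field_simps)
    also have "\<dots> \<le> L\<^sup>2 * (4 * (2 * (h k)\<^sup>2)) / (h k)^4"
    proof (intro divide_right_mono mult_mono)
      show "(d (f k y))\<^sup>2 \<le> L\<^sup>2" using dL(2)[of "f k y"] by (metis abs_ge_zero power2_abs power_mono)
    qed (use D2 in \<open>auto simp: D_def\<close>)
    also have "\<dots> = C / (h k)\<^sup>2" using h(1)[of k] by (simp add: C_def power4_eq_xxxx power2_eq_square)
    finally show ?thesis using yS by simp
  qed
  have "cutoff_seq A c"
    unfolding cutoff_seq_def
  proof (intro conjI allI impI)
    show "smooth (c k)" for k by (rule sc)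
    show "0 \<le> c k x" "c k x \<le> 1" for k x by (auto simp: c_def plateau_bounds)
    show "\<exists>N. open N \<and> A \<subseteq> N \<and> (\<forall>x\<in>N. c k x = 0)" for k
    proof (intro exI conjI)
      show "open {x. D x < (h k)\<^sup>2}"
        using smooth_continuous_on[OF sD] by (intro open_Collect_less continuous_on_const)
      show "A \<subseteq> {x. D x < (h k)\<^sup>2}" using h(1)[of k] by (auto simp: ab(4) D_def inner_commute)
      show "\<forall>x\<in>{x. D x < (h k)\<^sup>2}. c k x = 0"
        using h(1)[of k] by (auto simp: c_def f_def intro!: plateau_0)
    qed
    show "\<forall>\<^sub>F k in sequentially. c k x = 1 \<and> gradient (c k) x = 0" if x: "x \<notin> A" for x
    proof -
      have "D x > 0"
        using x unfolding ab(4) D_def inner_commute[of x] by (auto simp: add_pos_nonneg add_nonneg_pos)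
      moreover have "h \<longlonglongrightarrow> 0"
        unfolding h_def[abs_def] by (rule LIMSEQ_Suc[OF LIMSEQ_inverse_real_of_nat])
      then have "(\<lambda>k. 2 * (h k)\<^sup>2) \<longlonglongrightarrow> 2 * 0\<^sup>2"
        by (intro tendsto_mult tendsto_power tendsto_const)
      ultimately have "\<forall>\<^sub>F k in sequentially. 2 * (h k)\<^sup>2 < D x"
        by (intro order_tendstoD) auto
      then show ?thesis
      proof eventually_elim
        case (elim k)
        then have "f k x > 1" using h(1)[of k] by (simp add: f_def field_simps)
        then show ?case by (simp add: c_def plateau_1 gc dL(3) less_imp_le)
      qed
    qed
    show "\<exists>B. \<forall>k. ip M (gradient (c k)) (gradient (c k)) \<le> B"
    proof (intro exI allI)
      fix k
      let ?V = "measure lebesgue (ball (0::real^'n) (\<bar>R\<bar> + 12))"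
      have "ip M (gradient (c k)) (gradient (c k)) \<le> (\<integral>y. C / (h k)\<^sup>2 * indicator (S k) y \<partial>M)"
        unfolding ip_self
      proof (rule integral_mono)
        show "integrable M (\<lambda>y. (norm (gradient (c k) y))\<^sup>2)"
          using smooth_gradient_sqint[OF sc] by (rule sqint_integrable)
        have "S k \<in> sets lebesgue" using S by (rule fmeasurableD)
        then have meas: "indicat_real (S k) \<in> borel_measurable M"
          by (intro measurable_restrict_space1) simp
        have "integrable M (indicat_real (S k))"
        proof (rule finite_measure.integrable_const_bound[OF finite_measure_domain])
          show "AE x in M. norm (indicat_real (S k) x) \<le> 1" by (simp add: indicator_def)
        qed (rule meas)
        then show "integrable M (\<lambda>y. C / (h k)\<^sup>2 * indicator (S k) y)"
          by (rule integrable_mult_right)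
      qed (use bound in auto)
      also have "\<dots> \<le> C / (h k)\<^sup>2 * measure lebesgue (S k)"
      proof -
        have "(\<integral>y. indicat_real (S k) y \<partial>M) = measure M (S k \<inter> space M)" by simp
        also have "\<dots> = measure lebesgue (S k \<inter> \<Omega>)"
          by (simp add: measure_restrict_space fmeasurableD[OF S])
        also have "\<dots> \<le> measure lebesgue (S k)"
          by (rule measure_mono_fmeasurable[OF _ _ S]) (auto intro: fmeasurableD[OF S])
        finally show ?thesis by (simp add: C_def divide_right_mono mult_left_mono)
      qed
      also have "\<dots> \<le> C / (h k)\<^sup>2 * (?V * (2 * h k)\<^sup>2)"
        unfolding S_def using h[of k] by (intro mult_left_mono measure_strip_le ab) (auto simp: C_def)
      also have "\<dots> = 4 * C * ?V" using h(1)[of k] by (simp add: power_mult_distrib)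
      finally show "ip M (gradient (c k)) (gradient (c k)) \<le> 4 * C * ?V" .
    qed
  qed
  then show ?thesis by blast
qed

section \<open>Weak convergence of cut-off gradients and globalisation of local identities\<close>

context bounded_open
begin

lemma cutoff_seq_Un:
  assumes "cutoff_seq A c" "cutoff_seq B d"
  shows "cutoff_seq (A \<union> B) (\<lambda>k x. c k x * d k x)"
proof -
  note c = assms(1)[unfolded cutoff_seq_def] and d = assms(2)[unfolded cutoff_seq_def]
  have s: "smooth (c k)" "smooth (d k)" for k using c d by auto
  have cb: "0 \<le> c k x" "c k x \<le> 1" and db: "0 \<le> d k x" "d k x \<le> 1" for k x using c d by auto
  have g: "gradient (\<lambda>x. c k x * d k x) x = c k x *\<^sub>R gradient (d k) x + d k x *\<^sub>R gradient (c k) x" for k x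
    using s by (rule gradient_mult)
  obtain P Q where P: "\<And>k. ip M (gradient (c k)) (gradient (c k)) \<le> P"
    and Q: "\<And>k. ip M (gradient (d k)) (gradient (d k)) \<le> Q" using c d by blast
  show ?thesis
    unfolding cutoff_seq_def
  proof (intro conjI allI impI)
    show "smooth (\<lambda>x. c k x * d k x)" for k using s by auto
    show "0 \<le> c k x * d k x" "c k x * d k x \<le> 1" for k x
      using cb[of k x] db[of k x] by (auto intro: mult_le_one)
    show "\<exists>N. open N \<and> A \<union> B \<subseteq> N \<and> (\<forall>x\<in>N. c k x * d k x = 0)" for k
    proof -
      obtain N where N: "open N" "A \<subseteq> N" "\<forall>x\<in>N. c k x = 0" using c by blast
      obtain N' where N': "open N'" "B \<subseteq> N'" "\<forall>x\<in>N'. d k x = 0" using d by blast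
      show ?thesis by (rule exI[of _ "N \<union> N'"]) (use N N' in auto)
    qed
    show "\<forall>\<^sub>F k in sequentially. c k x * d k x = 1 \<and> gradient (\<lambda>x. c k x * d k x) x = 0"
      if x: "x \<notin> A \<union> B" for x
    proof -
      have "\<forall>\<^sub>F k in sequentially. c k x = 1 \<and> gradient (c k) x = 0"
        "\<forall>\<^sub>F k in sequentially. d k x = 1 \<and> gradient (d k) x = 0" using c d x by auto
      then show ?thesis by eventually_elim (simp add: g)
    qed
    show "\<exists>B. \<forall>k. ip M (gradient (\<lambda>x. c k x * d k x)) (gradient (\<lambda>x. c k x * d k x)) \<le> B"
    proof (intro exI allI)
      fix k
      have "ip M (gradient (\<lambda>x. c k x * d k x)) (gradient (\<lambda>x. c k x * d k x)) \<le>
          (\<integral>x. 2 * (norm (gradient (c k) x))\<^sup>2 + 2 * (norm (gradient (d k) x))\<^sup>2 \<partial>M)"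
        unfolding ip_self
      proof (rule integral_mono)
        show "integrable M (\<lambda>x. (norm (gradient (\<lambda>x. c k x * d k x) x))\<^sup>2)"
          by (intro sqint_integrable smooth_gradient_sqint smooth_mult s)
        show "integrable M (\<lambda>x. 2 * (norm (gradient (c k) x))\<^sup>2 + 2 * (norm (gradient (d k) x))\<^sup>2)"
          by (intro Bochner_Integration.integrable_add integrable_mult_right sqint_integrable
              smooth_gradient_sqint s)
        fix x
        have "norm (gradient (\<lambda>x. c k x * d k x) x) \<le> norm (gradient (d k) x) + norm (gradient (c k) x)"
          unfolding g using cb[of k x] db[of k x]
          by (intro order_trans[OF norm_triangle_ineq] add_mono) (auto intro: mult_left_le_one_le)
        then have "(norm (gradient (\<lambda>x. c k x * d k x) x))\<^sup>2 \<le> (norm (gradient (d k) x) + norm (gradient (c k) x))\<^sup>2"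
          by (intro power_mono) auto
        also have "\<dots> \<le> 2 * (norm (gradient (c k) x))\<^sup>2 + 2 * (norm (gradient (d k) x))\<^sup>2"
          using two_norm_mult_le[of "gradient (d k) x" "gradient (c k) x"] by (simp add: power2_sum)
        finally show "(norm (gradient (\<lambda>x. c k x * d k x) x))\<^sup>2 \<le>
            2 * (norm (gradient (c k) x))\<^sup>2 + 2 * (norm (gradient (d k) x))\<^sup>2" .
      qed
      also have "\<dots> = 2 * ip M (gradient (c k)) (gradient (c k)) + 2 * ip M (gradient (d k)) (gradient (d k))"
        unfolding ip_self
        by (subst Bochner_Integration.integral_add)
          (auto intro!: integrable_mult_right sqint_integrable smooth_gradient_sqint s)
      also have "\<dots> \<le> 2 * P + 2 * Q" using P[of k] Q[of k] by simp
      finally show "ip M (gradient (\<lambda>x. c k x * d k x)) (gradient (\<lambda>x. c k x * d k x)) \<le> 2 * P + 2 * Q" .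
    qed
  qed
qed

lemma cutoff_seq_Union:
  assumes "finite \<A>" "\<And>A. A \<in> \<A> \<Longrightarrow> codim2 A"
  shows "\<exists>c. cutoff_seq (\<Union>\<A>) c"
  using assms
proof (induction \<A> rule: finite_induct)
  case empty
  have "cutoff_seq {} (\<lambda>_ _. 1)" by (auto simp: cutoff_seq_def ip_def)
  then show ?case by auto
next
  case (insert A \<A>)
  obtain c where "cutoff_seq (\<Union>\<A>) c" using insert by auto
  moreover obtain d where "cutoff_seq A d" using cutoff_seq_codim2 insert.prems by blast
  ultimately show ?case using cutoff_seq_Un[of A d "\<Union>\<A>" c] by auto
qed

text \<open>The gradients are only bounded in L2, but every point off \<open>A\<close> eventually
  leaves the set where they are nonzero. So the restriction of the fixed factor to that set tends to
  zero in norm, and Cauchy-Schwarz gives the limit.\<close>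

lemma cutoff_seq_gradient_limit:
  assumes c: "cutoff_seq A c" and A: "negligible A" and w: "w \<in> sqint M"
    and q: "q \<in> borel_measurable M" "\<And>x. x \<in> \<Omega> \<Longrightarrow> \<bar>q x\<bar> \<le> C"
  shows "(\<lambda>k. ip M w (\<lambda>x. q x *\<^sub>R gradient (c k) x)) \<longlonglongrightarrow> 0"
proof -
  have s: "smooth (c k)" for k using c by (simp add: cutoff_seq_def)
  obtain B where B: "\<And>k. ip M (gradient (c k)) (gradient (c k)) \<le> B"
    using c unfolding cutoff_seq_def by blast
  have gs: "gradient (c k) \<in> sqint M" for k using s by auto
  have [measurable]: "gradient (c k) \<in> borel_measurable M" for k using gs by (rule sqint_measurable)
  have [measurable]: "w \<in> borel_measurable M" "q \<in> borel_measurable M"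
    using w q sqint_measurable by auto
  \<comment> \<open>The product of \<open>w\<close> and \<open>q\<close>, restricted to the points
    where the gradient of \<open>c k\<close> is nonzero; the restriction does not change the
    integral.\<close>
  define v where "v k x = (if gradient (c k) x = 0 then 0 else q x) *\<^sub>R w x" for k x
  have vs: "v k \<in> sqint M" for k
    unfolding v_def[abs_def]
  proof (rule sqint_bounded_scale[OF w, of _ "\<bar>C\<bar>"])
    show "(\<lambda>x. if gradient (c k) x = 0 then 0 else q x) \<in> borel_measurable M" by measurable
  qed (use q(2) in force)
  have "(\<lambda>k. ip M (v k) (v k)) \<longlonglongrightarrow> (\<integral>x. 0 \<partial>M)"
    unfolding ip_self
  proof (rule integral_dominated_convergence[where w = "\<lambda>x. C\<^sup>2 * (norm (w x))\<^sup>2"])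
    show "integrable M (\<lambda>x. C\<^sup>2 * (norm (w x))\<^sup>2)" using sqint_integrable[OF w] by simp
    show "AE x in M. (\<lambda>k. (norm (v k x))\<^sup>2) \<longlonglongrightarrow> 0"
    proof -
      have "AE x in lebesgue. x \<notin> A"
        using A unfolding negligible_iff_null_sets by (rule AE_not_in)
      then have "AE x in M. x \<notin> A" unfolding AE_domain[symmetric] by (rule eventually_mono) simp
      then show ?thesis
      proof eventually_elim
        case (elim x)
        then have "\<forall>\<^sub>F k in sequentially. c k x = 1 \<and> gradient (c k) x = 0"
          using c by (simp add: cutoff_seq_def)
        then have "\<forall>\<^sub>F k in sequentially. (norm (v k x))\<^sup>2 = 0"
          by eventually_elim (simp add: v_def)
        then show ?case by (rule tendsto_eventually)
      qed
    qed
    show "AE x in M. norm ((norm (v k x))\<^sup>2) \<le> C\<^sup>2 * (norm (w x))\<^sup>2" for k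
    proof (rule AE_I2)
      fix x assume "x \<in> space M"
      then have "(q x)\<^sup>2 \<le> C\<^sup>2" using q(2)[of x] by (metis abs_ge_zero power2_abs power_mono space_lebesgue_on)
      then show "norm ((norm (v k x))\<^sup>2) \<le> C\<^sup>2 * (norm (w x))\<^sup>2"
        by (auto simp: v_def power_mult_distrib intro!: mult_right_mono)
    qed
  qed (use vs in \<open>auto simp: sqint_def\<close>)
  then have lim: "(\<lambda>k. ip M (v k) (v k) * B) \<longlonglongrightarrow> 0"
    using tendsto_mult_right[of _ 0 sequentially B] by simp
  have "(\<lambda>k. (ip M w (\<lambda>x. q x *\<^sub>R gradient (c k) x))\<^sup>2) \<longlonglongrightarrow> 0"
  proof (rule tendsto_sandwich[OF _ _ tendsto_const lim])
    show "\<forall>\<^sub>F k in sequentially. (ip M w (\<lambda>x. q x *\<^sub>R gradient (c k) x))\<^sup>2 \<le> ip M (v k) (v k) * B"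
    proof (rule always_eventually, rule allI)
      fix k
      have "ip M w (\<lambda>x. q x *\<^sub>R gradient (c k) x) = ip M (v k) (gradient (c k))"
        unfolding ip_def v_def by (rule Bochner_Integration.integral_cong) auto
      also have "(ip M (v k) (gradient (c k)))\<^sup>2 \<le> ip M (v k) (v k) * ip M (gradient (c k)) (gradient (c k))"
        by (rule ip_Cauchy_Schwarz[OF vs gs])
      also have "\<dots> \<le> ip M (v k) (v k) * B" using B by (intro mult_left_mono) auto
      finally show "(ip M w (\<lambda>x. q x *\<^sub>R gradient (c k) x))\<^sup>2 \<le> ip M (v k) (v k) * B" .
    qed
  qed simp
  from tendsto_real_sqrt[OF this] show ?thesis
    by (simp add: tendsto_rabs_zero_iff)
qed

text \<open>Here \<open>r\<close> plays the part of the gradient of \<open>q\<close>. For fixed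
  \<open>k\<close> the support of \<open>c k\<close> within the closure is compact and is covered by
  finitely many balls with a local identity, so the identity holds for \<open>c k\<close>. Passing
  to the limit, the term with the gradient of \<open>c k\<close> disappears by weak convergence;
  this is where the boundedness of \<open>q\<close> enters.\<close>

theorem local_to_global:
  assumes w: "w0 \<in> sqint M" "w1 \<in> sqint M" and r: "r \<in> sqint M"
    and q: "q \<in> borel_measurable M" "\<And>x. x \<in> \<Omega> \<Longrightarrow> \<bar>q x\<bar> \<le> C"
    and \<A>: "finite \<A>" "\<And>A. A \<in> \<A> \<Longrightarrow> codim2 A"
    and loc: "\<And>x. x \<in> closure \<Omega> \<Longrightarrow> x \<notin> \<Union>\<A> \<Longrightarrow> \<exists>d>0. \<forall>\<theta>. test_fun (ball x d) \<theta> \<longrightarrow>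
      pair_ip w0 w1 (\<lambda>x. \<theta> x * q x) (\<lambda>x. \<theta> x *\<^sub>R r x + q x *\<^sub>R gradient \<theta> x) = 0"
  shows "pair_ip w0 w1 q r = 0"
proof -
  obtain c where c: "cutoff_seq (\<Union>\<A>) c" using cutoff_seq_Union[OF \<A>] by blast
  have sc: "smooth (c k)" for k using c by (simp add: cutoff_seq_def)
  have neg: "negligible (\<Union>\<A>)" using \<A> codim2_negligible by (intro negligible_Union) auto
  define G where "G \<theta> = pair_ip w0 w1 (\<lambda>x. \<theta> x * q x) (\<lambda>x. \<theta> x *\<^sub>R r x + q x *\<^sub>R gradient \<theta> x)" for \<theta>
  have one: "(\<lambda>_. 1::real) \<in> sqint M" by simp
  have qs: "q \<in> sqint M"
    using sqint_bounded_scale[OF one q(1), of C] q(2) by simp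
  have int: "(\<lambda>x. \<theta> x * q x) \<in> sqint M" "(\<lambda>x. q x *\<^sub>R gradient \<theta> x) \<in> sqint M"
    "(\<lambda>x. \<theta> x *\<^sub>R r x) \<in> sqint M" "(\<lambda>x. \<theta> x *\<^sub>R r x + q x *\<^sub>R gradient \<theta> x) \<in> sqint M" if "smooth \<theta>" for \<theta>
  proof -
    show 1: "(\<lambda>x. \<theta> x * q x) \<in> sqint M" using that qs by blast
    show 2: "(\<lambda>x. q x *\<^sub>R gradient \<theta> x) \<in> sqint M"
      by (rule sqint_bounded_scale[OF smooth_gradient_sqint[OF that] q(1)]) (use q(2) in auto)
    show 3: "(\<lambda>x. \<theta> x *\<^sub>R r x) \<in> sqint M" using that r by blast
    show "(\<lambda>x. \<theta> x *\<^sub>R r x + q x *\<^sub>R gradient \<theta> x) \<in> sqint M" by (rule sqint_add[OF 3 2])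
  qed
  have w': "(\<lambda>x. (w0 x, w1 x)) \<in> sqint M" using w by blast
  have Gdiff: "G (\<lambda>x. \<theta> x - \<eta> x) = G \<theta> - G \<eta>" if "smooth \<theta>" "smooth \<eta>" for \<theta> \<eta>
  proof -
    have "G (\<lambda>x. \<theta> x - \<eta> x) = ip M (\<lambda>x. (w0 x, w1 x))
        (\<lambda>x. (\<theta> x * q x, \<theta> x *\<^sub>R r x + q x *\<^sub>R gradient \<theta> x) - (\<eta> x * q x, \<eta> x *\<^sub>R r x + q x *\<^sub>R gradient \<eta> x))"
      unfolding G_def using that by (simp add: gradient_diff algebra_simps)
    also have "\<dots> = G \<theta> - G \<eta>"
      unfolding G_def using int[OF that(1)] int[OF that(2)] w' by (intro ip_diff) auto
    finally show ?thesis .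
  qed
  have Gc: "G (c k) = 0" for k
  proof -
    obtain N where N: "open N" "\<Union>\<A> \<subseteq> N" "\<forall>x\<in>N. c k x = 0"
      using c unfolding cutoff_seq_def by blast
    define K where "K = closure \<Omega> - N"
    have K: "compact K" unfolding K_def using bounded_domain N(1) by (intro compact_diff) auto
    have "\<exists>d>0. \<forall>\<theta>. test_fun (ball x d) \<theta> \<longrightarrow> G \<theta> = 0" if "x \<in> K" for x
      unfolding G_def using loc[of x] that N(2) by (auto simp: K_def)
    then obtain d where d: "\<And>x. x \<in> K \<Longrightarrow> d x > 0" "\<And>x \<theta>. x \<in> K \<Longrightarrow> test_fun (ball x (d x)) \<theta> \<Longrightarrow> G \<theta> = 0"
      by metis
    have cover: "K \<subseteq> (\<Union>x\<in>K. ball x (d x / 3))" using d(1) by auto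
    obtain F where F: "F \<subseteq> K" "finite F" "K \<subseteq> (\<Union>x\<in>F. ball x (d x / 3))"
      by (rule compactE_image[OF K _ cover]) auto
    have "\<exists>b. smooth b \<and> (\<forall>y\<in>ball x (d x / 3). b y = 1) \<and> (\<forall>y. y \<notin> cball x (d x / 2) \<longrightarrow> b y = 0)" if "x \<in> K" for x
    proof (rule smooth_bump[of "d x / 3" "d x / 2" x])
      fix b assume "smooth b" "\<And>y. y \<in> ball x (d x / 3) \<Longrightarrow> b y = 1" "\<And>y. y \<notin> cball x (d x / 2) \<Longrightarrow> b y = 0"
      then show ?thesis by blast
    qed (use d(1)[OF that] in auto)
    then obtain b where b: "\<And>x. x \<in> K \<Longrightarrow> smooth (b x)" "\<And>x y. x \<in> K \<Longrightarrow> y \<in> ball x (d x / 3) \<Longrightarrow> b x y = 1"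
      "\<And>x y. x \<in> K \<Longrightarrow> y \<notin> cball x (d x / 2) \<Longrightarrow> b x y = 0" by metis
    \<comment> \<open>The functional \<open>G\<close> is additive in the cut-off. Multiplying by
      \<open>1 - b z\<close> subtracts a function supported in one of the good balls and so leaves
      the value of \<open>G\<close> unchanged; after all factors the function vanishes on the whole
      domain.\<close>
    have step: "smooth (\<lambda>y. c k y * (\<Prod>x\<in>F'. 1 - b x y)) \<and> G (\<lambda>y. c k y * (\<Prod>x\<in>F'. 1 - b x y)) = G (c k)"
      if "F' \<subseteq> K" "finite F'" for F'
      using that(2,1)
    proof (induction F' rule: finite_induct)
      case empty
      then show ?case using sc by simp
    next
      case (insert z F')
      let ?p = "\<lambda>y. c k y * (\<Prod>x\<in>F'. 1 - b x y)"
      have p: "smooth ?p" "G ?p = G (c k)" and z: "z \<in> K" using insert by auto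
      have tf: "test_fun (ball z (d z)) (\<lambda>y. ?p y * b z y)"
      proof (rule test_funI[of _ "cball z (d z / 2)"])
        show "smooth (\<lambda>y. ?p y * b z y)" using p(1) b(1)[OF z] by (rule smooth_mult)
        show "cball z (d z / 2) \<subseteq> ball z (d z)" using d(1)[OF z] by (auto intro: cball_subset_ball_iff[THEN iffD2])
      qed (use b(3)[OF z] in auto)
      have eq: "(\<lambda>y. c k y * (\<Prod>x\<in>insert z F'. 1 - b x y)) = (\<lambda>y. ?p y - ?p y * b z y)"
        using insert.hyps by (auto simp: algebra_simps)
      have "G (\<lambda>y. ?p y - ?p y * b z y) = G (c k)"
        using Gdiff[OF p(1) test_fun_smooth[OF tf]] d(2)[OF z tf] p(2) by simp
      moreover have "smooth (\<lambda>y. ?p y - ?p y * b z y)" using p(1) test_fun_smooth[OF tf] by (rule smooth_diff)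
      ultimately show ?case unfolding eq by blast
    qed
    let ?p = "\<lambda>y. c k y * (\<Prod>x\<in>F. 1 - b x y)"
    have p0: "?p y = 0" if "y \<in> \<Omega>" for y
    proof (cases "y \<in> N")
      case False
      then have "y \<in> K" using that closure_subset by (auto simp: K_def)
      then obtain x where x: "x \<in> F" "y \<in> ball x (d x / 3)" using F(3) by blast
      then have "1 - b x y = 0" using b(2)[of x y] F(1) by auto
      then show ?thesis using F(2) x(1) by (auto intro!: prod_zero)
    qed (use N(3) in simp)
    have "G ?p = 0"
      unfolding G_def ip_def
    proof (rule integral_eq_zero_AE, rule AE_I2)
      fix x assume "x \<in> space M"
      then have "x \<in> \<Omega>" by simp
      moreover have "gradient ?p x = 0" by (rule gradient_eq_0_open[OF open_domain p0 \<open>x \<in> \<Omega>\<close>])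
      ultimately show "(w0 x, w1 x) \<bullet> (?p x * q x, ?p x *\<^sub>R r x + q x *\<^sub>R gradient ?p x) = 0"
        by (simp only: p0[OF \<open>x \<in> \<Omega>\<close>]) simp
    qed
    then show ?thesis using step[OF F(1,2)] by simp
  qed
  have "(\<lambda>k. \<integral>x. c k x * (w0 x * q x + w1 x \<bullet> r x) \<partial>M) \<longlonglongrightarrow> (\<integral>x. w0 x * q x + w1 x \<bullet> r x \<partial>M)"
  proof (rule integral_dominated_convergence[where w = "\<lambda>x. \<bar>w0 x * q x + w1 x \<bullet> r x\<bar>"])
    have I: "integrable M (\<lambda>x. w0 x * q x + w1 x \<bullet> r x)"
      using w r qs by (intro Bochner_Integration.integrable_add) auto
    then show "integrable M (\<lambda>x. \<bar>w0 x * q x + w1 x \<bullet> r x\<bar>)"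
      "(\<lambda>x. w0 x * q x + w1 x \<bullet> r x) \<in> borel_measurable M" by auto
    have "c k \<in> borel_measurable M" for k using sc by (rule smooth_measurable_domain)
    then show "(\<lambda>x. c k x * (w0 x * q x + w1 x \<bullet> r x)) \<in> borel_measurable M" for k
      using I by auto
    have "AE x in lebesgue. x \<notin> \<Union>\<A>" using neg unfolding negligible_iff_null_sets by (rule AE_not_in)
    then have "AE x in M. x \<notin> \<Union>\<A>" unfolding AE_domain[symmetric] by (rule eventually_mono) simp
    then show "AE x in M. (\<lambda>k. c k x * (w0 x * q x + w1 x \<bullet> r x)) \<longlonglongrightarrow> w0 x * q x + w1 x \<bullet> r x"
    proof eventually_elim
      case (elim x)
      then have "\<forall>\<^sub>F k in sequentially. c k x = 1 \<and> gradient (c k) x = 0"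
        using c unfolding cutoff_seq_def by blast
      then have "\<forall>\<^sub>F k in sequentially. c k x * (w0 x * q x + w1 x \<bullet> r x) = w0 x * q x + w1 x \<bullet> r x"
        by eventually_elim simp
      then show ?case by (rule tendsto_eventually)
    qed
    show "AE x in M. norm (c k x * (w0 x * q x + w1 x \<bullet> r x)) \<le> \<bar>w0 x * q x + w1 x \<bullet> r x\<bar>" for k
    proof -
      have "0 \<le> c k x \<and> c k x \<le> 1" for x using c by (simp add: cutoff_seq_def)
      then show ?thesis by (intro AE_I2) (simp add: abs_mult mult_left_le_one_le)
    qed
  qed
  moreover have "(\<integral>x. c k x * (w0 x * q x + w1 x \<bullet> r x) \<partial>M) = - ip M w1 (\<lambda>x. q x *\<^sub>R gradient (c k) x)" for k
  proof -
    have I1: "integrable M (\<lambda>x. c k x * (w0 x * q x + w1 x \<bullet> r x))"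
    proof -
      have "integrable M (\<lambda>x. w0 x * (c k x * q x) + w1 x \<bullet> (c k x *\<^sub>R r x))"
        using sqint_mult_integrable[OF w(1) int(1)[OF sc]] sqint_inner_integrable[OF w(2) int(3)[OF sc]]
        by (rule Bochner_Integration.integrable_add)
      then show ?thesis by (simp add: algebra_simps)
    qed
    have I2: "integrable M (\<lambda>x. w1 x \<bullet> (q x *\<^sub>R gradient (c k) x))"
      using w int[OF sc] by (intro sqint_inner_integrable)
    \<comment> \<open>The identity for \<open>c k\<close> trades the integral to be computed for the
      term carrying the gradient of the cut-off.\<close>
    have "0 = (\<integral>x. c k x * (w0 x * q x + w1 x \<bullet> r x) + w1 x \<bullet> (q x *\<^sub>R gradient (c k) x) \<partial>M)"
      using Gc[of k] by (simp add: G_def ip_def algebra_simps inner_add_right)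
    also have "\<dots> = (\<integral>x. c k x * (w0 x * q x + w1 x \<bullet> r x) \<partial>M) + ip M w1 (\<lambda>x. q x *\<^sub>R gradient (c k) x)"
      unfolding ip_def using I1 I2 by (rule Bochner_Integration.integral_add)
    finally show ?thesis by simp
  qed
  moreover have "(\<lambda>k. - ip M w1 (\<lambda>x. q x *\<^sub>R gradient (c k) x)) \<longlonglongrightarrow> - 0"
    by (intro tendsto_minus cutoff_seq_gradient_limit[OF c neg w(2) q])
  ultimately have "(\<integral>x. w0 x * q x + w1 x \<bullet> r x \<partial>M) = 0"
    using LIMSEQ_unique by fastforce
  then show ?thesis by (simp add: ip_def)
qed

end

section \<open>Mollification\<close>

text \<open>The support is centred at \<open>h *\<^sub>R c\<close> instead of 0, so that convolution
  at \<open>y\<close> samples values around \<open>y - h *\<^sub>R c\<close>, on a prescribed side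
  of a face.\<close>

lemma smooth_kernel:
  fixes c :: "real^'n"
  assumes "h > 0"
  obtains \<rho> where "test_fun UNIV \<rho>" "\<And>x. 0 \<le> \<rho> x" "(\<integral>x. \<rho> x \<partial>lborel) = 1"
    "\<And>x. x \<notin> cball (h *\<^sub>R c) (h / 2) \<Longrightarrow> \<rho> x = 0"
proof -
  obtain b where b: "smooth b" "\<And>y. 0 \<le> b y" "\<And>y. y \<in> ball (h *\<^sub>R c) (h / 4) \<Longrightarrow> b y = 1"
    "\<And>y. y \<notin> cball (h *\<^sub>R c) (h / 2) \<Longrightarrow> b y = 0"
    by (rule smooth_bump[of "h / 4" "h / 2" "h *\<^sub>R c"]) (use assms in auto)
  have tf: "test_fun UNIV b" by (rule test_funI[OF b(1) compact_cball subset_UNIV b(4)])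
  have int: "integrable lborel b" using tf by (rule test_fun_integrable)
  define J where "J = (\<integral>x. b x \<partial>lborel)"
  have "J \<noteq> 0"
  proof
    assume "J = 0"
    then have "AE x in lborel. b x = 0"
      using integral_nonneg_eq_0_iff_AE[OF int] b(2) by (simp add: J_def)
    then have "AE x in lborel. x \<notin> ball (h *\<^sub>R c) (h / 4)"
      by eventually_elim (use b(3) in force)
    then have "ball (h *\<^sub>R c) (h / 4) \<in> null_sets lborel"
      by (subst AE_iff_null_sets) auto
    then have "negligible (ball (h *\<^sub>R c) (h / 4))"
      unfolding negligible_iff_null_sets by (rule null_sets_completionI)
    moreover have "\<not> negligible (ball (h *\<^sub>R c) (h / 4))"
      using assms by (intro open_not_negligible) auto
    ultimately show False by blast
  qed
  moreover have "J \<ge> 0" unfolding J_def using b(2) by simp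
  ultimately have J: "J > 0" by simp
  show thesis
  proof (rule that[of "\<lambda>x. inverse J * b x"])
    show "test_fun UNIV (\<lambda>x. inverse J * b x)" by (rule test_fun_mult[OF smooth_const tf])
    show "(\<integral>x. inverse J * b x \<partial>lborel) = 1" using J by (simp add: J_def)
  qed (use b J in auto)
qed

lemma integral_lborel_reflect:
  fixes f :: "'a::euclidean_space \<Rightarrow> real"
  assumes [measurable]: "f \<in> borel_measurable borel"
  shows "(\<integral>x. f (c - x) \<partial>lborel) = (\<integral>x. f x \<partial>lborel)"
proof -
  have "lborel = distr lborel borel (\<lambda>x. c + (-1) *\<^sub>R x)"
    using lborel_affine[of "-1" c] by (simp add: density_1)
  then have "(\<integral>x. f x \<partial>lborel) = (\<integral>x. f x \<partial>distr lborel borel (\<lambda>x. c + (-1) *\<^sub>R x))" by simp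
  also have "\<dots> = (\<integral>x. f (c + (-1) *\<^sub>R x) \<partial>lborel)"
    by (rule integral_distr) auto
  finally show ?thesis by simp
qed

lemma test_fun_gradient_Lipschitz:
  fixes \<rho> :: "real^'n \<Rightarrow> real"
  assumes "test_fun A \<rho>"
  obtains L where "\<And>x y. norm (gradient \<rho> x - gradient \<rho> y) \<le> L * norm (x - y)"
proof -
  have "\<exists>L. \<forall>x y. \<bar>gradient \<rho> x $ i - gradient \<rho> y $ i\<bar> \<le> L * norm (x - y)" for i
    by (rule test_fun_Lipschitz[OF test_fun_gradient_component[OF assms]]) blast
  then obtain L where L: "\<And>i x y. \<bar>gradient \<rho> x $ i - gradient \<rho> y $ i\<bar> \<le> L i * norm (x - y)"
    by metis
  have "norm (gradient \<rho> x - gradient \<rho> y) \<le> (\<Sum>i\<in>UNIV. L i) * norm (x - y)" for x y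
    unfolding sum_distrib_right
    by (rule order_trans[OF norm_le_l1_cart sum_mono]) (use L in simp)
  then show thesis by (rule that)
qed

text \<open>The mean value inequality for the function minus its linear part, whose gradient is
  Lipschitz. The remainder is uniform in the base point, so a convolution with an integrable
  function can be differentiated by integrating this estimate.\<close>

lemma test_fun_second_order:
  fixes \<rho> :: "real^'n \<Rightarrow> real"
  assumes "test_fun A \<rho>"
  obtains L where "\<And>x y. \<bar>\<rho> y - \<rho> x - gradient \<rho> x \<bullet> (y - x)\<bar> \<le> L * (norm (y - x))\<^sup>2"
proof -
  obtain L where L: "\<And>x y. norm (gradient \<rho> x - gradient \<rho> y) \<le> L * norm (x - y)"
    using assms by (rule test_fun_gradient_Lipschitz) blast
  have "\<bar>\<rho> y - \<rho> x - gradient \<rho> x \<bullet> (y - x)\<bar> \<le> \<bar>L\<bar> * (norm (y - x))\<^sup>2" for x y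
  proof -
    let ?f = "\<lambda>z. \<rho> z - gradient \<rho> x \<bullet> z"
    have "norm (?f y - ?f x) \<le> \<bar>L\<bar> * norm (y - x) * norm (y - x)"
    proof (rule differentiable_bound[of "cball x (norm (y - x))"])
      fix z assume z: "z \<in> cball x (norm (y - x))"
      show "(?f has_derivative (\<lambda>h. (gradient \<rho> z - gradient \<rho> x) \<bullet> h)) (at z within cball x (norm (y - x)))"
        by (auto intro!: derivative_eq_intros has_derivative_at_withinI[OF smooth_has_derivative]
            test_fun_smooth[OF assms] simp: inner_diff_left)
      have "norm (gradient \<rho> z - gradient \<rho> x) \<le> \<bar>L\<bar> * norm (y - x)"
      proof -
        have "L * norm (z - x) \<le> \<bar>L\<bar> * norm (y - x)"
          using z by (intro mult_mono) (auto simp: dist_norm norm_minus_commute)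
        then show ?thesis using L[of z x] by linarith
      qed
      then have "norm ((gradient \<rho> z - gradient \<rho> x) \<bullet> h) \<le> \<bar>L\<bar> * norm (y - x) * norm h" for h
        unfolding real_norm_def
        by (rule order_trans[OF Cauchy_Schwarz_ineq2 mult_right_mono]) simp
      then show "onorm ((\<bullet>) (gradient \<rho> z - gradient \<rho> x)) \<le> \<bar>L\<bar> * norm (y - x)"
        by (intro onorm_bound) auto
    qed (auto simp: dist_norm norm_minus_commute)
    then show ?thesis by (simp add: inner_diff_right power2_eq_square algebra_simps)
  qed
  then show thesis by (rule that)
qed

section \<open>Convolution over the domain\<close>

context bounded_open
begin

text \<open>Since only the domain is integrated over, this convolves with the extension of
  \<open>u\<close> by zero; a kernel that sees only the exterior produces the value 0.\<close>

definition conv :: "(real^'n \<Rightarrow> real) \<Rightarrow> (real^'n \<Rightarrow> real) \<Rightarrow> real^'n \<Rightarrow> real" where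
  "conv \<rho> u y = (\<integral>t. \<rho> (y - t) * u t \<partial>M)"

lemma bounded_mult_integrable:
  fixes m u :: "real^'n \<Rightarrow> real"
  assumes "m \<in> borel_measurable M" "\<And>x. x \<in> \<Omega> \<Longrightarrow> \<bar>m x\<bar> \<le> C" "integrable M u"
  shows "integrable M (\<lambda>x. m x * u x)"
proof (rule Bochner_Integration.integrable_bound)
  show "integrable M (\<lambda>x. C * \<bar>u x\<bar>)" using assms(3) by simp
  show "(\<lambda>x. m x * u x) \<in> borel_measurable M" using assms(1,3) by auto
  show "AE x in M. norm (m x * u x) \<le> norm (C * \<bar>u x\<bar>)"
  proof (rule AE_I2)
    fix x assume "x \<in> space M"
    then have "\<bar>m x\<bar> * \<bar>u x\<bar> \<le> C * \<bar>u x\<bar>" using assms(2) by (intro mult_right_mono) auto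
    then show "norm (m x * u x) \<le> norm (C * \<bar>u x\<bar>)"
      unfolding real_norm_def abs_mult[of "m x"] by (rule order_trans[OF _ abs_ge_self])
  qed
qed

lemma conv_integrable:
  assumes "test_fun A \<rho>" "integrable M u"
  shows "integrable M (\<lambda>t. \<rho> (y - t) * u t)"
proof -
  obtain C where C: "\<And>x. \<bar>\<rho> x\<bar> \<le> C" using assms(1) by (rule test_fun_bounded) blast
  show ?thesis
    by (rule bounded_mult_integrable[OF smooth_measurable_domain[OF smooth_reflect] _ assms(2), of _ _ C])
      (use C test_fun_smooth[OF assms(1)] in auto)
qed

lemma conv_has_derivative:
  assumes \<rho>: "test_fun A \<rho>" and u: "integrable M u"
  shows "(conv \<rho> u has_derivative (\<lambda>h. (\<chi> i. conv (\<lambda>s. gradient \<rho> s $ i) u y) \<bullet> h)) (at y)"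
proof -
  obtain L where L: "\<And>x y. \<bar>\<rho> y - \<rho> x - gradient \<rho> x \<bullet> (y - x)\<bar> \<le> L * (norm (y - x))\<^sup>2"
    using \<rho> by (rule test_fun_second_order) blast
  define I where "I = (\<integral>t. \<bar>u t\<bar> \<partial>M)"
  let ?D = "\<lambda>h. (\<chi> i. conv (\<lambda>s. gradient \<rho> s $ i) u y) \<bullet> h"
  have int: "integrable M (\<lambda>t. \<rho> (y - t) * u t)" for y by (rule conv_integrable[OF \<rho> u])
  have intg: "integrable M (\<lambda>t. gradient \<rho> (y - t) $ i * u t)" for i
    by (rule conv_integrable[OF test_fun_gradient_component[OF \<rho>] u])
  have Dh: "integrable M (\<lambda>t. (gradient \<rho> (y - t) \<bullet> h) * u t)" "?D h = (\<integral>t. (gradient \<rho> (y - t) \<bullet> h) * u t \<partial>M)" for h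
  proof -
    have eq: "(gradient \<rho> (y - t) \<bullet> h) * u t = (\<Sum>i\<in>UNIV. h $ i * (gradient \<rho> (y - t) $ i * u t))" for t
      by (simp add: inner_vec_def sum_distrib_right sum_distrib_left mult_ac)
    show "integrable M (\<lambda>t. (gradient \<rho> (y - t) \<bullet> h) * u t)"
      unfolding eq using intg by (intro Bochner_Integration.integrable_sum integrable_mult_right)
    show "?D h = (\<integral>t. (gradient \<rho> (y - t) \<bullet> h) * u t \<partial>M)"
      unfolding eq using intg by (simp add: inner_vec_def conv_def mult.commute)
  qed
  show ?thesis
  proof (rule has_derivativeI_sandwich[where e = 1 and H = "\<lambda>z. L * norm (z - y) * I"])
    show "bounded_linear ?D" by (rule bounded_linear_inner_right)
    show "((\<lambda>z. L * norm (z - y) * I) \<longlongrightarrow> 0) (at y)"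
      by (rule tendsto_eq_intros refl | simp)+
    fix z assume z: "z \<noteq> y"
    have "conv \<rho> u z - conv \<rho> u y - ?D (z - y) =
        (\<integral>t. (\<rho> (z - t) - \<rho> (y - t) - gradient \<rho> (y - t) \<bullet> (z - y)) * u t \<partial>M)"
      unfolding Dh(2) unfolding conv_def using int Dh(1) by (simp add: left_diff_distrib)
    also have "\<bar>\<dots>\<bar> \<le> (\<integral>t. L * (norm (z - y))\<^sup>2 * \<bar>u t\<bar> \<partial>M)"
    proof (rule order_trans[OF integral_abs_bound], rule integral_mono)
      show "integrable M (\<lambda>t. \<bar>(\<rho> (z - t) - \<rho> (y - t) - gradient \<rho> (y - t) \<bullet> (z - y)) * u t\<bar>)"
        using int Dh(1)[of "z - y"] by (simp add: left_diff_distrib)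
      show "integrable M (\<lambda>t. L * (norm (z - y))\<^sup>2 * \<bar>u t\<bar>)" using u by simp
      fix t
      have "\<bar>\<rho> (z - t) - \<rho> (y - t) - gradient \<rho> (y - t) \<bullet> (z - y)\<bar> \<le> L * (norm (z - y))\<^sup>2"
        using L[where y = "z - t" and x = "y - t"] by simp
      then show "\<bar>(\<rho> (z - t) - \<rho> (y - t) - gradient \<rho> (y - t) \<bullet> (z - y)) * u t\<bar> \<le> L * (norm (z - y))\<^sup>2 * \<bar>u t\<bar>"
        unfolding abs_mult by (rule mult_right_mono) simp
    qed
    also have "\<dots> = L * (norm (z - y))\<^sup>2 * I" by (simp add: I_def)
    finally show "norm (conv \<rho> u z - conv \<rho> u y - ?D (z - y)) / norm (z - y) \<le> L * norm (z - y) * I"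
      using z by (simp add: field_simps power2_eq_square)
  qed auto
qed

lemma smooth_conv:
  assumes "test_fun A \<rho>" "integrable M u"
  shows "smooth (conv \<rho> u)"
  unfolding smooth_def
proof
  fix k show "C_k k (conv \<rho> u)"
    using assms(1)
  proof (induction k arbitrary: \<rho>)
    case 0
    show ?case
      unfolding C_k.simps
      by (intro continuous_at_imp_continuous_on ballI
          has_derivative_continuous[OF conv_has_derivative[OF 0 assms(2)]])
  next
    case (Suc k)
    show ?case
      by (rule C_k_SucI[OF conv_has_derivative[OF Suc.prems assms(2)]])
        (use Suc.IH[OF test_fun_gradient_component[OF Suc.prems]] in simp)
  qed
qed

lemma gradient_conv:
  assumes "test_fun A \<rho>" "integrable M u"
  shows "gradient (conv \<rho> u) y = (\<chi> i. conv (\<lambda>s. gradient \<rho> s $ i) u y)"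
  by (rule gradient_eqI[OF conv_has_derivative[OF assms]])

lemma integral_domain_le:
  fixes f :: "real^'n \<Rightarrow> real"
  assumes "integrable lborel f" "\<And>x. 0 \<le> f x"
  shows "(\<integral>x. f x \<partial>M) \<le> (\<integral>x. f x \<partial>lborel)"
proof -
  have [measurable]: "f \<in> borel_measurable borel" using assms(1) by auto
  have i: "integrable lebesgue f" using assms(1) by (simp add: integrable_completion)
  have "(\<integral>x. f x \<partial>M) = (\<integral>x. indicator \<Omega> x *\<^sub>R f x \<partial>lebesgue)"
    by (subst integral_restrict_space) auto
  also have "\<dots> \<le> (\<integral>x. f x \<partial>lebesgue)"
    using integrable_mult_indicator[OF domain_sets i] i assms(2)
    by (intro integral_mono) (auto simp: indicator_def)
  also have "\<dots> = (\<integral>x. f x \<partial>lborel)" by (rule integral_completion) simp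
  finally show ?thesis .
qed

context
  fixes \<rho> :: "real^'n \<Rightarrow> real"
  assumes tf: "test_fun UNIV \<rho>" and pos: "\<And>x. 0 \<le> \<rho> x" and one: "(\<integral>x. \<rho> x \<partial>lborel) = 1"
begin

lemma kernel_measurable: "\<rho> \<in> borel_measurable borel"
  using smooth_measurable[OF test_fun_smooth[OF tf]] .

lemma kernel_integral_reflect: "integrable lborel (\<lambda>t. \<rho> (y - t))" "(\<integral>t. \<rho> (y - t) \<partial>lborel) = 1"
proof -
  have "(\<integral>t. \<rho> (y - t) \<partial>lborel) = 1"
    using integral_lborel_reflect[OF kernel_measurable, of y] one by simp
  then show "(\<integral>t. \<rho> (y - t) \<partial>lborel) = 1" "integrable lborel (\<lambda>t. \<rho> (y - t))"
    using not_integrable_integral_eq by fastforce+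
qed

lemma kernel_integral_shift: "integrable lborel (\<lambda>t. \<rho> (t - y))" "(\<integral>t. \<rho> (t - y) \<partial>lborel) = 1"
proof -
  have "(\<integral>t. \<rho> (t - y) \<partial>lborel) = 1"
    using integral_lborel_shift[OF kernel_measurable, of "- y"] one by simp
  then show "(\<integral>t. \<rho> (t - y) \<partial>lborel) = 1" "integrable lborel (\<lambda>t. \<rho> (t - y))"
    using not_integrable_integral_eq by fastforce+
qed

text \<open>Jensen's inequality for the kernel, from Cauchy-Schwarz after writing it as the product
  of two square roots; over the domain its mass is at most 1.\<close>

lemma conv_square_le:
  assumes "u \<in> sqint M"
  shows "(conv \<rho> u y)\<^sup>2 \<le> (\<integral>t. \<rho> (y - t) * (u t)\<^sup>2 \<partial>M)"
proof -
  have sm: "(\<lambda>t. \<rho> (y - t)) \<in> borel_measurable M"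
    by (rule smooth_measurable_domain[OF smooth_reflect[OF test_fun_smooth[OF tf]]])
  obtain C where C: "\<And>x. \<bar>\<rho> x\<bar> \<le> C" using tf by (rule test_fun_bounded) blast
  have m: "(\<lambda>t. sqrt (\<rho> (y - t))) \<in> borel_measurable M" using sm by simp
  have b: "\<bar>sqrt (\<rho> (y - t))\<bar> \<le> sqrt C" for t
    using C[of "y - t"] pos[of "y - t"] by simp
  have s1: "(\<lambda>t. sqrt (\<rho> (y - t)) *\<^sub>R u t) \<in> sqint M"
    using assms m b by (intro sqint_bounded_scale) auto
  have s2: "(\<lambda>t. sqrt (\<rho> (y - t)) *\<^sub>R (1::real)) \<in> sqint M"
    using m b by (intro sqint_bounded_scale[where u = "\<lambda>_. 1::real"]) auto
  have "(conv \<rho> u y)\<^sup>2 = (ip M (\<lambda>t. sqrt (\<rho> (y - t)) *\<^sub>R (1::real)) (\<lambda>t. sqrt (\<rho> (y - t)) *\<^sub>R u t))\<^sup>2"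
    unfolding conv_def ip_def using pos by (simp add: mult.assoc[symmetric])
  also have "\<dots> \<le> ip M (\<lambda>t. sqrt (\<rho> (y - t)) *\<^sub>R (1::real)) (\<lambda>t. sqrt (\<rho> (y - t)) *\<^sub>R (1::real)) *
      ip M (\<lambda>t. sqrt (\<rho> (y - t)) *\<^sub>R u t) (\<lambda>t. sqrt (\<rho> (y - t)) *\<^sub>R u t)"
    by (rule ip_Cauchy_Schwarz[OF s2 s1])
  also have "\<dots> = (\<integral>t. \<rho> (y - t) \<partial>M) * (\<integral>t. \<rho> (y - t) * (u t)\<^sup>2 \<partial>M)"
    using pos by (simp add: ip_self power_mult_distrib)
  also have "\<dots> \<le> 1 * (\<integral>t. \<rho> (y - t) * (u t)\<^sup>2 \<partial>M)"
    using integral_domain_le[OF kernel_integral_reflect(1)[of y]] kernel_integral_reflect(2)[of y] pos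
    by (intro mult_right_mono) auto
  finally show ?thesis by simp
qed

text \<open>Integrating the pointwise bound and exchanging the integrals by Tonelli leaves the mass
  of the kernel in its other variable, again at most 1.\<close>

lemma conv_contraction:
  assumes u: "u \<in> sqint M"
  shows "ip M (conv \<rho> u) (conv \<rho> u) \<le> ip M u u"
proof -
  have fm: "finite_measure M" by (rule finite_measure_domain)
  then interpret M2: pair_sigma_finite M M
    by (simp add: pair_sigma_finite_def finite_measure.axioms(1))
  have ui: "integrable M u" using u by (rule sqint_imp_integrable)
  have [measurable]: "u \<in> borel_measurable M" using u by (rule sqint_measurable)
  have idm [measurable]: "(\<lambda>x. x) \<in> M \<rightarrow>\<^sub>M borel"
    by (rule continuous_measurable_domain) auto
  have [measurable]: "\<rho> \<in> borel_measurable borel" by (rule kernel_measurable)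
  have cs: "conv \<rho> u \<in> sqint M" using smooth_conv[OF tf ui] by blast
  have u2: "integrable M (\<lambda>t. (u t)\<^sup>2)" using sqint_integrable[OF u] by simp
  have "ennreal (ip M (conv \<rho> u) (conv \<rho> u)) = (\<integral>\<^sup>+y. ennreal ((conv \<rho> u y)\<^sup>2) \<partial>M)"
    using sqint_integrable[OF cs] by (subst nn_integral_eq_integral) (auto simp: ip_self)
  also have "\<dots> \<le> (\<integral>\<^sup>+y. (\<integral>\<^sup>+t. ennreal (\<rho> (y - t) * (u t)\<^sup>2) \<partial>M) \<partial>M)"
  proof (rule nn_integral_mono)
    fix y
    have "(\<integral>\<^sup>+t. ennreal (\<rho> (y - t) * (u t)\<^sup>2) \<partial>M) = ennreal (\<integral>t. \<rho> (y - t) * (u t)\<^sup>2 \<partial>M)"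
      using conv_integrable[OF tf u2] pos by (intro nn_integral_eq_integral) auto
    then show "ennreal ((conv \<rho> u y)\<^sup>2) \<le> (\<integral>\<^sup>+t. ennreal (\<rho> (y - t) * (u t)\<^sup>2) \<partial>M)"
      using conv_square_le[OF u] by (simp add: ennreal_leI)
  qed
  also have "\<dots> = (\<integral>\<^sup>+t. (\<integral>\<^sup>+y. ennreal (\<rho> (y - t) * (u t)\<^sup>2) \<partial>M) \<partial>M)"
    by (rule M2.Fubini') measurable
  also have "\<dots> \<le> (\<integral>\<^sup>+t. ennreal ((u t)\<^sup>2) \<partial>M)"
  proof (rule nn_integral_mono)
    fix t
    have sm: "smooth (\<lambda>y. \<rho> (y - t))"
      using smooth_reflect[OF smooth_reflect[OF test_fun_smooth[OF tf], of 0], of t] by simp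
    obtain C where C: "\<And>x. \<bar>\<rho> x\<bar> \<le> C" using tf by (rule test_fun_bounded) blast
    have i: "integrable M (\<lambda>y. \<rho> (y - t))"
      using smooth_measurable_domain[OF sm] C
      by (intro finite_measure.integrable_const_bound[OF fm, of _ C]) auto
    have "(\<integral>\<^sup>+y. ennreal (\<rho> (y - t) * (u t)\<^sup>2) \<partial>M) = ennreal (\<integral>y. \<rho> (y - t) * (u t)\<^sup>2 \<partial>M)"
      using i pos by (intro nn_integral_eq_integral) auto
    also have "(\<integral>y. \<rho> (y - t) * (u t)\<^sup>2 \<partial>M) \<le> 1 * (u t)\<^sup>2"
      using integral_domain_le[OF kernel_integral_shift(1)[of t]] kernel_integral_shift(2)[of t] pos
      by (subst integral_mult_left_zero) (intro mult_right_mono, auto)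
    finally show "(\<integral>\<^sup>+y. ennreal (\<rho> (y - t) * (u t)\<^sup>2) \<partial>M) \<le> ennreal ((u t)\<^sup>2)"
      by (simp add: ennreal_leI)
  qed
  also have "\<dots> = ennreal (ip M u u)"
    using u2 by (subst nn_integral_eq_integral) (auto simp: ip_self)
  finally show ?thesis by (simp add: ennreal_le_iff)
qed

lemma conv_test_fun_le:
  assumes \<phi>: "test_fun \<Omega> \<phi>" and L: "L \<ge> 0" "\<And>x y. \<bar>\<phi> x - \<phi> y\<bar> \<le> L * norm (x - y)"
    and supp: "\<And>x. norm x > \<delta> \<Longrightarrow> \<rho> x = 0"
  shows "\<bar>conv \<rho> \<phi> y - \<phi> y\<bar> \<le> L * \<delta>"
proof -
  have tf': "test_fun \<Omega> (\<lambda>t. \<rho> (y - t) * \<phi> t)"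
    using smooth_reflect[OF test_fun_smooth[OF tf]] \<phi> by (rule test_fun_mult)
  have "conv \<rho> \<phi> y = (\<integral>t. \<rho> (y - t) * \<phi> t \<partial>lborel)"
    unfolding conv_def by (rule test_fun_integral[OF tf'])
  moreover have "\<phi> y = (\<integral>t. \<rho> (y - t) * \<phi> y \<partial>lborel)"
    using kernel_integral_reflect by simp
  ultimately have "conv \<rho> \<phi> y - \<phi> y = (\<integral>t. \<rho> (y - t) * \<phi> t \<partial>lborel) - (\<integral>t. \<rho> (y - t) * \<phi> y \<partial>lborel)"
    by simp
  also have "\<dots> = (\<integral>t. \<rho> (y - t) * (\<phi> t - \<phi> y) \<partial>lborel)"
    using test_fun_integrable[OF tf'] kernel_integral_reflect(1)[of y]
    by (simp add: right_diff_distrib)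
  also have "\<bar>\<dots>\<bar> \<le> (\<integral>t. \<rho> (y - t) * (L * \<delta>) \<partial>lborel)"
  proof (rule order_trans[OF integral_abs_bound], rule integral_mono)
    show "integrable lborel (\<lambda>t. \<bar>\<rho> (y - t) * (\<phi> t - \<phi> y)\<bar>)"
      using test_fun_integrable[OF tf'] kernel_integral_reflect(1)[of y]
      by (simp add: right_diff_distrib)
    show "integrable lborel (\<lambda>t. \<rho> (y - t) * (L * \<delta>))"
      using kernel_integral_reflect(1)[of y] by simp
    fix t
    show "\<bar>\<rho> (y - t) * (\<phi> t - \<phi> y)\<bar> \<le> \<rho> (y - t) * (L * \<delta>)"
    proof (cases "norm (y - t) > \<delta>")
      case False
      have "\<bar>\<phi> t - \<phi> y\<bar> \<le> L * norm (t - y)" by (rule L(2))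
      also have "\<dots> \<le> L * \<delta>" using False L(1) by (intro mult_left_mono) (auto simp: norm_minus_commute)
      finally show ?thesis using pos[of "y - t"] by (simp add: abs_mult mult_left_mono)
    qed (use supp in simp)
  qed
  also have "\<dots> = L * \<delta>" using kernel_integral_reflect by simp
  finally show ?thesis .
qed

end

lemma sqint_triangle3:
  fixes a b c :: "real^'n \<Rightarrow> 'b::euclidean_space"
  assumes "a \<in> sqint M" "b \<in> sqint M" "c \<in> sqint M"
  shows "ip M (\<lambda>x. a x + b x + c x) (\<lambda>x. a x + b x + c x) \<le> 4 * ip M a a + 4 * ip M b b + 2 * ip M c c"
proof -
  have le: "ip M (\<lambda>x. u x + v x) (\<lambda>x. u x + v x) \<le> 2 * ip M u u + 2 * ip M v v"
    if "u \<in> sqint M" "v \<in> sqint M" for u v :: "real^'n \<Rightarrow> 'b"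
  proof -
    have "ip M (\<lambda>x. u x - (-1) *\<^sub>R v x) (\<lambda>x. u x - (-1) *\<^sub>R v x) \<le>
        2 * ip M u u + 2 * ip M (\<lambda>x. (-1) *\<^sub>R v x) (\<lambda>x. (-1) *\<^sub>R v x)"
      using that sqint_scale[of v M "-1"] by (intro ip_self_diff)
    then show ?thesis by (simp add: ip_self)
  qed
  show ?thesis
    using le[OF sqint_add[OF assms(1,2)] assms(3)] le[OF assms(1,2)] by linarith
qed

text \<open>Density: for a test function the convergence is uniform by the Lipschitz bound, and the
  contraction property controls the error of replacing \<open>u\<close> by a test function,
  uniformly in \<open>k\<close>.\<close>

theorem conv_tendsto:
  fixes \<rho> :: "nat \<Rightarrow> real^'n \<Rightarrow> real"
  assumes tf: "\<And>k. test_fun UNIV (\<rho> k)" and pos: "\<And>k x. 0 \<le> \<rho> k x"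
    and one: "\<And>k. (\<integral>x. \<rho> k x \<partial>lborel) = 1"
    and supp: "\<And>k x. norm x > \<delta> k \<Longrightarrow> \<rho> k x = 0" "\<delta> \<longlonglongrightarrow> 0"
    and u: "u \<in> sqint M"
  shows "(\<lambda>k. ip M (\<lambda>x. conv (\<rho> k) u x - u x) (\<lambda>x. conv (\<rho> k) u x - u x)) \<longlonglongrightarrow> 0"
proof (rule LIMSEQ_I)
  fix e :: real assume e: "e > 0"
  obtain \<phi> where \<phi>: "\<And>j::nat. test_fun \<Omega> (\<phi> j)"
    "(\<lambda>j. ip M (\<lambda>x. u x - \<phi> j x) (\<lambda>x. u x - \<phi> j x)) \<longlonglongrightarrow> 0"
    using u by (rule test_fun_dense) blast
  \<comment> \<open>The three-term estimate has weights 4, 4 and 2. Two errors below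
    \<open>e / 12\<close> contribute at most \<open>2 * e / 3\<close>, leaving \<open>e / 3\<close>
    for the uniform error of the test function.\<close>
  have "\<forall>\<^sub>F j in sequentially. ip M (\<lambda>x. u x - \<phi> j x) (\<lambda>x. u x - \<phi> j x) < e / 12"
    using \<phi>(2) e by (intro order_tendstoD) auto
  then obtain j where j: "ip M (\<lambda>x. u x - \<phi> j x) (\<lambda>x. u x - \<phi> j x) < e / 12"
    by (auto simp: eventually_sequentially)
  define f where "f = \<phi> j"
  have f: "test_fun \<Omega> f" "f \<in> sqint M" using \<phi>(1) by (auto simp: f_def)
  obtain L where L: "L \<ge> 0" "\<And>x y. \<bar>f x - f y\<bar> \<le> L * norm (x - y)"
    using f(1) by (rule test_fun_Lipschitz) blast
  have d: "(\<lambda>x. u x - f x) \<in> sqint M" using u f by blast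
  note int = sqint_imp_integrable[OF u] sqint_imp_integrable[OF f(2)] sqint_imp_integrable[OF d]
  have cs: "conv (\<rho> k) v \<in> sqint M" if "integrable M v" for k v
    using smooth_conv[OF tf that] by blast
  let ?m = "measure M (space M)"
  have le: "ip M (\<lambda>x. conv (\<rho> k) u x - u x) (\<lambda>x. conv (\<rho> k) u x - u x) \<le> 2 * e / 3 + 2 * ((L * \<delta> k)\<^sup>2 * ?m)" for k
  proof -
    have split: "conv (\<rho> k) u x = conv (\<rho> k) (\<lambda>x. u x - f x) x + conv (\<rho> k) f x" for x
      unfolding conv_def using conv_integrable[OF tf int(1)] conv_integrable[OF tf int(2)]
      by (simp add: right_diff_distrib)
    have "ip M (\<lambda>x. conv (\<rho> k) u x - u x) (\<lambda>x. conv (\<rho> k) u x - u x) =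
        ip M (\<lambda>x. conv (\<rho> k) (\<lambda>x. u x - f x) x + (f x - u x) + (conv (\<rho> k) f x - f x))
          (\<lambda>x. conv (\<rho> k) (\<lambda>x. u x - f x) x + (f x - u x) + (conv (\<rho> k) f x - f x))"
      by (simp add: split algebra_simps)
    also have "\<dots> \<le> 4 * ip M (conv (\<rho> k) (\<lambda>x. u x - f x)) (conv (\<rho> k) (\<lambda>x. u x - f x)) +
        4 * ip M (\<lambda>x. f x - u x) (\<lambda>x. f x - u x) +
        2 * ip M (\<lambda>x. conv (\<rho> k) f x - f x) (\<lambda>x. conv (\<rho> k) f x - f x)"
      using cs int f u by (intro sqint_triangle3) auto
    also have "ip M (conv (\<rho> k) (\<lambda>x. u x - f x)) (conv (\<rho> k) (\<lambda>x. u x - f x)) \<le> e / 12"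
      using conv_contraction[OF tf pos one d, of k] j by (simp add: f_def)
    also have "ip M (\<lambda>x. f x - u x) (\<lambda>x. f x - u x) \<le> e / 12"
      using j by (simp add: f_def ip_self power2_commute)
    also have "ip M (\<lambda>x. conv (\<rho> k) f x - f x) (\<lambda>x. conv (\<rho> k) f x - f x) \<le> (L * \<delta> k)\<^sup>2 * ?m"
    proof -
      have "ip M (\<lambda>x. conv (\<rho> k) f x - f x) (\<lambda>x. conv (\<rho> k) f x - f x) \<le> (\<integral>x. (L * \<delta> k)\<^sup>2 \<partial>M)"
        unfolding ip_self
      proof (rule integral_mono)
        show "integrable M (\<lambda>x. (norm (conv (\<rho> k) f x - f x))\<^sup>2)"
          using cs int f by (intro sqint_integrable sqint_diff) auto
        show "integrable M (\<lambda>x. (L * \<delta> k)\<^sup>2)"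
          by (rule finite_measure.integrable_const[OF finite_measure_domain])
        show "(norm (conv (\<rho> k) f x - f x))\<^sup>2 \<le> (L * \<delta> k)\<^sup>2" for x
        proof (rule power_mono)
          show "norm (conv (\<rho> k) f x - f x) \<le> L * \<delta> k"
            unfolding real_norm_def by (rule conv_test_fun_le[OF tf pos one f(1) L supp(1)])
        qed simp
      qed
      then show ?thesis by (simp add: mult.commute)
    qed
    finally show ?thesis by simp
  qed
  have "(\<lambda>k. 2 * ((L * \<delta> k)\<^sup>2 * ?m)) \<longlonglongrightarrow> 2 * ((L * 0)\<^sup>2 * ?m)"
    by (intro tendsto_mult tendsto_power tendsto_const supp(2))
  from order_tendstoD(2)[OF this, of "e / 3"] e
  have "\<forall>\<^sub>F k in sequentially. 2 * ((L * \<delta> k)\<^sup>2 * ?m) < e / 3" by simp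
  then obtain N where N: "\<And>k. k \<ge> N \<Longrightarrow> 2 * ((L * \<delta> k)\<^sup>2 * ?m) < e / 3"
    by (auto simp: eventually_sequentially)
  show "\<exists>N. \<forall>k\<ge>N. norm (ip M (\<lambda>x. conv (\<rho> k) u x - u x) (\<lambda>x. conv (\<rho> k) u x - u x) - 0) < e"
  proof (intro exI allI impI)
    fix k assume "N \<le> k"
    from N[OF this] le[of k] show "norm (ip M (\<lambda>x. conv (\<rho> k) u x - u x) (\<lambda>x. conv (\<rho> k) u x - u x) - 0) < e"
      by simp
  qed
qed

end

section \<open>Green's formula at flat boundary points\<close>

context bounded_open
begin

text \<open>Cut-offs depending only on the signed distance to the face, zero beyond it and in a thin
  layer before it. Their gradient is nonzero only where the distance times \<open>Suc k\<close> lies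
  between 1 and 2, so it is of the order of the inverse distance there. Multiplied by a function
  vanishing on the face it is bounded uniformly in \<open>k\<close>.\<close>

lemma flat_cutoff:
  fixes x0 n :: "real^'n"
  obtains c :: "nat \<Rightarrow> real^'n \<Rightarrow> real" and m :: "nat \<Rightarrow> real^'n \<Rightarrow> real" and L
  where "\<And>k. smooth (c k)" "\<And>k x. 0 \<le> c k x" "\<And>k x. c k x \<le> 1"
    "\<And>k x. gradient (c k) x = m k x *\<^sub>R n" "\<And>k. continuous_on UNIV (m k)"
    "\<And>k x. (x - x0) \<bullet> n > - inverse (real (Suc k)) \<Longrightarrow> c k x = 0"
    "\<And>k x. \<bar>m k x\<bar> * \<bar>(x - x0) \<bullet> n\<bar> \<le> L"
    "\<And>x. (x - x0) \<bullet> n < 0 \<Longrightarrow> \<forall>\<^sub>F k in sequentially. c k x = 1 \<and> m k x = 0"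
proof -
  obtain d L where dL: "\<And>t. (plateau has_real_derivative d t) (at t)" "\<And>t. \<bar>d t\<bar> \<le> L"
    "\<And>t. t < 0 \<or> t > 1 \<Longrightarrow> d t = 0"
    by (rule plateau_deriv_bounded) (rule that)
  define \<tau> where "\<tau> x = (x - x0) \<bullet> n" for x
  define N where "N k = real (Suc k)" for k
  have N: "N k \<ge> 1" for k by (simp add: N_def)
  define f where "f k x = - N k * \<tau> x - 1" for k x
  define c where "c k x = plateau (f k x)" for k x
  define m where "m k x = - N k * d (f k x)" for k x
  have f': "f k = (\<lambda>x. - N k * (x \<bullet> n) + (N k * (x0 \<bullet> n) - 1))" for k
    by (auto simp: f_def \<tau>_def inner_diff_left algebra_simps)
  have sf: "smooth (f k)" for k unfolding f' by (intro smooth_add smooth_mult) auto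
  have gf: "gradient (f k) x = - N k *\<^sub>R n" for k x
    unfolding f' by (rule gradient_eqI) (auto intro!: derivative_eq_intros simp: inner_commute)
  have sc: "smooth (c k)" for k unfolding c_def[abs_def] using sf by (rule smooth_plateau)
  have gc: "gradient (c k) x = m k x *\<^sub>R n" for k x
    unfolding c_def[abs_def] gradient_compose[OF sf dL(1)] gf m_def by simp
  have L0: "L \<ge> 0" using dL(2)[of 0] by linarith
  show thesis
  proof (rule that[of c m "2 * L"])
    show "continuous_on UNIV (m k)" for k
    proof -
      \<comment> \<open>The derivative was obtained with bounds only; uniqueness of derivatives
        identifies it with the explicit quotient, which is continuous.\<close>
      have d': "d t = expinv 2 t / (expinv 0 t + expinv 0 (1 - t)) -
          expinv 0 t * (expinv 2 t - expinv 2 (1 - t)) / ((expinv 0 t + expinv 0 (1 - t)) * (expinv 0 t + expinv 0 (1 - t)))" for t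
      proof (rule DERIV_unique[OF dL(1)])
        have e: "(expinv 0 has_real_derivative expinv 2 t) (at t)" for t
          using expinv_deriv[of 0 t] by (simp add: numeral_2_eq_2)
        have e1: "((\<lambda>t. expinv 0 (1 - t)) has_real_derivative - expinv 2 (1 - t)) (at t)" for t
        proof -
          have "((\<lambda>t. 1 - t) has_real_derivative -1) (at t)"
            by (auto intro!: derivative_eq_intros)
          from DERIV_chain2[OF e this] show ?thesis by simp
        qed
        have nz: "expinv 0 t + expinv 0 (1 - t) \<noteq> 0" using plateau_denominator[of t] by simp
        show "(plateau has_real_derivative (expinv 2 t / (expinv 0 t + expinv 0 (1 - t)) -
          expinv 0 t * (expinv 2 t - expinv 2 (1 - t)) / ((expinv 0 t + expinv 0 (1 - t)) * (expinv 0 t + expinv 0 (1 - t))))) (at t)"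
          unfolding plateau_def[abs_def]
          by (rule DERIV_cong[OF DERIV_divide[OF e DERIV_add[OF e e1] nz]])
            (use nz in \<open>simp add: divide_simps\<close>)
      qed
      have ce: "continuous_on UNIV (expinv j)" for j
        by (meson DERIV_isCont continuous_at_imp_continuous_on expinv_deriv)
      have ce': "continuous_on UNIV (\<lambda>t. expinv j (1 - t))" for j
        by (rule continuous_on_compose2[OF ce]) (auto intro!: continuous_intros)
      have "continuous_on UNIV d"
        unfolding d'[abs_def] using plateau_denominator
        by (intro continuous_intros ce ce') (auto simp: less_imp_neq[symmetric] neq_iff)
      then have "continuous_on UNIV (\<lambda>x. d (f k x))"
        by (rule continuous_on_compose2) (auto intro: smooth_continuous_on[OF sf])
      then show ?thesis unfolding m_def[abs_def] by (intro continuous_intros)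
    qed
    show "c k x = 0" if "(x - x0) \<bullet> n > - inverse (real (Suc k))" for k x
    proof -
      have "\<tau> x > - inverse (N k)" using that by (simp add: \<tau>_def N_def)
      then have "N k * \<tau> x > N k * (- inverse (N k))" using N[of k] by (intro mult_strict_left_mono) auto
      then have "f k x \<le> 0" using N[of k] by (simp add: f_def)
      then show ?thesis by (simp add: c_def plateau_0)
    qed
    show "\<bar>m k x\<bar> * \<bar>(x - x0) \<bullet> n\<bar> \<le> 2 * L" for k x
    proof (cases "f k x < 0 \<or> f k x > 1")
      case True
      then show ?thesis using L0 by (simp add: m_def dL(3))
    next
      case False
      then have "\<bar>N k * \<tau> x\<bar> \<le> 2" by (auto simp: f_def)
      then have "\<bar>d (f k x)\<bar> * \<bar>N k * \<tau> x\<bar> \<le> L * 2" using dL(2) L0 by (intro mult_mono) auto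
      then show ?thesis by (simp add: m_def \<tau>_def abs_mult mult_ac)
    qed
    show "\<forall>\<^sub>F k in sequentially. c k x = 1 \<and> m k x = 0" if "(x - x0) \<bullet> n < 0" for x
    proof -
      have t: "\<tau> x < 0" using that by (simp add: \<tau>_def)
      obtain K where K: "2 / - \<tau> x < real K" using reals_Archimedean2 by blast
      show ?thesis
        using eventually_ge_at_top[of K]
      proof eventually_elim
        case (elim k)
        have "2 / - \<tau> x < N k" using K elim by (simp add: N_def)
        then have "2 < N k * - \<tau> x" using t pos_divide_less_eq[of "- \<tau> x" 2 "N k"] by simp
        then have "f k x > 1" by (simp add: f_def)
        then show ?case by (simp add: c_def m_def plateau_1 dL(3) less_imp_le)
      qed
    qed
  qed (use sc gc in \<open>auto simp: c_def plateau_bounds\<close>)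
qed

lemma test_fun_le_hyperplane_dist:
  fixes y :: "real^'n \<Rightarrow> real"
  assumes "test_fun A y" "norm n = 1" "\<And>z. (z - x0) \<bullet> n = 0 \<Longrightarrow> y z = 0"
  obtains C where "C \<ge> 0" "\<And>z. \<bar>y z\<bar> \<le> C * \<bar>(z - x0) \<bullet> n\<bar>"
proof -
  obtain C where C: "C \<ge> 0" "\<And>x z. \<bar>y x - y z\<bar> \<le> C * norm (x - z)"
    using assms(1) by (rule test_fun_Lipschitz) blast
  have "\<bar>y z\<bar> \<le> C * \<bar>(z - x0) \<bullet> n\<bar>" for z
  proof -
    let ?p = "z - ((z - x0) \<bullet> n) *\<^sub>R n"
    have "n \<bullet> n = 1" using assms(2) by (simp add: dot_square_norm)
    then have "(?p - x0) \<bullet> n = 0" by (simp add: inner_diff_left)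
    then have "y ?p = 0" by (rule assms(3))
    then show ?thesis using C(2)[of z ?p] assms(2) by simp
  qed
  with C(1) show thesis by (rule that)
qed

text \<open>The support of \<open>y\<close> may cross the face, but its part below the level
  \<open>- e\<close> is compact and lies in the half ball that belongs to the domain.\<close>

lemma flat_point_cutoff_test_fun:
  assumes fp: "flat_point \<Omega> x0 n r" and y: "test_fun (ball x0 r) y" and c: "smooth c"
    and c0: "\<And>x. (x - x0) \<bullet> n > - e \<Longrightarrow> c x = 0" and e: "e > 0"
  shows "test_fun \<Omega> (\<lambda>x. c x * y x)"
proof -
  obtain K where K: "smooth y" "compact K" "K \<subseteq> ball x0 r" "\<And>x. x \<notin> K \<Longrightarrow> y x = 0"
    using y by (rule test_funE) blast
  let ?H = "{x. (x - x0) \<bullet> n \<le> - e}"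
  have "closed ?H" by (intro closed_Collect_le continuous_intros)
  then have "compact (K \<inter> ?H)" by (rule compact_Int_closed[OF K(2)])
  moreover have "K \<inter> ?H \<subseteq> \<Omega>"
  proof
    fix x assume x: "x \<in> K \<inter> ?H"
    then have "x \<in> {y \<in> ball x0 r. (y - x0) \<bullet> n < 0}" using K(3) e by auto
    then show "x \<in> \<Omega>" using fp unfolding flat_point_def by blast
  qed
  ultimately show ?thesis
    by (rule test_funI[OF smooth_mult[OF c K(1)]]) (use K(4) c0 in force)
qed

text \<open>As \<open>y\<close> vanishes on the face, it is dominated by the distance to it, so
  \<open>m k x * y x\<close> is bounded. At each point of the half ball \<open>m k\<close> is
  eventually zero, and dominated convergence removes the term with the gradient of the
  cut-off.\<close>

lemma flat_cutoff_limit: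
  assumes fp: "flat_point \<Omega> x0 n r"
    and c: "\<And>k. c k \<in> borel_measurable M" "\<And>k x. 0 \<le> c k x" "\<And>k x. c k x \<le> 1"
    and m: "\<And>k. m k \<in> borel_measurable M" "\<And>k x. \<bar>m k x\<bar> * \<bar>(x - x0) \<bullet> n\<bar> \<le> L"
    and ev: "\<And>x. (x - x0) \<bullet> n < 0 \<Longrightarrow> \<forall>\<^sub>F k in sequentially. c k x = 1 \<and> m k x = 0"
    and f: "integrable M f" "\<And>x. x \<in> \<Omega> \<Longrightarrow> x \<notin> ball x0 r \<Longrightarrow> f x = 0"
    and y: "test_fun (ball x0 r) y" "\<And>z. (z - x0) \<bullet> n = 0 \<Longrightarrow> y z = 0"
    and u: "integrable M u"
    and zero: "\<And>k. (\<integral>x. c k x * f x + m k x * y x * u x \<partial>M) = 0"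
  shows "(\<integral>x. f x \<partial>M) = (0::real)"
proof -
  have n: "norm n = 1" using fp by (simp add: flat_point_def)
  obtain C where C: "C \<ge> 0" "\<And>z. \<bar>y z\<bar> \<le> C * \<bar>(z - x0) \<bullet> n\<bar>"
    using y(1) n y(2) by (rule test_fun_le_hyperplane_dist) blast+
  have my: "\<bar>m k x * y x\<bar> \<le> C * L" for k x
  proof -
    have "\<bar>m k x\<bar> * \<bar>y x\<bar> \<le> \<bar>m k x\<bar> * (C * \<bar>(x - x0) \<bullet> n\<bar>)" using C(2) by (rule mult_left_mono) simp
    also have "\<dots> = C * (\<bar>m k x\<bar> * \<bar>(x - x0) \<bullet> n\<bar>)" by simp
    also have "\<dots> \<le> C * L" using m(2) C(1) by (rule mult_left_mono)
    finally show ?thesis by (simp add: abs_mult)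
  qed
  have [measurable]: "f \<in> borel_measurable M" "u \<in> borel_measurable M" using f u by auto
  have [measurable]: "y \<in> borel_measurable M"
    using smooth_measurable_domain[OF test_fun_smooth[OF y(1)]] .
  note [measurable] = c(1) m(1)
  have "(\<lambda>k. \<integral>x. c k x * f x + m k x * y x * u x \<partial>M) \<longlonglongrightarrow> (\<integral>x. f x \<partial>M)"
  proof (rule integral_dominated_convergence[where w = "\<lambda>x. \<bar>f x\<bar> + C * L * \<bar>u x\<bar>"])
    show "integrable M (\<lambda>x. \<bar>f x\<bar> + C * L * \<bar>u x\<bar>)" using f u by simp
    show "AE x in M. (\<lambda>k. c k x * f x + m k x * y x * u x) \<longlonglongrightarrow> f x"
    proof (rule AE_I2)
      fix x assume x: "x \<in> space M"
      show "(\<lambda>k. c k x * f x + m k x * y x * u x) \<longlonglongrightarrow> f x"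
      proof (cases "x \<in> ball x0 r")
        case True
        then have "(x - x0) \<bullet> n < 0" using fp x unfolding flat_point_def by auto
        from ev[OF this] have "\<forall>\<^sub>F k in sequentially. c k x * f x + m k x * y x * u x = f x"
          by eventually_elim simp
        then show ?thesis by (rule tendsto_eventually)
      next
        case False
        then have "y x = 0" "f x = 0" using test_fun_outside[OF y(1)] f(2) x by auto
        then show ?thesis by simp
      qed
    qed
    show "AE x in M. norm (c k x * f x + m k x * y x * u x) \<le> \<bar>f x\<bar> + C * L * \<bar>u x\<bar>" for k
    proof (rule AE_I2)
      fix x
      have "\<bar>c k x * f x\<bar> \<le> \<bar>f x\<bar>" using c(2,3)[of k x] by (simp add: abs_mult mult_left_le_one_le)
      moreover have "\<bar>m k x * y x * u x\<bar> \<le> C * L * \<bar>u x\<bar>"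
        unfolding abs_mult[of _ "u x"] using my by (rule mult_right_mono) simp
      ultimately show "norm (c k x * f x + m k x * y x * u x) \<le> \<bar>f x\<bar> + C * L * \<bar>u x\<bar>"
        unfolding real_norm_def by linarith
    qed
  qed measurable
  then show ?thesis unfolding zero by (simp add: LIMSEQ_const_iff)
qed

text \<open>Multiplied by the cut-off, \<open>y\<close> becomes a genuine test function inside the
  domain. The resulting error is \<open>m k * y\<close> times the normal component of
  \<open>v\<close>, and it disappears since \<open>y\<close> vanishes on the face.\<close>

lemma flat_point_pair_ip_Hdiv:
  assumes fp: "flat_point \<Omega> x0 n r" and y: "test_fun (ball x0 r) y" "\<And>z. (z - x0) \<bullet> n = 0 \<Longrightarrow> y z = 0"
    and v: "weak_div v q"
  shows "pair_ip q v y (gradient y) = 0"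
proof -
  obtain c m L where c: "\<And>k::nat. smooth (c k)" "\<And>k x. 0 \<le> c k x" "\<And>k x. c k x \<le> 1"
    "\<And>k x. gradient (c k) x = m k x *\<^sub>R n" "\<And>k. continuous_on UNIV (m k)"
    "\<And>k x. (x - x0) \<bullet> n > - inverse (real (Suc k)) \<Longrightarrow> c k x = 0"
    "\<And>k x. \<bar>m k x\<bar> * \<bar>(x - x0) \<bullet> n\<bar> \<le> L"
    "\<And>x. (x - x0) \<bullet> n < 0 \<Longrightarrow> \<forall>\<^sub>F k in sequentially. c k x = 1 \<and> m k x = 0"
    by (rule flat_cutoff[of n x0]) (rule that)
  note vs = weak_divD[OF v]
  have ys: "smooth y" using y(1) by (rule test_fun_smooth)
  have "(\<integral>x. q x * y x + v x \<bullet> gradient y x \<partial>M) = 0"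
  proof (rule flat_cutoff_limit[OF fp smooth_measurable_domain[OF c(1)] c(2,3)
        continuous_measurable_domain[OF c(5)] c(7,8) _ _ y])
    show "integrable M (\<lambda>x. q x * y x + v x \<bullet> gradient y x)"
      using vs ys by (intro Bochner_Integration.integrable_add) auto
    show "q x * y x + v x \<bullet> gradient y x = 0" if "x \<notin> ball x0 r" for x
      using test_fun_outside[OF y(1) that] test_fun_outside[OF test_fun_gradient_component[OF y(1)] that]
      by (simp add: inner_vec_def)
    show "integrable M (\<lambda>x. v x \<bullet> n)" using vs by (intro sqint_imp_integrable) auto
    fix k
    have tf: "test_fun \<Omega> (\<lambda>x. c k x * y x)"
      by (rule flat_point_cutoff_test_fun[OF fp y(1) c(1,6)]) auto
    have "0 = pair_ip q v (\<lambda>x. c k x * y x) (gradient (\<lambda>x. c k x * y x))"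
      using pair_ip_test_fun[OF v tf] by simp
    also have "\<dots> = (\<integral>x. c k x * (q x * y x + v x \<bullet> gradient y x) + m k x * y x * (v x \<bullet> n) \<partial>M)"
      unfolding ip_def gradient_mult[OF c(1) ys] c(4) by (simp add: inner_add_right algebra_simps)
    finally show "(\<integral>x. c k x * (q x * y x + v x \<bullet> gradient y x) + m k x * y x * (v x \<bullet> n) \<partial>M) = 0" ..
  qed auto
  then show ?thesis by (simp add: ip_def)
qed

text \<open>The dual version, with a smooth field against an H1 function. The gradient of the
  cut-off is parallel to \<open>n\<close>, so only the normal component of \<open>Y\<close>, which
  vanishes on the face, enters the error.\<close>

lemma flat_point_pair_ip_H1:
  assumes fp: "flat_point \<Omega> x0 n r" and Y: "\<And>i. test_fun (ball x0 r) (\<lambda>x. Y x $ i)"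
    and Yn: "\<And>z. (z - x0) \<bullet> n = 0 \<Longrightarrow> Y z \<bullet> n = 0"
    and z: "weak_grad z g"
  shows "pair_ip (div_smooth Y) Y z g = 0"
proof -
  obtain c m L where c: "\<And>k::nat. smooth (c k)" "\<And>k x. 0 \<le> c k x" "\<And>k x. c k x \<le> 1"
    "\<And>k x. gradient (c k) x = m k x *\<^sub>R n" "\<And>k. continuous_on UNIV (m k)"
    "\<And>k x. (x - x0) \<bullet> n > - inverse (real (Suc k)) \<Longrightarrow> c k x = 0"
    "\<And>k x. \<bar>m k x\<bar> * \<bar>(x - x0) \<bullet> n\<bar> \<le> L"
    "\<And>x. (x - x0) \<bullet> n < 0 \<Longrightarrow> \<forall>\<^sub>F k in sequentially. c k x = 1 \<and> m k x = 0"
    by (rule flat_cutoff[of n x0]) (rule that)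
  note zs = weak_gradD[OF z]
  have Ys: "smooth (\<lambda>x. Y x $ i)" for i using Y by (rule test_fun_smooth)
  have ds: "smooth (div_smooth Y)" using Ys by blast
  have Yq: "Y \<in> sqint M" by (rule sqint_vec) (use Ys in blast)
  have Yn': "test_fun (ball x0 r) (\<lambda>x. Y x \<bullet> n)"
  proof -
    have "test_fun (ball x0 r) (\<lambda>x. \<Sum>i\<in>I. Y x $ i * n $ i)" if "finite I" for I
      using that by (induction I) (auto intro!: test_fun_add test_fun_mult' Y)
    then show ?thesis by (simp add: inner_vec_def)
  qed
  have "(\<integral>x. div_smooth Y x * z x + Y x \<bullet> g x \<partial>M) = 0"
  proof (rule flat_cutoff_limit[OF fp smooth_measurable_domain[OF c(1)] c(2,3)
        continuous_measurable_domain[OF c(5)] c(7,8) _ _ Yn' Yn])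
    show "integrable M (\<lambda>x. div_smooth Y x * z x + Y x \<bullet> g x)"
      using zs ds Yq by (intro Bochner_Integration.integrable_add) auto
    show "div_smooth Y x * z x + Y x \<bullet> g x = 0" if "x \<notin> ball x0 r" for x
      using test_fun_outside[OF Y that] test_fun_outside[OF test_fun_gradient_component[OF Y] that]
      by (simp add: inner_vec_def div_smooth_def)
    show "integrable M z" using zs by (intro sqint_imp_integrable)
    fix k
    have tf: "test_fun \<Omega> (\<lambda>x. (c k x *\<^sub>R Y x) $ i)" for i
      using flat_point_cutoff_test_fun[OF fp Y c(1,6)] by simp
    have dv: "div_smooth (\<lambda>x. c k x *\<^sub>R Y x) x = c k x * div_smooth Y x + m k x * (Y x \<bullet> n)" for x
      unfolding div_smooth_def inner_vec_def
      by (simp add: gradient_mult[OF c(1) Ys] c(4) sum.distrib sum_distrib_left mult_ac)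
    have "0 = pair_ip (div_smooth (\<lambda>x. c k x *\<^sub>R Y x)) (\<lambda>x. c k x *\<^sub>R Y x) z g"
      using weak_grad_test_field[OF z tf] by simp
    also have "\<dots> = (\<integral>x. c k x * (div_smooth Y x * z x + Y x \<bullet> g x) + m k x * (Y x \<bullet> n) * z x \<partial>M)"
      unfolding ip_def by (simp add: dv algebra_simps)
    finally show "(\<integral>x. c k x * (div_smooth Y x * z x + Y x \<bullet> g x) + m k x * (Y x \<bullet> n) * z x \<partial>M) = 0" ..
  qed auto
  then show ?thesis by (simp add: ip_def)
qed

end

section \<open>Local approximation by smooth functions\<close>

context bounded_open
begin

lemma ip_vec_eq_sum:
  fixes u v :: "real^'n \<Rightarrow> real^'n"
  assumes "u \<in> sqint M" "v \<in> sqint M"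
  shows "ip M u v = (\<Sum>i\<in>UNIV. ip M (\<lambda>x. u x $ i) (\<lambda>x. v x $ i))"
proof -
  have "integrable M (\<lambda>x. u x $ i * v x $ i)" for i
    using assms by (intro sqint_mult_integrable) blast+
  then show ?thesis by (simp add: ip_def inner_vec_def)
qed

lemma conv_vec_tendsto:
  fixes \<rho> :: "nat \<Rightarrow> real^'n \<Rightarrow> real" and g :: "real^'n \<Rightarrow> real^'n"
  assumes tf: "\<And>k. test_fun UNIV (\<rho> k)" and pos: "\<And>k x. 0 \<le> \<rho> k x"
    and one: "\<And>k. (\<integral>x. \<rho> k x \<partial>lborel) = 1"
    and supp: "\<And>k x. norm x > \<delta> k \<Longrightarrow> \<rho> k x = 0" "\<delta> \<longlonglongrightarrow> 0"
    and g: "g \<in> sqint M"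
  shows "(\<lambda>k. ip M (\<lambda>x. (\<chi> i. conv (\<rho> k) (\<lambda>x. g x $ i) x) - g x)
    (\<lambda>x. (\<chi> i. conv (\<rho> k) (\<lambda>x. g x $ i) x) - g x)) \<longlonglongrightarrow> 0"
proof -
  have gi: "(\<lambda>x. g x $ i) \<in> sqint M" for i using g by blast
  have "(\<lambda>k. \<Sum>i\<in>UNIV. ip M (\<lambda>x. conv (\<rho> k) (\<lambda>x. g x $ i) x - g x $ i)
      (\<lambda>x. conv (\<rho> k) (\<lambda>x. g x $ i) x - g x $ i)) \<longlonglongrightarrow> (\<Sum>i\<in>(UNIV::'n set). 0)"
    by (intro tendsto_sum conv_tendsto[OF tf pos one supp gi])
  moreover have "ip M (\<lambda>x. (\<chi> i. conv (\<rho> k) (\<lambda>x. g x $ i) x) - g x) (\<lambda>x. (\<chi> i. conv (\<rho> k) (\<lambda>x. g x $ i) x) - g x) =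
      (\<Sum>i\<in>UNIV. ip M (\<lambda>x. conv (\<rho> k) (\<lambda>x. g x $ i) x - g x $ i) (\<lambda>x. conv (\<rho> k) (\<lambda>x. g x $ i) x - g x $ i))" for k
  proof -
    have "conv (\<rho> k) (\<lambda>x. g x $ i) \<in> sqint M" for i
      using smooth_conv[OF tf sqint_imp_integrable[OF gi]] by blast
    then have "(\<lambda>x. (\<chi> i. conv (\<rho> k) (\<lambda>x. g x $ i) x) - g x) \<in> sqint M"
      by (intro sqint_vec) (auto intro!: sqint_diff gi)
    then show ?thesis by (simp add: ip_vec_eq_sum)
  qed
  ultimately show ?thesis by simp
qed

lemma sqint_tendsto_AE_subseq:
  fixes u :: "nat \<Rightarrow> real^'n \<Rightarrow> real"
  assumes "\<And>k. u k \<in> sqint M" "v \<in> sqint M"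
    and "(\<lambda>k. ip M (\<lambda>x. u k x - v x) (\<lambda>x. u k x - v x)) \<longlonglongrightarrow> 0"
  shows "\<exists>s. strict_mono s \<and> (AE x in M. (\<lambda>k. u (s k) x) \<longlonglongrightarrow> v x)"
proof -
  have d: "(\<lambda>x. u k x - v x) \<in> sqint M" for k using assms by blast
  have "\<exists>s. strict_mono s \<and> (AE x in M. (\<lambda>k. (u (s k) x - v x)\<^sup>2) \<longlonglongrightarrow> 0)"
  proof (rule tendsto_L1_AE_subseq)
    show "integrable M (\<lambda>x. (u k x - v x)\<^sup>2)" for k using sqint_integrable[OF d] by simp
    show "(\<lambda>k. \<integral>x. norm ((u k x - v x)\<^sup>2) \<partial>M) \<longlonglongrightarrow> 0"
      using assms(3) by (simp add: ip_self)
  qed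
  then obtain s where s: "strict_mono s" "AE x in M. (\<lambda>k. (u (s k) x - v x)\<^sup>2) \<longlonglongrightarrow> 0" by blast
  have "AE x in M. (\<lambda>k. u (s k) x) \<longlonglongrightarrow> v x"
    using s(2)
  proof eventually_elim
    case (elim x)
    from tendsto_real_sqrt[OF this] have "(\<lambda>k. u (s k) x - v x) \<longlonglongrightarrow> 0"
      by (simp add: tendsto_rabs_zero_iff)
    then show ?case by (simp add: LIM_zero_iff)
  qed
  with s(1) show ?thesis by blast
qed

text \<open>The weak derivative identity is required only for the reflected kernel at the one point
  \<open>y\<close>. This allows points near the boundary, as long as the kernel stays where the
  identity is available.\<close>

lemma gradient_conv_weak:
  assumes "test_fun A \<rho>" "integrable M p"
    and der: "\<And>a. (\<integral>t. p t * (gradient (\<lambda>t. \<rho> (y - t)) t \<bullet> a) \<partial>M) = - (\<integral>t. \<rho> (y - t) * (g t \<bullet> a) \<partial>M)"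
  shows "gradient (conv \<rho> p) y = (\<chi> i. conv \<rho> (\<lambda>x. g x $ i) y)"
proof -
  have "conv (\<lambda>s. gradient \<rho> s $ i) p y = conv \<rho> (\<lambda>x. g x $ i) y" for i
  proof -
    have "conv (\<lambda>s. gradient \<rho> s $ i) p y = - (\<integral>t. p t * (gradient (\<lambda>t. \<rho> (y - t)) t \<bullet> axis i 1) \<partial>M)"
      unfolding conv_def
      by (simp add: gradient_reflect[OF test_fun_smooth[OF assms(1)]] inner_axis mult.commute)
    also have "\<dots> = (\<integral>t. \<rho> (y - t) * (g t \<bullet> axis i 1) \<partial>M)"
      using der[of "axis i 1"] by simp
    also have "\<dots> = conv \<rho> (\<lambda>x. g x $ i) y" by (simp add: conv_def inner_axis)
    finally show ?thesis .
  qed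
  then show ?thesis unfolding gradient_conv[OF assms(1,2)] by simp
qed

lemma kernel_test_fun:
  assumes "test_fun A \<rho>" "h > 0" "\<And>x. x \<notin> cball (h *\<^sub>R c) (h / 2) \<Longrightarrow> \<rho> x = 0"
  shows "test_fun (ball (y - h *\<^sub>R c) h) (\<lambda>t. \<rho> (y - t))"
proof (rule test_funI[of _ "cball (y - h *\<^sub>R c) (h / 2)"])
  show "smooth (\<lambda>t. \<rho> (y - t))" by (rule smooth_reflect[OF test_fun_smooth[OF assms(1)]])
  show "cball (y - h *\<^sub>R c) (h / 2) \<subseteq> ball (y - h *\<^sub>R c) h"
    using assms(2) by (auto simp: subset_iff)
  fix t assume "t \<notin> cball (y - h *\<^sub>R c) (h / 2)"
  then have "y - t \<notin> cball (h *\<^sub>R c) (h / 2)"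
    by (simp add: dist_norm norm_minus_commute algebra_simps)
  then show "\<rho> (y - t) = 0" by (rule assms(3))
qed simp

text \<open>The shift by \<open>h *\<^sub>R c\<close> makes the mollified function sample \<open>p\<close> on one side of the boundary only;
  the sine serves as a smooth truncation, so that the limit function is bounded.\<close>

lemma local_truncation:
  fixes x0 c :: "real^'n"
  assumes p: "p \<in> sqint M" "g \<in> sqint M" and w: "w0 \<in> sqint M" "w1 \<in> sqint M"
    and ann: "\<And>\<phi>. smooth \<phi> \<Longrightarrow> (\<And>x. x \<in> \<Gamma> \<Longrightarrow> \<phi> x = 0) \<Longrightarrow> pair_ip w0 w1 \<phi> (gradient \<phi>) = 0"
    and c: "norm c \<le> 1" and H: "H > 0"
    and der: "\<And>h y \<psi> a. 0 < h \<Longrightarrow> h < H \<Longrightarrow> y \<in> \<Omega> \<inter> ball x0 d \<Longrightarrow> test_fun (ball (y - h *\<^sub>R c) h) \<psi> \<Longrightarrow>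
      (\<integral>x. p x * (gradient \<psi> x \<bullet> a) \<partial>M) = - (\<integral>x. \<psi> x * (g x \<bullet> a) \<partial>M)"
    and van: "\<And>h y. 0 < h \<Longrightarrow> h < H \<Longrightarrow> y \<in> \<Gamma> \<inter> ball x0 d \<Longrightarrow> ball (y - h *\<^sub>R c) h \<inter> \<Omega> = {}"
    and \<theta>: "test_fun (ball x0 d) \<theta>"
  shows "pair_ip w0 w1 (\<lambda>x. \<theta> x * sin (s * p x))
    (\<lambda>x. \<theta> x *\<^sub>R ((s * cos (s * p x)) *\<^sub>R g x) + sin (s * p x) *\<^sub>R gradient \<theta> x) = 0"
proof -
  define h where "h k = H / real (k + 2)" for k :: nat
  have h: "0 < h k" "h k < H" for k using H by (auto simp: h_def field_simps add_pos_nonneg)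
  have h0: "h \<longlonglongrightarrow> 0" unfolding h_def using LIMSEQ_ignore_initial_segment[OF lim_const_over_n[of H], of 2] by simp
  have "\<exists>\<rho>. test_fun UNIV \<rho> \<and> (\<forall>x. 0 \<le> \<rho> x) \<and> (\<integral>x. \<rho> x \<partial>lborel) = 1 \<and>
      (\<forall>x. x \<notin> cball (h k *\<^sub>R c) (h k / 2) \<longrightarrow> \<rho> x = 0)" for k
    by (rule smooth_kernel[OF h(1), of k c]) blast
  then obtain \<rho> where \<rho>: "\<And>k. test_fun UNIV (\<rho> k)" "\<And>k x. 0 \<le> \<rho> k x" "\<And>k. (\<integral>x. \<rho> k x \<partial>lborel) = 1"
    "\<And>k x. x \<notin> cball (h k *\<^sub>R c) (h k / 2) \<Longrightarrow> \<rho> k x = 0" by metis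
  have supp: "\<rho> k x = 0" if "norm x > 2 * h k" for k x
  proof (rule \<rho>(4))
    have "norm x \<le> norm (h k *\<^sub>R c) + norm (h k *\<^sub>R c - x)"
      by (metis add.commute norm_minus_commute norm_triangle_sub)
    moreover have "norm (h k *\<^sub>R c) \<le> h k" using c h(1)[of k] by (simp add: mult_left_le)
    ultimately have "h k / 2 < norm (h k *\<^sub>R c - x)" using that h(1)[of k] by linarith
    then show "x \<notin> cball (h k *\<^sub>R c) (h k / 2)" by (simp add: dist_norm)
  qed
  have d0: "(\<lambda>k. 2 * h k) \<longlonglongrightarrow> 0" using tendsto_mult_right[OF h0, of 2] by simp
  have pint: "integrable M p" and gint: "integrable M (\<lambda>x. g x $ i)" for i
    using p by (auto intro!: sqint_imp_integrable)
  define P where "P k = conv (\<rho> k) p" for k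
  define G where "G k x = (\<chi> i. conv (\<rho> k) (\<lambda>x. g x $ i) x)" for k x
  have Ps: "smooth (P k)" for k unfolding P_def by (rule smooth_conv[OF \<rho>(1) pint])
  have Gs: "smooth (\<lambda>x. G k x $ i)" for k i unfolding G_def using smooth_conv[OF \<rho>(1) gint] by simp
  have Gq: "G k \<in> sqint M" for k by (rule sqint_vec) (use Gs in blast)
  have tfball: "test_fun (ball (y - h k *\<^sub>R c) (h k)) (\<lambda>t. \<rho> k (y - t))" for k y
    by (rule kernel_test_fun[OF \<rho>(1) h(1) \<rho>(4)])
  have gradP: "gradient (P k) y = G k y" if y: "y \<in> \<Omega> \<inter> ball x0 d" for k y
  proof -
    show ?thesis unfolding P_def G_def
      by (rule gradient_conv_weak[OF \<rho>(1) pint]) (rule der[OF h y tfball])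
  qed
  \<comment> \<open>At points of \<open>\<Gamma>\<close> the shifted kernel sees only the exterior,
    where the zero extension of \<open>p\<close> vanishes; as sin 0 = 0, the truncated product
    vanishes there as well.\<close>
  have P0: "P k y = 0" if "y \<in> \<Gamma> \<inter> ball x0 d" for k y
  proof -
    have "P k y = (\<integral>t. 0 \<partial>M)"
      unfolding P_def conv_def
    proof (rule Bochner_Integration.integral_cong)
      fix t assume "t \<in> space M"
      then have "t \<notin> ball (y - h k *\<^sub>R c) (h k)" using van[OF h that, of k] by auto
      then show "\<rho> k (y - t) * p t = 0" using test_fun_outside[OF tfball] by simp
    qed simp
    then show ?thesis by simp
  qed
  have \<theta>s: "smooth \<theta>" using \<theta> by (rule test_fun_smooth)
  have \<theta>0: "\<theta> x = 0" "gradient \<theta> x = 0" if "x \<notin> ball x0 d" for x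
    using test_fun_outside[OF \<theta> that] test_fun_outside[OF test_fun_gradient_component[OF \<theta>] that]
    by (auto simp: vec_eq_iff)
  obtain C where C: "C \<ge> 0" "\<And>x. \<bar>\<theta> x\<bar> \<le> C" using \<theta> by (rule test_fun_bounded) blast
  have P_lim: "(\<lambda>k. ip M (\<lambda>x. P k x - p x) (\<lambda>x. P k x - p x)) \<longlonglongrightarrow> 0"
    unfolding P_def by (rule conv_tendsto[OF \<rho>(1,2,3) supp d0 p(1)])
  have G_lim: "(\<lambda>k. ip M (\<lambda>x. G k x - g x) (\<lambda>x. G k x - g x)) \<longlonglongrightarrow> 0"
    unfolding G_def by (rule conv_vec_tendsto[OF \<rho>(1,2,3) supp d0 p(2)])
  \<comment> \<open>Sine and cosine of the mollified functions need pointwise convergence, which L2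
    convergence provides along a subsequence.\<close>
  obtain \<sigma> where \<sigma>: "strict_mono \<sigma>" "AE x in M. (\<lambda>k. P (\<sigma> k) x) \<longlonglongrightarrow> p x"
    using sqint_tendsto_AE_subseq[OF smooth_sqint[OF Ps] p(1) P_lim] by blast
  define Q where "Q k = P (\<sigma> k)" for k
  define R where "R k = G (\<sigma> k)" for k
  have Qs: "smooth (Q k)" and Rq: "R k \<in> sqint M" for k using Ps Gq by (auto simp: Q_def R_def)
  have R_lim: "(\<lambda>k. ip M (\<lambda>x. R k x - g x) (\<lambda>x. R k x - g x)) \<longlonglongrightarrow> 0"
    unfolding R_def using LIMSEQ_subseq_LIMSEQ[OF G_lim \<sigma>(1)] by (simp add: o_def)
  have sQ: "smooth (\<lambda>x. s * Q k x)" for k using Qs by auto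
  have [measurable]: "p \<in> borel_measurable M" "g \<in> borel_measurable M" "w0 \<in> borel_measurable M"
    "w1 \<in> borel_measurable M" "R k \<in> borel_measurable M" for k
    using p w Rq sqint_measurable by blast+
  have [measurable]: "\<theta> \<in> borel_measurable M" "Q k \<in> borel_measurable M" for k
    using \<theta>s Qs smooth_measurable_domain by blast+
  have [measurable]: "gradient \<theta> \<in> borel_measurable M"
    using smooth_gradient_sqint[OF \<theta>s] by (rule sqint_measurable)
  \<comment> \<open>Splitting the integrand: \<open>F\<close> keeps the limit gradient
    \<open>g\<close> and varies only the argument of sine and cosine, so it is dominated;
    \<open>E\<close> carries the difference of the gradients, which tends to zero in norm against a
    bounded multiple of \<open>w1\<close>.\<close>
  define F where "F q x = w0 x * (\<theta> x * sin (s * q)) + (w1 x \<bullet> gradient \<theta> x) * sin (s * q) +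
      (w1 x \<bullet> g x) * (\<theta> x * (s * cos (s * q)))" for q x
  define E where "E k = ip M (\<lambda>x. (s * \<theta> x * cos (s * Q k x)) *\<^sub>R w1 x) (\<lambda>x. R k x - g x)" for k
  have sb: "\<bar>s * \<theta> x * cos q\<bar> \<le> \<bar>s\<bar> * C" for x q
  proof -
    have "\<bar>s\<bar> * \<bar>\<theta> x\<bar> * \<bar>cos q\<bar> \<le> \<bar>s\<bar> * C * 1"
      using C abs_cos_le_one by (intro mult_mono) auto
    then show ?thesis by (simp add: abs_mult)
  qed
  have usq: "(\<lambda>x. (s * \<theta> x * cos (s * Q k x)) *\<^sub>R w1 x) \<in> sqint M" for k
    by (rule sqint_bounded_scale[OF w(2), of _ "\<bar>s\<bar> * C"]) (measurable, use sb in auto)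
  have dsq: "(\<lambda>x. R k x - g x) \<in> sqint M" for k using Rq p by blast
  have E_lim: "E \<longlonglongrightarrow> 0"
  proof -
    have "(\<lambda>k. (E k)\<^sup>2) \<longlonglongrightarrow> 0"
    proof (rule tendsto_sandwich[OF _ _ tendsto_const])
      show "(\<lambda>k. (\<bar>s\<bar> * C)\<^sup>2 * ip M w1 w1 * ip M (\<lambda>x. R k x - g x) (\<lambda>x. R k x - g x)) \<longlonglongrightarrow> 0"
        using tendsto_mult[OF tendsto_const R_lim] by simp
      show "\<forall>\<^sub>F k in sequentially. (E k)\<^sup>2 \<le> (\<bar>s\<bar> * C)\<^sup>2 * ip M w1 w1 * ip M (\<lambda>x. R k x - g x) (\<lambda>x. R k x - g x)"
      proof (rule always_eventually, rule allI)
        fix k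
        have "(E k)\<^sup>2 \<le> ip M (\<lambda>x. (s * \<theta> x * cos (s * Q k x)) *\<^sub>R w1 x) (\<lambda>x. (s * \<theta> x * cos (s * Q k x)) *\<^sub>R w1 x) *
            ip M (\<lambda>x. R k x - g x) (\<lambda>x. R k x - g x)"
          unfolding E_def by (rule ip_Cauchy_Schwarz[OF usq dsq])
        also have "\<dots> \<le> ((\<bar>s\<bar> * C)\<^sup>2 * ip M w1 w1) * ip M (\<lambda>x. R k x - g x) (\<lambda>x. R k x - g x)"
        proof (rule mult_right_mono)
          have "ip M (\<lambda>x. (s * \<theta> x * cos (s * Q k x)) *\<^sub>R w1 x) (\<lambda>x. (s * \<theta> x * cos (s * Q k x)) *\<^sub>R w1 x) \<le>
              (\<integral>x. (\<bar>s\<bar> * C)\<^sup>2 * (norm (w1 x))\<^sup>2 \<partial>M)"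
            unfolding ip_self
          proof (rule integral_mono)
            show "integrable M (\<lambda>x. (norm ((s * \<theta> x * cos (s * Q k x)) *\<^sub>R w1 x))\<^sup>2)"
              using usq by (rule sqint_integrable)
            show "integrable M (\<lambda>x. (\<bar>s\<bar> * C)\<^sup>2 * (norm (w1 x))\<^sup>2)" using sqint_integrable[OF w(2)] by simp
            show "(norm ((s * \<theta> x * cos (s * Q k x)) *\<^sub>R w1 x))\<^sup>2 \<le> (\<bar>s\<bar> * C)\<^sup>2 * (norm (w1 x))\<^sup>2" for x
              unfolding norm_scaleR power_mult_distrib[of _ "norm (w1 x)"]
              by (intro mult_right_mono power_mono sb) auto
          qed
          then show "ip M (\<lambda>x. (s * \<theta> x * cos (s * Q k x)) *\<^sub>R w1 x) (\<lambda>x. (s * \<theta> x * cos (s * Q k x)) *\<^sub>R w1 x) \<le>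
              (\<bar>s\<bar> * C)\<^sup>2 * ip M w1 w1"
            by (simp add: ip_self)
        qed simp
        finally show "(E k)\<^sup>2 \<le> (\<bar>s\<bar> * C)\<^sup>2 * ip M w1 w1 * ip M (\<lambda>x. R k x - g x) (\<lambda>x. R k x - g x)" .
      qed
    qed simp
    from tendsto_real_sqrt[OF this] show ?thesis by (simp add: tendsto_rabs_zero_iff)
  qed
  have wg: "integrable M (\<lambda>x. \<bar>w0 x\<bar> * C + \<bar>w1 x \<bullet> gradient \<theta> x\<bar> + \<bar>w1 x \<bullet> g x\<bar> * (\<bar>s\<bar> * C))"
    using sqint_imp_integrable[OF w(1)] sqint_inner_integrable[OF w(2) p(2)]
      sqint_inner_integrable[OF w(2) smooth_gradient_sqint[OF \<theta>s]] by simp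
  have Fb: "\<bar>F q x\<bar> \<le> \<bar>w0 x\<bar> * C + \<bar>w1 x \<bullet> gradient \<theta> x\<bar> + \<bar>w1 x \<bullet> g x\<bar> * (\<bar>s\<bar> * C)" for q x
  proof -
    have "\<bar>\<theta> x * sin (s * q)\<bar> \<le> C * 1"
      unfolding abs_mult using C by (intro mult_mono) auto
    then have "\<bar>w0 x * (\<theta> x * sin (s * q))\<bar> \<le> \<bar>w0 x\<bar> * C"
      unfolding abs_mult[of "w0 x"] by (intro mult_left_mono) auto
    moreover have "\<bar>(w1 x \<bullet> gradient \<theta> x) * sin (s * q)\<bar> \<le> \<bar>w1 x \<bullet> gradient \<theta> x\<bar> * 1"
      unfolding abs_mult by (intro mult_left_mono) auto
    moreover have "\<bar>(w1 x \<bullet> g x) * (\<theta> x * (s * cos (s * q)))\<bar> \<le> \<bar>w1 x \<bullet> g x\<bar> * (\<bar>s\<bar> * C)"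
      unfolding abs_mult[of "w1 x \<bullet> g x"] using sb[of x "s * q"] by (intro mult_left_mono) (auto simp: mult_ac)
    ultimately show ?thesis unfolding F_def by linarith
  qed
  have Fm: "(\<lambda>x. F (p x) x) \<in> borel_measurable M" "(\<lambda>x. F (Q k x) x) \<in> borel_measurable M" for k
    unfolding F_def by measurable
  have Fi: "integrable M (\<lambda>x. F (Q k x) x)" for k
    by (rule Bochner_Integration.integrable_bound[OF wg Fm(2)])
      (use Fb in \<open>auto intro!: AE_I2 order_trans[OF _ abs_ge_self]\<close>)
  have F_lim: "(\<lambda>k. \<integral>x. F (Q k x) x \<partial>M) \<longlonglongrightarrow> (\<integral>x. F (p x) x \<partial>M)"
  proof (rule integral_dominated_convergence[OF Fm wg])
    show "AE x in M. (\<lambda>k. F (Q k x) x) \<longlonglongrightarrow> F (p x) x"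
      using \<sigma>(2)
    proof eventually_elim
      case (elim x)
      then show ?case unfolding F_def Q_def by (intro tendsto_intros)
    qed
    show "AE x in M. norm (F (Q k x) x) \<le> \<bar>w0 x\<bar> * C + \<bar>w1 x \<bullet> gradient \<theta> x\<bar> + \<bar>w1 x \<bullet> g x\<bar> * (\<bar>s\<bar> * C)" for k
      using Fb by simp
  qed
  have zero: "(\<integral>x. F (Q k x) x \<partial>M) + E k = 0" for k
  proof -
    let ?f = "\<lambda>x. \<theta> x * sin (s * Q k x)"
    have "smooth ?f" by (rule smooth_mult[OF \<theta>s smooth_sin[OF sQ]])
    moreover have "?f x = 0" if "x \<in> \<Gamma>" for x
      using P0[of x] \<theta>0(1)[of x] that by (cases "x \<in> ball x0 d") (auto simp: Q_def)
    ultimately have "pair_ip w0 w1 ?f (gradient ?f) = 0" by (rule ann)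
    also have "pair_ip w0 w1 ?f (gradient ?f) =
        (\<integral>x. F (Q k x) x + ((s * \<theta> x * cos (s * Q k x)) *\<^sub>R w1 x) \<bullet> (R k x - g x) \<partial>M)"
      unfolding ip_def
    proof (rule Bochner_Integration.integral_cong)
      fix x assume x: "x \<in> space M"
      have gq: "gradient (\<lambda>x. s * Q k x) x = s *\<^sub>R gradient (Q k) x"
        using gradient_mult[OF smooth_const Qs] by simp
      have gf: "gradient ?f x = (\<theta> x * cos (s * Q k x) * s) *\<^sub>R gradient (Q k) x + sin (s * Q k x) *\<^sub>R gradient \<theta> x"
        using gradient_mult[OF \<theta>s smooth_sin[OF sQ]] gradient_sin[OF sQ] gq by simp
      \<comment> \<open>The formula for the gradient is known only in the small ball; outside it the
        factor \<open>\<theta>\<close> is zero.\<close>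
      have eq: "\<theta> x *\<^sub>R gradient (Q k) x = \<theta> x *\<^sub>R R k x"
        using gradP[of x "\<sigma> k"] \<theta>0(1)[of x] x by (cases "x \<in> ball x0 d") (auto simp: Q_def R_def)
      have "(\<theta> x * cos (s * Q k x) * s) *\<^sub>R v = (cos (s * Q k x) * s) *\<^sub>R (\<theta> x *\<^sub>R v)" for v :: "real^'n"
        by (simp add: mult_ac)
      then have eq': "(\<theta> x * cos (s * Q k x) * s) *\<^sub>R gradient (Q k) x = (\<theta> x * cos (s * Q k x) * s) *\<^sub>R R k x"
        by (simp only: eq)
      from gf[unfolded eq'] have gf': "gradient ?f x = (\<theta> x * cos (s * Q k x) * s) *\<^sub>R R k x + sin (s * Q k x) *\<^sub>R gradient \<theta> x"
        .
      then show "(w0 x, w1 x) \<bullet> (?f x, gradient ?f x) =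
          F (Q k x) x + ((s * \<theta> x * cos (s * Q k x)) *\<^sub>R w1 x) \<bullet> (R k x - g x)"
        unfolding gf' F_def by (simp add: inner_add_right inner_diff_right algebra_simps)
    qed simp
    also have "\<dots> = (\<integral>x. F (Q k x) x \<partial>M) + E k"
      unfolding E_def ip_def using Fi sqint_inner_integrable[OF usq dsq] by (rule Bochner_Integration.integral_add)
    finally show ?thesis .
  qed
  have "(\<lambda>k. (\<integral>x. F (Q k x) x \<partial>M) + E k) \<longlonglongrightarrow> (\<integral>x. F (p x) x \<partial>M) + 0"
    by (rule tendsto_add[OF F_lim E_lim])
  then have "(\<integral>x. F (p x) x \<partial>M) = 0"
    unfolding zero by (simp add: LIMSEQ_const_iff)
  moreover have "(\<integral>x. F (p x) x \<partial>M) = pair_ip w0 w1 (\<lambda>x. \<theta> x * sin (s * p x))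
    (\<lambda>x. \<theta> x *\<^sub>R ((s * cos (s * p x)) *\<^sub>R g x) + sin (s * p x) *\<^sub>R gradient \<theta> x)"
    unfolding ip_def F_def by (rule Bochner_Integration.integral_cong) (auto simp: inner_add_right algebra_simps)
  ultimately show ?thesis by simp
qed

end

section \<open>One-sided mollification at interior points and at flat boundary points\<close>

context bounded_open
begin

text \<open>What mollification in the direction \<open>c\<close> needs near \<open>x\<close>: for
  points of the domain the weak derivative identity holds on the kernel ball, and for points of
  \<open>\<Gamma>\<close> the kernel ball misses the domain. No \<open>\<Gamma>\<close> nearby
  allows sampling inwards; on \<open>\<Gamma>\<close> the sampling must be outwards.\<close>

definition sampling_ball :: "(real^'n \<Rightarrow> real) \<Rightarrow> (real^'n \<Rightarrow> real^'n) \<Rightarrow> (real^'n) set \<Rightarrow> real^'n \<Rightarrow> bool" where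
  "sampling_ball p g \<Gamma> x \<longleftrightarrow> (\<exists>d c H. d > 0 \<and> norm c \<le> 1 \<and> H > 0 \<and>
     (\<forall>h y \<psi> a. 0 < h \<longrightarrow> h < H \<longrightarrow> y \<in> \<Omega> \<inter> ball x d \<longrightarrow> test_fun (ball (y - h *\<^sub>R c) h) \<psi> \<longrightarrow>
        (\<integral>x. p x * (gradient \<psi> x \<bullet> a) \<partial>M) = - (\<integral>x. \<psi> x * (g x \<bullet> a) \<partial>M)) \<and>
     (\<forall>h y. 0 < h \<longrightarrow> h < H \<longrightarrow> y \<in> \<Gamma> \<inter> ball x d \<longrightarrow> ball (y - h *\<^sub>R c) h \<inter> \<Omega> = {}))"

lemma sampling_ball_interior:
  assumes "weak_grad p g" "x \<in> \<Omega>" "\<Gamma> \<subseteq> frontier \<Omega>"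
  shows "sampling_ball p g \<Gamma> x"
proof -
  obtain e where e: "e > 0" "ball x e \<subseteq> \<Omega>" using assms(2) open_domain open_contains_ball by blast
  have sub: "ball y h \<subseteq> \<Omega>" if "h < e / 2" "y \<in> ball x (e / 2)" for h y
  proof -
    have "ball y h \<subseteq> ball x e"
    proof
      fix z assume "z \<in> ball y h"
      then show "z \<in> ball x e" using that dist_triangle[of x z y] by simp
    qed
    then show ?thesis using e(2) by blast
  qed
  have "\<Omega> \<inter> frontier \<Omega> = {}" using open_domain by (auto simp: frontier_def interior_open)
  moreover have "ball x (e / 2) \<subseteq> \<Omega>" using e subset_ball[of "e / 2" e x] by auto
  ultimately have "\<Gamma> \<inter> ball x (e / 2) = {}" using assms(3) by blast
  then show ?thesis
    unfolding sampling_ball_def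
    by (intro exI[of _ "e / 2"] exI[of _ "0"])
      (use e sub weak_grad_inner[OF assms(1) test_fun_mono] in auto)
qed

text \<open>The shift changes the signed distance by \<open>- h * \<sigma>\<close> and the radius by
  less than \<open>h\<close>. So for \<open>\<sigma> = 1\<close> the ball lies strictly below the
  level of \<open>y\<close>, and for \<open>\<sigma> = -1\<close> strictly above it.\<close>

lemma flat_point_ball_shift:
  assumes "flat_point \<Omega> x n r" "h < r / 4" "y \<in> ball x (r / 2)" "\<bar>\<sigma>\<bar> \<le> 1" "z \<in> ball (y - h *\<^sub>R (\<sigma> *\<^sub>R n)) h" "h > 0"
  shows "z \<in> ball x r" "\<bar>(z - x) \<bullet> n - (y - x) \<bullet> n + h * \<sigma>\<bar> < h"
proof -
  have n: "norm n = 1" "n \<bullet> n = 1" using assms(1) by (auto simp: flat_point_def dot_square_norm)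
  define v where "v = z - (y - h *\<^sub>R (\<sigma> *\<^sub>R n))"
  have v: "norm v < h" using assms(5) by (simp add: v_def dist_norm norm_minus_commute)
  have zeq: "z = y - h *\<^sub>R (\<sigma> *\<^sub>R n) + v" by (simp add: v_def)
  have "norm (z - x) \<le> norm (y - x) + norm (h *\<^sub>R (\<sigma> *\<^sub>R n)) + norm v"
    unfolding zeq by (smt (verit) add_diff_eq diff_add_eq norm_triangle_ineq norm_triangle_ineq4)
  moreover have "norm (h *\<^sub>R (\<sigma> *\<^sub>R n)) \<le> h" using n assms(4,6) by (simp add: abs_mult mult_left_le)
  ultimately show "z \<in> ball x r"
    using v assms(2,3) by (simp add: dist_norm norm_minus_commute)
  have "(z - x) \<bullet> n - (y - x) \<bullet> n + h * \<sigma> = v \<bullet> n"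
    unfolding zeq using n(2) by (simp add: inner_diff_left inner_add_left)
  moreover have "\<bar>v \<bullet> n\<bar> \<le> norm v" using Cauchy_Schwarz_ineq2[of v n] n(1) by simp
  ultimately show "\<bar>(z - x) \<bullet> n - (y - x) \<bullet> n + h * \<sigma>\<bar> < h" using v by simp
qed

text \<open>With \<open>c = n\<close> the kernel balls of points of the domain stay inside it, and
  no vanishing is demanded near \<open>x\<close>.\<close>

lemma sampling_ball_inside:
  assumes "weak_grad p g" "flat_point \<Omega> x n r" "\<Gamma> \<inter> ball x r = {}"
  shows "sampling_ball p g \<Gamma> x"
proof -
  have r: "r > 0" and n: "norm n = 1" and \<Omega>r: "\<And>y. y \<in> ball x r \<Longrightarrow> y \<in> \<Omega> \<longleftrightarrow> (y - x) \<bullet> n < 0"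
    using assms(2) unfolding flat_point_def by blast+
  have sub: "ball (y - h *\<^sub>R n) h \<subseteq> \<Omega>" if h: "0 < h" "h < r / 4" and y: "y \<in> \<Omega> \<inter> ball x (r / 2)" for h y
  proof
    fix z assume z: "z \<in> ball (y - h *\<^sub>R n) h"
    note * = flat_point_ball_shift[OF assms(2) h(2), of y 1 z]
    have "y \<in> ball x r" using y r by auto
    then have "(y - x) \<bullet> n < 0" using y \<Omega>r by blast
    then have "(z - x) \<bullet> n < 0" using *(2) y z h by auto
    then show "z \<in> \<Omega>" using *(1) y z h \<Omega>r[of z] by auto
  qed
  have "\<Gamma> \<inter> ball x (r / 2) = {}" using assms(3) r subset_ball[of "r / 2" r x] by fastforce
  moreover have "(\<integral>x. p x * (gradient \<psi> x \<bullet> a) \<partial>M) = - (\<integral>x. \<psi> x * (g x \<bullet> a) \<partial>M)"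
    if "0 < h" "h < r / 4" "y \<in> \<Omega> \<inter> ball x (r / 2)" "test_fun (ball (y - h *\<^sub>R n) h) \<psi>" for h y \<psi> a
    by (rule weak_grad_inner[OF assms(1) test_fun_mono[OF that(4) sub[OF that(1-3)]]])
  moreover have "r / 2 > 0" "r / 4 > 0" "norm n \<le> 1" using r n by auto
  ultimately show ?thesis
    unfolding sampling_ball_def by blast
qed

text \<open>With \<open>c = - n\<close> the kernels look outwards and may cross the face. The
  hypothesis \<open>ext\<close> says that the extension of \<open>p\<close> by zero is weakly
  differentiable across the face, a weak form of zero trace.\<close>

lemma sampling_ball_outside:
  assumes "flat_point \<Omega> x n r" "\<Gamma> \<subseteq> frontier \<Omega>"
    and ext: "\<And>\<psi> a. test_fun (ball x r) \<psi> \<Longrightarrow>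
      (\<integral>x. p x * (gradient \<psi> x \<bullet> a) \<partial>M) = - (\<integral>x. \<psi> x * (g x \<bullet> a) \<partial>M)"
  shows "sampling_ball p g \<Gamma> x"
proof -
  have r: "r > 0" and n: "norm n = 1" and \<Omega>r: "\<And>y. y \<in> ball x r \<Longrightarrow> y \<in> \<Omega> \<longleftrightarrow> (y - x) \<bullet> n < 0"
    and fr: "\<And>y. y \<in> ball x r \<Longrightarrow> y \<in> frontier \<Omega> \<longleftrightarrow> (y - x) \<bullet> n = 0"
    using assms(1) unfolding flat_point_def by blast+
  have sub: "ball (y - h *\<^sub>R (- n)) h \<subseteq> ball x r" if h: "0 < h" "h < r / 4" and y: "y \<in> ball x (r / 2)" for h y
    using flat_point_ball_shift(1)[OF assms(1) h(2) y, of "-1"] h(1) by auto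
  have out: "ball (y - h *\<^sub>R (- n)) h \<inter> \<Omega> = {}" if h: "0 < h" "h < r / 4" and y: "y \<in> \<Gamma> \<inter> ball x (r / 2)" for h y
  proof -
    have "z \<notin> \<Omega>" if z: "z \<in> ball (y - h *\<^sub>R (- n)) h" for z
    proof -
      have *: "z \<in> ball x r" "\<bar>(z - x) \<bullet> n - (y - x) \<bullet> n + h * (-1)\<bar> < h"
        using flat_point_ball_shift[OF assms(1) h(2), of y "-1" z] y z h(1) by auto
      have "y \<in> ball x r" using y r by auto
      then have "(y - x) \<bullet> n = 0" using y fr assms(2) by blast
      then have "(z - x) \<bullet> n > 0" using *(2) by linarith
      then show ?thesis using \<Omega>r[OF *(1)] by simp
    qed
    then show ?thesis by blast
  qed
  show ?thesis
    unfolding sampling_ball_def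
  proof (rule exI[of _ "r / 2"], rule exI[of _ "- n"], rule exI[of _ "r / 4"], intro conjI allI impI)
    fix h y \<psi> a
    assume h: "0 < h" "h < r / 4" "y \<in> \<Omega> \<inter> ball x (r / 2)" "test_fun (ball (y - h *\<^sub>R - n) h) \<psi>"
    have "ball (y - h *\<^sub>R - n) h \<subseteq> ball x r" using h(3) by (intro sub[OF h(1,2)]) blast
    then show "(\<integral>x. p x * (gradient \<psi> x \<bullet> a) \<partial>M) = - (\<integral>x. \<psi> x * (g x \<bullet> a) \<partial>M)"
      by (rule ext[OF test_fun_mono[OF h(4)]])
  next
    fix h y assume "0 < h" "h < r / 4" "y \<in> \<Gamma> \<inter> ball x (r / 2)"
    then show "ball (y - h *\<^sub>R - n) h \<inter> \<Omega> = {}" by (rule out)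
  qed (use r n in auto)
qed

text \<open>The function sin(s p) is bounded, so the local identities can be globalised for it.
  Division by s and s tending to 0 recover \<open>p\<close>, with |sin t| \<le> |t| as the
  dominating estimate.\<close>

theorem pair_ip_annihilates_H1:
  assumes p: "weak_grad p g" and w: "w0 \<in> sqint M" "w1 \<in> sqint M"
    and ann: "\<And>\<phi>. smooth \<phi> \<Longrightarrow> (\<And>x. x \<in> \<Gamma> \<Longrightarrow> \<phi> x = 0) \<Longrightarrow> pair_ip w0 w1 \<phi> (gradient \<phi>) = 0"
    and \<A>: "finite \<A>" "\<And>A. A \<in> \<A> \<Longrightarrow> codim2 A"
    and loc: "\<And>x. x \<in> closure \<Omega> \<Longrightarrow> x \<notin> \<Union>\<A> \<Longrightarrow> sampling_ball p g \<Gamma> x"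
  shows "pair_ip w0 w1 p g = 0"
proof -
  note ps = weak_gradD[OF p]
  have [measurable]: "p \<in> borel_measurable M" "g \<in> borel_measurable M" "w0 \<in> borel_measurable M"
    "w1 \<in> borel_measurable M"
    using ps w sqint_measurable by blast+
  have rs: "(\<lambda>x. (s * cos (s * p x)) *\<^sub>R g x) \<in> sqint M" for s
  proof (rule sqint_bounded_scale[OF ps(2)])
    show "\<bar>s * cos (s * p x)\<bar> \<le> \<bar>s\<bar> * 1" for x
      unfolding abs_mult by (intro mult_left_mono) auto
  qed measurable
  have zero: "pair_ip w0 w1 (\<lambda>x. sin (s * p x)) (\<lambda>x. (s * cos (s * p x)) *\<^sub>R g x) = 0" for s
  proof (rule local_to_global[OF w rs _ _ \<A>])
    fix x assume x: "x \<in> closure \<Omega>" "x \<notin> \<Union>\<A>"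
    obtain d c H where d: "d > 0" and c: "norm c \<le> 1" and H: "H > 0"
      and der: "\<forall>h y \<psi> a. 0 < h \<longrightarrow> h < H \<longrightarrow> y \<in> \<Omega> \<inter> ball x d \<longrightarrow> test_fun (ball (y - h *\<^sub>R c) h) \<psi> \<longrightarrow>
        (\<integral>x. p x * (gradient \<psi> x \<bullet> a) \<partial>M) = - (\<integral>x. \<psi> x * (g x \<bullet> a) \<partial>M)"
      and van: "\<forall>h y. 0 < h \<longrightarrow> h < H \<longrightarrow> y \<in> \<Gamma> \<inter> ball x d \<longrightarrow> ball (y - h *\<^sub>R c) h \<inter> \<Omega> = {}"
      using loc[OF x] unfolding sampling_ball_def by blast
    show "\<exists>d>0. \<forall>\<theta>. test_fun (ball x d) \<theta> \<longrightarrow>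
        pair_ip w0 w1 (\<lambda>x. \<theta> x * sin (s * p x))
          (\<lambda>x. \<theta> x *\<^sub>R ((s * cos (s * p x)) *\<^sub>R g x) + sin (s * p x) *\<^sub>R gradient \<theta> x) = 0"
      by (intro exI[of _ d] conjI d allI impI local_truncation[OF ps w ann c H der[rule_format] van[rule_format]])
  qed (auto intro: abs_sin_le_one)
  define s where "s k = inverse (real (Suc k))" for k
  have s: "s k > 0" for k by (simp add: s_def)
  have s0: "s \<longlonglongrightarrow> 0" unfolding s_def[abs_def] by (rule LIMSEQ_inverse_real_of_nat)
  let ?F = "\<lambda>k x. w0 x * (sin (s k * p x) / s k) + cos (s k * p x) * (w1 x \<bullet> g x)"
  have "(\<lambda>k. \<integral>x. ?F k x \<partial>M) \<longlonglongrightarrow> (\<integral>x. w0 x * p x + w1 x \<bullet> g x \<partial>M)"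
  proof (rule integral_dominated_convergence[where w = "\<lambda>x. \<bar>w0 x * p x\<bar> + \<bar>w1 x \<bullet> g x\<bar>"])
    show "integrable M (\<lambda>x. \<bar>w0 x * p x\<bar> + \<bar>w1 x \<bullet> g x\<bar>)"
      using sqint_mult_integrable[OF w(1) ps(1)] sqint_inner_integrable[OF w(2) ps(2)] by simp
    show "AE x in M. (\<lambda>k. ?F k x) \<longlonglongrightarrow> w0 x * p x + w1 x \<bullet> g x"
    proof (rule AE_I2)
      fix x
      have "((\<lambda>t. sin (t * p x)) has_real_derivative p x) (at 0)"
        by (auto intro!: derivative_eq_intros)
      then have "((\<lambda>t. sin (t * p x) / t) \<longlongrightarrow> p x) (at 0)" by (simp add: DERIV_def)
      moreover have "filterlim s (at 0) sequentially"
        using s0 s unfolding filterlim_at by (auto simp: less_imp_neq[symmetric])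
      ultimately have "(\<lambda>k. sin (s k * p x) / s k) \<longlonglongrightarrow> p x"
        by (rule filterlim_compose)
      moreover have "(\<lambda>k. cos (s k * p x)) \<longlonglongrightarrow> cos (0 * p x)"
        by (intro tendsto_intros s0)
      ultimately have "(\<lambda>k. ?F k x) \<longlonglongrightarrow> w0 x * p x + cos (0 * p x) * (w1 x \<bullet> g x)"
        by (intro tendsto_add tendsto_mult tendsto_const)
      then show "(\<lambda>k. ?F k x) \<longlonglongrightarrow> w0 x * p x + w1 x \<bullet> g x" by simp
    qed
    show "AE x in M. norm (?F k x) \<le> \<bar>w0 x * p x\<bar> + \<bar>w1 x \<bullet> g x\<bar>" for k
    proof (rule AE_I2)
      fix x
      have "\<bar>sin (s k * p x)\<bar> \<le> \<bar>s k * p x\<bar>" by (rule abs_sin_x_le_abs_x)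
      then have "\<bar>sin (s k * p x) / s k\<bar> \<le> \<bar>p x\<bar>" using s[of k] by (simp add: abs_mult field_simps)
      then have "\<bar>w0 x * (sin (s k * p x) / s k)\<bar> \<le> \<bar>w0 x * p x\<bar>"
        unfolding abs_mult[of "w0 x"] by (rule mult_left_mono) simp
      moreover have "\<bar>cos (s k * p x) * (w1 x \<bullet> g x)\<bar> \<le> 1 * \<bar>w1 x \<bullet> g x\<bar>"
        unfolding abs_mult by (rule mult_right_mono) auto
      ultimately show "norm (?F k x) \<le> \<bar>w0 x * p x\<bar> + \<bar>w1 x \<bullet> g x\<bar>"
        unfolding real_norm_def by linarith
    qed
  qed measurable
  moreover have "(\<integral>x. ?F k x \<partial>M) = 0" for k
  proof -
    have "(\<integral>x. ?F k x \<partial>M) = (\<integral>x. inverse (s k) * ((w0 x, w1 x) \<bullet> (sin (s k * p x), (s k * cos (s k * p x)) *\<^sub>R g x)) \<partial>M)"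
      using s[of k] by (intro Bochner_Integration.integral_cong) (auto simp: field_simps)
    also have "\<dots> = inverse (s k) * 0"
      using zero[of "s k"] unfolding ip_def by (subst integral_mult_right_zero) simp
    finally show ?thesis by simp
  qed
  ultimately have "(\<integral>x. w0 x * p x + w1 x \<bullet> g x \<partial>M) = 0" by (simp add: LIMSEQ_const_iff)
  then show ?thesis by (simp add: ip_def)
qed

section \<open>Test functions adapted to one face\<close>

lemma div_smooth_add:
  assumes "\<And>i. smooth (\<lambda>x. Y x $ i)" "\<And>i. smooth (\<lambda>x. Z x $ i)"
  shows "div_smooth (\<lambda>x. Y x + Z x) x = div_smooth Y x + div_smooth Z x"
  using assms by (simp add: div_smooth_def gradient_add sum.distrib)

lemma div_smooth_scale_const:
  assumes "smooth \<theta>" shows "div_smooth (\<lambda>x. \<theta> x *\<^sub>R a) x = gradient \<theta> x \<bullet> a"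
  using assms by (simp add: div_smooth_def gradient_mult inner_vec_def mult.commute)

lemma pair_ip_field_add:
  assumes Y: "\<And>i. smooth (\<lambda>x. Y x $ i)" and Z: "\<And>i. smooth (\<lambda>x. Z x $ i)" and z: "weak_grad z g"
  shows "pair_ip (div_smooth (\<lambda>x. Y x + Z x)) (\<lambda>x. Y x + Z x) z g =
    pair_ip (div_smooth Y) Y z g + pair_ip (div_smooth Z) Z z g"
proof -
  have s: "(\<lambda>x. (div_smooth Y x, Y x)) \<in> sqint M" "(\<lambda>x. (div_smooth Z x, Z x)) \<in> sqint M"
    "(\<lambda>x. (z x, g x)) \<in> sqint M"
    using weak_divD[OF weak_div_smooth[OF Y]] weak_divD[OF weak_div_smooth[OF Z]] weak_gradD[OF z] by blast+
  have "pair_ip (div_smooth (\<lambda>x. Y x + Z x)) (\<lambda>x. Y x + Z x) z g =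
      ip M (\<lambda>x. (div_smooth Y x, Y x) + (div_smooth Z x, Z x)) (\<lambda>x. (z x, g x))"
    by (simp add: div_smooth_add[OF Y Z])
  also have "\<dots> = pair_ip (div_smooth Y) Y z g + pair_ip (div_smooth Z) Z z g"
    unfolding ip_commute[of M _ "\<lambda>x. (z x, g x)"] using s by (rule ip_add)
  finally show ?thesis .
qed

text \<open>From the natural boundary condition \<open>nat\<close> to a zero trace of
  \<open>p\<close>: in the field \<open>\<theta> x *\<^sub>R a\<close> the tangential part of
  \<open>a\<close> is harmless on a flat face, and the normal part is matched by the gradient of an
  admissible function.\<close>

lemma dirichlet_face:
  assumes fp: "flat_point \<Omega> x0 n r" and p: "weak_grad p g"
    and nat: "\<And>v. test_fun (ball x0 r) v \<Longrightarrow> (\<And>z. (z - x0) \<bullet> n = 0 \<Longrightarrow> v z = 0) \<Longrightarrow>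
      pair_ip (div_smooth (gradient v)) (gradient v) p g = 0"
    and \<theta>: "test_fun (ball x0 r) \<theta>"
  shows "(\<integral>x. p x * (gradient \<theta> x \<bullet> a) \<partial>M) = - (\<integral>x. \<theta> x * (g x \<bullet> a) \<partial>M)"
proof -
  have nn: "n \<bullet> n = 1" using fp by (simp add: flat_point_def dot_square_norm)
  note ps = weak_gradD[OF p]
  have \<theta>s: "smooth \<theta>" using \<theta> by (rule test_fun_smooth)
  define \<tau> where "\<tau> x = x \<bullet> n - x0 \<bullet> n" for x
  have \<tau>: "smooth \<tau>" "gradient \<tau> x = n" "\<tau> x = (x - x0) \<bullet> n" for x
    unfolding \<tau>_def[abs_def] by (auto simp: gradient_diff inner_diff_left)
  have sc: "smooth (\<lambda>x. (\<theta> x *\<^sub>R b) $ i)" for b i using \<theta>s by auto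
  have normal: "pair_ip (div_smooth (\<lambda>x. \<theta> x *\<^sub>R n)) (\<lambda>x. \<theta> x *\<^sub>R n) p g = 0"
  proof -
    \<comment> \<open>This function vanishes on the face, and its gradient is
      \<open>\<theta> x *\<^sub>R n\<close> plus a field that vanishes there.\<close>
    let ?v = "\<lambda>x. \<tau> x * \<theta> x"
    have gv: "gradient ?v = (\<lambda>x. \<theta> x *\<^sub>R n + \<tau> x *\<^sub>R gradient \<theta> x)"
      using gradient_mult[OF \<tau>(1) \<theta>s] \<tau>(2) by (auto simp: add.commute)
    have tf: "test_fun (ball x0 r) (\<lambda>x. (\<tau> x *\<^sub>R gradient \<theta> x) $ i)" for i
      using test_fun_mult[OF \<tau>(1) test_fun_gradient_component[OF \<theta>]] by simp
    have "0 = pair_ip (div_smooth (gradient ?v)) (gradient ?v) p g"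
      by (rule nat[symmetric]) (use test_fun_mult[OF \<tau>(1) \<theta>] \<tau>(3) in auto)
    also have "\<dots> = pair_ip (div_smooth (\<lambda>x. \<theta> x *\<^sub>R n)) (\<lambda>x. \<theta> x *\<^sub>R n) p g +
        pair_ip (div_smooth (\<lambda>x. \<tau> x *\<^sub>R gradient \<theta> x)) (\<lambda>x. \<tau> x *\<^sub>R gradient \<theta> x) p g"
      unfolding gv by (rule pair_ip_field_add[OF sc test_fun_smooth[OF tf] p])
    also have "pair_ip (div_smooth (\<lambda>x. \<tau> x *\<^sub>R gradient \<theta> x)) (\<lambda>x. \<tau> x *\<^sub>R gradient \<theta> x) p g = 0"
      by (rule flat_point_pair_ip_H1[OF fp tf _ p]) (simp add: \<tau>(3))
    finally show ?thesis by simp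
  qed
  have scaled: "pair_ip (div_smooth (\<lambda>x. \<theta> x *\<^sub>R (c *\<^sub>R n))) (\<lambda>x. \<theta> x *\<^sub>R (c *\<^sub>R n)) p g = 0" for c
  proof -
    have "pair_ip (div_smooth (\<lambda>x. \<theta> x *\<^sub>R (c *\<^sub>R n))) (\<lambda>x. \<theta> x *\<^sub>R (c *\<^sub>R n)) p g =
        (\<integral>x. c * ((div_smooth (\<lambda>x. \<theta> x *\<^sub>R n) x, \<theta> x *\<^sub>R n) \<bullet> (p x, g x)) \<partial>M)"
      unfolding ip_def div_smooth_scale_const[OF \<theta>s] by (simp add: algebra_simps)
    then show ?thesis using normal unfolding ip_def by simp
  qed
  let ?t = "a - (a \<bullet> n) *\<^sub>R n"
  have tang: "pair_ip (div_smooth (\<lambda>x. \<theta> x *\<^sub>R ?t)) (\<lambda>x. \<theta> x *\<^sub>R ?t) p g = 0"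
  proof (rule flat_point_pair_ip_H1[OF fp _ _ p])
    show "test_fun (ball x0 r) (\<lambda>x. (\<theta> x *\<^sub>R ?t) $ i)" for i
      using test_fun_mult'[OF \<theta> smooth_const] by simp
    show "(\<theta> z *\<^sub>R ?t) \<bullet> n = 0" for z using nn by (simp add: inner_diff_left)
  qed
  have "\<theta> x *\<^sub>R a = \<theta> x *\<^sub>R ((a \<bullet> n) *\<^sub>R n) + \<theta> x *\<^sub>R ?t" for x by (simp add: algebra_simps)
  then have "pair_ip (div_smooth (\<lambda>x. \<theta> x *\<^sub>R a)) (\<lambda>x. \<theta> x *\<^sub>R a) p g = 0"
    using pair_ip_field_add[OF sc sc p, of "(a \<bullet> n) *\<^sub>R n" ?t] scaled tang by simp
  then have "(\<integral>x. p x * (gradient \<theta> x \<bullet> a) + \<theta> x * (g x \<bullet> a) \<partial>M) = 0"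
    by (simp add: ip_def div_smooth_scale_const[OF \<theta>s] inner_commute mult.commute)
  moreover have "integrable M (\<lambda>x. p x * (gradient \<theta> x \<bullet> a))" "integrable M (\<lambda>x. \<theta> x * (g x \<bullet> a))"
    using ps \<theta>s by (intro sqint_mult_integrable; blast)+
  ultimately show ?thesis by simp
qed

text \<open>On the face, where the signed distance is 0 and has normal derivative 1, the correction
  leaves the value unchanged and cancels exactly the normal derivative.\<close>

lemma neumann_face:
  assumes fp: "flat_point \<Omega> x0 n r" and z: "test_fun (ball x0 r) z"
  obtains v where "test_fun (ball x0 r) v" "\<And>y. (y - x0) \<bullet> n = 0 \<Longrightarrow> gradient v y \<bullet> n = 0"
    "\<And>y. (y - x0) \<bullet> n = 0 \<Longrightarrow> z y - v y = 0"
proof -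
  have nn: "n \<bullet> n = 1" using fp by (simp add: flat_point_def dot_square_norm)
  define \<tau> where "\<tau> x = x \<bullet> n - x0 \<bullet> n" for x
  have \<tau>: "smooth \<tau>" "gradient \<tau> x = n" "\<tau> x = (x - x0) \<bullet> n" for x
    unfolding \<tau>_def[abs_def] by (auto simp: gradient_diff inner_diff_left)
  let ?d = "\<lambda>x. gradient z x \<bullet> n"
  have zs: "smooth z" using z by (rule test_fun_smooth)
  have ds: "smooth ?d" using zs by blast
  have t: "test_fun (ball x0 r) (\<lambda>x. \<tau> x * ?d x)" using test_fun_mult[OF \<tau>(1) test_fun_gradient_inner[OF z]] .
  show thesis
  proof (rule that[of "\<lambda>x. z x - \<tau> x * ?d x"])
    have "test_fun (ball x0 r) (\<lambda>x. z x + (-1) * (\<tau> x * ?d x))"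
      by (rule test_fun_add[OF z test_fun_mult[OF smooth_const t]])
    then show "test_fun (ball x0 r) (\<lambda>x. z x - \<tau> x * ?d x)" by simp
    show "gradient (\<lambda>x. z x - \<tau> x * ?d x) y \<bullet> n = 0" if "(y - x0) \<bullet> n = 0" for y
      using that nn \<tau>(3)[of y]
      by (simp add: gradient_diff[OF zs test_fun_smooth[OF t]] gradient_mult[OF \<tau>(1) ds] \<tau>(2) inner_diff_left inner_add_left)
  qed (simp add: \<tau>(3))
qed

end

section \<open>Functions with vanishing gradient\<close>

text \<open>Supplies a disk on which a Dirichlet condition holds, needed to fix the additive
  constant in the uniqueness proof. At a relative interior point of the facet the chart direction
  \<open>e\<close> is transversal, and a line in that direction meets the frontier at most once in
  the chart; so near the point the frontier is nothing but the facet.\<close>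

lemma facet_flat_point:
  fixes \<Omega> :: "(real^'n) set"
  assumes \<Omega>: "lipschitz_boundary \<Omega>" "open \<Omega>"
    and P: "polytope P" "aff_dim P = int CARD('n) - 1" "P \<noteq> {}" "P \<subseteq> frontier \<Omega>"
  shows "\<exists>x m r. flat_point \<Omega> x m r \<and> frontier \<Omega> \<inter> ball x r \<subseteq> P"
proof -
  obtain n0 s0 where n0: "n0 \<noteq> 0" "affine hull P = {x. n0 \<bullet> x = s0}"
    using P(2) aff_dim_eq_hyperplane[of P] by auto
  define n s where "n = n0 /\<^sub>R norm n0" and "s = s0 / norm n0"
  have n: "norm n = 1" "affine hull P = {x. n \<bullet> x = s}"
    using n0 by (auto simp: n_def s_def field_simps)
  have "rel_interior P \<noteq> {}"
    using P(1,3) polytope_imp_convex rel_interior_eq_empty by blast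
  then obtain x0 r0 where x0: "x0 \<in> P" "r0 > 0" "ball x0 r0 \<inter> affine hull P \<subseteq> P"
    by (auto simp: mem_rel_interior_ball)
  have xf: "x0 \<in> frontier \<Omega>" using x0(1) P(4) by blast
  have xs: "n \<bullet> x0 = s" using x0(1) hull_subset[of P affine] n(2) by blast
  obtain U e g L where U: "open U" "x0 \<in> U" "norm e = 1"
    "\<Omega> \<inter> U = {y \<in> U. y \<bullet> e < g (y - (y \<bullet> e) *\<^sub>R e)}"
    "\<And>y. y \<in> frontier \<Omega> \<inter> U \<Longrightarrow> y \<bullet> e = g (y - (y \<bullet> e) *\<^sub>R e)"
    by (rule lipschitz_boundary_chart[OF \<Omega> xf]) (rule that)
  have val: "(y + h *\<^sub>R e) \<bullet> e = y \<bullet> e + h" for y h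
    using U(3) by (simp add: inner_add_left dot_square_norm)
  have same: "h = 0" if "y \<in> frontier \<Omega> \<inter> U" "y + h *\<^sub>R e \<in> frontier \<Omega> \<inter> U" for y h
    using U(5)[OF that(1)] U(5)[OF that(2)] unfolding proj_shift[OF U(3)] unfolding val by simp
  \<comment> \<open>If \<open>e\<close> were tangential, moving along it would stay in the facet and
    give a second frontier point on the same chart line.\<close>
  have ne: "n \<bullet> e \<noteq> 0"
  proof
    assume 0: "n \<bullet> e = 0"
    obtain t where t: "t > 0" "\<And>h. \<bar>h\<bar> \<le> t \<Longrightarrow> x0 + h *\<^sub>R e \<in> U \<inter> ball x0 r0"
      by (rule small_segment[of "U \<inter> ball x0 r0" x0]) (use U x0 in auto)
    have "x0 + t *\<^sub>R e \<in> U \<inter> ball x0 r0" using t by auto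
    moreover have "x0 + t *\<^sub>R e \<in> affine hull P" using 0 xs n(2) by (simp add: inner_add_right)
    ultimately have "x0 + t *\<^sub>R e \<in> frontier \<Omega> \<inter> U" using x0(3) P(4) by blast
    then have "t = 0" using same[of x0 t] xf U(2) by blast
    then show False using t(1) by simp
  qed
  \<comment> \<open>Projection along \<open>e\<close> onto the hyperplane of the facet: a frontier
    point and its image lie on one chart line, and both are in the frontier, so they
    coincide.\<close>
  define \<pi> where "\<pi> y = y + ((s - n \<bullet> y) / (n \<bullet> e)) *\<^sub>R e" for y
  have "continuous_on UNIV \<pi>" unfolding \<pi>_def using ne by (intro continuous_intros) auto
  moreover have "open (U \<inter> ball x0 r0)" using U(1) by auto
  ultimately have "open (\<pi> -` (U \<inter> ball x0 r0))" by (rule open_vimage[rotated])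
  then have "open (\<pi> -` (U \<inter> ball x0 r0) \<inter> (U \<inter> ball x0 r0))" using U(1) by blast
  moreover have "x0 \<in> \<pi> -` (U \<inter> ball x0 r0) \<inter> (U \<inter> ball x0 r0)"
    using U(2) x0(2) xs by (simp add: \<pi>_def)
  ultimately obtain r where r: "r > 0" "ball x0 r \<subseteq> \<pi> -` (U \<inter> ball x0 r0) \<inter> (U \<inter> ball x0 r0)"
    by (meson open_contains_ball)
  have sub: "{y. n \<bullet> y = s} \<inter> ball x0 r \<subseteq> P"
    using x0(3) n(2) r(2) by blast
  have "frontier \<Omega> \<inter> ball x0 r = {y. n \<bullet> y = s} \<inter> ball x0 r"
  proof
    show "{y. n \<bullet> y = s} \<inter> ball x0 r \<subseteq> frontier \<Omega> \<inter> ball x0 r" using sub P(4) by blast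
    show "frontier \<Omega> \<inter> ball x0 r \<subseteq> {y. n \<bullet> y = s} \<inter> ball x0 r"
    proof
      fix y assume y: "y \<in> frontier \<Omega> \<inter> ball x0 r"
      have "n \<bullet> \<pi> y = s" using ne by (simp add: \<pi>_def inner_add_right)
      moreover have pU: "\<pi> y \<in> U \<inter> ball x0 r0" using y r(2) by blast
      ultimately have "\<pi> y \<in> P" using x0(3) n(2) by blast
      then have "\<pi> y \<in> frontier \<Omega> \<inter> U" using P(4) pU by blast
      moreover have "y \<in> frontier \<Omega> \<inter> U" using y r(2) by blast
      ultimately have "(s - n \<bullet> y) / (n \<bullet> e) = 0" unfolding \<pi>_def by (intro same)
      then show "y \<in> {y. n \<bullet> y = s} \<inter> ball x0 r" using ne y by simp
    qed
  qed
  then obtain m where "flat_point \<Omega> x0 m r"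
    using flat_pointI[OF \<Omega> xf r(1) n(1) xs] by blast
  moreover have "frontier \<Omega> \<inter> ball x0 r \<subseteq> P"
    using \<open>frontier \<Omega> \<inter> ball x0 r = _\<close> sub by blast
  ultimately show ?thesis by blast
qed

section \<open>Vanishing weak gradient and the exclusion of nonzero constants\<close>

context bounded_open
begin

lemma AE_open_ex:
  assumes "AE y in M. P y" "open S" "S \<subseteq> \<Omega>" "S \<noteq> {}"
  shows "\<exists>y\<in>S. P y"
proof (rule ccontr)
  assume a: "\<not> ?thesis"
  have "AE y in lebesgue. y \<in> \<Omega> \<longrightarrow> P y" using assms(1) unfolding AE_domain[symmetric] .
  then have "AE y in lebesgue. y \<notin> S"
    by eventually_elim (use a assms(3) in blast)
  then have "negligible S" using assms(2)
    by (simp add: negligible_iff_null_sets AE_iff_null_sets)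
  then show False using open_not_negligible assms(2,4) by blast
qed

text \<open>Mollifications have zero classical gradient on a smaller ball, so they are constants
  there, and a subsequence converges to \<open>u\<close> almost everywhere.\<close>

lemma weak_grad_0_locally_constant:
  assumes u: "weak_grad u g" "AE x in M. g x = 0" and x: "x \<in> \<Omega>"
  shows "\<exists>d>0. \<exists>c. ball x d \<subseteq> \<Omega> \<and> (AE y in M. y \<in> ball x d \<longrightarrow> u y = c)"
proof -
  obtain e where e: "e > 0" "ball x e \<subseteq> \<Omega>" using x open_domain open_contains_ball by blast
  note us = weak_gradD[OF u(1)]
  have ui: "integrable M u" using us(1) by (rule sqint_imp_integrable)
  define h where "h k = (e / 2) / real (Suc k)" for k :: nat
  have h: "0 < h k" "h k \<le> e / 2" for k using e(1) by (auto simp: h_def field_simps)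
  have h0: "h \<longlonglongrightarrow> 0"
    unfolding h_def using LIMSEQ_Suc[OF lim_const_over_n[of "e / 2"]] by simp
  have "\<exists>\<rho>. test_fun UNIV \<rho> \<and> (\<forall>x. 0 \<le> \<rho> x) \<and> (\<integral>x. \<rho> x \<partial>lborel) = 1 \<and>
      (\<forall>x. x \<notin> cball (h k *\<^sub>R (0::real^'n)) (h k / 2) \<longrightarrow> \<rho> x = 0)" for k
    by (rule smooth_kernel[OF h(1), of k 0]) blast
  then obtain \<rho> where \<rho>: "\<And>k. test_fun UNIV (\<rho> k)" "\<And>k x. 0 \<le> \<rho> k x" "\<And>k. (\<integral>x. \<rho> k x \<partial>lborel) = 1"
    "\<And>k x. x \<notin> cball (h k *\<^sub>R (0::real^'n)) (h k / 2) \<Longrightarrow> \<rho> k x = 0" by metis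
  have supp: "\<rho> k x = 0" if "norm x > h k" for k x
    using that h(1)[of k] by (intro \<rho>(4)) auto
  have cs: "smooth (conv (\<rho> k) u)" for k by (rule smooth_conv[OF \<rho>(1) ui])
  have grad0: "gradient (conv (\<rho> k) u) y = 0" if y: "y \<in> ball x (e / 2)" for k y
  proof -
    have sub: "ball (y - h k *\<^sub>R 0) (h k) \<subseteq> \<Omega>"
    proof -
      have "ball y (h k) \<subseteq> ball x e"
      proof
        fix z assume "z \<in> ball y (h k)"
        then show "z \<in> ball x e" using y h(2)[of k] dist_triangle[of x z y] by simp
      qed
      then show ?thesis using e(2) by simp
    qed
    have "gradient (conv (\<rho> k) u) y = (\<chi> i. conv (\<rho> k) (\<lambda>x. g x $ i) y)"
      by (rule gradient_conv_weak[OF \<rho>(1) ui])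
        (rule weak_grad_inner[OF u(1) test_fun_mono[OF kernel_test_fun[OF \<rho>(1) h(1) \<rho>(4)] sub]])
    moreover have "conv (\<rho> k) (\<lambda>x. g x $ i) y = 0" for i
      unfolding conv_def
      by (rule integral_eq_zero_AE) (use u(2) in \<open>eventually_elim, simp\<close>)
    ultimately show ?thesis by (simp add: vec_eq_iff)
  qed
  have "\<exists>c. \<forall>y\<in>ball x (e / 2). conv (\<rho> k) u y = c" for k
  proof (rule has_derivative_zero_constant)
    fix y assume "y \<in> ball x (e / 2)"
    then have "(conv (\<rho> k) u has_derivative (\<lambda>h. 0)) (at y)"
      using smooth_has_derivative[OF cs, of k y] grad0 by simp
    then show "(conv (\<rho> k) u has_derivative (\<lambda>h. 0)) (at y within ball x (e / 2))"
      by (rule has_derivative_at_withinI)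
  qed simp
  then obtain c where c: "\<And>k y. y \<in> ball x (e / 2) \<Longrightarrow> conv (\<rho> k) u y = c k" by metis
  have "(\<lambda>k. ip M (\<lambda>x. conv (\<rho> k) u x - u x) (\<lambda>x. conv (\<rho> k) u x - u x)) \<longlonglongrightarrow> 0"
    by (rule conv_tendsto[OF \<rho>(1,2,3) supp h0 us(1)])
  then obtain \<sigma> where \<sigma>: "AE y in M. (\<lambda>k. conv (\<rho> (\<sigma> k)) u y) \<longlonglongrightarrow> u y"
    using sqint_tendsto_AE_subseq[where u = "\<lambda>k. conv (\<rho> k) u", OF smooth_sqint[OF cs] us(1)] by blast
  have "AE y in M. y \<in> ball x (e / 2) \<longrightarrow> u y = lim (\<lambda>k. c (\<sigma> k))"
    using \<sigma>
  proof eventually_elim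
    case (elim y)
    then show ?case using c[of y] limI by force
  qed
  moreover have "ball x (e / 2) \<subseteq> \<Omega>" using e subset_ball[of "e / 2" e x] by auto
  ultimately show ?thesis using e(1) by (intro exI[of _ "e / 2"]) auto
qed

text \<open>Two local constants agree when their balls overlap, since an open overlap has positive
  measure; connectedness then propagates the value.\<close>

lemma weak_grad_0_constant:
  assumes conn: "connected \<Omega>" and u: "weak_grad u g" "AE x in M. g x = 0"
  shows "\<exists>c. AE x in M. u x = c"
proof (cases "\<Omega> = {}")
  case True
  then show ?thesis by (auto simp: AE_domain[symmetric])
next
  case False
  then obtain a where a: "a \<in> \<Omega>" by blast
  define G where "G x d c \<longleftrightarrow> d > 0 \<and> ball x d \<subseteq> \<Omega> \<and> (AE y in M. y \<in> ball x d \<longrightarrow> u y = c)" for x d c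
  have "\<exists>d c. G x d c" if "x \<in> \<Omega>" for x
    using weak_grad_0_locally_constant[OF u that] unfolding G_def by blast
  then obtain d c where G: "\<And>x. x \<in> \<Omega> \<Longrightarrow> G x (d x) (c x)" by metis
  have d: "d x > 0" "ball x (d x) \<subseteq> \<Omega>" and c: "AE y in M. y \<in> ball x (d x) \<longrightarrow> u y = c x" if "x \<in> \<Omega>" for x
    using G[OF that] unfolding G_def by auto
  have loc: "c x = c y" if xy: "x \<in> \<Omega>" "y \<in> ball x (d x)" for x y
  proof -
    have y: "y \<in> \<Omega>" using xy d(2) by blast
    have "AE z in M. (z \<in> ball x (d x) \<longrightarrow> u z = c x) \<and> (z \<in> ball y (d y) \<longrightarrow> u z = c y)"
      using c[OF xy(1)] c[OF y] by eventually_elim blast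
    moreover have "y \<in> ball x (d x) \<inter> ball y (d y)" using xy(2) d(1)[OF y] by auto
    ultimately obtain z where "z \<in> ball x (d x) \<inter> ball y (d y)"
      "(z \<in> ball x (d x) \<longrightarrow> u z = c x) \<and> (z \<in> ball y (d y) \<longrightarrow> u z = c y)"
      using AE_open_ex[of _ "ball x (d x) \<inter> ball y (d y)"] d(2)[OF xy(1)] by blast
    then show ?thesis by auto
  qed
  have const: "c x = c a" if "x \<in> \<Omega>" for x
  proof (rule connected_local_const[OF conn that a], rule ballI)
    fix y assume y: "y \<in> \<Omega>"
    have "\<forall>\<^sub>F z in nhds y. z \<in> ball y (d y)"
      using d(1)[OF y] by (intro eventually_nhds_in_open) auto
    then have ev: "\<forall>\<^sub>F z in at y within \<Omega>. z \<in> ball y (d y)"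
      by (auto simp: eventually_at_filter elim: eventually_mono)
    show "\<forall>\<^sub>F z in at y within \<Omega>. c y = c z"
      by (rule eventually_mono[OF ev loc[OF y]])
  qed
  \<comment> \<open>Countably many of the balls cover the domain, so the exceptional null sets can
    be united.\<close>
  obtain F where F: "F \<subseteq> (\<lambda>x. ball x (d x)) ` \<Omega>" "countable F" "\<Union>F = \<Union>((\<lambda>x. ball x (d x)) ` \<Omega>)"
    by (rule Lindelof[of "(\<lambda>x. ball x (d x)) ` \<Omega>"]) auto
  have "AE y in M. \<forall>B\<in>F. y \<in> B \<longrightarrow> u y = c a"
  proof (rule AE_ball_countable[THEN iffD2, OF F(2)], rule ballI)
    fix B assume "B \<in> F"
    then obtain x where "x \<in> \<Omega>" "B = ball x (d x)" using F(1) by blast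
    then show "AE y in M. y \<in> B \<longrightarrow> u y = c a" using c[of x] const[of x] by simp
  qed
  moreover have "AE y in M. y \<in> \<Omega>" by (rule AE_I2) simp
  ultimately have "AE y in M. u y = c a"
  proof eventually_elim
    case (elim y)
    have "y \<in> ball y (d y)" using d(1)[OF elim(2)] by simp
    then have "y \<in> \<Union>F" unfolding F(3) using elim(2) by blast
    then show ?case using elim(1) by blast
  qed
  then show ?thesis by blast
qed

lemma div_smooth_scale:
  assumes "smooth \<phi>" "\<And>i. smooth (\<lambda>x. Y x $ i)"
  shows "div_smooth (\<lambda>x. \<phi> x *\<^sub>R Y x) x = \<phi> x * div_smooth Y x + gradient \<phi> x \<bullet> Y x"
  using assms by (simp add: div_smooth_def gradient_mult inner_vec_def sum.distrib sum_distrib_left mult.commute)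

text \<open>The divergence theorem for \<open>\<phi> *\<^sub>R Y\<close> in a half ball.\<close>

lemma flat_point_pair_ip_vanishing:
  assumes fp: "flat_point \<Omega> x0 n r" and Y: "\<And>i. test_fun (ball x0 r) (\<lambda>x. Y x $ i)"
    and \<phi>: "smooth \<phi>" "\<And>x. x \<in> frontier \<Omega> \<inter> ball x0 r \<Longrightarrow> \<phi> x = 0"
  shows "pair_ip (div_smooth Y) Y \<phi> (gradient \<phi>) = 0"
proof -
  have fr: "\<And>y. y \<in> ball x0 r \<Longrightarrow> y \<in> frontier \<Omega> \<longleftrightarrow> (y - x0) \<bullet> n = 0"
    using fp unfolding flat_point_def by blast
  have Z: "test_fun (ball x0 r) (\<lambda>x. (\<phi> x *\<^sub>R Y x) $ i)" for i
    using test_fun_mult[OF \<phi>(1) Y] by simp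
  \<comment> \<open>Pairing with the constant 1 leaves only the divergence of the product, whose
    normal component vanishes on the face because \<open>\<phi>\<close> does.\<close>
  have "pair_ip (div_smooth (\<lambda>x. \<phi> x *\<^sub>R Y x)) (\<lambda>x. \<phi> x *\<^sub>R Y x) (\<lambda>_. 1) (gradient (\<lambda>_. 1)) = 0"
  proof (rule flat_point_pair_ip_H1[OF fp Z _ weak_grad_smooth[OF smooth_const]])
    fix z assume z: "(z - x0) \<bullet> n = 0"
    show "(\<phi> z *\<^sub>R Y z) \<bullet> n = 0"
    proof (cases "z \<in> ball x0 r")
      case True
      then show ?thesis using fr z \<phi>(2) by simp
    next
      case False
      then have "Y z = 0" using test_fun_outside[OF Y] by (simp add: vec_eq_iff)
      then show ?thesis by simp
    qed
  qed
  then show ?thesis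
    unfolding ip_def div_smooth_scale[OF \<phi>(1) test_fun_smooth[OF Y]] by (simp add: inner_commute mult.commute)
qed

text \<open>For a nonzero constant, a zero trace on the disk would make the mollified indicator of
  the domain stationary along the normal segment through \<open>x0\<close>. But this function is 1
  at the inner end, where the kernel lies in the domain, and 0 at the outer end.\<close>

lemma trace_zero_constant:
  assumes fp: "flat_point \<Omega> x0 n r" "frontier \<Omega> \<inter> ball x0 r \<subseteq> \<Gamma>"
    and v: "weak_grad v g" "AE x in M. v x = c" "AE x in M. g x = 0" "trace_zero_on \<Omega> \<Gamma> v"
  shows "c = 0"
proof (rule ccontr)
  assume c: "c \<noteq> 0"
  have r: "r > 0" and n: "norm n = 1" "n \<bullet> n = 1" and \<Omega>r: "\<And>y. y \<in> ball x0 r \<Longrightarrow> y \<in> \<Omega> \<longleftrightarrow> (y - x0) \<bullet> n < 0"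
    using fp(1) unfolding flat_point_def by (blast, blast, simp add: dot_square_norm, blast)
  obtain \<rho> where \<rho>: "test_fun UNIV \<rho>" "\<And>x. 0 \<le> \<rho> x" "(\<integral>x. \<rho> x \<partial>lborel) = 1"
    "\<And>x. x \<notin> cball ((r / 4) *\<^sub>R (0::real^'n)) ((r / 4) / 2) \<Longrightarrow> \<rho> x = 0"
    by (rule smooth_kernel[of "r / 4" 0]) (use r that in auto)
  have one: "integrable M (\<lambda>_. 1::real)" by (rule sqint_imp_integrable) simp
  define y where "y s = x0 + s *\<^sub>R n" for s
  have tf: "test_fun (ball (y s) (r / 4)) (\<lambda>t. \<rho> (y s - t))" for s
    using kernel_test_fun[where h = "r / 4" and c = 0 and y = "y s", OF \<rho>(1) _ \<rho>(4)] r by simp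
  have near: "t \<in> ball x0 r" "\<bar>(t - x0) \<bullet> n - s\<bar> < r / 4" if s: "\<bar>s\<bar> \<le> r / 2" and t: "t \<in> ball (y s) (r / 4)" for s t
  proof -
    have "dist x0 (y s) \<le> r / 2" using s n by (simp add: y_def dist_norm)
    then show "t \<in> ball x0 r" using t dist_triangle[of x0 t "y s"] r by simp
    have "(t - x0) \<bullet> n - s = (t - y s) \<bullet> n" using n by (simp add: y_def inner_diff_left inner_add_left)
    moreover have "\<bar>(t - y s) \<bullet> n\<bar> \<le> norm (t - y s)" using Cauchy_Schwarz_ineq2[of "t - y s" n] n by simp
    moreover have "norm (t - y s) < r / 4" using t by (simp add: dist_norm norm_minus_commute)
    ultimately show "\<bar>(t - x0) \<bullet> n - s\<bar> < r / 4" by simp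
  qed
  \<comment> \<open>The zero trace is tested with the field formed by the reflected kernel and
    \<open>n\<close>. As \<open>v\<close> is constant, what remains is \<open>c\<close> times the
    integral of the normal derivative of that kernel over the domain.\<close>
  have grad0: "gradient (conv \<rho> (\<lambda>_. 1)) (y s) \<bullet> n = 0" if s: "\<bar>s\<bar> \<le> r / 2" for s
  proof -
    let ?b = "\<lambda>t. \<rho> (y s - t)"
    have b: "test_fun (ball x0 r) ?b" using tf near(1)[OF s] by (meson subsetI test_fun_mono)
    have bs: "smooth ?b" using b by (rule test_fun_smooth)
    let ?Y = "\<lambda>t. ?b t *\<^sub>R n"
    have Y: "test_fun (ball x0 r) (\<lambda>t. ?Y t $ i)" for i
      using test_fun_mult'[OF b smooth_const] by simp
    have Yd: "weak_div ?Y (div_smooth ?Y)" by (rule weak_div_smooth[OF test_fun_smooth[OF Y]])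
    have "pair_ip (div_smooth ?Y) ?Y v g = 0"
      by (rule trace_zero_on_annihilator[OF v(1,4) weak_divD(2,1)[OF Yd]])
        (rule flat_point_pair_ip_vanishing[OF fp(1) Y], use fp(2) in auto)
    also have "pair_ip (div_smooth ?Y) ?Y v g = pair_ip (div_smooth ?Y) ?Y (\<lambda>_. c) (\<lambda>_. 0)"
    proof (rule ip_cong_AE)
      show "AE x in M. (v x, g x) = (c, 0)" using v(2,3) by eventually_elim simp
    qed (use weak_divD[OF Yd] weak_gradD[OF v(1)] in auto)
    also have "\<dots> = c * (\<integral>t. gradient ?b t \<bullet> n \<partial>M)"
      by (simp add: ip_def div_smooth_scale_const[OF bs])
    finally have "(\<integral>t. gradient ?b t \<bullet> n \<partial>M) = 0" using c by simp
    then have "(\<integral>t. gradient \<rho> (y s - t) \<bullet> n \<partial>M) = 0"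
      by (simp add: gradient_reflect[OF test_fun_smooth[OF \<rho>(1)]])
    moreover have "gradient (conv \<rho> (\<lambda>_. 1)) (y s) \<bullet> n = (\<integral>t. gradient \<rho> (y s - t) \<bullet> n \<partial>M)"
      using conv_integrable[OF test_fun_gradient_component[OF \<rho>(1)] one, of "y s"]
      by (simp add: gradient_conv[OF \<rho>(1) one] inner_vec_def conv_def)
    ultimately show ?thesis by simp
  qed
  have "\<exists>C. \<forall>s\<in>{-(r/2)..r/2}. conv \<rho> (\<lambda>_. 1) (y s) = C"
  proof (rule has_derivative_zero_constant)
    fix s assume "s \<in> {-(r/2)..r/2}"
    then have s: "\<bar>s\<bar> \<le> r / 2" by auto
    have "(y has_derivative (\<lambda>h. h *\<^sub>R n)) (at s within {-(r/2)..r/2})"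
      unfolding y_def by (auto intro!: derivative_eq_intros)
    from has_derivative_compose[OF this smooth_has_derivative[OF smooth_conv[OF \<rho>(1) one]]]
    show "((\<lambda>s. conv \<rho> (\<lambda>_. 1) (y s)) has_derivative (\<lambda>h. 0)) (at s within {-(r/2)..r/2})"
      using grad0[OF s] by simp
  qed simp
  then have "conv \<rho> (\<lambda>_. 1) (y (r/2)) = conv \<rho> (\<lambda>_. 1) (y (-(r/2)))" using r by auto
  moreover have "conv \<rho> (\<lambda>_. 1) (y (r/2)) = (\<integral>t. 0 \<partial>M)"
    unfolding conv_def
  proof (rule Bochner_Integration.integral_cong)
    fix t assume t: "t \<in> space M"
    have "t \<notin> ball (y (r/2)) (r / 4)"
    proof
      assume "t \<in> ball (y (r/2)) (r / 4)"
      then have "t \<in> ball x0 r" "\<bar>(t - x0) \<bullet> n - r / 2\<bar> < r / 4" using near[of "r/2" t] r by auto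
      then show False using \<Omega>r[of t] t r by simp
    qed
    then show "\<rho> (y (r/2) - t) * 1 = 0" using test_fun_outside[OF tf] by simp
  qed simp
  moreover have "conv \<rho> (\<lambda>_. 1) (y (-(r/2))) = 1"
  proof -
    have "ball (y (-(r/2))) (r / 4) \<subseteq> \<Omega>"
    proof
      fix t assume "t \<in> ball (y (-(r/2))) (r / 4)"
      then have "t \<in> ball x0 r" "\<bar>(t - x0) \<bullet> n + r / 2\<bar> < r / 4" using near[of "-(r/2)" t] r by auto
      then show "t \<in> \<Omega>" using \<Omega>r[of t] r by linarith
    qed
    then have "test_fun \<Omega> (\<lambda>t. \<rho> (y (-(r/2)) - t))" by (rule test_fun_mono[OF tf])
    then show ?thesis
      using kernel_integral_reflect(2)[OF \<rho>(1,2,3)] by (simp add: conv_def test_fun_integral)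
  qed
  ultimately show False by simp
qed

end

section \<open>The saddle-point problem\<close>

locale mixed_domain = bounded_open \<Omega> for \<Omega> :: "(real^'n) set" +
  fixes \<Gamma>0 \<Gamma>1 \<Gamma>3 :: "(real^'n) set" and \<A> :: "(real^'n) set set"
  assumes frontier_eq: "frontier \<Omega> = \<Gamma>0 \<union> \<Gamma>1 \<union> \<Gamma>3"
    and finite_exceptional: "finite \<A>" and codim2_exceptional: "\<And>A. A \<in> \<A> \<Longrightarrow> codim2 A"
    and regular: "\<And>x. x \<in> frontier \<Omega> \<Longrightarrow> x \<notin> \<Union>\<A> \<Longrightarrow> \<exists>n r. flat_point \<Omega> x n r \<and>
      (frontier \<Omega> \<inter> ball x r \<subseteq> \<Gamma>0 \<and> \<Gamma>1 \<inter> ball x r = {} \<and> \<Gamma>3 \<inter> ball x r = {} \<or>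
       frontier \<Omega> \<inter> ball x r \<subseteq> \<Gamma>1 \<and> \<Gamma>0 \<inter> ball x r = {} \<and> \<Gamma>3 \<inter> ball x r = {} \<or>
       frontier \<Omega> \<inter> ball x r \<subseteq> \<Gamma>3 \<and> \<Gamma>0 \<inter> ball x r = {} \<and> \<Gamma>1 \<inter> ball x r = {})"
begin

lemma domain_frontier_disjoint: "\<Omega> \<inter> frontier \<Omega> = {}"
  using open_domain by (auto simp: frontier_def interior_open)

lemma closure_cases:
  assumes "x \<in> closure \<Omega>" "x \<notin> \<Union>\<A>"
  obtains (interior) r where "r > 0" "ball x r \<subseteq> \<Omega>"
    | (face0) n r where "flat_point \<Omega> x n r" "frontier \<Omega> \<inter> ball x r \<subseteq> \<Gamma>0" "\<Gamma>1 \<inter> ball x r = {}" "\<Gamma>3 \<inter> ball x r = {}"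
    | (face1) n r where "flat_point \<Omega> x n r" "frontier \<Omega> \<inter> ball x r \<subseteq> \<Gamma>1" "\<Gamma>0 \<inter> ball x r = {}" "\<Gamma>3 \<inter> ball x r = {}"
    | (face3) n r where "flat_point \<Omega> x n r" "frontier \<Omega> \<inter> ball x r \<subseteq> \<Gamma>3" "\<Gamma>0 \<inter> ball x r = {}" "\<Gamma>1 \<inter> ball x r = {}"
proof (cases "x \<in> \<Omega>")
  case True
  then show thesis using open_domain interior by (meson open_contains_ball)
next
  case False
  then have "x \<in> frontier \<Omega>" using assms(1) open_domain by (simp add: frontier_def interior_open)
  from regular[OF this assms(2)] show thesis using face0 face1 face3 by (elim exE conjE disjE)
qed

lemma test_fun_vanishes: "test_fun \<Omega> \<phi> \<Longrightarrow> x \<in> frontier \<Omega> \<Longrightarrow> \<phi> x = 0"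
  using test_fun_outside domain_frontier_disjoint by blast

text \<open>The set \<open>frontier \<Omega> - \<Gamma>3\<close> may be smaller than
  \<open>\<Gamma>0 \<union> \<Gamma>1\<close> by points that these closed segments share with
  \<open>\<Gamma>3\<close>. Such points are exceptional, and in the balls around all other points
  vanishing on the one set gives vanishing on the other.\<close>

lemma annihilator_extends:
  assumes w: "w0 \<in> sqint M" "w1 \<in> sqint M"
    and ann: "\<And>\<phi>. smooth \<phi> \<Longrightarrow> (\<And>x. x \<in> \<Gamma>0 \<union> \<Gamma>1 \<Longrightarrow> \<phi> x = 0) \<Longrightarrow> pair_ip w0 w1 \<phi> (gradient \<phi>) = 0"
    and \<phi>: "smooth \<phi>" "\<And>x. x \<in> frontier \<Omega> - \<Gamma>3 \<Longrightarrow> \<phi> x = 0"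
  shows "pair_ip w0 w1 \<phi> (gradient \<phi>) = 0"
proof -
  obtain C where C: "\<And>x. x \<in> \<Omega> \<Longrightarrow> norm (\<phi> x) \<le> C"
    by (rule continuous_bounded_domain[OF smooth_continuous_on[OF \<phi>(1)]]) blast
  show ?thesis
  proof (rule local_to_global[OF w smooth_gradient_sqint[OF \<phi>(1)] smooth_measurable_domain[OF \<phi>(1)]
        C[unfolded real_norm_def] finite_exceptional codim2_exceptional])
    fix x assume x: "x \<in> closure \<Omega>" "x \<notin> \<Union>\<A>"
    have concl: "pair_ip w0 w1 (\<lambda>x. \<theta> x * \<phi> x) (\<lambda>x. \<theta> x *\<^sub>R gradient \<phi> x + \<phi> x *\<^sub>R gradient \<theta> x) = 0"
      if \<theta>: "test_fun (ball x d) \<theta>" and van: "\<And>y. y \<in> (\<Gamma>0 \<union> \<Gamma>1) \<inter> ball x d \<Longrightarrow> \<phi> y = 0" for \<theta> d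
    proof -
      have s: "smooth \<theta>" using \<theta> by (rule test_fun_smooth)
      have "pair_ip w0 w1 (\<lambda>x. \<theta> x * \<phi> x) (gradient (\<lambda>x. \<theta> x * \<phi> x)) = 0"
      proof (rule ann)
        show "smooth (\<lambda>x. \<theta> x * \<phi> x)" using s \<phi>(1) by (rule smooth_mult)
        show "\<theta> y * \<phi> y = 0" if "y \<in> \<Gamma>0 \<union> \<Gamma>1" for y
          using van[of y] test_fun_outside[OF \<theta>, of y] that by (cases "y \<in> ball x d") auto
      qed
      then show ?thesis by (simp add: gradient_mult[OF s \<phi>(1)])
    qed
    show "\<exists>d>0. \<forall>\<theta>. test_fun (ball x d) \<theta> \<longrightarrow>
        pair_ip w0 w1 (\<lambda>x. \<theta> x * \<phi> x) (\<lambda>x. \<theta> x *\<^sub>R gradient \<phi> x + \<phi> x *\<^sub>R gradient \<theta> x) = 0"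
      using x
    proof (cases rule: closure_cases)
      case (interior r)
      have "(\<Gamma>0 \<union> \<Gamma>1) \<inter> ball x r = {}" using interior(2) domain_frontier_disjoint frontier_eq by blast
      then show ?thesis using interior(1) concl by blast
    next
      case (face0 n r)
      have "r > 0" using face0(1) by (simp add: flat_point_def)
      moreover have "\<phi> y = 0" if "y \<in> (\<Gamma>0 \<union> \<Gamma>1) \<inter> ball x r" for y
        using that face0 frontier_eq by (intro \<phi>(2)) blast
      ultimately show ?thesis using concl by blast
    next
      case (face1 n r)
      have "r > 0" using face1(1) by (simp add: flat_point_def)
      moreover have "\<phi> y = 0" if "y \<in> (\<Gamma>0 \<union> \<Gamma>1) \<inter> ball x r" for y
        using that face1 frontier_eq by (intro \<phi>(2)) blast
      ultimately show ?thesis using concl by blast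
    next
      case (face3 n r)
      have "r > 0" using face3(1) by (simp add: flat_point_def)
      moreover have "(\<Gamma>0 \<union> \<Gamma>1) \<inter> ball x r = {}" using face3 by blast
      ultimately show ?thesis using concl by blast
    qed
  qed
qed

text \<open>Membership in \<open>V0\<close> refers to the chosen representatives
  \<open>wgrad\<close> and \<open>wdiv\<close>; equality almost everywhere lets any explicit
  gradient and divergence take their place.\<close>

lemma V0I:
  assumes "weak_grad u g" "weak_div g q" "trace_zero_on \<Omega> (\<Gamma>0 \<union> \<Gamma>1) u" "g \<in> H0div \<Omega> (\<Gamma>1 \<union> \<Gamma>3)"
  shows "u \<in> V0 \<Omega> \<Gamma>0 \<Gamma>1 \<Gamma>3" "AE x in M. wgrad \<Omega> u x = g x" "AE x in M. wlaplace \<Omega> u x = q x"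
proof -
  have H: "u \<in> H1 \<Omega>" using assms(1) by (rule weak_grad_imp_H1)
  show ae: "AE x in M. wgrad \<Omega> u x = g x" using assms(1) by (rule wgrad_AE)
  have meas: "wgrad \<Omega> u \<in> borel_measurable M" using weak_grad_wgrad[OF H] weak_gradD sqint_measurable by blast
  have ae': "AE x in M. g x = wgrad \<Omega> u x" using ae by eventually_elim simp
  have d: "weak_div (wgrad \<Omega> u) q" using assms(2) ae' meas by (rule weak_div_cong_AE)
  show "AE x in M. wlaplace \<Omega> u x = q x" unfolding wlaplace_def using d by (rule wdiv_AE)
  have "wgrad \<Omega> u \<in> H0div \<Omega> (\<Gamma>1 \<union> \<Gamma>3)"
    unfolding H0div_iff[OF d]
  proof (intro allI impI)
    fix \<phi> assume \<phi>: "smooth \<phi>" "\<forall>x\<in>frontier \<Omega> - (\<Gamma>1 \<union> \<Gamma>3). \<phi> x = 0"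
    have "pair_ip q (wgrad \<Omega> u) \<phi> (gradient \<phi>) = pair_ip q g \<phi> (gradient \<phi>)"
      using ae weak_divD[OF assms(2)] weak_divD[OF d] \<phi>(1)
      by (intro ip_cong_AE) auto
    then show "pair_ip q (wgrad \<Omega> u) \<phi> (gradient \<phi>) = 0"
      using assms(4) \<phi> unfolding H0div_iff[OF assms(2)] by simp
  qed
  then show "u \<in> V0 \<Omega> \<Gamma>0 \<Gamma>1 \<Gamma>3"
    using assms(3) H by (simp add: V0_def V_def H0div_def)
qed

lemma V0D:
  assumes "u \<in> V0 \<Omega> \<Gamma>0 \<Gamma>1 \<Gamma>3"
  shows "weak_grad u (wgrad \<Omega> u)" "weak_div (wgrad \<Omega> u) (wlaplace \<Omega> u)"
    "trace_zero_on \<Omega> (\<Gamma>0 \<union> \<Gamma>1) u" "wgrad \<Omega> u \<in> H0div \<Omega> (\<Gamma>1 \<union> \<Gamma>3)"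
  using assms weak_grad_wgrad weak_div_wdiv unfolding V0_def V_def H0div_def wlaplace_def by auto

lemma smooth_V0:
  assumes "smooth \<phi>" "\<And>x. x \<in> \<Gamma>0 \<union> \<Gamma>1 \<Longrightarrow> \<phi> x = 0"
    and "\<And>\<psi>. smooth \<psi> \<Longrightarrow> (\<And>x. x \<in> frontier \<Omega> - (\<Gamma>1 \<union> \<Gamma>3) \<Longrightarrow> \<psi> x = 0) \<Longrightarrow>
      pair_ip (div_smooth (gradient \<phi>)) (gradient \<phi>) \<psi> (gradient \<psi>) = 0"
  shows "\<phi> \<in> V0 \<Omega> \<Gamma>0 \<Gamma>1 \<Gamma>3" "AE x in M. wgrad \<Omega> \<phi> x = gradient \<phi> x"
    "AE x in M. wlaplace \<Omega> \<phi> x = div_smooth (gradient \<phi>) x"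
proof -
  have d: "weak_div (gradient \<phi>) (div_smooth (gradient \<phi>))"
    by (rule weak_div_smooth) (rule smooth_gradient_component[OF assms(1)])
  have t: "trace_zero_on \<Omega> (\<Gamma>0 \<union> \<Gamma>1) \<phi>" using assms(1,2) by (rule trace_zero_on_smooth)
  have h: "gradient \<phi> \<in> H0div \<Omega> (\<Gamma>1 \<union> \<Gamma>3)" unfolding H0div_iff[OF d] using assms(3) by blast
  show "\<phi> \<in> V0 \<Omega> \<Gamma>0 \<Gamma>1 \<Gamma>3" "AE x in M. wgrad \<Omega> \<phi> x = gradient \<phi> x"
    "AE x in M. wlaplace \<Omega> \<phi> x = div_smooth (gradient \<phi>) x"
    using V0I[OF weak_grad_smooth[OF assms(1)] d t h] by blast+
qed

lemma test_field_H0div: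
  assumes "\<And>i. test_fun \<Omega> (\<lambda>x. Y x $ i)"
  shows "weak_div Y (div_smooth Y)" "Y \<in> H0div \<Omega> \<Gamma>"
proof -
  show d: "weak_div Y (div_smooth Y)" by (rule weak_div_smooth[OF test_fun_smooth[OF assms]])
  show "Y \<in> H0div \<Omega> \<Gamma>" unfolding H0div_iff[OF d]
    using weak_grad_test_field[OF weak_grad_smooth assms] by blast
qed

lemma b_form_eq:
  assumes "weak_div \<beta> q" "u \<in> sqint M" "v \<in> sqint M"
  shows "b_form \<Omega> (u, v) \<beta> = pair_ip q \<beta> u v"
proof -
  have "b_form \<Omega> (u, v) \<beta> = pair_ip (wdiv \<Omega> \<beta>) \<beta> u v"
    by (simp add: b_form_def LINT_domain ip_def algebra_simps)
  also have "\<dots> = pair_ip q \<beta> u v"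
    using wdiv_AE[OF assms(1)] weak_divD[OF assms(1)] weak_divD[OF weak_div_wdiv[OF weak_div_imp_Hdiv[OF assms(1)]]] assms(2,3)
    by (intro ip_cong_AE) auto
  finally show ?thesis .
qed

lemma a_form_eq:
  assumes "weak_div v p" "weak_div \<psi> q"
  shows "a_form \<Omega> c0 c1 (u, v) (\<phi>, \<psi>) = c0 * ip M v \<psi> + ip M p q + c1 * ip M u \<phi>"
proof -
  have "ip M (wdiv \<Omega> v) (wdiv \<Omega> \<psi>) = ip M p q"
    by (rule ip_cong_AE[OF wdiv_AE[OF assms(1)] wdiv_AE[OF assms(2)]])
      (use weak_divD[OF assms(1)] weak_divD[OF assms(2)] weak_divD[OF weak_div_wdiv[OF weak_div_imp_Hdiv[OF assms(1)]]]
        weak_divD[OF weak_div_wdiv[OF weak_div_imp_Hdiv[OF assms(2)]]] in auto)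
  then show ?thesis by (simp add: a_form_def LINT_domain ip_def)
qed

text \<open>The second equation of the saddle-point problem encodes \<open>v = grad u\<close> and the essential boundary
  condition on \<open>u\<close>.\<close>

lemma constraint_imp_gradient:
  assumes u: "u \<in> sqint M" and v: "v \<in> sqint M"
    and b: "\<And>\<beta>. \<beta> \<in> H0div \<Omega> \<Gamma>3 \<Longrightarrow> b_form \<Omega> (u, v) \<beta> = 0"
  shows "weak_grad u v" "trace_zero_on \<Omega> (\<Gamma>0 \<union> \<Gamma>1) u"
proof -
  show wg: "weak_grad u v"
    unfolding weak_grad_def
  proof (intro conjI u v allI impI)
    fix \<phi> i assume \<phi>: "test_fun \<Omega> \<phi>"
    have s: "smooth \<phi>" using \<phi> by (rule test_fun_smooth)
    let ?Y = "\<lambda>x. \<phi> x *\<^sub>R (axis i 1 :: real^'n)"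
    have Y: "test_fun \<Omega> (\<lambda>x. ?Y x $ j)" for j using test_fun_mult'[OF \<phi> smooth_const] by simp
    have "0 = pair_ip (div_smooth ?Y) ?Y u v"
      using b[OF test_field_H0div(2)[OF Y]] b_form_eq[OF test_field_H0div(1)[OF Y] u v] by simp
    also have "\<dots> = (\<integral>x. u x * gradient \<phi> x $ i + \<phi> x * v x $ i \<partial>M)"
      by (simp add: ip_def div_smooth_scale_const[OF s] inner_axis inner_axis' mult.commute)
    also have "\<dots> = (\<integral>x. u x * gradient \<phi> x $ i \<partial>M) + (\<integral>x. \<phi> x * v x $ i \<partial>M)"
      by (rule Bochner_Integration.integral_add; rule sqint_mult_integrable) (use u v s in auto)
    finally show "(\<integral>x. u x * gradient \<phi> x $ i \<partial>M) = - (\<integral>x. \<phi> x * v x $ i \<partial>M)" by simp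
  qed
  show "trace_zero_on \<Omega> (\<Gamma>0 \<union> \<Gamma>1) u"
  proof (rule trace_zero_onI[OF wg])
    fix w0 w1 assume w: "w0 \<in> sqint M" "w1 \<in> sqint M"
      and ann: "\<And>\<phi>. smooth \<phi> \<Longrightarrow> (\<And>x. x \<in> \<Gamma>0 \<union> \<Gamma>1 \<Longrightarrow> \<phi> x = 0) \<Longrightarrow> pair_ip w0 w1 \<phi> (gradient \<phi>) = 0"
    have d: "weak_div w1 w0"
    proof (rule pair_ip_test_funD[OF w])
      fix \<phi> assume \<phi>: "test_fun \<Omega> \<phi>"
      show "pair_ip w0 w1 \<phi> (gradient \<phi>) = 0"
        by (rule ann[OF test_fun_smooth[OF \<phi>]]) (rule test_fun_vanishes[OF \<phi>], auto simp: frontier_eq)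
    qed
    \<comment> \<open>The annihilating field is itself an admissible \<open>\<beta>\<close>, with
      divergence \<open>w0\<close>, so the constraint applies to it directly.\<close>
    have "w1 \<in> H0div \<Omega> \<Gamma>3"
      unfolding H0div_iff[OF d] using annihilator_extends[OF w ann] by blast
    then show "pair_ip w0 w1 u v = 0" using b b_form_eq[OF d u v] by simp
  qed
qed

lemma saddle_imp_V0:
  assumes s: "saddle_solution \<Omega> \<Gamma>1 \<Gamma>3 c0 c1 F u v \<alpha>"
  shows "weak_grad u v" "weak_div v (wdiv \<Omega> v)" "trace_zero_on \<Omega> (\<Gamma>0 \<union> \<Gamma>1) u" "v \<in> H0div \<Omega> (\<Gamma>1 \<union> \<Gamma>3)"
    and "\<And>z. z \<in> V0 \<Omega> \<Gamma>0 \<Gamma>1 \<Gamma>3 \<Longrightarrow>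
      c0 * ip M v (wgrad \<Omega> z) + ip M (wdiv \<Omega> v) (wlaplace \<Omega> z) + c1 * ip M u z = F z"
proof -
  note s' = s[unfolded saddle_solution_def]
  have u: "u \<in> sqint M" using s' L2_iff by blast
  show vH: "v \<in> H0div \<Omega> (\<Gamma>1 \<union> \<Gamma>3)" using s' by blast
  show vd: "weak_div v (wdiv \<Omega> v)" using vH by (intro weak_div_wdiv) (simp add: H0div_def)
  have aH: "\<alpha> \<in> H0div \<Omega> \<Gamma>3" using s' by blast
  have ad: "weak_div \<alpha> (wdiv \<Omega> \<alpha>)" using aH by (intro weak_div_wdiv) (simp add: H0div_def)
  have b: "\<And>\<beta>. \<beta> \<in> H0div \<Omega> \<Gamma>3 \<Longrightarrow> b_form \<Omega> (u, v) \<beta> = 0" using s' by blast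
  show "weak_grad u v" "trace_zero_on \<Omega> (\<Gamma>0 \<union> \<Gamma>1) u"
    using constraint_imp_gradient[OF u weak_divD(1)[OF vd] b] by blast+
  fix z assume "z \<in> V0 \<Omega> \<Gamma>0 \<Gamma>1 \<Gamma>3"
  note z = V0D[OF this]
  have zL: "z \<in> L2 \<Omega>" using weak_gradD(1)[OF z(1)] L2_iff by blast
  have "b_form \<Omega> (z, wgrad \<Omega> z) \<alpha> = pair_ip (wdiv \<Omega> \<alpha>) \<alpha> z (wgrad \<Omega> z)"
    by (rule b_form_eq[OF ad weak_gradD[OF z(1)]])
  \<comment> \<open>The multiplier term drops out because the conditions are complementary:
    \<open>\<alpha>\<close> has no normal trace on \<open>\<Gamma>3\<close>, and \<open>z\<close>
    has no trace on the rest.\<close>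
  also have "\<dots> = 0"
    by (rule H0div_annihilates[OF ad aH z(1,3)]) (auto simp: frontier_eq)
  finally have b0: "b_form \<Omega> (z, wgrad \<Omega> z) \<alpha> = 0" .
  have "a_form \<Omega> c0 c1 (u, v) (z, wgrad \<Omega> z) + b_form \<Omega> (z, wgrad \<Omega> z) \<alpha> = F z"
    using s' zL z(4) by blast
  then show "c0 * ip M v (wgrad \<Omega> z) + ip M (wdiv \<Omega> v) (wlaplace \<Omega> z) + c1 * ip M u z = F z"
    unfolding b0 a_form_eq[OF vd z(2)] by simp
qed

section \<open>Uniqueness of the solution and of the multiplier\<close>

lemma ip_self_eq_0_AE:
  fixes u :: "real^'n \<Rightarrow> 'b::euclidean_space"
  assumes "u \<in> sqint M" "ip M u u = 0"
  shows "AE x in M. u x = 0"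
proof -
  have "AE x in M. (norm (u x))\<^sup>2 = 0"
    using integral_nonneg_eq_0_iff_AE[OF sqint_integrable[OF assms(1)]] assms(2) by (simp add: ip_self)
  then show ?thesis by eventually_elim simp
qed

text \<open>The difference is admissible as its own test function, so three nonnegative terms sum to
  zero. If \<open>c1\<close> is positive the difference itself vanishes. Otherwise its Laplacian
  vanishes, Green's formula makes the gradient vanish, and the remaining constant is excluded by a
  Dirichlet face. This covers \<open>c0 = 0\<close> too.\<close>

lemma V0_unique:
  assumes c: "c0 \<ge> 0" "c1 \<ge> (0::real)" and conn: "connected \<Omega>"
    and face: "c1 > 0 \<or> (\<exists>x n r. flat_point \<Omega> x n r \<and> frontier \<Omega> \<inter> ball x r \<subseteq> \<Gamma>0 \<union> \<Gamma>1)"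
    and u: "weak_grad u gu" "weak_div gu qu" "trace_zero_on \<Omega> (\<Gamma>0 \<union> \<Gamma>1) u" "gu \<in> H0div \<Omega> (\<Gamma>1 \<union> \<Gamma>3)"
    and v: "weak_grad v gv" "weak_div gv qv" "trace_zero_on \<Omega> (\<Gamma>0 \<union> \<Gamma>1) v" "gv \<in> H0div \<Omega> (\<Gamma>1 \<union> \<Gamma>3)"
    and eq: "\<And>z. z \<in> V0 \<Omega> \<Gamma>0 \<Gamma>1 \<Gamma>3 \<Longrightarrow>
      c0 * ip M gu (wgrad \<Omega> z) + ip M qu (wlaplace \<Omega> z) + c1 * ip M u z =
      c0 * ip M gv (wgrad \<Omega> z) + ip M qv (wlaplace \<Omega> z) + c1 * ip M v z"
  shows "AE x in M. u x = v x" "AE x in M. gu x = gv x"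
proof -
  let ?w = "\<lambda>x. u x - v x" and ?d = "\<lambda>x. gu x - gv x" and ?e = "\<lambda>x. qu x - qv x"
  have wd: "weak_grad ?w ?d" using u(1) v(1) by (rule weak_grad_diff)
  have de: "weak_div ?d ?e" using weak_div_lincomb[OF u(2) v(2), of 1 "-1"] by simp
  note ws = weak_gradD[OF wd] weak_divD[OF de]
  note us = weak_gradD[OF u(1)] weak_divD[OF u(2)]
  note vs = weak_gradD[OF v(1)] weak_divD[OF v(2)]
  have tr: "trace_zero_on \<Omega> (\<Gamma>0 \<union> \<Gamma>1) ?w"
  proof (rule trace_zero_onI[OF wd])
    fix w0 w1 assume w: "w0 \<in> sqint M" "w1 \<in> sqint M"
      and ann: "\<And>\<phi>. smooth \<phi> \<Longrightarrow> (\<And>x. x \<in> \<Gamma>0 \<union> \<Gamma>1 \<Longrightarrow> \<phi> x = 0) \<Longrightarrow> pair_ip w0 w1 \<phi> (gradient \<phi>) = 0"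
    have "pair_ip w0 w1 ?w ?d = ip M (\<lambda>x. (w0 x, w1 x)) (\<lambda>x. (u x, gu x) - (v x, gv x))" by simp
    also have "\<dots> = pair_ip w0 w1 u gu - pair_ip w0 w1 v gv"
      using us vs w by (intro ip_diff) auto
    also have "\<dots> = 0"
      using trace_zero_on_annihilator[OF u(1,3) w ann] trace_zero_on_annihilator[OF v(1,3) w ann] by simp
    finally show "pair_ip w0 w1 ?w ?d = 0" .
  qed
  have dH: "?d \<in> H0div \<Omega> (\<Gamma>1 \<union> \<Gamma>3)"
    unfolding H0div_iff[OF de]
  proof (intro allI impI)
    fix \<phi> assume \<phi>: "smooth \<phi>" "\<forall>x\<in>frontier \<Omega> - (\<Gamma>1 \<union> \<Gamma>3). \<phi> x = 0"
    have "pair_ip ?e ?d \<phi> (gradient \<phi>) = ip M (\<lambda>x. (\<phi> x, gradient \<phi> x)) (\<lambda>x. (qu x, gu x) - (qv x, gv x))"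
      by (subst ip_commute) simp
    also have "\<dots> = ip M (\<lambda>x. (\<phi> x, gradient \<phi> x)) (\<lambda>x. (qu x, gu x)) - ip M (\<lambda>x. (\<phi> x, gradient \<phi> x)) (\<lambda>x. (qv x, gv x))"
      using us vs \<phi>(1) by (intro ip_diff) auto
    also have "\<dots> = 0"
      using u(4) v(4) \<phi> unfolding H0div_iff[OF u(2)] H0div_iff[OF v(2)]
      by (simp add: ip_commute[of M "\<lambda>x. (\<phi> x, gradient \<phi> x)"])
    finally show "pair_ip ?e ?d \<phi> (gradient \<phi>) = 0" .
  qed
  note z = V0I[OF wd de tr dH]
  note zs = V0D[OF z(1)]
  have gs: "wgrad \<Omega> ?w \<in> sqint M" "wlaplace \<Omega> ?w \<in> sqint M"
    using weak_gradD[OF zs(1)] weak_divD[OF zs(2)] by blast+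
  have r: "ip M f (wgrad \<Omega> ?w) = ip M f ?d" if "f \<in> sqint M" for f
    using z(2) that gs ws by (intro ip_cong_AE) auto
  have r': "ip M f (wlaplace \<Omega> ?w) = ip M f ?e" if "f \<in> sqint M" for f
    using z(3) that gs ws by (intro ip_cong_AE) auto
  have "c0 * ip M gu ?d + ip M qu ?e + c1 * ip M u ?w = c0 * ip M gv ?d + ip M qv ?e + c1 * ip M v ?w"
    using eq[OF z(1)] us vs by (simp add: r r')
  moreover have "ip M ?d ?d = ip M gu ?d - ip M gv ?d" "ip M ?e ?e = ip M qu ?e - ip M qv ?e"
    "ip M ?w ?w = ip M u ?w - ip M v ?w"
    using ip_diff[OF us(2) vs(2) ws(2)] ip_diff[OF us(4) vs(4) ws(4)] ip_diff[OF us(1) vs(1) ws(1)]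
    by (simp_all add: ip_commute)
  ultimately have sum: "c0 * ip M ?d ?d + ip M ?e ?e + c1 * ip M ?w ?w = 0"
    by (simp add: right_diff_distrib)
  have nn: "0 \<le> c0 * ip M ?d ?d" "0 \<le> ip M ?e ?e" "0 \<le> c1 * ip M ?w ?w" using c by auto
  have "AE x in M. ?w x = 0 \<and> ?d x = 0"
  proof (cases "c1 > 0")
    case True
    then have "ip M ?w ?w = 0" using sum nn by (simp add: add_nonneg_eq_0_iff)
    then have w0: "AE x in M. ?w x = 0" by (rule ip_self_eq_0_AE[OF ws(1)])
    have "weak_grad (\<lambda>_. 0) ?d" by (rule weak_grad_cong_AE[OF wd w0]) simp
    moreover have "weak_grad (\<lambda>_. 0) (\<lambda>_. 0)" by (simp add: weak_grad_def)
    ultimately have "AE x in M. ?d x = 0" by (rule weak_grad_unique)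
    with w0 show ?thesis by eventually_elim simp
  next
    case False
    have "ip M ?e ?e = 0" using sum nn by linarith
    then have e0: "AE x in M. ?e x = 0" by (rule ip_self_eq_0_AE[OF ws(4)])
    \<comment> \<open>With zero Laplacian the squared norm of the gradient is a Green product of the
      difference with its own gradient. The trace vanishes on
      \<open>\<Gamma>0 \<union> \<Gamma>1\<close>, the normal trace on
      \<open>\<Gamma>1 \<union> \<Gamma>3\<close>, and together these cover the frontier.\<close>
    have "ip M ?d ?d = pair_ip (\<lambda>_. 0) ?d ?w ?d" by (simp add: ip_def)
    also have "\<dots> = pair_ip ?e ?d ?w ?d"
      using e0 ws by (intro ip_cong_AE) auto
    also have "\<dots> = 0"
      by (rule H0div_annihilates[OF de dH wd tr]) (auto simp: frontier_eq)
    finally have d0: "AE x in M. ?d x = 0" by (rule ip_self_eq_0_AE[OF ws(2)])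
    obtain c where c: "AE x in M. ?w x = c" using weak_grad_0_constant[OF conn wd d0] by blast
    obtain x n r where "flat_point \<Omega> x n r" "frontier \<Omega> \<inter> ball x r \<subseteq> \<Gamma>0 \<union> \<Gamma>1" using face False by blast
    then have "c = 0" using trace_zero_constant[OF _ _ wd c d0 tr] by blast
    show ?thesis using c d0 unfolding \<open>c = 0\<close> by eventually_elim simp
  qed
  then show "AE x in M. u x = v x" "AE x in M. gu x = gv x" by (eventually_elim, simp)+
qed

text \<open>With zero scalar test function and a compactly supported vector test function, the first
  equation expresses the action of the multiplier through \<open>v\<close> alone; the fundamental
  lemma then determines it almost everywhere.\<close>

lemma multiplier_unique:
  assumes s: "saddle_solution \<Omega> \<Gamma>1 \<Gamma>3 c0 c1 F u v \<alpha>" "saddle_solution \<Omega> \<Gamma>1 \<Gamma>3 c0 c1 F u' v' \<alpha>'"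
    and v: "AE x in M. v x = v' x"
  shows "AE x in M. \<alpha> x = \<alpha>' x"
proof -
  note s1 = s(1)[unfolded saddle_solution_def] and s2 = s(2)[unfolded saddle_solution_def]
  have vd: "weak_div v (wdiv \<Omega> v)" "weak_div v' (wdiv \<Omega> v')"
    using s1 s2 by (auto intro!: weak_div_wdiv simp: H0div_def)
  have ad: "weak_div \<alpha> (wdiv \<Omega> \<alpha>)" "weak_div \<alpha>' (wdiv \<Omega> \<alpha>')"
    using s1 s2 by (auto intro!: weak_div_wdiv simp: H0div_def)
  note vs = weak_divD[OF vd(1)] weak_divD[OF vd(2)] and as = weak_divD[OF ad(1)] weak_divD[OF ad(2)]
  have q: "AE x in M. wdiv \<Omega> v x = wdiv \<Omega> v' x"
    by (rule weak_div_unique[OF weak_div_cong_AE[OF vd(1) v] vd(2)]) (use vs sqint_measurable in blast)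
  have "AE x in M. \<alpha> x $ i - \<alpha>' x $ i = 0" for i
  proof (rule sqint_eq_0_AE)
    show "(\<lambda>x. \<alpha> x $ i - \<alpha>' x $ i) \<in> sqint M" using as by (intro sqint_diff sqint_component)
    fix \<phi> assume \<phi>: "test_fun \<Omega> \<phi>"
    let ?Y = "\<lambda>x. \<phi> x *\<^sub>R (axis i 1 :: real^'n)"
    have Y: "test_fun \<Omega> (\<lambda>x. ?Y x $ j)" for j using test_fun_mult'[OF \<phi> smooth_const] by simp
    note Yd = test_field_H0div(1)[OF Y] and YH = test_field_H0div(2)[OF Y]
    note Ys = weak_divD[OF Yd]
    have z: "(\<lambda>_. 0) \<in> L2 \<Omega>" by (simp add: L2_iff)
    have *: "pair_ip (wdiv \<Omega> a) a (\<lambda>_. 0) ?Y = (\<integral>x. \<phi> x * a x $ i \<partial>M)" for a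
      by (simp add: ip_def inner_axis mult.commute)
    have "a_form \<Omega> c0 c1 (u, v) (\<lambda>_. 0, ?Y) + b_form \<Omega> (\<lambda>_. 0, ?Y) \<alpha> = F (\<lambda>_. 0)"
      "a_form \<Omega> c0 c1 (u', v') (\<lambda>_. 0, ?Y) + b_form \<Omega> (\<lambda>_. 0, ?Y) \<alpha>' = F (\<lambda>_. 0)"
      using s1 s2 z YH by blast+
    moreover have "a_form \<Omega> c0 c1 (u, v) (\<lambda>_. 0, ?Y) = a_form \<Omega> c0 c1 (u', v') (\<lambda>_. 0, ?Y)"
    proof -
      have "ip M v ?Y = ip M v' ?Y" using v vs Ys by (intro ip_cong_AE) auto
      moreover have "ip M (wdiv \<Omega> v) (div_smooth ?Y) = ip M (wdiv \<Omega> v') (div_smooth ?Y)"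
        using q vs Ys by (intro ip_cong_AE) auto
      ultimately show ?thesis
        unfolding a_form_eq[OF vd(1) Yd] a_form_eq[OF vd(2) Yd] by (simp add: ip_def)
    qed
    ultimately have "b_form \<Omega> (\<lambda>_. 0, ?Y) \<alpha> = b_form \<Omega> (\<lambda>_. 0, ?Y) \<alpha>'" by simp
    then have "(\<integral>x. \<phi> x * \<alpha> x $ i \<partial>M) = (\<integral>x. \<phi> x * \<alpha>' x $ i \<partial>M)"
      unfolding b_form_eq[OF ad(1) sqint_zero Ys(1)] b_form_eq[OF ad(2) sqint_zero Ys(1)] * .
    moreover have "integrable M (\<lambda>x. \<phi> x * \<alpha> x $ i)" "integrable M (\<lambda>x. \<phi> x * \<alpha>' x $ i)"
      using as \<phi> by (auto intro!: sqint_mult_integrable)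
    ultimately show "(\<integral>x. \<phi> x * (\<alpha> x $ i - \<alpha>' x $ i) \<partial>M) = 0"
      by (simp add: right_diff_distrib)
  qed
  then have "AE x in M. \<forall>i. \<alpha> x $ i - \<alpha>' x $ i = 0" by (rule eventually_all_finite)
  then show ?thesis by (simp add: vec_eq_iff)
qed

end

section \<open>Regularity of the Laplacian and representation of the load\<close>

context bounded_open
begin

lemma weak_grad_sum:
  assumes "\<And>i. i \<in> I \<Longrightarrow> weak_grad (u i) (g i)"
  shows "weak_grad (\<lambda>x. \<Sum>i\<in>I. u i x) (\<lambda>x. \<Sum>i\<in>I. g i x)"
  using assms
proof (induction I rule: infinite_finite_induct)
  case (insert i I)
  then have "weak_grad (u i) (g i)" "weak_grad (\<lambda>x. \<Sum>i\<in>I. u i x) (\<lambda>x. \<Sum>i\<in>I. g i x)" by auto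
  from weak_grad_lincomb[OF this, of 1 1] show ?case using insert.hyps by simp
qed (simp_all add: weak_grad_def)

lemma weak_div_componentwise:
  assumes v: "v \<in> sqint M" and h: "\<And>i. weak_grad (\<lambda>x. v x $ i) (h i)"
  shows "weak_div v (\<lambda>x. \<Sum>i\<in>UNIV. h i x $ i)"
  unfolding weak_div_def
proof (intro conjI v allI impI)
  have hs: "h i \<in> sqint M" for i using h by (rule weak_gradD(2))
  show "(\<lambda>x. \<Sum>i\<in>UNIV. h i x $ i) \<in> sqint M" using hs by (intro sqint_sum sqint_component)
  fix \<phi> assume \<phi>: "test_fun \<Omega> \<phi>"
  then have s: "smooth \<phi>" by (rule test_fun_smooth)
  have int: "integrable M (\<lambda>x. v x $ i * gradient \<phi> x $ i)" "integrable M (\<lambda>x. \<phi> x * h i x $ i)" for i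
    using v hs s by (auto intro!: sqint_mult_integrable)
  have "(\<integral>x. v x \<bullet> gradient \<phi> x \<partial>M) = (\<Sum>i\<in>UNIV. \<integral>x. v x $ i * gradient \<phi> x $ i \<partial>M)"
    using int(1) by (simp add: inner_vec_def)
  also have "\<dots> = (\<Sum>i\<in>UNIV. - (\<integral>x. \<phi> x * h i x $ i \<partial>M))"
    using h \<phi> by (simp add: weak_grad_def)
  also have "\<dots> = - (\<integral>x. \<phi> x * (\<Sum>i\<in>UNIV. h i x $ i) \<partial>M)"
    using int(2) by (simp add: sum_distrib_left sum_negf)
  finally show "(\<integral>x. v x \<bullet> gradient \<phi> x \<partial>M) = - (\<integral>x. \<phi> x * (\<Sum>i\<in>UNIV. h i x $ i) \<partial>M)" .
qed

text \<open>Four integer orders are peeled off: the diagonal second derivatives add up to the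
  Laplacian almost everywhere, third derivatives give its gradient, and fourth derivatives give the
  divergence of that gradient.\<close>

lemma Hs_4_wlaplace:
  assumes "u \<in> Hs \<Omega> p" "p \<ge> 4"
  shows "\<exists>g q. weak_grad (wlaplace \<Omega> u) g \<and> weak_div g q"
proof -
  have "nat \<lfloor>p\<rfloor> \<ge> 4" using assms(2) by linarith
  then have "nat \<lfloor>p\<rfloor> = Suc (Suc (Suc (Suc (nat \<lfloor>p\<rfloor> - 4))))" by simp
  then obtain m where "nat \<lfloor>p\<rfloor> = Suc (Suc (Suc (Suc m)))" by blast
  then have u: "u \<in> Hs_aux \<Omega> (frac p) (Suc (Suc (Suc (Suc m))))" using assms(1) by (simp add: Hs_def)
  define a where "a i = (\<lambda>x. wgrad \<Omega> u x $ i)" for i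
  define b where "b i j = (\<lambda>x. wgrad \<Omega> (a i) x $ j)" for i j
  define c where "c i j l = (\<lambda>x. wgrad \<Omega> (b i j) x $ l)" for i j l
  have uH: "u \<in> H1 \<Omega>" and aS: "a i \<in> Hs_aux \<Omega> (frac p) (Suc (Suc (Suc m)))" for i
    using u unfolding a_def Hs_aux.simps(2)[of _ _ "Suc (Suc (Suc m))"] by blast+
  have aH: "a i \<in> H1 \<Omega>" and bS: "b i j \<in> Hs_aux \<Omega> (frac p) (Suc (Suc m))" for i j
    using aS[of i] unfolding b_def Hs_aux.simps(2)[of _ _ "Suc (Suc m)"] by blast+
  have bH: "b i j \<in> H1 \<Omega>" and cS: "c i j l \<in> Hs_aux \<Omega> (frac p) (Suc m)" for i j l
    using bS[of i j] unfolding c_def Hs_aux.simps(2)[of _ _ "Suc m"] by blast+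
  have cH: "c i j l \<in> H1 \<Omega>" for i j l using cS[of i j l] unfolding Hs_aux.simps(2) by blast
  have us: "wgrad \<Omega> u \<in> sqint M" using weak_grad_wgrad[OF uH] by (rule weak_gradD)
  have "weak_div (wgrad \<Omega> u) (\<lambda>x. \<Sum>i\<in>UNIV. wgrad \<Omega> (a i) x $ i)"
    using weak_grad_wgrad[OF aH] by (intro weak_div_componentwise us) (simp add: a_def)
  then have d: "weak_div (wgrad \<Omega> u) (\<lambda>x. \<Sum>i\<in>UNIV. b i i x)" by (simp add: b_def)
  have "AE x in M. wlaplace \<Omega> u x = (\<Sum>i\<in>UNIV. b i i x)" unfolding wlaplace_def using d by (rule wdiv_AE)
  then have ae: "AE x in M. (\<Sum>i\<in>UNIV. b i i x) = wlaplace \<Omega> u x" by eventually_elim simp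
  define g where "g = (\<lambda>x. \<Sum>i\<in>UNIV. wgrad \<Omega> (b i i) x)"
  have wg: "weak_grad (\<lambda>x. \<Sum>i\<in>UNIV. b i i x) g"
    unfolding g_def by (intro weak_grad_sum weak_grad_wgrad bH)
  have wm: "wlaplace \<Omega> u \<in> borel_measurable M"
    unfolding wlaplace_def
    by (rule sqint_measurable[OF weak_divD(2)[OF weak_div_wdiv[OF weak_div_imp_Hdiv[OF d]]]])
  have 1: "weak_grad (wlaplace \<Omega> u) g" by (rule weak_grad_cong_AE[OF wg ae wm])
  have gl: "(\<lambda>x. g x $ l) = (\<lambda>x. \<Sum>i\<in>UNIV. c i i l x)" for l by (simp add: g_def c_def)
  have "weak_grad (\<lambda>x. g x $ l) (\<lambda>x. \<Sum>i\<in>UNIV. wgrad \<Omega> (c i i l) x)" for l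
    unfolding gl by (intro weak_grad_sum weak_grad_wgrad cH)
  then have "weak_div g (\<lambda>x. \<Sum>l\<in>UNIV. (\<Sum>i\<in>UNIV. wgrad \<Omega> (c i i l) x) $ l)"
    by (rule weak_div_componentwise[OF weak_gradD(2)[OF 1]])
  with 1 show ?thesis by blast
qed

text \<open>A functional bounded in the L2 norm is determined by its values on the dense test
  functions; this identifies the Riesz representative of the load.\<close>

lemma functional_eq_ip:
  assumes F: "F \<in> dual (L2 \<Omega>) (L2_norm \<Omega>)" and w: "w \<in> sqint M"
    and test: "\<And>\<phi>. test_fun \<Omega> \<phi> \<Longrightarrow> F \<phi> = ip M w \<phi>" and u: "u \<in> sqint M"
  shows "F u = ip M w u"
proof -
  obtain C where lin: "\<And>u v a b. u \<in> L2 \<Omega> \<Longrightarrow> v \<in> L2 \<Omega> \<Longrightarrow> F (\<lambda>x. a * u x + b * v x) = a * F u + b * F v"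
    and C: "\<And>u. u \<in> L2 \<Omega> \<Longrightarrow> \<bar>F u\<bar> \<le> C * L2_norm \<Omega> u"
    using F unfolding dual_def by blast
  obtain \<phi> where \<phi>: "\<And>k::nat. test_fun \<Omega> (\<phi> k)" "(\<lambda>k. ip M (\<lambda>x. u x - \<phi> k x) (\<lambda>x. u x - \<phi> k x)) \<longlonglongrightarrow> 0"
    by (rule test_fun_dense[OF u]) blast
  have \<phi>s: "\<phi> k \<in> sqint M" for k using \<phi>(1) by blast
  have "(\<lambda>k. F u - F (\<phi> k)) \<longlonglongrightarrow> 0"
  proof (rule Lim_null_comparison)
    have "\<bar>F u - F (\<phi> k)\<bar> \<le> C * sqrt (ip M (\<lambda>x. u x - \<phi> k x) (\<lambda>x. u x - \<phi> k x))" for k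
    proof -
      have "F (\<lambda>x. u x - \<phi> k x) = F u - F (\<phi> k)"
        using lin[of u "\<phi> k" 1 "-1"] u \<phi>s by (simp add: L2_iff)
      moreover have "(\<lambda>x. u x - \<phi> k x) \<in> L2 \<Omega>" using u \<phi>s by (auto simp: L2_iff)
      ultimately show ?thesis
        using C[of "\<lambda>x. u x - \<phi> k x"] by (simp add: L2_norm_def LINT_domain ip_self)
    qed
    then show "\<forall>\<^sub>F k in sequentially. norm (F u - F (\<phi> k)) \<le> C * sqrt (ip M (\<lambda>x. u x - \<phi> k x) (\<lambda>x. u x - \<phi> k x))"
      by simp
    show "(\<lambda>k. C * sqrt (ip M (\<lambda>x. u x - \<phi> k x) (\<lambda>x. u x - \<phi> k x))) \<longlonglongrightarrow> 0"
      using tendsto_mult[OF tendsto_const[of C] tendsto_real_sqrt[OF \<phi>(2)]] by simp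
  qed
  then have "(\<lambda>k. F (\<phi> k)) \<longlonglongrightarrow> F u"
    using tendsto_diff[OF tendsto_const[of "F u"]] by fastforce
  moreover have "(\<lambda>k. F (\<phi> k)) \<longlonglongrightarrow> ip M w u"
    unfolding test[OF \<phi>(1)] by (rule ip_tendsto[OF \<phi>s u w \<phi>(2)])
  ultimately show ?thesis by (rule LIMSEQ_unique)
qed

end

section \<open>Existence of the multiplier\<close>

context mixed_domain
begin

lemma primal_solution_eq:
  assumes "primal_solution \<Omega> \<Gamma>0 \<Gamma>1 \<Gamma>3 c0 c1 f u" "z \<in> V0 \<Omega> \<Gamma>0 \<Gamma>1 \<Gamma>3"
  shows "c0 * ip M (wgrad \<Omega> u) (wgrad \<Omega> z) + ip M (wlaplace \<Omega> u) (wlaplace \<Omega> z) + c1 * ip M u z = f z"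
proof -
  have "u \<in> V0 \<Omega> \<Gamma>0 \<Gamma>1 \<Gamma>3" using assms(1) by (simp add: primal_solution_def)
  note u = V0D(1,2)[OF this] and z = V0D(1,2)[OF assms(2)]
  have i: "integrable M (\<lambda>x. wlaplace \<Omega> u x * wlaplace \<Omega> z x)" "integrable M (\<lambda>x. wgrad \<Omega> u x \<bullet> wgrad \<Omega> z x)"
    "integrable M (\<lambda>x. u x * z x)"
    using weak_gradD[OF u(1)] weak_divD[OF u(2)] weak_gradD[OF z(1)] weak_divD[OF z(2)] by blast+
  have "f z = (\<integral>x. wlaplace \<Omega> u x * wlaplace \<Omega> z x + c0 * (wgrad \<Omega> u x \<bullet> wgrad \<Omega> z x) + c1 * (u x * z x) \<partial>M)"
    using assms by (simp add: primal_solution_def LINT_domain)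
  also have "\<dots> = c0 * ip M (wgrad \<Omega> u) (wgrad \<Omega> z) + ip M (wlaplace \<Omega> u) (wlaplace \<Omega> z) + c1 * ip M u z"
    using i by (simp add: ip_def)
  finally show ?thesis ..
qed

text \<open>Compactly supported test functions give the differential equation in the interior.
  Inserted back into the primal equation, it leaves an identity between two boundary functionals for
  smooth members of V0. Both natural conditions come from test functions that make one side of it
  vanish: the gradient side on faces of \<open>\<Gamma>3\<close>, the value side on faces of
  \<open>\<Gamma>0\<close>.\<close>

theorem multiplier_exists:
  assumes prim: "primal_solution \<Omega> \<Gamma>0 \<Gamma>1 \<Gamma>3 c0 c1 f u"
    and F: "F \<in> dual (L2 \<Omega>) (L2_norm \<Omega>)" "\<And>v. v \<in> V \<Omega> \<Longrightarrow> F v = f v"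
    and p: "weak_grad (wlaplace \<Omega> u) g" "weak_div g q"
  shows "\<exists>\<alpha>. saddle_solution \<Omega> \<Gamma>1 \<Gamma>3 c0 c1 F u (wgrad \<Omega> u) \<alpha>"
proof -
  let ?p = "wlaplace \<Omega> u" and ?v = "wgrad \<Omega> u"
  have "u \<in> V0 \<Omega> \<Gamma>0 \<Gamma>1 \<Gamma>3" using prim by (simp add: primal_solution_def)
  note u = V0D[OF this]
  note us = weak_gradD[OF u(1)] and vs = weak_divD[OF u(2)] and gs = weak_divD[OF p(2)]
  define \<alpha> where "\<alpha> = (\<lambda>x. g x - c0 *\<^sub>R ?v x)"
  \<comment> \<open>The divergence of \<open>\<alpha>\<close>: the bilaplacian of \<open>u\<close>
    minus \<open>c0\<close> times its Laplacian, so that \<open>r x + c1 * u x\<close> is the left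
    side of the fourth-order equation.\<close>
  define r where "r = (\<lambda>x. q x - c0 * ?p x)"
  have \<alpha>d: "weak_div \<alpha> r"
    using weak_div_lincomb[OF p(2) u(2), of 1 "- c0"] by (simp add: \<alpha>_def r_def)
  note \<alpha>s = weak_divD[OF \<alpha>d]
  have prim_eq: "c0 * ip M ?v gz + ip M ?p qz + c1 * ip M u z = F z"
    if "z \<in> V0 \<Omega> \<Gamma>0 \<Gamma>1 \<Gamma>3" "AE x in M. wgrad \<Omega> z x = gz x" "AE x in M. wlaplace \<Omega> z x = qz x"
      "gz \<in> sqint M" "qz \<in> sqint M" for z gz qz
  proof -
    note z = V0D(1,2)[OF that(1)]
    have "ip M ?v (wgrad \<Omega> z) = ip M ?v gz" "ip M ?p (wlaplace \<Omega> z) = ip M ?p qz"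
      using that us vs weak_gradD[OF z(1)] weak_divD[OF z(2)] by (auto intro!: ip_cong_AE)
    moreover have "F z = f z" using F(2) that(1) by (simp add: V0_def)
    ultimately show ?thesis using primal_solution_eq[OF prim that(1)] by simp
  qed
  have F_eq: "F \<phi> = ip M (\<lambda>x. r x + c1 * u x) \<phi>" if "\<phi> \<in> sqint M" for \<phi>
  proof (rule functional_eq_ip[OF F(1) _ _ that])
    show "(\<lambda>x. r x + c1 * u x) \<in> sqint M" by (rule sqint_add[OF \<alpha>s(2) sqint_cmult[OF us(1)]])
    fix \<phi> assume \<phi>: "test_fun \<Omega> \<phi>"
    have s: "smooth \<phi>" using \<phi> by (rule test_fun_smooth)
    have Y: "test_fun \<Omega> (\<lambda>x. gradient \<phi> x $ i)" for i using \<phi> by blast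
    have ds: "div_smooth (gradient \<phi>) \<in> sqint M" "gradient \<phi> \<in> sqint M"
      using weak_divD[OF test_field_H0div(1)[OF Y]] by blast+
    have V: "\<phi> \<in> V0 \<Omega> \<Gamma>0 \<Gamma>1 \<Gamma>3" "AE x in M. wgrad \<Omega> \<phi> x = gradient \<phi> x"
      "AE x in M. wlaplace \<Omega> \<phi> x = div_smooth (gradient \<phi>) x"
    proof -
      have van: "\<And>x. x \<in> \<Gamma>0 \<union> \<Gamma>1 \<Longrightarrow> \<phi> x = 0" using test_fun_vanishes[OF \<phi>] by (auto simp: frontier_eq)
      have "pair_ip (div_smooth (gradient \<phi>)) (gradient \<phi>) \<psi> (gradient \<psi>) = 0" if "smooth \<psi>" for \<psi>
        by (rule weak_grad_test_field[OF weak_grad_smooth[OF that] Y])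
      then show "\<phi> \<in> V0 \<Omega> \<Gamma>0 \<Gamma>1 \<Gamma>3" "AE x in M. wgrad \<Omega> \<phi> x = gradient \<phi> x"
        "AE x in M. wlaplace \<Omega> \<phi> x = div_smooth (gradient \<phi>) x"
        using smooth_V0[OF s van] by blast+
    qed
    have i: "integrable M (\<lambda>x. div_smooth (gradient \<phi>) x * ?p x)" "integrable M (\<lambda>x. gradient \<phi> x \<bullet> g x)"
      "integrable M (\<lambda>x. q x * \<phi> x)" "integrable M (\<lambda>x. ?p x * \<phi> x)" "integrable M (\<lambda>x. u x * \<phi> x)"
      using ds gs us vs smooth_sqint[OF s] by blast+
    \<comment> \<open>Two integrations by parts: first the derivative is moved from the gradient of
      the test function to the Laplacian, then from the test function to \<open>g\<close>.\<close>
    have "ip M ?p (div_smooth (gradient \<phi>)) = - (\<integral>x. gradient \<phi> x \<bullet> g x \<partial>M)"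
      using weak_grad_test_field[OF p(1) Y] i(1,2) by (simp add: ip_def mult.commute)
    also have "\<dots> = (\<integral>x. q x * \<phi> x \<partial>M)"
      using p(2) \<phi> by (simp add: weak_div_def inner_commute mult.commute)
    finally have 1: "ip M ?p (div_smooth (gradient \<phi>)) = (\<integral>x. q x * \<phi> x \<partial>M)" .
    have 2: "ip M ?v (gradient \<phi>) = - (\<integral>x. ?p x * \<phi> x \<partial>M)"
      using u(2) \<phi> by (simp add: weak_div_def ip_def mult.commute)
    have "F \<phi> = c0 * ip M ?v (gradient \<phi>) + ip M ?p (div_smooth (gradient \<phi>)) + c1 * ip M u \<phi>"
      using prim_eq[OF V ds(2,1)] by simp
    also have "\<dots> = ip M (\<lambda>x. r x + c1 * u x) \<phi>"
      unfolding 1 2 using i by (simp add: ip_def r_def algebra_simps)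
    finally show "F \<phi> = ip M (\<lambda>x. r x + c1 * u x) \<phi>" .
  qed
  \<comment> \<open>The left product is formally the boundary integral of the Laplacian of
    \<open>u\<close> against the normal derivative of \<open>z\<close>, the right one that of the
    normal component of \<open>\<alpha>\<close> against \<open>z\<close>. The interior terms have
    cancelled by the differential equation.\<close>
  have balance: "pair_ip (div_smooth (gradient z)) (gradient z) ?p g = pair_ip r \<alpha> z (gradient z)"
    if s: "smooth z" and V: "z \<in> V0 \<Omega> \<Gamma>0 \<Gamma>1 \<Gamma>3" "AE x in M. wgrad \<Omega> z x = gradient z x"
      "AE x in M. wlaplace \<Omega> z x = div_smooth (gradient z) x" for z
  proof -
    have ds: "div_smooth (gradient z) \<in> sqint M" "gradient z \<in> sqint M" "z \<in> sqint M"
      using s by auto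
    have i: "integrable M (\<lambda>x. div_smooth (gradient z) x * ?p x)" "integrable M (\<lambda>x. gradient z x \<bullet> g x)"
      "integrable M (\<lambda>x. ?v x \<bullet> gradient z x)" "integrable M (\<lambda>x. r x * z x)" "integrable M (\<lambda>x. u x * z x)"
      using ds gs us vs \<alpha>s by blast+
    have ja: "integrable M (\<lambda>x. \<alpha> x \<bullet> gradient z x)" using ds \<alpha>s by blast
    have "c0 * ip M ?v (gradient z) + ip M ?p (div_smooth (gradient z)) = ip M r z"
      using prim_eq[OF V ds(2,1)] F_eq[OF ds(3)] i by (simp add: ip_def algebra_simps)
    moreover have "ip M ?p (div_smooth (gradient z)) = (\<integral>x. div_smooth (gradient z) x * ?p x \<partial>M)"
      by (simp add: ip_def mult.commute)
    moreover have "(\<integral>x. \<alpha> x \<bullet> gradient z x \<partial>M) =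
        (\<integral>x. gradient z x \<bullet> g x \<partial>M) - c0 * ip M ?v (gradient z)"
      using i(2,3) by (simp add: \<alpha>_def ip_def inner_diff_left inner_commute[of "g _"])
    ultimately show ?thesis
      using i(1,2,4) ja by (simp add: ip_def)
  qed
  have \<alpha>H: "\<alpha> \<in> H0div \<Omega> \<Gamma>3"
    unfolding H0div_iff[OF \<alpha>d]
  proof (intro allI impI)
    fix \<phi> assume \<phi>: "smooth \<phi>" "\<forall>x\<in>frontier \<Omega> - \<Gamma>3. \<phi> x = 0"
    obtain C where C: "\<And>x. x \<in> \<Omega> \<Longrightarrow> norm (\<phi> x) \<le> C"
      by (rule continuous_bounded_domain[OF smooth_continuous_on[OF \<phi>(1)]]) blast
    show "pair_ip r \<alpha> \<phi> (gradient \<phi>) = 0"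
    proof (rule local_to_global[OF \<alpha>s(2,1) smooth_gradient_sqint[OF \<phi>(1)] smooth_measurable_domain[OF \<phi>(1)]
          C[unfolded real_norm_def] finite_exceptional codim2_exceptional])
      fix x assume x: "x \<in> closure \<Omega>" "x \<notin> \<Union>\<A>"
      have prod: "pair_ip r \<alpha> (\<lambda>x. \<theta> x * \<phi> x) (\<lambda>x. \<theta> x *\<^sub>R gradient \<phi> x + \<phi> x *\<^sub>R gradient \<theta> x) =
          pair_ip r \<alpha> (\<lambda>x. \<theta> x * \<phi> x) (gradient (\<lambda>x. \<theta> x * \<phi> x))" if "test_fun A \<theta>" for A \<theta>
        using gradient_mult[OF test_fun_smooth[OF that] \<phi>(1)] by simp
      \<comment> \<open>Near a face outside \<open>\<Gamma>3\<close> the function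
        \<open>\<phi>\<close> vanishes on the face, so the local identity holds for every field in
        H(div).\<close>
      have dirichlet: "pair_ip r \<alpha> (\<lambda>x. \<theta> x * \<phi> x) (\<lambda>x. \<theta> x *\<^sub>R gradient \<phi> x + \<phi> x *\<^sub>R gradient \<theta> x) = 0"
        if fp: "flat_point \<Omega> x n r'" and g3: "\<Gamma>3 \<inter> ball x r' = {}" and \<theta>: "test_fun (ball x r') \<theta>" for n r' \<theta>
      proof -
        have "\<theta> z * \<phi> z = 0" if "(z - x) \<bullet> n = 0" for z
        proof (cases "z \<in> ball x r'")
          case True
          then have "z \<in> frontier \<Omega> - \<Gamma>3" using fp that g3 unfolding flat_point_def by blast
          then show ?thesis using \<phi>(2) by simp
        qed (use test_fun_outside[OF \<theta>] in simp)
        from flat_point_pair_ip_Hdiv[OF fp test_fun_mult'[OF \<theta> \<phi>(1)] this \<alpha>d] show ?thesis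
          unfolding prod[OF \<theta>] .
      qed
      show "\<exists>d>0. \<forall>\<theta>. test_fun (ball x d) \<theta> \<longrightarrow>
          pair_ip r \<alpha> (\<lambda>x. \<theta> x * \<phi> x) (\<lambda>x. \<theta> x *\<^sub>R gradient \<phi> x + \<phi> x *\<^sub>R gradient \<theta> x) = 0"
        using x
      proof (cases rule: closure_cases)
        case (interior d)
        have "pair_ip r \<alpha> (\<lambda>x. \<theta> x * \<phi> x) (\<lambda>x. \<theta> x *\<^sub>R gradient \<phi> x + \<phi> x *\<^sub>R gradient \<theta> x) = 0"
          if \<theta>: "test_fun (ball x d) \<theta>" for \<theta>
          unfolding prod[OF \<theta>]
          by (rule pair_ip_test_fun[OF \<alpha>d test_fun_mult'[OF test_fun_mono[OF \<theta> interior(2)] \<phi>(1)]])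
        then show ?thesis using interior(1) by blast
      next
        case (face0 n d)
        then have "d > 0" by (simp add: flat_point_def)
        then show ?thesis using dirichlet[OF face0(1,4)] by blast
      next
        case (face1 n d)
        then have "d > 0" by (simp add: flat_point_def)
        then show ?thesis using dirichlet[OF face1(1,4)] by blast
      next
        case (face3 n d)
        have d: "d > 0" using face3(1) by (simp add: flat_point_def)
        have "pair_ip r \<alpha> (\<lambda>x. \<theta> x * \<phi> x) (\<lambda>x. \<theta> x *\<^sub>R gradient \<phi> x + \<phi> x *\<^sub>R gradient \<theta> x) = 0"
          if \<theta>: "test_fun (ball x d) \<theta>" for \<theta>
        proof -
          let ?y = "\<lambda>x. \<theta> x * \<phi> x"
          have y: "test_fun (ball x d) ?y" using \<theta> \<phi>(1) by (rule test_fun_mult')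
          have ys: "smooth ?y" using y by (rule test_fun_smooth)
          \<comment> \<open>On a face of \<open>\<Gamma>3\<close> the localised function need not
            have zero normal derivative. It is replaced by \<open>z\<close>, which has the same
            values on the face and is admissible; the difference vanishes on the face and is treated
            by Green's formula for H(div).\<close>
          obtain z where z: "test_fun (ball x d) z" "\<And>t. (t - x) \<bullet> n = 0 \<Longrightarrow> gradient z t \<bullet> n = 0"
            "\<And>t. (t - x) \<bullet> n = 0 \<Longrightarrow> ?y t - z t = 0"
            by (rule neumann_face[OF face3(1) y]) blast
          have zs: "smooth z" using z(1) by (rule test_fun_smooth)
          have green: "pair_ip (div_smooth (gradient z)) (gradient z) w h = 0" if "weak_grad w h" for w h
            by (rule flat_point_pair_ip_H1[OF face3(1) test_fun_gradient_component[OF z(1)] z(2) that])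
          have "z t = 0" if "t \<in> \<Gamma>0 \<union> \<Gamma>1" for t
            using that face3(3,4) by (intro test_fun_outside[OF z(1)]) blast
          from smooth_V0[OF zs this green[OF weak_grad_smooth]]
          have "pair_ip r \<alpha> z (gradient z) = 0"
            using balance[OF zs] green[OF p(1)] by simp
          moreover have "pair_ip r \<alpha> (\<lambda>x. ?y x - z x) (gradient (\<lambda>x. ?y x - z x)) = 0"
          proof (rule flat_point_pair_ip_Hdiv[OF face3(1) _ z(3) \<alpha>d])
            have "test_fun (ball x d) (\<lambda>x. ?y x + (-1) * z x)"
              by (rule test_fun_add[OF y test_fun_mult[OF smooth_const z(1)]])
            then show "test_fun (ball x d) (\<lambda>x. ?y x - z x)" by simp
          qed
          moreover have "pair_ip r \<alpha> (\<lambda>x. ?y x - z x) (gradient (\<lambda>x. ?y x - z x)) =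
              pair_ip r \<alpha> ?y (gradient ?y) - pair_ip r \<alpha> z (gradient z)"
          proof -
            have "pair_ip r \<alpha> (\<lambda>x. ?y x - z x) (gradient (\<lambda>x. ?y x - z x)) =
                ip M (\<lambda>x. (r x, \<alpha> x)) (\<lambda>x. (?y x, gradient ?y x) - (z x, gradient z x))"
              by (simp add: gradient_diff[OF ys zs])
            also have "\<dots> = pair_ip r \<alpha> ?y (gradient ?y) - pair_ip r \<alpha> z (gradient z)"
              using \<alpha>s smooth_sqint[OF ys] smooth_gradient_sqint[OF ys] smooth_sqint[OF zs] smooth_gradient_sqint[OF zs]
              by (intro ip_diff sqint_Pair)
            finally show ?thesis .
          qed
          ultimately show ?thesis unfolding prod[OF \<theta>] by simp
        qed
        then show ?thesis using d by blast
      qed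
    qed
  qed
  \<comment> \<open>The field has no normal trace on \<open>\<Gamma>1 \<union> \<Gamma>3\<close>, so
    what has to enter is the zero trace of the Laplacian on \<open>\<Gamma>0\<close>. Kernels look
    outwards at faces of \<open>\<Gamma>0\<close> and inwards at the other faces.\<close>
  have green: "pair_ip qs \<psi> ?p g = 0" if \<psi>: "\<psi> \<in> H0div \<Omega> (\<Gamma>1 \<union> \<Gamma>3)" "weak_div \<psi> qs" for \<psi> qs
  proof (rule pair_ip_annihilates_H1[OF p(1) weak_divD(2,1)[OF \<psi>(2)] _ finite_exceptional codim2_exceptional])
    fix \<phi> assume "smooth \<phi>" "\<And>x. x \<in> \<Gamma>0 \<Longrightarrow> \<phi> x = (0::real)"
    then show "pair_ip qs \<psi> \<phi> (gradient \<phi>) = 0"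
      using \<psi>(1) unfolding H0div_iff[OF \<psi>(2)] by (auto simp: frontier_eq)
  next
    fix x assume x: "x \<in> closure \<Omega>" "x \<notin> \<Union>\<A>"
    show "sampling_ball ?p g \<Gamma>0 x"
      using x
    proof (cases rule: closure_cases)
      case (interior d)
      then have "x \<in> \<Omega>" by auto
      then show ?thesis by (rule sampling_ball_interior[OF p(1)]) (auto simp: frontier_eq)
    next
      case (face1 n d)
      show ?thesis by (rule sampling_ball_inside[OF p(1) face1(1,3)])
    next
      case (face3 n d)
      show ?thesis by (rule sampling_ball_inside[OF p(1) face3(1,3)])
    next
      case (face0 n d)
      show ?thesis
      proof (rule sampling_ball_outside[OF face0(1)], force simp: frontier_eq, rule dirichlet_face[OF face0(1) p(1)])
        fix v assume v: "test_fun (ball x d) v" "\<And>z. (z - x) \<bullet> n = 0 \<Longrightarrow> v z = 0"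
        have s: "smooth v" using v(1) by (rule test_fun_smooth)
        have van: "v z = 0" if "z \<in> \<Gamma>0 \<union> \<Gamma>1" for z
        proof (cases "z \<in> ball x d")
          case True
          then have "(z - x) \<bullet> n = 0" using face0(1) that frontier_eq unfolding flat_point_def by blast
          then show ?thesis by (rule v(2))
        qed (use test_fun_outside[OF v(1)] in simp)
        \<comment> \<open>On a face of \<open>\<Gamma>0\<close> nothing is prescribed for the normal
          derivative: the functions that test membership in V0 vanish on this face, so
          \<open>v\<close> is admissible with arbitrary normal derivative.\<close>
        have "pair_ip (div_smooth (gradient v)) (gradient v) \<psi> (gradient \<psi>) = 0"
          if "smooth \<psi>" "\<And>x. x \<in> frontier \<Omega> - (\<Gamma>1 \<union> \<Gamma>3) \<Longrightarrow> \<psi> x = 0" for \<psi>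
          by (rule flat_point_pair_ip_vanishing[OF face0(1) test_fun_gradient_component[OF v(1)] that(1)])
            (rule that(2), use face0 in blast)
        note V = smooth_V0[OF s van this]
        \<comment> \<open>In the balance the side containing the values of \<open>v\<close> is zero,
          so the Laplacian annihilates arbitrary normal derivatives on the face.\<close>
        show "pair_ip (div_smooth (gradient v)) (gradient v) ?p g = 0"
          by (rule trans[OF balance[OF s V] flat_point_pair_ip_Hdiv[OF face0(1) v \<alpha>d]])
      qed
    qed
  qed
  have "saddle_solution \<Omega> \<Gamma>1 \<Gamma>3 c0 c1 F u ?v \<alpha>"
    unfolding saddle_solution_def
  proof (intro conjI ballI \<alpha>H u(4))
    show "u \<in> L2 \<Omega>" using us by (simp add: L2_iff)
    fix \<beta> assume \<beta>: "\<beta> \<in> H0div \<Omega> \<Gamma>3"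
    then have d: "weak_div \<beta> (wdiv \<Omega> \<beta>)" by (intro weak_div_wdiv) (simp add: H0div_def)
    show "b_form \<Omega> (u, ?v) \<beta> = 0"
      unfolding b_form_eq[OF d us] by (rule H0div_annihilates[OF d \<beta> u(1,3)]) (auto simp: frontier_eq)
  next
    fix \<phi> :: "real^'n \<Rightarrow> real" and \<psi>
    assume \<phi>: "\<phi> \<in> L2 \<Omega>" and \<psi>: "\<psi> \<in> H0div \<Omega> (\<Gamma>1 \<union> \<Gamma>3)"
    have d: "weak_div \<psi> (wdiv \<Omega> \<psi>)" using \<psi> by (intro weak_div_wdiv) (simp add: H0div_def)
    note \<psi>s = weak_divD[OF d]
    have \<phi>s: "\<phi> \<in> sqint M" using \<phi> by (simp add: L2_iff)
    have i: "integrable M (\<lambda>x. ?v x \<bullet> \<psi> x)" "integrable M (\<lambda>x. ?p x * wdiv \<Omega> \<psi> x)" "integrable M (\<lambda>x. u x * \<phi> x)"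
      "integrable M (\<lambda>x. r x * \<phi> x)" "integrable M (\<lambda>x. g x \<bullet> \<psi> x)" "integrable M (\<lambda>x. \<alpha> x \<bullet> \<psi> x)"
      using us vs gs \<alpha>s \<psi>s \<phi>s by blast+
    have "ip M ?p (wdiv \<Omega> \<psi>) + (\<integral>x. g x \<bullet> \<psi> x \<partial>M) = pair_ip (wdiv \<Omega> \<psi>) \<psi> ?p g"
      using i by (simp add: ip_def inner_commute mult.commute)
    also have "\<dots> = 0" by (rule green[OF \<psi> d])
    finally have 0: "ip M ?p (wdiv \<Omega> \<psi>) + (\<integral>x. g x \<bullet> \<psi> x \<partial>M) = 0" .
    have \<alpha>\<psi>: "(\<integral>x. \<alpha> x \<bullet> \<psi> x \<partial>M) = (\<integral>x. g x \<bullet> \<psi> x \<partial>M) - c0 * ip M ?v \<psi>"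
      unfolding \<alpha>_def ip_def using i by (simp add: inner_diff_left)
    have "a_form \<Omega> c0 c1 (u, ?v) (\<phi>, \<psi>) + b_form \<Omega> (\<phi>, \<psi>) \<alpha> =
        c0 * ip M ?v \<psi> + ip M ?p (wdiv \<Omega> \<psi>) + c1 * ip M u \<phi> + pair_ip r \<alpha> \<phi> \<psi>"
      unfolding a_form_eq[OF u(2) d] b_form_eq[OF \<alpha>d \<phi>s \<psi>s(1)] ..
    also have "pair_ip r \<alpha> \<phi> \<psi> = (\<integral>x. r x * \<phi> x \<partial>M) + ((\<integral>x. g x \<bullet> \<psi> x \<partial>M) - c0 * ip M ?v \<psi>)"
      unfolding \<alpha>\<psi>[symmetric] using i by (simp add: ip_def)
    also have "c0 * ip M ?v \<psi> + ip M ?p (wdiv \<Omega> \<psi>) + c1 * ip M u \<phi> +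
        ((\<integral>x. r x * \<phi> x \<partial>M) + ((\<integral>x. g x \<bullet> \<psi> x \<partial>M) - c0 * ip M ?v \<psi>)) =
        (\<integral>x. r x * \<phi> x \<partial>M) + c1 * ip M u \<phi>"
      using 0 by simp
    also have "\<dots> = F \<phi>"
      unfolding F_eq[OF \<phi>s] using i by (simp add: ip_def algebra_simps)
    finally show "a_form \<Omega> c0 c1 (u, ?v) (\<phi>, \<psi>) + b_form \<Omega> (\<phi>, \<psi>) \<alpha> = F \<phi>" .
  qed
  then show ?thesis by blast
qed

end

section \<open>From the geometric hypotheses to the final theorem\<close>

lemma nonoverlapping_ball:
  assumes "nonoverlapping \<Omega> \<Gamma> \<Gamma>'" "x \<in> frontier \<Omega>" "r > 0"
  shows "\<not> (frontier \<Omega> \<inter> ball x r \<subseteq> \<Gamma> \<inter> \<Gamma>')"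
proof
  assume "frontier \<Omega> \<inter> ball x r \<subseteq> \<Gamma> \<inter> \<Gamma>'"
  moreover have "openin (top_of_set (frontier \<Omega>)) (frontier \<Omega> \<inter> ball x r)" by (simp add: openin_open_Int)
  ultimately have "frontier \<Omega> \<inter> ball x r \<subseteq> top_of_set (frontier \<Omega>) interior_of (\<Gamma> \<inter> \<Gamma>')"
    by (rule interior_of_maximal)
  moreover have "x \<in> frontier \<Omega> \<inter> ball x r" using assms(2,3) by simp
  ultimately show False using assms(1) unfolding nonoverlapping_def by blast
qed

text \<open>At a regular point every segment fills the boundary disk or misses it. One of them fills
  it because they cover the frontier; two cannot, since the disk is relatively open and would lie in
  the interior of their intersection.\<close>

lemma mixed_domainI:
  fixes \<Omega> :: "(real^'n) set"
  assumes "open \<Omega>" "bounded \<Omega>" "lipschitz_boundary \<Omega>"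
    and seg: "boundary_segment \<Omega> \<Gamma>0" "boundary_segment \<Omega> \<Gamma>1" "boundary_segment \<Omega> \<Gamma>3"
    and no: "nonoverlapping \<Omega> \<Gamma>0 \<Gamma>1" "nonoverlapping \<Omega> \<Gamma>0 \<Gamma>3" "nonoverlapping \<Omega> \<Gamma>1 \<Gamma>3"
    and fr: "frontier \<Omega> = \<Gamma>0 \<union> \<Gamma>1 \<union> \<Gamma>3"
  shows "\<exists>\<A>. mixed_domain \<Omega> \<Gamma>0 \<Gamma>1 \<Gamma>3 \<A>"
proof -
  have "\<exists>\<A>. finite \<A> \<and> (\<forall>A\<in>\<A>. codim2 A) \<and>
      (\<forall>x\<in>frontier \<Omega> - \<Union>\<A>. \<exists>n r. regular_point \<Omega> {\<Gamma>0, \<Gamma>1, \<Gamma>3} x n r)"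
    using seg fr by (intro regular_points assms(1,3)) auto
  then obtain \<A> where \<A>: "finite \<A>" "\<forall>A\<in>\<A>. codim2 A"
    and reg: "\<forall>x\<in>frontier \<Omega> - \<Union>\<A>. \<exists>n r. regular_point \<Omega> {\<Gamma>0, \<Gamma>1, \<Gamma>3} x n r"
    by blast
  have "mixed_domain \<Omega> \<Gamma>0 \<Gamma>1 \<Gamma>3 \<A>"
  proof unfold_locales
    fix x assume x: "x \<in> frontier \<Omega>" "x \<notin> \<Union>\<A>"
    obtain n r where nr: "regular_point \<Omega> {\<Gamma>0, \<Gamma>1, \<Gamma>3} x n r" using bspec[OF reg, of x] x by blast
    then have fp: "flat_point \<Omega> x n r" by (simp add: regular_point_def)
    then have r: "r > 0" by (simp add: flat_point_def)
    have cases: "\<Gamma> \<inter> ball x r = {} \<or> \<Gamma> \<inter> ball x r = frontier \<Omega> \<inter> ball x r" if "\<Gamma> \<in> {\<Gamma>0, \<Gamma>1, \<Gamma>3}" for \<Gamma>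
      using nr that unfolding regular_point_def by blast
    have xr: "x \<in> frontier \<Omega> \<inter> ball x r" using x(1) r by simp
    note n = nonoverlapping_ball[OF no(1) x(1) r] nonoverlapping_ball[OF no(2) x(1) r] nonoverlapping_ball[OF no(3) x(1) r]
    have "frontier \<Omega> \<inter> ball x r \<subseteq> \<Gamma>0 \<and> \<Gamma>1 \<inter> ball x r = {} \<and> \<Gamma>3 \<inter> ball x r = {} \<or>
       frontier \<Omega> \<inter> ball x r \<subseteq> \<Gamma>1 \<and> \<Gamma>0 \<inter> ball x r = {} \<and> \<Gamma>3 \<inter> ball x r = {} \<or>
       frontier \<Omega> \<inter> ball x r \<subseteq> \<Gamma>3 \<and> \<Gamma>0 \<inter> ball x r = {} \<and> \<Gamma>1 \<inter> ball x r = {}"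
      using cases[of \<Gamma>0] cases[of \<Gamma>1] cases[of \<Gamma>3] n xr fr by blast
    then show "\<exists>n r. flat_point \<Omega> x n r \<and>
      (frontier \<Omega> \<inter> ball x r \<subseteq> \<Gamma>0 \<and> \<Gamma>1 \<inter> ball x r = {} \<and> \<Gamma>3 \<inter> ball x r = {} \<or>
       frontier \<Omega> \<inter> ball x r \<subseteq> \<Gamma>1 \<and> \<Gamma>0 \<inter> ball x r = {} \<and> \<Gamma>3 \<inter> ball x r = {} \<or>
       frontier \<Omega> \<inter> ball x r \<subseteq> \<Gamma>3 \<and> \<Gamma>0 \<inter> ball x r = {} \<and> \<Gamma>1 \<inter> ball x r = {})"
      using fp by blast
  qed (use assms(1,2) fr \<A> in auto)
  then show ?thesis by blast
qed

lemma boundary_segment_flat_point: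
  fixes \<Omega> :: "(real^'n) set"
  assumes "lipschitz_boundary \<Omega>" "open \<Omega>" "boundary_segment \<Omega> \<Gamma>" "\<Gamma> \<noteq> {}"
  shows "\<exists>x n r. flat_point \<Omega> x n r \<and> frontier \<Omega> \<inter> ball x r \<subseteq> \<Gamma>"
proof -
  obtain \<P> where \<P>: "\<And>P. P \<in> \<P> \<Longrightarrow> polytope P \<and> aff_dim P = int CARD('n) - 1" "\<Gamma> = \<Union>\<P>" "\<Gamma> \<subseteq> frontier \<Omega>"
    using assms(3) unfolding boundary_segment_def by blast
  obtain P where P: "P \<in> \<P>" "P \<noteq> {}" using \<P>(2) assms(4) by blast
  have "P \<subseteq> frontier \<Omega>" using P(1) \<P>(2,3) by blast
  then show ?thesis
    using facet_flat_point[OF assms(1,2) _ _ P(2)] \<P>(1)[OF P(1)] P(1) \<P>(2) by blast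
qed

text \<open>The first equation is tested with all of L2, so the load enters through
  \<open>F\<close>, a bounded functional on L2 that agrees with \<open>f\<close> on V. With
  \<open>\<Gamma>0 \<union> \<Gamma>1\<close> empty and \<open>c1 = 0\<close>, constants could be
  added to any solution; that case is excluded. Uniqueness of the multiplier is stated together with
  its existence.\<close>

theorem corollary11:
  fixes \<Omega> \<Gamma>0 \<Gamma>1 \<Gamma>3 :: "(real^'n) set"
    and c0 c1 :: real
    and f F :: "(real^'n \<Rightarrow> real) \<Rightarrow> real"
    and ubar :: "real^'n \<Rightarrow> real"
  assumes "CARD('n) \<in> {2, 3}"
    and "open \<Omega>" and "connected \<Omega>" and "bounded \<Omega>" and "\<Omega> \<noteq> {}"
    and "polytopal \<Omega>" and "lipschitz_boundary \<Omega>"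
    and "boundary_segment \<Omega> \<Gamma>0" and "boundary_segment \<Omega> \<Gamma>1" and "boundary_segment \<Omega> \<Gamma>3"
    and "nonoverlapping \<Omega> \<Gamma>0 \<Gamma>1" and "nonoverlapping \<Omega> \<Gamma>0 \<Gamma>3" and "nonoverlapping \<Omega> \<Gamma>1 \<Gamma>3"
    and "frontier \<Omega> = \<Gamma>0 \<union> \<Gamma>1 \<union> \<Gamma>3"
    and "c0 \<ge> 0" and "c1 \<ge> 0"
    and "\<Gamma>0 \<union> \<Gamma>1 \<noteq> {} \<or> c1 > 0"
    and "f \<in> dual (V \<Omega>) (V_norm \<Omega>)"
    and "F \<in> dual (L2 \<Omega>) (L2_norm \<Omega>)" and "\<forall>v\<in>V \<Omega>. F v = f v"
    and "primal_solution \<Omega> \<Gamma>0 \<Gamma>1 \<Gamma>3 c0 c1 f ubar"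
  shows "(\<forall>u v \<alpha>. saddle_solution \<Omega> \<Gamma>1 \<Gamma>3 c0 c1 F u v \<alpha> \<longrightarrow>
            (AE x\<in>\<Omega> in lebesgue. u x = ubar x) \<and> (AE x\<in>\<Omega> in lebesgue. v x = wgrad \<Omega> ubar x))
       \<and> (\<forall>p\<ge>4. ubar \<in> Hs \<Omega> p \<longrightarrow>
            (\<exists>\<alpha>. saddle_solution \<Omega> \<Gamma>1 \<Gamma>3 c0 c1 F ubar (wgrad \<Omega> ubar) \<alpha> \<and>
               (\<forall>u v \<alpha>'. saddle_solution \<Omega> \<Gamma>1 \<Gamma>3 c0 c1 F u v \<alpha>' \<longrightarrow>
                  (AE x\<in>\<Omega> in lebesgue. \<alpha>' x = \<alpha> x))))"
proof -
  obtain \<A> where "mixed_domain \<Omega> \<Gamma>0 \<Gamma>1 \<Gamma>3 \<A>"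
    using mixed_domainI[OF assms(2,4,7-14)] by blast
  then interpret mixed_domain \<Omega> \<Gamma>0 \<Gamma>1 \<Gamma>3 \<A> .
  have face: "c1 > 0 \<or> (\<exists>x n r. flat_point \<Omega> x n r \<and> frontier \<Omega> \<inter> ball x r \<subseteq> \<Gamma>0 \<union> \<Gamma>1)"
    using assms(17) boundary_segment_flat_point[OF assms(7,2,8)] boundary_segment_flat_point[OF assms(7,2,9)]
    by blast
  have ubar: "ubar \<in> V0 \<Omega> \<Gamma>0 \<Gamma>1 \<Gamma>3" using assms(21) by (simp add: primal_solution_def)
  have unique: "AE x in M. u x = ubar x" "AE x in M. v x = wgrad \<Omega> ubar x"
    if s: "saddle_solution \<Omega> \<Gamma>1 \<Gamma>3 c0 c1 F u v \<alpha>" for u v \<alpha>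
  proof -
    have eq: "c0 * ip M v (wgrad \<Omega> z) + ip M (wdiv \<Omega> v) (wlaplace \<Omega> z) + c1 * ip M u z =
        c0 * ip M (wgrad \<Omega> ubar) (wgrad \<Omega> z) + ip M (wlaplace \<Omega> ubar) (wlaplace \<Omega> z) + c1 * ip M ubar z"
      if z: "z \<in> V0 \<Omega> \<Gamma>0 \<Gamma>1 \<Gamma>3" for z
    proof -
      \<comment> \<open>Both problems now yield the same equation for every test function in V0,
        which is contained in V.\<close>
      have "F z = f z" using assms(20) z by (simp add: V0_def)
      then show ?thesis using saddle_imp_V0(5)[OF s z] primal_solution_eq[OF assms(21) z] by simp
    qed
    show "AE x in M. u x = ubar x" "AE x in M. v x = wgrad \<Omega> ubar x"
      using V0_unique[OF assms(15,16,3) face saddle_imp_V0(1-4)[OF s] V0D[OF ubar] eq] by blast+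
  qed
  have "\<exists>\<alpha>. saddle_solution \<Omega> \<Gamma>1 \<Gamma>3 c0 c1 F ubar (wgrad \<Omega> ubar) \<alpha> \<and>
      (\<forall>u v \<alpha>'. saddle_solution \<Omega> \<Gamma>1 \<Gamma>3 c0 c1 F u v \<alpha>' \<longrightarrow> (AE x in M. \<alpha>' x = \<alpha> x))"
    if p: "p \<ge> 4" "ubar \<in> Hs \<Omega> p" for p
  proof -
    obtain g q where "weak_grad (wlaplace \<Omega> ubar) g" "weak_div g q"
      using Hs_4_wlaplace[OF p(2,1)] by blast
    then obtain \<alpha> where \<alpha>: "saddle_solution \<Omega> \<Gamma>1 \<Gamma>3 c0 c1 F ubar (wgrad \<Omega> ubar) \<alpha>"
      using multiplier_exists[OF assms(21,19)] assms(20) by blast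
    then show ?thesis using multiplier_unique[OF _ \<alpha> unique(2)] by blast
  qed
  then show ?thesis
    unfolding AE_domain using unique by blast
qed

end
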